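(* Let $m\in\mathcal M_n$ be a fixed candidate model, with true conditional mean-squared prediction error $\rho^2(m)$ and empirical counterpart $\hat\rho^2(m)$ as defined in the context. Then for every $\varepsilon>0$, $$\mathbb P\left(\left|\log\frac{\hat\rho^2(m)}{\rho^2(m)}\right|\ge\varepsilon\right)\le 31\,|m|\exp\left(-n\left(\frac{|m_1|}{n}\right)^2\left(1-\frac{|m|}{n}\right)^5\frac{\varepsilon^2}{14397(1+\varepsilon)^2}\right).$$ Alternatively, the left-hand side is also bounded from above by $$31\,|m|\exp\left(-n\left(1-\frac{|m|}{n}\right)^5\frac{\varepsilon^2}{28279\,(1+\mu(m))^2(1+\varepsilon)^2}\right),$$ where $\mu(m)=\theta'\Sigma(m)\theta/\sigma^2(m)$ and $\Sigma(m)$ is the variance-covariance matrix of $x(m)$.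
   Context: Data-generating process. $y=\sum_{i=1}^\infty x_i\beta_i+u$, where $x=(x_i)_{i\ge1}$ are stochastic explanatory variables, $\beta=(\beta_i)_{i\ge1}$ are unknown parameters, $u$ has mean $0$ and variance $\sigma^2>0$, $x$ is centered with variance-covariance $\Sigma=[\mathbb E x_ix_j]_{i,j\ge1}$ such that every finite subvector $(x_{i_1},\dots,x_{i_k})'$ has positive definite covariance matrix, $u$ and $x$ are independent, the series converges in squared mean, and $(y,x)$ is jointly Gaussian. The training sample $(Y,X)$ consists of $n$ i.i.d. copies $(y^{(j)},x^{(j)})$, $1\le j\le n$, of $(y,x)$; $Y=(y^{(1)},\dots,y^{(n)})'$ and $X$ has rows $x^{(j)}$. Candidate models. $\mathcal M_n$ is a collection of $0$-$1$ sequences $m=(m_i)_{i\ge1}$; $|m|=\sum_i m_i$ and $6\le|m|<n$. $x(m)$ consists of the entries $x_i$ with $m_i=1$ and $X(m)$ ($n\times|m|$) of the corresponding columns of $X$. By Gaussianity, $y\mid x(m)\sim N(x(m)'\theta,\sigma^2(m))$ for some $\theta\in\mathbb R^{|m|}$ and $\sigma^2(m)>0$ (both depending on $m$). The coordinates of $x(m)$ are divided into two blocks of sizes $|m_1|\ge3$ and $|m_2|\ge3$, $|m_1|+|m_2|=|m|$; correspondingly $X(m)=(X_1(m),X_2(m))$. (Here $|m_1|,|m_2|$ denote block sizes.) Estimator. Put $M_1(m)=I_n-X_1(m)(X_1(m)'X_1(m))^{-1}X_1(m)'$ and $X_2^*(m)=M_1(m)X_2(m)$ (Moore–Penrose inverses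 on the null event where inverses do not exist). Let $\hat\theta_1^*=(X_1(m)'X_1(m))^{-1}X_1(m)'Y$, $\hat\theta_2=(X_2(m)'M_1(m)X_2(m))^{-1}X_2(m)'M_1(m)Y$, and let $\hat\sigma^2(m)$ be the usual unbiased variance estimator (residual sum of squares of the least-squares regression of $Y$ on $X(m)$, divided by $n-|m|$). For fixed tuning parameters $c_1,c_2\ge0$ let $$a_1(m)=\min\left\{1,\frac{c_1\hat\sigma^2(m)|m_1|}{\hat\theta_1^{*\prime}X_1(m)'X_1(m)\hat\theta_1^*}\right\},\quad a_2(m)=\min\left\{1,\frac{c_2\hat\sigma^2(m)|m_2|}{\hat\theta_2'X_2^*(m)'X_2^*(m)\hat\theta_2}\right\}.$$ Set $\hat\theta_1^{*JS}=(1-a_1(m))\hat\theta_1^*$, $\hat\theta_2^{JS}=(1-a_2(m))\hat\theta_2$, $\hat\theta_1^{JS}=\hat\theta_1^{*JS}-(X_1(m)'X_1(m))^{-1}X_1(m)'X_2(m)\hat\theta_2^{JS}$. The estimator $\hat\beta^B(m)$ of $\beta$ has $i$-th component $0$ if $m_i=0$, and its remaining $|m|$ components are given by $(\hat\theta_1^{JS\prime},\hat\theta_2^{JS\prime})'$. Prediction errors. Let $(y^{(0)},x^{(0)})$ be a copy of $(y,x)$ independent of the training sample, $\hat y^{(0)}(m)=\sum_i x_i^{(0)}\hat\beta_i^B(m)$, and $$\rho^2(m)=\mathbb E\left[(\hat y^{(0)}(m)-y^{(0)})^2\,\middle|\,X,Y\right].$$ With $a_1=a_1(m),a_2=a_2(m)$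 the empirical counterpart is $$\hat\rho^2(m)=w_1\hat\sigma^2(m)+w_2\frac{Y'(I_n-M_1(m))Y}{n}+w_3\frac{Y'M_1(m)Y}{n-|m_1|},$$ $$w_1=(1-a_2)^2\tfrac{|m|}{n-|m|+1}+1-a_2^2-(a_1-a_2)^2\tfrac{|m_1|}{n-|m_1|+1}+(a_2-a_1)(2-a_1-a_2)\tfrac{|m_1|}{n-|m_1|+1},$$ $$w_2=a_1^2,\qquad w_3=a_2^2-a_1^2\tfrac{|m_1|}{n}+(a_2-a_1)^2\tfrac{|m_1|}{n-|m_1|+1}.$$ Note $\rho^2(m)\ge\sigma^2>0$. Convention: $|\log(\hat\rho^2(m)/\rho^2(m))|$ is interpreted as $\infty$ if $\hat\rho^2(m)\le0$. *)

theory Defs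
  imports "HOL-Probability.Probability"
begin

section \<open>Data-generating process\<close>

text \<open>Degenerate (almost surely constant) variables count as Gaussian.\<close>

definition gaussian_rv :: "'a measure \<Rightarrow> ('a \<Rightarrow> real) \<Rightarrow> bool" where
  "gaussian_rv M Z \<longleftrightarrow> Z \<in> borel_measurable M \<and>
     ((\<exists>c. AE \<omega> in M. Z \<omega> = c) \<or>
      (\<exists>c s. s > 0 \<and> distributed M lborel Z (\<lambda>t. ennreal (normal_density c s t))))"

definition jointly_gaussian :: "'a measure \<Rightarrow> ('i \<Rightarrow> 'a \<Rightarrow> real) \<Rightarrow> bool" where
  "jointly_gaussian M Z \<longleftrightarrow>
     (\<forall>I a. finite I \<longrightarrow> gaussian_rv M (\<lambda>\<omega>. \<Sum>i\<in>I. a i * Z i \<omega>))"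

text \<open>
  Like \<^const>\<open>prob_space.indep_var\<close>, but the two random elements may take values in
  different types.
\<close>

definition indep_elements ::
    "'a measure \<Rightarrow> 'b measure \<Rightarrow> ('a \<Rightarrow> 'b) \<Rightarrow> 'c measure \<Rightarrow> ('a \<Rightarrow> 'c) \<Rightarrow> bool" where
  "indep_elements M S X T Z \<longleftrightarrow> X \<in> measurable M S \<and> Z \<in> measurable M T \<and>
     prob_space.indep_set M (sets (vimage_algebra (space M) X S))
                            (sets (vimage_algebra (space M) Z T))"

definition second_moment :: "'a measure \<Rightarrow> (nat \<Rightarrow> 'a \<Rightarrow> real) \<Rightarrow> nat \<Rightarrow> nat \<Rightarrow> real" where
  "second_moment M x i j = (\<integral>\<omega>. x i \<omega> * x j \<omega> \<partial>M)"

text \<open>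
  The explanatory variables are indexed by the natural numbers starting from 0.
  Convergence in squared mean is stated with the nonnegative integral, so that it
  entails finiteness of the second moments of the remainders (from some point on).
\<close>

locale regression_dgp = prob_space M for M :: "'a measure" +
  fixes y :: "'a \<Rightarrow> real" and x :: "nat \<Rightarrow> 'a \<Rightarrow> real" and u :: "'a \<Rightarrow> real"
    and \<beta> :: "nat \<Rightarrow> real" and \<sigma>2 :: real
  assumes y_measurable: "y \<in> borel_measurable M"
    and x_measurable: "\<And>i. x i \<in> borel_measurable M"
    and u_measurable: "u \<in> borel_measurable M"
    and x_sq_integrable: "\<And>i. integrable M (\<lambda>\<omega>. (x i \<omega>)\<^sup>2)"
    and u_sq_integrable: "integrable M (\<lambda>\<omega>. (u \<omega>)\<^sup>2)"
    and series: "(\<lambda>N. \<integral>\<^sup>+\<omega>. ennreal ((y \<omega> - u \<omega> - (\<Sum>i<N. x i \<omega> * \<beta> i))\<^sup>2) \<partial>M)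
                   \<longlonglongrightarrow> 0"
    and x_centered: "\<And>i. expectation (x i) = 0"
    and u_mean: "expectation u = 0"
    and u_variance: "variance u = \<sigma>2"
    and \<sigma>2_pos: "\<sigma>2 > 0"
    and covariance_pos_def: "\<And>I v. finite I \<Longrightarrow> (\<exists>i\<in>I. v i \<noteq> 0) \<Longrightarrow>
           (\<Sum>i\<in>I. \<Sum>j\<in>I. v i * second_moment M x i j * v j) > 0"
    and u_x_indep: "indep_elements M borel u (Pi\<^sub>M UNIV (\<lambda>_. borel)) (\<lambda>\<omega> i. x i \<omega>)"
    and gaussian: "jointly_gaussian M (case_option y x)"

definition obs_space :: "(real \<times> (nat \<Rightarrow> real)) measure" where
  "obs_space = borel \<Otimes>\<^sub>M Pi\<^sub>M UNIV (\<lambda>_. borel)"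

definition obs :: "('a \<Rightarrow> real) \<Rightarrow> (nat \<Rightarrow> 'a \<Rightarrow> real) \<Rightarrow> 'a \<Rightarrow> real \<times> (nat \<Rightarrow> real)" where
  "obs y x \<omega> = (y \<omega>, \<lambda>i. x i \<omega>)"

definition sample_space :: "('n::finite \<Rightarrow> real \<times> (nat \<Rightarrow> real)) measure" where
  "sample_space = Pi\<^sub>M UNIV (\<lambda>_. obs_space)"

definition sample :: "('n::finite \<Rightarrow> 'a \<Rightarrow> real) \<Rightarrow> ('n \<Rightarrow> nat \<Rightarrow> 'a \<Rightarrow> real)
    \<Rightarrow> 'a \<Rightarrow> 'n \<Rightarrow> real \<times> (nat \<Rightarrow> real)" where
  "sample yt xt \<omega> = (\<lambda>j. obs (yt j) (xt j) \<omega>)"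

text \<open>
  The training sample is indexed by the finite type \<open>'n\<close>, so the sample size is
  \<open>CARD('n)\<close>; \<open>y0\<close>, \<open>x0\<close> is the new observation to be predicted.
\<close>

locale regression_sample = regression_dgp M y x u \<beta> \<sigma>2
  for M :: "'a measure" and y x u \<beta> \<sigma>2 +
  fixes yt :: "'n::finite \<Rightarrow> 'a \<Rightarrow> real" and xt :: "'n \<Rightarrow> nat \<Rightarrow> 'a \<Rightarrow> real"
    and y0 :: "'a \<Rightarrow> real" and x0 :: "nat \<Rightarrow> 'a \<Rightarrow> real"
  assumes training_indep: "indep_vars (\<lambda>_. obs_space) (\<lambda>j. obs (yt j) (xt j)) UNIV"
    and training_copies:
      "\<And>j. distr M obs_space (obs (yt j) (xt j)) = distr M obs_space (obs y x)"
    and new_copy: "distr M obs_space (obs y0 x0) = distr M obs_space (obs y x)"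
    and new_indep: "indep_elements M obs_space (obs y0 x0) sample_space (sample yt xt)"


section \<open>Candidate models\<close>

text \<open>
  The sum is 0 when the support is infinite, so a positive lower bound on the size
  forces the support to be finite.
\<close>

definition model_size :: "(nat \<Rightarrow> nat) \<Rightarrow> nat" where
  "model_size m = (\<Sum>i | m i \<noteq> 0. m i)"

definition candidate_models :: "nat \<Rightarrow> (nat \<Rightarrow> nat) set" where
  "candidate_models n = {m. (\<forall>i. m i \<in> {0, 1}) \<and> 6 \<le> model_size m \<and> model_size m < n}"

text \<open>
  A division of the selected coordinates into two blocks is given by a bijection \<open>s\<close>
  from the disjoint union of two finite index types onto the support of \<open>m\<close>; the block
  sizes are \<open>CARD('p)\<close> and \<open>CARD('q)\<close>.
\<close>

definition block_division :: "(nat \<Rightarrow> nat) \<Rightarrow> ('p::finite + 'q::finite \<Rightarrow> nat) \<Rightarrow> bool" where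
  "block_division m s \<longleftrightarrow> bij_betw s UNIV {i. m i = 1} \<and> 3 \<le> CARD('p) \<and> 3 \<le> CARD('q)"

definition subvec :: "('k::finite \<Rightarrow> nat) \<Rightarrow> (nat \<Rightarrow> 'a \<Rightarrow> real) \<Rightarrow> 'a \<Rightarrow> real^'k" where
  "subvec s x \<omega> = (\<chi> k. x (s k) \<omega>)"

definition subcov :: "'a measure \<Rightarrow> ('k::finite \<Rightarrow> nat) \<Rightarrow> (nat \<Rightarrow> 'a \<Rightarrow> real) \<Rightarrow> real^'k^'k" where
  "subcov M s x = (\<chi> k l. second_moment M x (s k) (s l))"

definition design :: "('k::finite \<Rightarrow> nat) \<Rightarrow> ('n::finite \<Rightarrow> nat \<Rightarrow> 'a \<Rightarrow> real) \<Rightarrow> 'a \<Rightarrow> real^'k^'n" where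
  "design s xt \<omega> = (\<chi> j. subvec s (xt j) \<omega>)"

definition response :: "('n::finite \<Rightarrow> 'a \<Rightarrow> real) \<Rightarrow> 'a \<Rightarrow> real^'n" where
  "response yt \<omega> = (\<chi> j. yt j \<omega>)"

text \<open>
  \<open>y | z \<sim> N(z'\<theta>, v)\<close>, where \<open>v\<close> is the variance (\<^const>\<open>normal_density\<close> takes the
  standard deviation).
\<close>

definition conditionally_normal ::
    "'a measure \<Rightarrow> ('a \<Rightarrow> real) \<Rightarrow> ('a \<Rightarrow> real^'k) \<Rightarrow> real^'k::finite \<Rightarrow> real \<Rightarrow> bool" where
  "conditionally_normal M y z \<theta> v \<longleftrightarrow> v > 0 \<and>
     (\<forall>B\<in>sets borel. AE \<omega> in M.
        real_cond_exp M (vimage_algebra (space M) z borel) (\<lambda>\<omega>'. indicator B (y \<omega>')) \<omega>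
        = measure (density lborel (\<lambda>t. ennreal (normal_density (z \<omega> \<bullet> \<theta>) (sqrt v) t))) B)"


section \<open>The two-block James--Stein type estimator\<close>

text \<open>Moore--Penrose inverse, characterised by the four Penrose equations.\<close>

definition pinv :: "real^'k::finite^'l::finite \<Rightarrow> real^'l^'k" where
  "pinv A = (THE B. A ** B ** A = A \<and> B ** A ** B = B \<and>
                    transpose (A ** B) = A ** B \<and> transpose (B ** A) = B ** A)"

definition block1 :: "real^('p::finite + 'q::finite)^'n::finite \<Rightarrow> real^'p^'n" where
  "block1 X = (\<chi> j k. X $ j $ Inl k)"

definition block2 :: "real^('p::finite + 'q::finite)^'n::finite \<Rightarrow> real^'q^'n" where
  "block2 X = (\<chi> j k. X $ j $ Inr k)"

definition least_squares :: "real^'k::finite^'n::finite \<Rightarrow> real^'n \<Rightarrow> real^'k" where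
  "least_squares X Y = pinv (transpose X ** X) *v (transpose X *v Y)"

definition M1 :: "real^('p::finite + 'q::finite)^'n::finite \<Rightarrow> real^'n^'n" where
  "M1 X = mat 1 - block1 X ** pinv (transpose (block1 X) ** block1 X) ** transpose (block1 X)"

definition X2_star :: "real^('p::finite + 'q::finite)^'n::finite \<Rightarrow> real^'q^'n" where
  "X2_star X = M1 X ** block2 X"

definition \<theta>1_star :: "real^('p::finite + 'q::finite)^'n::finite \<Rightarrow> real^'n \<Rightarrow> real^'p" where
  "\<theta>1_star X Y = least_squares (block1 X) Y"

definition \<theta>2_hat :: "real^('p::finite + 'q::finite)^'n::finite \<Rightarrow> real^'n \<Rightarrow> real^'q" where
  "\<theta>2_hat X Y = pinv (transpose (block2 X) ** M1 X ** block2 X)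
                 *v (transpose (block2 X) *v (M1 X *v Y))"

definition \<sigma>2_hat :: "real^'k::finite^'n::finite \<Rightarrow> real^'n \<Rightarrow> real" where
  "\<sigma>2_hat X Y = (norm (Y - X *v least_squares X Y))\<^sup>2 / (real CARD('n) - real CARD('k))"

text \<open>
  The denominators below vanish only on a null event, so the convention \<open>x / 0 = 0\<close> is immaterial.
\<close>

definition shrink1 :: "real \<Rightarrow> real^('p::finite + 'q::finite)^'n::finite \<Rightarrow> real^'n \<Rightarrow> real" where
  "shrink1 c1 X Y = min 1 (c1 * \<sigma>2_hat X Y * real CARD('p) /
     (\<theta>1_star X Y \<bullet> ((transpose (block1 X) ** block1 X) *v \<theta>1_star X Y)))"

definition shrink2 :: "real \<Rightarrow> real^('p::finite + 'q::finite)^'n::finite \<Rightarrow> real^'n \<Rightarrow> real" where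
  "shrink2 c2 X Y = min 1 (c2 * \<sigma>2_hat X Y * real CARD('q) /
     (\<theta>2_hat X Y \<bullet> ((transpose (X2_star X) ** X2_star X) *v \<theta>2_hat X Y)))"

definition \<theta>1_star_JS :: "real \<Rightarrow> real^('p::finite + 'q::finite)^'n::finite \<Rightarrow> real^'n \<Rightarrow> real^'p" where
  "\<theta>1_star_JS c1 X Y = (1 - shrink1 c1 X Y) *\<^sub>R \<theta>1_star X Y"

definition \<theta>2_JS :: "real \<Rightarrow> real^('p::finite + 'q::finite)^'n::finite \<Rightarrow> real^'n \<Rightarrow> real^'q" where
  "\<theta>2_JS c2 X Y = (1 - shrink2 c2 X Y) *\<^sub>R \<theta>2_hat X Y"

definition \<theta>1_JS ::
    "real \<Rightarrow> real \<Rightarrow> real^('p::finite + 'q::finite)^'n::finite \<Rightarrow> real^'n \<Rightarrow> real^'p" where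
  "\<theta>1_JS c1 c2 X Y = \<theta>1_star_JS c1 X Y
     - least_squares (block1 X) (block2 X *v \<theta>2_JS c2 X Y)"

definition \<beta>_hat :: "(nat \<Rightarrow> nat) \<Rightarrow> ('p::finite + 'q::finite \<Rightarrow> nat) \<Rightarrow> real \<Rightarrow> real
    \<Rightarrow> real^('p + 'q)^'n::finite \<Rightarrow> real^'n \<Rightarrow> nat \<Rightarrow> real" where
  "\<beta>_hat m s c1 c2 X Y i =
     (if m i = 0 then 0
      else case inv s i of Inl k \<Rightarrow> \<theta>1_JS c1 c2 X Y $ k | Inr k \<Rightarrow> \<theta>2_JS c2 X Y $ k)"


section \<open>Prediction error and its empirical counterpart\<close>

definition y0_hat :: "(nat \<Rightarrow> nat) \<Rightarrow> ('p::finite + 'q::finite \<Rightarrow> nat) \<Rightarrow> real \<Rightarrow> real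
    \<Rightarrow> ('n::finite \<Rightarrow> 'a \<Rightarrow> real) \<Rightarrow> ('n \<Rightarrow> nat \<Rightarrow> 'a \<Rightarrow> real) \<Rightarrow> (nat \<Rightarrow> 'a \<Rightarrow> real)
    \<Rightarrow> 'a \<Rightarrow> real" where
  "y0_hat m s c1 c2 yt xt x0 \<omega> =
     (\<Sum>i. x0 i \<omega> * \<beta>_hat m s c1 c2 (design s xt \<omega>) (response yt \<omega>) i)"

definition \<rho>2 :: "'a measure \<Rightarrow> (nat \<Rightarrow> nat) \<Rightarrow> ('p::finite + 'q::finite \<Rightarrow> nat) \<Rightarrow> real \<Rightarrow> real
    \<Rightarrow> ('n::finite \<Rightarrow> 'a \<Rightarrow> real) \<Rightarrow> ('n \<Rightarrow> nat \<Rightarrow> 'a \<Rightarrow> real)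
    \<Rightarrow> ('a \<Rightarrow> real) \<Rightarrow> (nat \<Rightarrow> 'a \<Rightarrow> real) \<Rightarrow> 'a \<Rightarrow> real" where
  "\<rho>2 M m s c1 c2 yt xt y0 x0 =
     real_cond_exp M (vimage_algebra (space M) (sample yt xt) sample_space)
       (\<lambda>\<omega>. (y0_hat m s c1 c2 yt xt x0 \<omega> - y0 \<omega>)\<^sup>2)"

definition w1 :: "real \<Rightarrow> real \<Rightarrow> real \<Rightarrow> real \<Rightarrow> real \<Rightarrow> real" where
  "w1 n k k1 a1 a2 =
     (1 - a2)\<^sup>2 * (k / (n - k + 1)) + 1 - a2\<^sup>2 - (a1 - a2)\<^sup>2 * (k1 / (n - k1 + 1))
     + (a2 - a1) * (2 - a1 - a2) * (k1 / (n - k1 + 1))"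

definition w2 :: "real \<Rightarrow> real" where
  "w2 a1 = a1\<^sup>2"

definition w3 :: "real \<Rightarrow> real \<Rightarrow> real \<Rightarrow> real \<Rightarrow> real" where
  "w3 n k1 a1 a2 = a2\<^sup>2 - a1\<^sup>2 * (k1 / n) + (a2 - a1)\<^sup>2 * (k1 / (n - k1 + 1))"

definition \<rho>2_hat ::
    "real \<Rightarrow> real \<Rightarrow> real^('p::finite + 'q::finite)^'n::finite \<Rightarrow> real^'n \<Rightarrow> real" where
  "\<rho>2_hat c1 c2 X Y =
     (let n = real CARD('n); k1 = real CARD('p); k = real CARD('p + 'q);
          a1 = shrink1 c1 X Y; a2 = shrink2 c2 X Y
      in w1 n k k1 a1 a2 * \<sigma>2_hat X Y
         + w2 a1 * ((Y \<bullet> ((mat 1 - M1 X) *v Y)) / n)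
         + w3 n k1 a1 a2 * ((Y \<bullet> (M1 X *v Y)) / (n - k1)))"

text \<open>\<open>|log (a / b)|\<close> for \<open>b > 0\<close>, with value \<open>\<infinity>\<close> if \<open>a \<le> 0\<close>.\<close>

definition abs_log_ratio :: "real \<Rightarrow> real \<Rightarrow> ereal" where
  "abs_log_ratio a b = (if a \<le> 0 then \<infinity> else ereal \<bar>ln (a / b)\<bar>)"

end

theory Submission
  imports Defs
begin

text \<open>
  Let \<open>E\<close> whiten the selected regressors by Gram--Schmidt, respecting the order of the two blocks,
  so that \<open>z = E x(m)\<close> has independent standard normal entries and
  \<open>y = r v + d2 \<bullet> z2 + d1 \<bullet> z1\<close> with \<open>v\<close> standard normal and independent of \<open>z\<close>. The whitened sample
  \<open>(W1, v, W2)\<close> is then a standard Gaussian element, and the estimator, being equivariant under block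
  triangular changes of the regressors, is explicit in terms of it. Almost surely
  \<open>\<rho>2 = r\<^sup>2 + |d - b|\<^sup>2\<close>, where \<open>b\<close> are the estimated whitened coefficients. Both \<open>\<rho>2\<close> and \<open>\<rho>2_hat\<close> are
  close to one and the same quadratic form \<open>Q\<close> in \<open>(r, |d2|, |d1|)\<close> with coefficients depending on the
  random shrinkage factors \<open>a1, a2 \<in> [0, 1]\<close>: the errors are controlled, uniformly in \<open>a1, a2\<close>, by the
  deviations of a few chi-square variables and of \<open>|Z\<^sup>+ v|\<^sup>2\<close> and \<open>(f \<bullet> Z\<^sup>+ v)\<^sup>2\<close> for Gaussian matrices \<open>Z\<close>.
  The latter are ratios: the squared norm of the restriction of \<open>Z\<^sup>+ v\<close> to \<open>j\<close> coordinates is distributed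
  as a chi-square variable with \<open>j\<close> degrees of freedom divided by an independent one with \<open>n - k + 1\<close> degrees of freedom.

  The weight \<open>lam\<close> satisfies \<open>lam * (r\<^sup>2 + |d2|\<^sup>2 + |d1|\<^sup>2) * a1\<^sup>2 \<le> Q\<close> and \<open>lam * |d2|\<^sup>2 * (a1 - a2)\<^sup>2 \<le> Q\<close>, so that
  errors proportional to these terms are absorbed by \<open>Q\<close>. It may be taken as \<open>k1 / (n + 1)\<close>, \<open>k1\<close> being the size
  of the first block, or as the noise proportion \<open>1 / (1 + \<mu>)\<close>; this gives the two bounds.
\<close>

section \<open>The standard Gaussian measure\<close>

text \<open>The shrinkage factors depend on the very data whose errors they multiply, so bounds at
  fixed \<open>a1\<close>, \<open>a2\<close> would not do: probability enters only through
  quantities free of \<open>a1\<close>, \<open>a2\<close>, and the comparison with \<open>Q\<close>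
  is algebra. Two obstacles shape the probabilistic part. Laws of ratios are wanted without matrix
  decompositions; they come from characteristic functions and adjoint pairs of linear maps. And the
  first-block error carries random weights \<open>(1, - e)\<close> with \<open>e\<close> from the
  same sample; independence is saved because \<open>e\<close> ignores the projections onto the first
  block. Constants: the relative tolerance is \<open>t = \<epsilon> / (1 + \<epsilon>)\<close>, and
  \<open>s = t / 20\<close> works since \<open>\<rho>2\<close> and \<open>\<rho>2_hat\<close> differ
  from \<open>Q\<close> by at most 77/10 and 3 times \<open>s * Q\<close>. The exponent then has
  denominator 27 * 20^2 = 10800; the slack up to 14397 pays for \<open>n + 1\<close> in
  \<open>lam\<close>. The union bound has total weight 38, below 31 |m| as |m| is at least 6. The
  fifth power of \<open>1 - |m| / n\<close> comes from the chi-square denominator of the squared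
  norm of \<open>e\<close>, whose tolerance is itself proportional to
  \<open>1 - |m| / n\<close>.\<close>

definition stdg :: "'a::euclidean_space measure" where
  "stdg = density lborel (\<lambda>x. \<Prod>b\<in>Basis. ennreal (std_normal_density (x \<bullet> b)))"

lemma sets_stdg [simp, measurable_cong]: "sets stdg = sets borel"
  by (simp add: stdg_def)

lemma space_stdg [simp]: "space stdg = UNIV"
  by (simp add: stdg_def)

lemma nn_integral_stdg_prod:
  fixes f :: "'a::euclidean_space \<Rightarrow> real \<Rightarrow> ennreal"
  assumes [measurable]: "\<And>b. b \<in> Basis \<Longrightarrow> f b \<in> borel_measurable borel"
  shows "(\<integral>\<^sup>+x. (\<Prod>b\<in>Basis. f b (x \<bullet> b)) \<partial>stdg)
    = (\<Prod>b\<in>Basis. \<integral>\<^sup>+t. f b t \<partial>std_normal_distribution)"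
proof -
  have "(\<integral>\<^sup>+x. (\<Prod>b\<in>Basis. f b (x \<bullet> b)) \<partial>stdg)
      = (\<integral>\<^sup>+x. (\<Prod>b\<in>Basis. ennreal (std_normal_density (x \<bullet> b)) * f b (x \<bullet> b)) \<partial>lborel)"
    unfolding stdg_def by (subst nn_integral_density) (auto simp: prod.distrib)
  also have "\<dots> = (\<Prod>b\<in>Basis. \<integral>\<^sup>+t. ennreal (std_normal_density t) * f b t \<partial>lborel)"
    by (rule nn_integral_lborel_prod[where f = "\<lambda>b t. ennreal (std_normal_density t) * f b t"]) auto
  also have "\<dots> = (\<Prod>b\<in>Basis. \<integral>\<^sup>+t. f b t \<partial>std_normal_distribution)"
    by (intro prod.cong refl) (subst nn_integral_density, auto)
  finally show ?thesis .
qed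

lemma prob_space_stdg: "prob_space stdg"
proof (rule prob_spaceI)
  have "emeasure stdg (space (stdg :: 'a measure)) = (\<integral>\<^sup>+x. (\<Prod>b\<in>(Basis::'a set). (\<lambda>b t. 1) b (x \<bullet> b)) \<partial>(stdg :: 'a measure))"
    by simp
  also have "\<dots> = (\<Prod>b\<in>(Basis::'a set). \<integral>\<^sup>+t. 1 \<partial>std_normal_distribution)"
    by (rule nn_integral_stdg_prod[where f = "\<lambda>b t. 1"]) auto
  also have "\<dots> = 1"
    using prob_space.emeasure_space_1[OF prob_space_normal_density[of 1 0]] by simp
  finally show "emeasure stdg (space (stdg :: 'a measure)) = 1" .
qed

interpretation stdg: prob_space stdg
  by (rule prob_space_stdg)

lemma emeasure_stdg_UNIV [simp]: "emeasure stdg (UNIV :: 'a::euclidean_space set) = 1"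
  using stdg.emeasure_space_1[where 'a='a] by simp

lemma measure_stdg_UNIV [simp]: "measure stdg (UNIV :: 'a::euclidean_space set) = 1"
  using stdg.prob_space[where 'a='a] by simp

lemma integral_lborel_prod:
  fixes f :: "'a::euclidean_space \<Rightarrow> real \<Rightarrow> complex"
  assumes "\<And>b. b \<in> Basis \<Longrightarrow> integrable lborel (f b)"
  shows "(\<integral>x. (\<Prod>b\<in>Basis. f b (x \<bullet> b)) \<partial>lborel) = (\<Prod>b\<in>Basis. \<integral>t. f b t \<partial>lborel)"
proof -
  have [measurable]: "f b \<in> borel_measurable borel" if "b \<in> Basis" for b
    using borel_measurable_integrable[OF assms[OF that]] by simp
  interpret product_sigma_finite "\<lambda>b::'a. lborel :: real measure"
    by standard
  have "(\<integral>x. (\<Prod>b\<in>Basis. f b (x \<bullet> b)) \<partial>lborel)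
      = (\<integral>x. (\<Prod>b\<in>Basis. f b (x b)) \<partial>(\<Pi>\<^sub>M b\<in>Basis. lborel))"
    unfolding lborel_eq[where 'a='a] by (subst integral_distr) (auto intro!: Bochner_Integration.integral_cong prod.cong)
  also have "\<dots> = (\<Prod>b\<in>Basis. \<integral>t. f b t \<partial>lborel)"
    by (rule product_integral_prod) (use assms in auto)
  finally show ?thesis .
qed

lemma char_stdg: "(CLINT x|stdg. iexp (a \<bullet> x)) = exp (- (norm a)\<^sup>2 / 2)"
proof -
  have 1: "integrable lborel (\<lambda>t. complex_of_real (std_normal_density t) * iexp (c * t))" for c
    by (rule Bochner_Integration.integrable_bound[where f = std_normal_density])
       (auto simp: norm_mult intro!: AE_I2)
  have 2: "(CLINT t|lborel. complex_of_real (std_normal_density t) * iexp (c * t)) = exp (- c\<^sup>2 / 2)" for c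
  proof -
    have "(CLINT t|lborel. complex_of_real (std_normal_density t) * iexp (c * t)) = char std_normal_distribution c"
      unfolding char_def by (subst integral_density) (auto simp: scaleR_conv_of_real)
    then show ?thesis by (simp add: char_std_normal_distribution exp_of_real)
  qed
  have "(CLINT x|stdg. iexp (a \<bullet> x)) =
     (CLINT x|lborel. (\<Prod>b\<in>Basis. std_normal_density (x \<bullet> b)) *\<^sub>R iexp (a \<bullet> x))"
    unfolding stdg_def prod_ennreal[OF normal_density_nonneg]
    by (subst integral_density) (auto intro!: prod_nonneg)
  also have "\<dots> = (CLINT x|lborel. (\<Prod>b\<in>Basis. complex_of_real (std_normal_density (x \<bullet> b)) * iexp ((a \<bullet> b) * (x \<bullet> b))))"
  proof (intro Bochner_Integration.integral_cong refl)
    fix x :: 'a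
    have "iexp (a \<bullet> x) = (\<Prod>b\<in>Basis. iexp ((a \<bullet> b) * (x \<bullet> b)))"
      by (subst euclidean_inner) (simp add: sum_distrib_left exp_sum)
    then show "(\<Prod>b\<in>Basis. std_normal_density (x \<bullet> b)) *\<^sub>R iexp (a \<bullet> x) = (\<Prod>b\<in>Basis. complex_of_real (std_normal_density (x \<bullet> b)) * iexp ((a \<bullet> b) * (x \<bullet> b)))"
      by (simp add: scaleR_conv_of_real prod.distrib)
  qed
  also have "\<dots> = complex_of_real (\<Prod>b\<in>Basis. exp (- (a \<bullet> b)\<^sup>2 / 2))"
    by (subst integral_lborel_prod[OF 1]) (simp only: 2 of_real_prod)
  also have "\<dots> = exp (- (norm a)\<^sup>2 / 2)"
    by (simp add: exp_sum[symmetric] norm_eq_sqrt_inner euclidean_inner[of a a] power2_eq_square sum_negf sum_divide_distrib sum_nonneg)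
  finally show ?thesis .
qed

lemma density_stdg: "stdg = density lborel (\<lambda>x::'a::euclidean_space. ennreal ((1 / sqrt (2*pi))^DIM('a) * exp (- (norm x)\<^sup>2 / 2)))"
proof -
  have "(\<Prod>b\<in>Basis. ennreal (std_normal_density (x \<bullet> b))) = ennreal ((1 / sqrt (2*pi))^DIM('a) * exp (- (norm x)\<^sup>2 / 2))" for x :: 'a
  proof -
    have "(\<Prod>b\<in>Basis. ennreal (std_normal_density (x \<bullet> b))) = ennreal (\<Prod>b\<in>Basis. std_normal_density (x \<bullet> b))"
      by (rule prod_ennreal) simp
    also have "(\<Prod>b\<in>Basis. std_normal_density (x \<bullet> b)) = (1 / sqrt (2*pi))^DIM('a) * (\<Prod>b\<in>Basis. exp (- (x \<bullet> b)\<^sup>2/2))"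
      by (simp add: std_normal_density_def prod.distrib power_divide prod_dividef)
    also have "(\<Prod>b\<in>Basis. exp (- (x \<bullet> b)\<^sup>2/2)) = exp (- (norm x)\<^sup>2 / 2)"
      by (simp add: exp_sum[symmetric] norm_eq_sqrt_inner euclidean_inner[of x x] power2_eq_square sum_negf sum_divide_distrib sum_nonneg)
    finally show ?thesis .
  qed
  then show ?thesis by (simp add: stdg_def)
qed

section \<open>Uniqueness of a law with given characteristic function\<close>

lemma finite_borel_eqI_closed:
  fixes M N :: "'a::euclidean_space measure"
  assumes "prob_space M" "prob_space N" and [simp]: "sets M = sets borel" "sets N = sets borel"
    and eq: "\<And>C. closed C \<Longrightarrow> emeasure M C = emeasure N C"
  shows "M = N"
proof (rule measure_eqI_generator_eq[where E = "{C. closed C}" and \<Omega> = UNIV and A = "\<lambda>_. UNIV"])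
  interpret M: prob_space M by fact
  show "Int_stable {C::'a set. closed C}" by (auto simp: Int_stable_def)
  show "sets M = sigma_sets UNIV {C. closed C}" "sets N = sigma_sets UNIV {C. closed C}"
    by (simp_all add: borel_eq_closed)
  show "emeasure M UNIV \<noteq> \<infinity>" by simp
qed (use eq in auto)

text \<open>The indicator of a nonempty closed set is the limit of the continuous functions
  \<open>max 0 (1 - k * infdist x C)\<close>, so continuous test functions with values in [0, 1]
  determine the measure of closed sets.\<close>

lemma measure_eqI_continuous:
  fixes M N :: "'a::euclidean_space measure"
  assumes M: "prob_space M" and N: "prob_space N" and [measurable_cong]: "sets M = sets borel" "sets N = sets borel"
    and eq: "\<And>f::'a\<Rightarrow>real. continuous_on UNIV f \<Longrightarrow> (\<And>x. 0 \<le> f x \<and> f x \<le> 1) \<Longrightarrow> (\<integral>x. f x \<partial>M) = (\<integral>x. f x \<partial>N)"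
  shows "M = N"
proof (rule finite_borel_eqI_closed)
  interpret M: prob_space M by fact
  interpret N: prob_space N by fact
  fix C :: "'a set" assume C: "closed C"
  show "emeasure M C = emeasure N C"
  proof (cases "C = {}")
    case False
    define f where "f k x = max 0 (1 - real k * infdist x C)" for k x
    have cont: "continuous_on UNIV (f k)" for k
      unfolding f_def by (intro continuous_intros)
    have [measurable]: "f k \<in> borel_measurable borel" for k
      by (rule borel_measurable_continuous_onI[OF cont])
    have rng: "0 \<le> f k x \<and> f k x \<le> 1" for k x
      by (auto simp: f_def infdist_nonneg)
    have lim: "(\<lambda>k. f k x) \<longlonglongrightarrow> indicator C x" for x
    proof (cases "x \<in> C")
      case True then show ?thesis by (simp add: f_def)
    next
      case notin: False
      then have "infdist x C > 0"
        using C False by (simp add: infdist_pos_not_in_closed)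
      then have "eventually (\<lambda>k. real k > 1 / infdist x C) sequentially"
        by real_asymp
      then have "eventually (\<lambda>k. f k x = 0) sequentially"
        by eventually_elim (use \<open>infdist x C > 0\<close> in \<open>auto simp: f_def field_simps max_def\<close>)
      then show ?thesis using notin by (simp add: tendsto_eventually)
    qed
    have *: "(\<lambda>k. \<integral>x. f k x \<partial>L) \<longlonglongrightarrow> measure L C" if "prob_space L" and [simp, measurable_cong]: "sets L = sets borel" for L
    proof -
      interpret L: prob_space L by fact
      have [measurable]: "C \<in> sets borel" using C by simp
      have "space L = UNIV" using sets_eq_imp_space_eq[OF that(2)] by simp
      have "(\<lambda>k. \<integral>x. f k x \<partial>L) \<longlonglongrightarrow> (\<integral>x. indicator C x \<partial>L)"
        by (rule integral_dominated_convergence[where w = "\<lambda>_. 1"]) (use lim rng in \<open>auto intro!: AE_I2\<close>)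
      then show ?thesis using \<open>space L = UNIV\<close> by simp
    qed
    have "measure M C = measure N C"
      using LIMSEQ_unique[OF *[OF M] *[OF N, unfolded eq[OF cont rng, symmetric]]] by (simp add: assms)
    then show ?thesis by (simp add: M.emeasure_eq_measure N.emeasure_eq_measure)
  qed simp
qed (use assms in auto)

text \<open>The Gaussian kernel is the characteristic function of \<open>stdg\<close>. After
  exchanging the two integrals, \<open>M\<close> enters the smoothed density only through its own
  characteristic function.\<close>

lemma gauss_kernel_eq:
  fixes M N :: "'a::euclidean_space measure"
  assumes "prob_space M" and [measurable_cong]: "sets M = sets borel" 
  shows "complex_of_real (\<integral>x. exp (- (norm (z - c *\<^sub>R x))\<^sup>2 / 2) \<partial>M)
       = (CLINT a|stdg. iexp (a \<bullet> z) * (CLINT x|M. iexp ((- c *\<^sub>R a) \<bullet> x)))"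
proof -
  interpret M: prob_space M by fact
  interpret MS: pair_prob_space M "stdg :: 'a measure" ..
  have int: "integrable (M \<Otimes>\<^sub>M stdg) (\<lambda>(x, a). iexp (a \<bullet> (z - c *\<^sub>R x)))"
    by (rule MS.P.integrable_const_bound[where B=1]) (auto simp: case_prod_beta)
  have "complex_of_real (\<integral>x. exp (- (norm (z - c *\<^sub>R x))\<^sup>2 / 2) \<partial>M)
     = (CLINT x|M. CLINT a|stdg. iexp (a \<bullet> (z - c *\<^sub>R x)))"
    by (subst inner_commute, subst char_stdg) (simp add: exp_of_real)
  also have "\<dots> = (CLINT a|stdg. CLINT x|M. iexp (a \<bullet> (z - c *\<^sub>R x)))"
    using MS.Fubini_integral[OF int] by simp
  also have "\<dots> = (CLINT a|stdg. iexp (a \<bullet> z) * (CLINT x|M. iexp ((- c *\<^sub>R a) \<bullet> x)))"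
    by (simp add: inner_diff_right algebra_simps exp_diff exp_add exp_minus divide_inverse)
  finally show ?thesis .
qed

text \<open>Substitution of \<open>x + (1/c) *\<^sub>R w\<close> for \<open>z\<close> in Lebesgue
  measure; the constant is the Jacobian divided by the Gaussian normalisation.\<close>

lemma nn_integral_gauss_kernel_scale:
  fixes f :: "'a::euclidean_space \<Rightarrow> ennreal"
  assumes [measurable]: "f \<in> borel_measurable borel" and "c > 0"
  shows "(\<integral>\<^sup>+z. f z * ennreal (exp (- (norm (c *\<^sub>R z - c *\<^sub>R x))\<^sup>2 / 2)) \<partial>lborel)
     = ennreal ((sqrt (2*pi) / c)^DIM('a)) * (\<integral>\<^sup>+w. f (x + (1/c) *\<^sub>R w) \<partial>stdg)"
proof -
  define h where "h z = f z * ennreal (exp (- (norm (c *\<^sub>R z - c *\<^sub>R x))\<^sup>2 / 2))" for z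
  have [measurable]: "h \<in> borel_measurable borel" unfolding h_def by measurable
  have hh: "h (x + (1/c) *\<^sub>R w) = f (x + (1/c) *\<^sub>R w) * ennreal (exp (- (norm w)\<^sup>2 / 2))" for w
    using \<open>c > 0\<close> by (simp add: h_def scaleR_right_distrib)
  have "(\<integral>\<^sup>+z. h z \<partial>lborel) = (\<integral>\<^sup>+z. h z \<partial>density (distr lborel borel (\<lambda>w. x + (1/c) *\<^sub>R w)) (\<lambda>_. ennreal (\<bar>1/c\<bar> ^ DIM('a))))"
    using lborel_affine[of "1/c" x] \<open>c > 0\<close> by simp
  also have "\<dots> = (\<integral>\<^sup>+w. ennreal (\<bar>1/c\<bar> ^ DIM('a)) * h (x + (1/c) *\<^sub>R w) \<partial>lborel)"
    by (subst nn_integral_density, measurable, subst nn_integral_distr) measurable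
  also have "\<dots> = (\<integral>\<^sup>+w. ennreal (\<bar>1/c\<bar> ^ DIM('a)) * (f (x + (1/c) *\<^sub>R w) * ennreal (exp (- (norm w)\<^sup>2 / 2))) \<partial>lborel)"
    by (simp only: hh)
  also have "(\<integral>\<^sup>+w. ennreal (\<bar>1/c\<bar> ^ DIM('a)) * (f (x + (1/c) *\<^sub>R w) * ennreal (exp (- (norm w)\<^sup>2 / 2))) \<partial>lborel) = (\<integral>\<^sup>+w. ennreal ((sqrt (2*pi) / c)^DIM('a)) * (ennreal ((1 / sqrt (2*pi))^DIM('a) * exp (- (norm w)\<^sup>2 / 2)) * f (x + (1/c) *\<^sub>R w)) \<partial>lborel)"
  proof (intro nn_integral_cong)
    fix w :: 'a
    have "ennreal (\<bar>1/c\<bar> ^ DIM('a)) * ennreal (exp (- (norm w)\<^sup>2 / 2))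
        = ennreal ((sqrt (2*pi) / c)^DIM('a)) * ennreal ((1 / sqrt (2*pi))^DIM('a) * exp (- (norm w)\<^sup>2 / 2))"
    proof -
      have "\<bar>1/c\<bar> = (sqrt (2*pi) / c) * (1 / sqrt (2*pi))" using \<open>c > 0\<close> by simp
      then have "\<bar>1/c\<bar> ^ DIM('a) = (sqrt (2*pi) / c)^DIM('a) * (1 / sqrt (2*pi))^DIM('a)"
        by (simp only: power_mult_distrib)
      moreover have "0 \<le> (sqrt (2*pi) / c)^DIM('a)" "0 \<le> (1 / sqrt (2*pi))^DIM('a)" "0 \<le> \<bar>1/c\<bar> ^ DIM('a)"
        using \<open>c > 0\<close> by (auto intro!: zero_le_power)
      ultimately show ?thesis
        by (simp only: ennreal_mult[symmetric] exp_ge_zero mult_nonneg_nonneg mult.assoc)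
    qed
    then show "ennreal (\<bar>1/c\<bar> ^ DIM('a)) * (f (x + (1/c) *\<^sub>R w) * ennreal (exp (- (norm w)\<^sup>2 / 2)))
      = ennreal ((sqrt (2*pi) / c)^DIM('a)) * (ennreal ((1 / sqrt (2*pi))^DIM('a) * exp (- (norm w)\<^sup>2 / 2)) * f (x + (1/c) *\<^sub>R w))"
      by (simp only: mult.assoc[symmetric] mult.commute[of "f (x + (1/c) *\<^sub>R w)"])
  qed
  also have "\<dots> = ennreal ((sqrt (2*pi) / c)^DIM('a)) * (\<integral>\<^sup>+w. f (x + (1/c) *\<^sub>R w) \<partial>stdg)"
    unfolding density_stdg
    by (subst nn_integral_cmult, measurable, subst nn_integral_density, measurable)
  finally show ?thesis unfolding h_def .
qed

lemma measurable_gauss_kernel: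
  fixes f :: "'a::euclidean_space \<Rightarrow> real"
  assumes "f \<in> borel_measurable borel"
  shows "(\<lambda>(x, z). ennreal (f z) * ennreal (exp (- (norm (c *\<^sub>R z - c *\<^sub>R x))\<^sup>2 / 2))) \<in> borel_measurable (borel \<Otimes>\<^sub>M borel)"
proof -
  have "continuous_on UNIV (\<lambda>p::'a \<times> 'a. exp (- (norm (c *\<^sub>R snd p - c *\<^sub>R fst p))\<^sup>2 / 2))"
    by (intro continuous_intros) auto
  then have "(\<lambda>p::'a \<times> 'a. exp (- (norm (c *\<^sub>R snd p - c *\<^sub>R fst p))\<^sup>2 / 2)) \<in> borel_measurable (borel \<Otimes>\<^sub>M borel)"
    unfolding borel_prod by (rule borel_measurable_continuous_onI)
  then have 1: "(\<lambda>p::'a \<times> 'a. ennreal (exp (- (norm (c *\<^sub>R snd p - c *\<^sub>R fst p))\<^sup>2 / 2))) \<in> borel_measurable (borel \<Otimes>\<^sub>M borel)"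
    by (rule measurable_compose[OF _ measurable_ennreal])
  have "(\<lambda>p::'a \<times> 'a. f (snd p)) \<in> borel_measurable (borel \<Otimes>\<^sub>M borel)"
    by (rule measurable_compose[OF measurable_snd assms])
  then have 2: "(\<lambda>p::'a \<times> 'a. ennreal (f (snd p))) \<in> borel_measurable (borel \<Otimes>\<^sub>M borel)"
    by (rule measurable_compose[OF _ measurable_ennreal])
  show ?thesis
    using borel_measurable_times_ennreal[OF 2 1] by (simp add: case_prod_beta')
qed

lemma norm_integral_stdg_le_1:
  fixes g :: "'a::euclidean_space \<Rightarrow> real"
  assumes [measurable]: "g \<in> borel_measurable borel" and rng: "\<And>x. 0 \<le> g x \<and> g x \<le> 1"
  shows "integrable stdg g" "0 \<le> (\<integral>w. g w \<partial>stdg)" "(\<integral>w. g w \<partial>stdg) \<le> 1"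
proof -
  show i: "integrable stdg g"
    by (intro stdg.integrable_const_bound[where B=1] AE_I2) (simp_all add: rng)
  show "(\<integral>w. g w \<partial>stdg) \<le> 1"
    by (rule stdg.integral_le_const[OF i]) (simp add: rng)
  show "0 \<le> (\<integral>w. g w \<partial>stdg)"
    by (rule integral_nonneg_AE) (simp add: rng)
qed

text \<open>If \<open>x\<close> has law \<open>L\<close> and \<open>w\<close> is an independent
  standard Gaussian element, then \<open>x + (1/c) *\<^sub>R w\<close> has the kernel integral as
  its density, up to normalisation. The identity is Fubini between \<open>L\<close> and Lebesgue
  measure.\<close>

lemma nn_integral_smoothing:
  fixes L :: "'a::euclidean_space measure" and f :: "'a \<Rightarrow> real"
  assumes L: "prob_space L" and sets_L [measurable_cong]: "sets L = sets borel"
    and [measurable]: "f \<in> borel_measurable borel" and rng: "\<And>x. 0 \<le> f x \<and> f x \<le> 1" and c: "c > 0"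
  shows "ennreal ((sqrt (2*pi) / c)^DIM('a)) * ennreal (\<integral>x. (\<integral>w. f (x + (1 / c) *\<^sub>R w) \<partial>stdg) \<partial>L)
      = (\<integral>\<^sup>+z. ennreal (f z) * ennreal (\<integral>x. exp (- (norm (c *\<^sub>R z - c *\<^sub>R x))\<^sup>2 / 2) \<partial>L) \<partial>lborel)"
proof -
  interpret L: prob_space L by fact
  interpret LL: pair_sigma_finite L "lborel :: 'a measure" ..
  have bd: "integrable stdg (\<lambda>w. f (x + (1 / c) *\<^sub>R w))" "0 \<le> (\<integral>w. f (x + (1 / c) *\<^sub>R w) \<partial>stdg)"
    "(\<integral>w. f (x + (1 / c) *\<^sub>R w) \<partial>stdg) \<le> 1" for x
    by (rule norm_integral_stdg_le_1; simp add: rng)+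
  have meas: "(\<lambda>x. \<integral>w. f (x + (1 / c) *\<^sub>R w) \<partial>stdg) \<in> borel_measurable L"
    by measurable
  have i1: "(\<integral>\<^sup>+w. ennreal (f (x + (1 / c) *\<^sub>R w)) \<partial>stdg) = ennreal (\<integral>w. f (x + (1 / c) *\<^sub>R w) \<partial>stdg)" for x
    by (rule nn_integral_eq_integral[OF bd(1)]) (simp add: rng)
  have "ennreal (\<integral>x. (\<integral>w. f (x + (1 / c) *\<^sub>R w) \<partial>stdg) \<partial>L) = (\<integral>\<^sup>+x. \<integral>\<^sup>+w. f (x + (1 / c) *\<^sub>R w) \<partial>stdg \<partial>L)"
    unfolding i1
  proof (rule nn_integral_eq_integral[symmetric])
    show "integrable L (\<lambda>x. \<integral>w. f (x + (1 / c) *\<^sub>R w) \<partial>stdg)"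
      by (rule L.integrable_const_bound[where B=1, OF _ meas]) (simp add: bd)
  qed (simp add: bd)
  then have "ennreal ((sqrt (2*pi) / c)^DIM('a)) * ennreal (\<integral>x. (\<integral>w. f (x + (1 / c) *\<^sub>R w) \<partial>stdg) \<partial>L)
    = (\<integral>\<^sup>+x. ennreal ((sqrt (2*pi) / c)^DIM('a)) * (\<integral>\<^sup>+w. f (x + (1 / c) *\<^sub>R w) \<partial>stdg) \<partial>L)"
    by (simp only:) (rule nn_integral_cmult[symmetric], measurable)
  also have "\<dots> = (\<integral>\<^sup>+x. \<integral>\<^sup>+z. ennreal (f z) * ennreal (exp (- (norm (c *\<^sub>R z - c *\<^sub>R x))\<^sup>2 / 2)) \<partial>lborel \<partial>L)"
    by (subst nn_integral_gauss_kernel_scale[OF _ c]) measurable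
  also have "\<dots> = (\<integral>\<^sup>+z. \<integral>\<^sup>+x. ennreal (f z) * ennreal (exp (- (norm (c *\<^sub>R z - c *\<^sub>R x))\<^sup>2 / 2)) \<partial>L \<partial>lborel)"
  proof (rule LL.Fubini'[symmetric])
    have e: "borel_measurable (L \<Otimes>\<^sub>M lborel) = (borel_measurable (borel \<Otimes>\<^sub>M borel) :: ('a \<times> 'a \<Rightarrow> ennreal) set)"
      by (rule measurable_cong_sets[OF sets_pair_measure_cong[OF sets_L sets_lborel] refl])
    show "(\<lambda>(x, z). ennreal (f z) * ennreal (exp (- (norm (c *\<^sub>R z - c *\<^sub>R x))\<^sup>2 / 2))) \<in> borel_measurable (L \<Otimes>\<^sub>M lborel)"
      unfolding e by (rule measurable_gauss_kernel) fact
  qed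
  also have "\<dots> = (\<integral>\<^sup>+z. ennreal (f z) * ennreal (\<integral>x. exp (- (norm (c *\<^sub>R z - c *\<^sub>R x))\<^sup>2 / 2) \<partial>L) \<partial>lborel)"
  proof (rule nn_integral_cong)
    fix z
    have i: "integrable L (\<lambda>x. exp (- (norm (c *\<^sub>R z - c *\<^sub>R x))\<^sup>2 / 2))"
      by (rule L.integrable_const_bound[where B=1]) auto
    have "(\<integral>\<^sup>+x. ennreal (f z) * ennreal (exp (- (norm (c *\<^sub>R z - c *\<^sub>R x))\<^sup>2 / 2)) \<partial>L)
      = ennreal (f z) * (\<integral>\<^sup>+x. ennreal (exp (- (norm (c *\<^sub>R z - c *\<^sub>R x))\<^sup>2 / 2)) \<partial>L)"
      by (rule nn_integral_cmult) measurable
    also have "(\<integral>\<^sup>+x. ennreal (exp (- (norm (c *\<^sub>R z - c *\<^sub>R x))\<^sup>2 / 2)) \<partial>L) = ennreal (\<integral>x. exp (- (norm (c *\<^sub>R z - c *\<^sub>R x))\<^sup>2 / 2) \<partial>L)"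
      by (rule nn_integral_eq_integral[OF i]) simp
    finally show "(\<integral>\<^sup>+x. ennreal (f z) * ennreal (exp (- (norm (c *\<^sub>R z - c *\<^sub>R x))\<^sup>2 / 2)) \<partial>L)
      = ennreal (f z) * ennreal (\<integral>x. exp (- (norm (c *\<^sub>R z - c *\<^sub>R x))\<^sup>2 / 2) \<partial>L)" .
  qed
  finally show ?thesis .
qed

text \<open>An independent Gaussian perturbation of scale \<open>1 / real (Suc c)\<close> gives both
  measures a density that is a function of the common characteristic function. As the scale tends to
  0, dominated convergence, used once for the perturbation and once for the measure, recovers the
  integral of a bounded continuous function.\<close>

theorem char_eq_imp_measure_eq:
  fixes M N :: "'a::euclidean_space measure"
  assumes M: "prob_space M" and N: "prob_space N" and sets [measurable_cong]: "sets M = sets borel" "sets N = sets borel"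
    and eq: "\<And>a. (CLINT x|M. iexp (a \<bullet> x)) = (CLINT x|N. iexp (a \<bullet> x))"
  shows "M = N"
proof (rule measure_eqI_continuous[OF M N sets])
  fix f :: "'a \<Rightarrow> real" assume cont: "continuous_on UNIV f" and rng: "\<And>x. 0 \<le> f x \<and> f x \<le> 1"
  have f[measurable]: "f \<in> borel_measurable borel"
    by (rule borel_measurable_continuous_onI[OF cont])
  define S where "S L c = (\<integral>x. (\<integral>w. f (x + (1 / real (Suc c)) *\<^sub>R w) \<partial>stdg) \<partial>L)" for L c
  have bd: "0 \<le> (\<integral>w. f (x + c *\<^sub>R w) \<partial>stdg)" "(\<integral>w. f (x + c *\<^sub>R w) \<partial>stdg) \<le> 1" for x c
    by (rule norm_integral_stdg_le_1; simp add: rng)+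
  have S_eq: "S M c = S N c" for c
  proof -
    let ?c = "real (Suc c)"
    have pos: "?c > 0" by simp
    have "(\<integral>x. exp (- (norm (?c *\<^sub>R z - ?c *\<^sub>R x))\<^sup>2 / 2) \<partial>M) = (\<integral>x. exp (- (norm (?c *\<^sub>R z - ?c *\<^sub>R x))\<^sup>2 / 2) \<partial>N)" for z
    proof -
      have "complex_of_real (\<integral>x. exp (- (norm (?c *\<^sub>R z - ?c *\<^sub>R x))\<^sup>2 / 2) \<partial>M) = complex_of_real (\<integral>x. exp (- (norm (?c *\<^sub>R z - ?c *\<^sub>R x))\<^sup>2 / 2) \<partial>N)"
        unfolding gauss_kernel_eq[OF M sets(1)] gauss_kernel_eq[OF N sets(2)] eq by (rule refl)
      then show ?thesis by (rule iffD1[OF of_real_eq_iff])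
    qed
    then have "ennreal ((sqrt (2*pi) / ?c)^DIM('a)) * ennreal (S M c) = ennreal ((sqrt (2*pi) / ?c)^DIM('a)) * ennreal (S N c)"
      unfolding S_def nn_integral_smoothing[OF M sets(1) f rng pos] nn_integral_smoothing[OF N sets(2) f rng pos]
      by (simp only:)
    moreover have "S L c \<ge> 0" for L
      unfolding S_def by (intro integral_nonneg_AE AE_I2 bd)
    moreover have "ennreal ((sqrt (2*pi) / ?c)^DIM('a)) \<noteq> 0"
    proof -
      have "0 < (sqrt (2*pi) / ?c)^DIM('a)" by (intro zero_less_power divide_pos_pos pos) simp
      then show ?thesis by simp
    qed
    ultimately show ?thesis
      by (simp add: ennreal_mult_cancel_left)
  qed
  have lim: "(\<lambda>c. S L c) \<longlonglongrightarrow> (\<integral>x. f x \<partial>L)" if L: "prob_space L" and sets_L [measurable_cong]: "sets L = sets borel" for L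
  proof -
    interpret L: prob_space L by fact
    have 1: "(\<lambda>c. \<integral>w. f (x + (1 / real (Suc c)) *\<^sub>R w) \<partial>stdg) \<longlonglongrightarrow> f x" for x
    proof -
      have "(\<lambda>c. \<integral>w. f (x + (1 / real (Suc c)) *\<^sub>R w) \<partial>stdg) \<longlonglongrightarrow> (\<integral>w. f x \<partial>(stdg::'a measure))"
      proof (rule integral_dominated_convergence[where w = "\<lambda>_. 1"])
        show "AE w in stdg. (\<lambda>c. f (x + (1 / real (Suc c)) *\<^sub>R w)) \<longlonglongrightarrow> f x"
        proof (rule AE_I2)
          fix w :: 'a
          have "(\<lambda>c. x + (1 / real (Suc c)) *\<^sub>R w) \<longlonglongrightarrow> x + 0 *\<^sub>R w"
            by (intro tendsto_intros LIMSEQ_Suc[OF lim_1_over_n])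
          then show "(\<lambda>c. f (x + (1 / real (Suc c)) *\<^sub>R w)) \<longlonglongrightarrow> f x"
            using cont by (intro continuous_on_tendsto_compose[of UNIV f]) auto
        qed
      qed (simp_all add: rng)
      then show ?thesis by simp
    qed
    have m: "(\<lambda>x. \<integral>w. f (x + (1 / real (Suc c)) *\<^sub>R w) \<partial>stdg) \<in> borel_measurable L" for c
      by measurable
    show ?thesis unfolding S_def
    proof (rule integral_dominated_convergence[where w = "\<lambda>_. 1"])
      show "AE x in L. norm (\<integral>w. f (x + (1 / real (Suc c)) *\<^sub>R w) \<partial>stdg) \<le> 1" for c
        using bd by simp
    qed (use 1 m in \<open>simp_all del: of_nat_Suc\<close>)
  qed
  show "(\<integral>x. f x \<partial>M) = (\<integral>x. f x \<partial>N)"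
    using LIMSEQ_unique[OF lim[OF M sets(1)]] lim[OF N sets(2)] S_eq by simp
qed

lemma stdg_eqI:
  fixes M :: "'a::euclidean_space measure"
  assumes "prob_space M" "sets M = sets borel"
    and "\<And>a. (CLINT x|M. iexp (a \<bullet> x)) = exp (- (norm a)\<^sup>2 / 2)"
  shows "M = stdg"
  by (rule char_eq_imp_measure_eq[OF assms(1) prob_space_stdg assms(2)]) (simp_all add: assms(3) char_stdg)

section \<open>Products and images of the standard Gaussian measure\<close>

lemma stdg_pair: "stdg \<Otimes>\<^sub>M stdg = (stdg :: ('a::euclidean_space \<times> 'b::euclidean_space) measure)"
proof -
  let ?f = "\<lambda>x::'a. ennreal ((1 / sqrt (2*pi))^DIM('a) * exp (- (norm x)\<^sup>2 / 2))"
  let ?g = "\<lambda>y::'b. ennreal ((1 / sqrt (2*pi))^DIM('b) * exp (- (norm y)\<^sup>2 / 2))"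
  have mf: "?f \<in> borel_measurable lborel" by simp
  have mg: "?g \<in> borel_measurable lborel" by simp
  have sf: "sigma_finite_measure (density lborel ?g)"
    using prob_space_imp_sigma_finite[OF prob_space_stdg[where 'a='b]] unfolding density_stdg .
  have "(stdg :: 'a measure) \<Otimes>\<^sub>M (stdg :: 'b measure) = density (lborel \<Otimes>\<^sub>M lborel) (\<lambda>(x, y). ?f x * ?g y)"
    unfolding density_stdg
    by (rule pair_measure_density[OF mf mg sigma_finite_lborel sf])
  also have "\<dots> = density lborel (\<lambda>z. ennreal ((1 / sqrt (2*pi))^DIM('a \<times> 'b) * exp (- (norm z)\<^sup>2 / 2)))"
    unfolding lborel_prod
  proof (rule density_cong)
    show "AE z in lborel. (case z of (x, y) \<Rightarrow> ?f x * ?g y) = ennreal ((1 / sqrt (2*pi))^DIM('a \<times> 'b) * exp (- (norm z)\<^sup>2 / 2))"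
    proof (rule AE_I2)
      fix z :: "'a \<times> 'b"
      obtain x y where z: "z = (x, y)" by (cases z)
      have "exp (- (norm z)\<^sup>2 / 2) = exp (- (norm x)\<^sup>2 / 2) * exp (- (norm y)\<^sup>2 / 2)"
        unfolding z norm_Pair exp_add[symmetric] by (simp add: field_simps)
      moreover have "?f x * ?g y = ennreal (((1 / sqrt (2*pi))^DIM('a) * exp (- (norm x)\<^sup>2 / 2)) * ((1 / sqrt (2*pi))^DIM('b) * exp (- (norm y)\<^sup>2 / 2)))"
        by (rule ennreal_mult[symmetric]) simp_all
      ultimately show "(case z of (x, y) \<Rightarrow> ?f x * ?g y) = ennreal ((1 / sqrt (2*pi))^DIM('a \<times> 'b) * exp (- (norm z)\<^sup>2 / 2))"
        unfolding z by (simp only: prod.case DIM_prod power_add mult_ac)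
    qed
    have "(\<lambda>x. ?f (fst x)) \<in> borel_measurable (borel \<Otimes>\<^sub>M (borel :: 'b measure))"
      by (rule measurable_compose[OF measurable_fst]) simp
    moreover have "(\<lambda>x. ?g (snd x)) \<in> borel_measurable ((borel :: 'a measure) \<Otimes>\<^sub>M borel)"
      by (rule measurable_compose[OF measurable_snd]) simp
    ultimately have "(\<lambda>x. ?f (fst x) * ?g (snd x)) \<in> borel_measurable (borel \<Otimes>\<^sub>M borel)"
      by (rule borel_measurable_times_ennreal)
    then show "(\<lambda>(x, y). ?f x * ?g y) \<in> borel_measurable lborel"
      by (simp add: case_prod_beta' borel_prod)
    show "(\<lambda>z. ennreal ((1 / sqrt (2*pi))^DIM('a \<times> 'b) * exp (- (norm z)\<^sup>2 / 2))) \<in> borel_measurable lborel"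
      by simp
  qed
  also have "\<dots> = stdg"
    unfolding density_stdg ..
  finally show ?thesis .
qed

text \<open>The characteristic function of the image at \<open>a\<close> is that of
  \<open>stdg\<close> at \<open>T' a\<close>, where only the norm matters. The invariances of
  \<open>stdg\<close> used later are instances with an explicit isometric adjoint \<open>T'\<close>,
  so that no Jacobian has to be computed.\<close>

lemma distr_stdg_coisometry:
  fixes T :: "'a::euclidean_space \<Rightarrow> 'b::euclidean_space"
  assumes T: "\<And>x a. a \<bullet> T x = T' a \<bullet> x" and iso: "\<And>a. norm (T' a) = norm a" and [measurable]: "T \<in> borel_measurable borel"
  shows "distr stdg borel T = stdg"
proof (rule stdg_eqI)
  show "prob_space (distr stdg borel T)" by (rule stdg.prob_space_distr) simp
  fix a
  show "(CLINT x|distr stdg borel T. iexp (a \<bullet> x)) = exp (- (norm a)\<^sup>2 / 2)"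
    by (subst integral_distr) (simp_all add: T char_stdg iso)
qed simp

section \<open>Exponential moments and chi-square tails\<close>

lemma nn_integral_exp_square_std_normal:
  assumes "\<theta> < 1 / 2"
  shows "(\<integral>\<^sup>+t. ennreal (exp (\<theta> * t\<^sup>2)) \<partial>std_normal_distribution) = ennreal (1 / sqrt (1 - 2 * \<theta>))"
proof -
  let ?s = "1 / sqrt (1 - 2 * \<theta>)"
  have s: "?s > 0" using assms by simp
  have "std_normal_density t * exp (\<theta> * t\<^sup>2) = ?s * normal_density 0 ?s t" for t
  proof -
    have "exp (- t\<^sup>2 / 2) * exp (\<theta> * t\<^sup>2) = exp (- (t - 0)\<^sup>2 / (2 * ?s\<^sup>2))"
      using assms by (simp add: exp_add[symmetric] power_divide field_simps)
    moreover have "1 / sqrt (2 * pi) = ?s * (1 / sqrt (2 * pi * ?s\<^sup>2))"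
      using s by (simp add: real_sqrt_mult real_sqrt_divide power_divide)
    ultimately have "1 / sqrt (2 * pi) * (exp (- t\<^sup>2 / 2) * exp (\<theta> * t\<^sup>2)) = ?s * (1 / sqrt (2 * pi * ?s\<^sup>2)) * exp (- (t - 0)\<^sup>2 / (2 * ?s\<^sup>2))"
      by (simp only:)
    then show ?thesis
      by (simp only: std_normal_density_def normal_density_def[of 0 ?s] mult.assoc)
  qed
  then have "(\<integral>\<^sup>+t. ennreal (exp (\<theta> * t\<^sup>2)) \<partial>std_normal_distribution)
     = (\<integral>\<^sup>+t. ennreal ?s * ennreal (normal_density 0 ?s t) \<partial>lborel)"
    using s by (subst nn_integral_density) (simp_all add: ennreal_mult[symmetric] del: divide_const_simps)
  also have "\<dots> = ennreal ?s * (\<integral>\<^sup>+t. ennreal (normal_density 0 ?s t) \<partial>lborel)"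
    by (rule nn_integral_cmult) simp
  also have "(\<integral>\<^sup>+t. ennreal (normal_density 0 ?s t) \<partial>lborel) = 1"
    using prob_space.emeasure_space_1[OF prob_space_normal_density[OF s, of 0]]
    by (simp add: emeasure_density)
  finally show ?thesis by simp
qed

lemma orthonormal_family_extend:
  fixes B :: "'a::euclidean_space set"
  assumes "pairwise orthogonal B" and "\<And>b. b \<in> B \<Longrightarrow> norm b = 1"
  obtains C where "B \<subseteq> C" "pairwise orthogonal C" "\<And>c. c \<in> C \<Longrightarrow> norm c = 1" "card C = DIM('a)" "finite C"
proof -
  define S where "S = {y::'a. \<forall>x\<in>span B. orthogonal x y}"
  have "subspace S" unfolding S_def by (rule subspace_orthogonal_to_vectors)
  then obtain D where D: "D \<subseteq> S" "pairwise orthogonal D" "\<And>x. x \<in> D \<Longrightarrow> norm x = 1"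
    "independent D" "card D = dim S" "span D = S"
    using orthonormal_basis_subspace by metis
  have iB: "independent B"
    using assms by (intro pairwise_orthogonal_independent) force+
  have "dim S + dim (span B) = DIM('a)"
    using dim_subspace_orthogonal_to_vectors[of "span B" "UNIV :: 'a set"] by (simp add: S_def)
  then have "card B + card D = DIM('a)"
    using iB D by (simp add: dim_eq_card_independent)
  moreover have "B \<inter> D = {}"
  proof (rule ccontr)
    assume "B \<inter> D \<noteq> {}"
    then obtain x where "x \<in> B" "x \<in> S" using D by auto
    then have "orthogonal x x" by (auto simp: S_def span_base)
    then show False using assms(2)[OF \<open>x \<in> B\<close>] by (auto simp: orthogonal_self)
  qed
  moreover have "finite B" "finite D"
    using iB D(4) independent_imp_finite by auto
  ultimately have "card (B \<union> D) = DIM('a)" "finite (B \<union> D)"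
    by (simp_all add: card_Un_disjoint)
  moreover have "pairwise orthogonal (B \<union> D)"
  proof -
    have "orthogonal b d" if "b \<in> B" "d \<in> D" for b d
      using D(1) that by (auto simp: S_def span_base)
    then show ?thesis
      using assms(1) D(2) unfolding pairwise_def by (metis Un_iff orthogonal_commute)
  qed
  ultimately show ?thesis
    using that[of "B \<union> D"] assms(2) D(3) by auto
qed

text \<open>The family is completed to an orthonormal basis, whose coordinates form again a standard
  Gaussian element. In these coordinates the integral is a product, and the added basis vectors
  contribute the factor 1.\<close>

lemma nn_integral_exp_orthonormal_squares:
  fixes B :: "'a::euclidean_space set"
  assumes B: "pairwise orthogonal B" "\<And>b. b \<in> B \<Longrightarrow> norm b = 1" and "\<theta> < 1 / 2"
  shows "(\<integral>\<^sup>+x. ennreal (exp (\<theta> * (\<Sum>b\<in>B. (b \<bullet> x)\<^sup>2))) \<partial>stdg) = ennreal ((1 / sqrt (1 - 2 * \<theta>)) ^ card B)"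
proof -
  obtain C where C: "B \<subseteq> C" "pairwise orthogonal C" "\<And>c. c \<in> C \<Longrightarrow> norm c = 1" "card C = DIM('a)" "finite C"
    using orthonormal_family_extend[OF B] by blast
  obtain \<pi> where \<pi>: "bij_betw \<pi> (Basis :: 'a set) C"
    using finite_same_card_bij[OF finite_Basis C(5)] C(4) by auto
  define T where "T x = (\<Sum>i\<in>Basis. (\<pi> i \<bullet> x) *\<^sub>R i)" for x
  define T' where "T' a = (\<Sum>i\<in>Basis. (a \<bullet> i) *\<^sub>R \<pi> i)" for a
  have Ti: "T x \<bullet> i = \<pi> i \<bullet> x" if "i \<in> Basis" for x i
    using that by (simp add: T_def inner_sum_left inner_Basis if_distrib[of "\<lambda>c. _ * c"] sum.delta cong: if_cong)
  have ip: "\<pi> i \<bullet> \<pi> j = (if i = j then 1 else 0)" if "i \<in> Basis" "j \<in> Basis" for i j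
  proof (cases "i = j")
    case True
    then show ?thesis using C(3)[of "\<pi> j"] \<pi> that by (auto simp: bij_betw_def norm_eq_1)
  next
    case False
    then have "\<pi> i \<noteq> \<pi> j" using \<pi> that by (auto simp: bij_betw_def inj_on_def)
    then show ?thesis using C(2) \<pi> that False by (auto simp: pairwise_def orthogonal_def bij_betw_def)
  qed
  have dist: "distr stdg borel T = stdg"
  proof (rule distr_stdg_coisometry[where T' = T'])
    show "a \<bullet> T x = T' a \<bullet> x" for a x
      by (subst euclidean_inner) (simp add: Ti T'_def inner_sum_left)
    have "T' a \<bullet> T' a = a \<bullet> a" for a
      unfolding T'_def euclidean_inner[of a a]
      by (simp add: inner_sum_left inner_sum_right ip if_distrib[of "\<lambda>c. _ * c"] sum.delta cong: if_cong)
    then show "norm (T' a) = norm a" for a by (simp add: norm_eq_sqrt_inner)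
    show "T \<in> borel_measurable borel" unfolding T_def by measurable
  qed
  have [measurable]: "T \<in> borel_measurable borel" unfolding T_def by measurable
  define I where "I = {i \<in> Basis. \<pi> i \<in> B}"
  have bI: "bij_betw \<pi> I B"
    using \<pi> C(1) by (auto simp: I_def bij_betw_def inj_on_def)
  have sq: "(\<Sum>b\<in>B. (b \<bullet> x)\<^sup>2) = (\<Sum>i\<in>I. (T x \<bullet> i)\<^sup>2)" for x
    using sum.reindex_bij_betw[OF bI, of "\<lambda>b. (b \<bullet> x)\<^sup>2"] by (simp add: Ti I_def)
  have pr: "exp (\<theta> * (\<Sum>i\<in>I. (z \<bullet> i)\<^sup>2)) = (\<Prod>i\<in>Basis. if i \<in> I then exp (\<theta> * (z \<bullet> i)\<^sup>2) else 1)" for z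
  proof -
    have "exp (\<theta> * (\<Sum>i\<in>I. (z \<bullet> i)\<^sup>2)) = (\<Prod>i\<in>I. exp (\<theta> * (z \<bullet> i)\<^sup>2))"
      by (simp add: sum_distrib_left exp_sum I_def)
    also have "\<dots> = (\<Prod>i\<in>Basis. if i \<in> I then exp (\<theta> * (z \<bullet> i)\<^sup>2) else 1)"
      unfolding I_def by (subst prod.inter_filter[symmetric]) (auto intro!: prod.cong)
    finally show ?thesis .
  qed
  have "(\<integral>\<^sup>+x. ennreal (exp (\<theta> * (\<Sum>b\<in>B. (b \<bullet> x)\<^sup>2))) \<partial>stdg) = (\<integral>\<^sup>+z. ennreal (exp (\<theta> * (\<Sum>i\<in>I. (z \<bullet> i)\<^sup>2))) \<partial>distr stdg borel T)"
    unfolding sq by (subst nn_integral_distr) simp_all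
  also have "\<dots> = (\<integral>\<^sup>+z. (\<Prod>i\<in>Basis. (if i \<in> I then ennreal (exp (\<theta> * (z \<bullet> i)\<^sup>2)) else 1)) \<partial>stdg)"
    unfolding dist pr by (intro nn_integral_cong, subst prod_ennreal[symmetric]) (auto intro!: prod.cong)
  also have "\<dots> = (\<Prod>i\<in>Basis. \<integral>\<^sup>+t. (if i \<in> I then ennreal (exp (\<theta> * t\<^sup>2)) else 1) \<partial>std_normal_distribution)"
    by (rule nn_integral_stdg_prod[where f = "\<lambda>i t. if i \<in> I then ennreal (exp (\<theta> * t\<^sup>2)) else 1"]) measurable
  also have "\<dots> = (\<Prod>i\<in>Basis. if i \<in> I then ennreal (1 / sqrt (1 - 2 * \<theta>)) else 1)"
  proof (intro prod.cong refl)
    fix i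
    show "(\<integral>\<^sup>+t. (if i \<in> I then ennreal (exp (\<theta> * t\<^sup>2)) else 1) \<partial>std_normal_distribution) = (if i \<in> I then ennreal (1 / sqrt (1 - 2 * \<theta>)) else 1)"
      using prob_space.emeasure_space_1[OF prob_space_normal_density[of 1 0]]
      by (cases "i \<in> I") (simp_all only: if_True if_False nn_integral_exp_square_std_normal[OF \<open>\<theta> < 1/2\<close>], simp)
  qed
  also have "\<dots> = (\<Prod>i\<in>I. ennreal (1 / sqrt (1 - 2 * \<theta>)))"
    unfolding I_def by (subst prod.inter_filter) (auto intro!: prod.cong)
  also have "\<dots> = ennreal ((1 / sqrt (1 - 2 * \<theta>)) ^ card B)"
    using bij_betw_same_card[OF bI] assms(3) by (simp add: ennreal_power)
  finally show ?thesis .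
qed

text \<open>The derivative of \<open>ln (1 - t) + t + t\<^sup>2\<close> is
  \<open>t * (1 - 2 * t) / (1 - t)\<close>, nonnegative up to 1/2.\<close>

lemma ln_one_minus_ge:
  assumes "0 \<le> x" "x \<le> (1::real) / 2"
  shows "- x - x\<^sup>2 \<le> ln (1 - x)"
proof -
  have "ln (1 - 0) + 0 + 0\<^sup>2 \<le> ln (1 - x) + x + x\<^sup>2"
  proof (rule DERIV_nonneg_imp_nondecreasing[OF assms(1)])
    fix t assume t: "0 \<le> t" "t \<le> x"
    then have t': "0 \<le> t" "t \<le> 1/2" using assms by auto
    have "((\<lambda>x. ln (1 - x) + x + x\<^sup>2) has_real_derivative (- 1 / (1 - t) + 1 + 2 * t)) (at t)"
      using t' by (auto intro!: derivative_eq_intros)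
    moreover have "- 1 / (1 - t) + 1 + 2 * t = t * (1 - 2 * t) / (1 - t)"
      using t' by (simp add: field_simps)
    moreover have "t * (1 - 2 * t) / (1 - t) \<ge> 0"
      using t' by (intro divide_nonneg_nonneg mult_nonneg_nonneg) auto
    ultimately show "\<exists>y. ((\<lambda>x. ln (1 - x) + x + x\<^sup>2) has_real_derivative y) (at t) \<and> 0 \<le> y"
      by metis
  qed
  then show ?thesis by simp
qed

lemma powr_half_bound_upper:
  assumes "0 \<le> \<theta>" "\<theta> \<le> 1 / 4"
  shows "(1 / sqrt (1 - 2 * \<theta>)) ^ r \<le> exp (real r * (\<theta> + 2 * \<theta>\<^sup>2))"
proof -
  have "ln (1 - 2 * \<theta>) \<ge> - (2 * \<theta>) - (2 * \<theta>)\<^sup>2"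
    using ln_one_minus_ge[of "2 * \<theta>"] assms by simp
  then have "- ln (1 - 2 * \<theta>) / 2 \<le> \<theta> + 2 * \<theta>\<^sup>2"
    by (simp add: field_simps power2_eq_square)
  moreover have "1 / sqrt (1 - 2 * \<theta>) = exp (- ln (1 - 2 * \<theta>) / 2)"
    using assms by (simp add: exp_minus ln_sqrt[symmetric] inverse_eq_divide)
  ultimately have "1 / sqrt (1 - 2 * \<theta>) \<le> exp (\<theta> + 2 * \<theta>\<^sup>2)" by simp
  then have "(1 / sqrt (1 - 2 * \<theta>)) ^ r \<le> exp (\<theta> + 2 * \<theta>\<^sup>2) ^ r"
    using assms by (intro power_mono) auto
  then show ?thesis by (simp add: exp_of_nat_mult[symmetric])
qed

lemma powr_half_bound_lower:
  assumes "0 \<le> \<theta>" "\<theta> \<le> 1 / 4"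
  shows "(1 / sqrt (1 + 2 * \<theta>)) ^ r \<le> exp (real r * (2 * \<theta>\<^sup>2 - \<theta>))"
proof -
  have "ln (1 + 2 * \<theta>) \<ge> 2 * \<theta> - (2 * \<theta>)\<^sup>2"
    using ln_one_plus_pos_lower_bound[of "2*\<theta>"] assms by simp
  then have "- ln (1 + 2 * \<theta>) / 2 \<le> 2 * \<theta>\<^sup>2 - \<theta>"
    by (simp add: field_simps power2_eq_square)
  moreover have "1 / sqrt (1 + 2 * \<theta>) = exp (- ln (1 + 2 * \<theta>) / 2)"
    using assms by (simp add: exp_minus ln_sqrt[symmetric] inverse_eq_divide)
  ultimately have "1 / sqrt (1 + 2 * \<theta>) \<le> exp (2 * \<theta>\<^sup>2 - \<theta>)" by simp
  then have "(1 / sqrt (1 + 2 * \<theta>)) ^ r \<le> exp (2 * \<theta>\<^sup>2 - \<theta>) ^ r"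
    using assms by (intro power_mono) auto
  then show ?thesis by (simp add: exp_of_nat_mult[symmetric])
qed

text \<open>Chernoff bounds on both sides, with the logarithm of the exponential moment bounded to
  second order in the parameter. The maximum in the exponent merges the Gaussian regime, where
  \<open>w\<close> is below the degrees of freedom, with the exponential regime above.\<close>

lemma chi_square_deviation:
  fixes B :: "'a::euclidean_space set"
  assumes B: "pairwise orthogonal B" "\<And>b. b \<in> B \<Longrightarrow> norm b = 1" and "w > 0"
  shows "measure stdg {x. \<bar>(\<Sum>b\<in>B. (b \<bullet> x)\<^sup>2) - real (card B)\<bar> \<ge> w}
    \<le> 2 * exp (- w\<^sup>2 / (8 * max (real (card B)) w))"
proof -
  define r where "r = card B"
  define M where "M = max (real r) w"
  define f where "f x = (\<Sum>b\<in>B. (b \<bullet> x)\<^sup>2)" for x :: 'a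
  have [measurable]: "f \<in> borel_measurable borel" unfolding f_def by measurable
  have M: "M > 0" "w \<le> M" "real r \<le> M" using \<open>w > 0\<close> by (auto simp: M_def)
  have e: "w\<^sup>2 / (8 * M) = (w / M) * w / 8" by (simp add: power2_eq_square)
  have wM: "0 \<le> w / M" "w / M \<le> 1" using M \<open>w > 0\<close> by auto
  have up: "emeasure stdg {x. f x \<ge> real r + w} \<le> ennreal (exp (- w\<^sup>2 / (8 * M)))"
  proof -
    \<comment> \<open>Minimiser of \<open>- \<theta> * w + 2 * M * \<theta>\<^sup>2\<close>. It is
      at most 1/4 because \<open>w \<le> M\<close>, as the second-order bound on the exponential
      moment requires.\<close>
    define \<theta> where "\<theta> = w / (4 * M)"
    have t: "0 < \<theta>" "\<theta> \<le> 1 / 4" using M \<open>w > 0\<close> by (auto simp: \<theta>_def field_simps)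
    have "emeasure stdg {x\<in>UNIV. f x \<ge> real r + w} \<le> ennreal (exp (- \<theta> * (real r + w))) * (\<integral>\<^sup>+x. ennreal (exp (\<theta> * f x)) * indicator UNIV x \<partial>stdg)"
      by (rule Chernoff_ineq_nn_integral_ge[OF t(1)]) auto
    also have "(\<integral>\<^sup>+x. ennreal (exp (\<theta> * f x)) * indicator UNIV x \<partial>stdg) = ennreal ((1 / sqrt (1 - 2 * \<theta>)) ^ r)"
      using nn_integral_exp_orthonormal_squares[OF B, of \<theta>] t by (simp add: f_def r_def)
    also have "ennreal (exp (- \<theta> * (real r + w))) * \<dots> \<le> ennreal (exp (- \<theta> * (real r + w))) * ennreal (exp (real r * (\<theta> + 2 * \<theta>\<^sup>2)))"
      using powr_half_bound_upper[of \<theta> r] t by (intro mult_left_mono ennreal_leI) auto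
    also have "\<dots> = ennreal (exp (- \<theta> * w + 2 * real r * \<theta>\<^sup>2))"
      by (simp add: ennreal_mult[symmetric] exp_add[symmetric] algebra_simps)
    also have "\<dots> \<le> ennreal (exp (- w\<^sup>2 / (8 * M)))"
    proof (intro ennreal_leI, subst exp_le_cancel_iff)
      have "real r * \<theta>\<^sup>2 \<le> M * \<theta>\<^sup>2" using M by (intro mult_right_mono) auto
      also have "M * \<theta>\<^sup>2 = w\<^sup>2 / (16 * M)" using M by (simp add: \<theta>_def power2_eq_square field_simps)
      finally have "- \<theta> * w + 2 * real r * \<theta>\<^sup>2 \<le> - \<theta> * w + 2 * (w\<^sup>2 / (16 * M))" by simp
      also have "\<dots> = - w\<^sup>2 / (8 * M)" using M by (simp add: \<theta>_def power2_eq_square field_simps)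
      finally show "- \<theta> * w + 2 * real r * \<theta>\<^sup>2 \<le> - w\<^sup>2 / (8 * M)" .
    qed
    finally show ?thesis by simp
  qed
  have low: "emeasure stdg {x. f x \<le> real r - w} \<le> ennreal (exp (- w\<^sup>2 / (8 * M)))"
  proof -
    define \<theta> where "\<theta> = w / (4 * M)"
    have t: "0 < \<theta>" "\<theta> \<le> 1 / 4" using M \<open>w > 0\<close> by (auto simp: \<theta>_def field_simps)
    have "emeasure stdg {x\<in>UNIV. f x \<le> real r - w} \<le> ennreal (exp (\<theta> * (real r - w))) * (\<integral>\<^sup>+x. ennreal (exp (- \<theta> * f x)) * indicator UNIV x \<partial>stdg)"
      by (rule Chernoff_ineq_nn_integral_le[OF t(1)]) auto
    also have "(\<integral>\<^sup>+x. ennreal (exp (- \<theta> * f x)) * indicator UNIV x \<partial>stdg) = ennreal ((1 / sqrt (1 + 2 * \<theta>)) ^ r)"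
      using nn_integral_exp_orthonormal_squares[OF B, of "- \<theta>"] t by (simp add: f_def r_def)
    also have "ennreal (exp (\<theta> * (real r - w))) * \<dots> \<le> ennreal (exp (\<theta> * (real r - w))) * ennreal (exp (real r * (2 * \<theta>\<^sup>2 - \<theta>)))"
      using powr_half_bound_lower[of \<theta> r] t by (intro mult_left_mono ennreal_leI) auto
    also have "\<dots> = ennreal (exp (- \<theta> * w + 2 * real r * \<theta>\<^sup>2))"
      by (simp add: ennreal_mult[symmetric] exp_add[symmetric] algebra_simps)
    also have "\<dots> \<le> ennreal (exp (- w\<^sup>2 / (8 * M)))"
    proof (intro ennreal_leI, subst exp_le_cancel_iff)
      have "real r * \<theta>\<^sup>2 \<le> M * \<theta>\<^sup>2" using M by (intro mult_right_mono) auto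
      also have "M * \<theta>\<^sup>2 = w\<^sup>2 / (16 * M)" using M by (simp add: \<theta>_def power2_eq_square field_simps)
      finally have "- \<theta> * w + 2 * real r * \<theta>\<^sup>2 \<le> - \<theta> * w + 2 * (w\<^sup>2 / (16 * M))" by simp
      also have "\<dots> = - w\<^sup>2 / (8 * M)" using M by (simp add: \<theta>_def power2_eq_square field_simps)
      finally show "- \<theta> * w + 2 * real r * \<theta>\<^sup>2 \<le> - w\<^sup>2 / (8 * M)" .
    qed
    finally show ?thesis by simp
  qed
  have "{x. \<bar>f x - real r\<bar> \<ge> w} \<subseteq> {x. f x \<ge> real r + w} \<union> {x. f x \<le> real r - w}" by auto
  then have "measure stdg {x. \<bar>f x - real r\<bar> \<ge> w} \<le> measure stdg ({x. f x \<ge> real r + w} \<union> {x. f x \<le> real r - w})"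
    by (intro stdg.finite_measure_mono) auto
  also have "\<dots> \<le> measure stdg {x. f x \<ge> real r + w} + measure stdg {x. f x \<le> real r - w}"
    by (intro measure_Un_le) auto
  also have "\<dots> \<le> exp (- w\<^sup>2 / (8 * M)) + exp (- w\<^sup>2 / (8 * M))"
    using up low by (intro add_mono) (simp_all add: stdg.emeasure_eq_measure)
  finally show ?thesis by (simp add: f_def r_def M_def)
qed

text \<open>At the Chernoff parameter 3/8 the exponential moment equals 2, since 1 - 2 * 3/8 =
  1/4.\<close>

lemma stdg_linear_form_tail:
  fixes f :: "'a::euclidean_space"
  assumes "norm f = 1"
  shows "measure stdg {x. (f \<bullet> x)\<^sup>2 \<ge> a} \<le> 2 * exp (- 3 * a / 8)"
proof -
  have "emeasure stdg {x\<in>UNIV. (f \<bullet> x)\<^sup>2 \<ge> a} \<le> ennreal (exp (- (3/8) * a)) * (\<integral>\<^sup>+x. ennreal (exp ((3/8) * (f \<bullet> x)\<^sup>2)) * indicator UNIV x \<partial>stdg)"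
    by (rule Chernoff_ineq_nn_integral_ge) auto
  also have "(\<integral>\<^sup>+x. ennreal (exp ((3/8) * (f \<bullet> x)\<^sup>2)) * indicator UNIV x \<partial>stdg) = ennreal 2"
    using nn_integral_exp_orthonormal_squares[of "{f}" "3/8"] assms by (simp add: real_sqrt_divide)
  also have "ennreal (exp (- (3/8) * a)) * ennreal 2 = ennreal (2 * exp (- 3 * a / 8))"
    by (subst ennreal_mult[symmetric]) (simp_all add: mult.commute)
  finally show ?thesis by (simp add: stdg.emeasure_eq_measure)
qed

section \<open>Least squares and the Moore--Penrose inverse\<close>

declare transpose_matrix_vector [simp del]

lemma inner_matrix_vector: "(A *v x) \<bullet> y = x \<bullet> (transpose A *v y)" for A :: "real^'n^'m"
  by (metis dot_lmul_matrix vector_transpose_matrix)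

lemma transpose_vector_sum: "transpose W *v c = (\<Sum>i\<in>UNIV. c $ i *\<^sub>R W $ i)" for W :: "real^'n^'k"
  by (simp add: vec_eq_iff matrix_vector_mult_def transpose_def mult.commute)

lemma closed_projection_compact:
  fixes G :: "('a::metric_space \<times> 'b::metric_space) set"
  assumes "closed G" "compact K"
  shows "closed (fst ` (G \<inter> UNIV \<times> K))"
  unfolding closed_sequential_limits
proof (intro allI impI)
  fix a and l assume a: "(\<forall>n. a n \<in> fst ` (G \<inter> UNIV \<times> K)) \<and> a \<longlonglongrightarrow> l"
  then have "\<forall>n. \<exists>b. (a n, b) \<in> G \<and> b \<in> K" by force
  then obtain b where b: "\<And>n. (a n, b n) \<in> G" "\<And>n. b n \<in> K" by metis
  obtain l' r where r: "l' \<in> K" "strict_mono r" "(b \<circ> r) \<longlonglongrightarrow> l'"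
    using assms(2) b(2) unfolding compact_def by metis
  have "(\<lambda>n. (a (r n), b (r n))) \<longlonglongrightarrow> (l, l')"
    using r a LIMSEQ_subseq_LIMSEQ[of a l r] by (intro tendsto_Pair) (auto simp: o_def)
  then have "(l, l') \<in> G"
    using closed_sequentially[OF assms(1), of "\<lambda>n. (a (r n), b (r n))"] b(1) by auto
  then show "l \<in> fst ` (G \<inter> UNIV \<times> K)" using r(1) by force
qed

text \<open>A projection of a closed set need not be closed, but the fibre is a countable union of
  compact balls, so the projection is a countable union of closed sets. This serves for sets defined
  by the existence of a matrix or vector, namely the domain of \<open>pinv\<close> and the
  rank-deficient matrices.\<close>

lemma borel_projection_closed:
  fixes G :: "('a::metric_space \<times> 'b::euclidean_space) set"
  assumes "closed G"
  shows "fst ` G \<in> sets borel"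
proof -
  have "fst ` G = (\<Union>n. fst ` (G \<inter> UNIV \<times> cball 0 (real n)))"
  proof (intro equalityI subsetI)
    fix a assume "a \<in> fst ` G"
    then obtain b where "(a, b) \<in> G" by auto
    moreover obtain n where "norm b \<le> real n" using real_arch_simple by blast
    ultimately show "a \<in> (\<Union>n. fst ` (G \<inter> UNIV \<times> cball 0 (real n)))" by force
  qed auto
  moreover have "fst ` (G \<inter> UNIV \<times> cball 0 (real n)) \<in> sets borel" for n
    using closed_projection_compact[OF assms compact_cball] by (intro borel_closed)
  ultimately show ?thesis by auto
qed

lemma continuous_on_matrix_mult [continuous_intros]:
  fixes f :: "'a::topological_space \<Rightarrow> real^'n^'m" and g :: "'a \<Rightarrow> real^'k^'n"
  assumes "continuous_on S f" "continuous_on S g"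
  shows "continuous_on S (\<lambda>x. f x ** g x)"
  unfolding matrix_matrix_mult_def by (intro continuous_intros assms)

lemma continuous_on_matrix_vector_mult [continuous_intros]:
  fixes f :: "'a::topological_space \<Rightarrow> real^'n^'m" and g :: "'a \<Rightarrow> real^'n"
  assumes "continuous_on S f" "continuous_on S g"
  shows "continuous_on S (\<lambda>x. f x *v g x)"
  unfolding matrix_vector_mult_def by (intro continuous_intros assms)

lemma continuous_on_transpose [continuous_intros]:
  fixes f :: "'a::topological_space \<Rightarrow> real^'n^'m"
  assumes "continuous_on S f"
  shows "continuous_on S (\<lambda>x. transpose (f x))"
  unfolding transpose_def by (intro continuous_intros assms)

lemma measurable_matrix_mult [measurable]:
  fixes f :: "'a \<Rightarrow> real^'n^'m" and g :: "'a \<Rightarrow> real^'k^'n"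
  assumes "f \<in> borel_measurable M" "g \<in> borel_measurable M"
  shows "(\<lambda>x. f x ** g x) \<in> borel_measurable M"
  by (rule borel_measurable_continuous_Pair[OF assms]) (intro continuous_intros)

lemma measurable_matrix_vector_mult [measurable]:
  fixes f :: "'a \<Rightarrow> real^'n^'m" and g :: "'a \<Rightarrow> real^'n"
  assumes "f \<in> borel_measurable M" "g \<in> borel_measurable M"
  shows "(\<lambda>x. f x *v g x) \<in> borel_measurable M"
  by (rule borel_measurable_continuous_Pair[OF assms]) (intro continuous_intros)

lemma measurable_transpose [measurable]:
  fixes f :: "'a \<Rightarrow> real^'n^'m"
  assumes "f \<in> borel_measurable M"
  shows "(\<lambda>x. transpose (f x)) \<in> borel_measurable M"
  by (rule measurable_compose[OF assms borel_measurable_continuous_onI]) (intro continuous_intros)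

text \<open>Two solutions give the same projections \<open>A ** B\<close> and \<open>B ** A\<close>,
  and a solution is recovered from these.\<close>

lemma penrose_unique:
  fixes A :: "real^'k^'l" and B C :: "real^'l^'k"
  assumes B: "A ** B ** A = A" "B ** A ** B = B" "transpose (A ** B) = A ** B" "transpose (B ** A) = B ** A"
    and C: "A ** C ** A = A" "C ** A ** C = C" "transpose (A ** C) = A ** C" "transpose (C ** A) = C ** A"
  shows "B = C"
proof -
  have AB: "A ** B = A ** C"
  proof -
    have "A ** B = transpose (A ** C ** A ** B)" using B(3) C(1) by simp
    also have "\<dots> = transpose (A ** B) ** transpose (A ** C)"
      by (simp add: matrix_transpose_mul matrix_mul_assoc)
    also have "\<dots> = A ** B ** A ** C" using B(3) C(3) by (simp add: matrix_mul_assoc)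
    finally show ?thesis using B(1) by simp
  qed
  have BA: "B ** A = C ** A"
  proof -
    have "B ** A = transpose (B ** (A ** C ** A))" using B(4) C(1) by simp
    also have "\<dots> = transpose (C ** A) ** transpose (B ** A)"
      by (simp add: matrix_transpose_mul matrix_mul_assoc)
    also have "\<dots> = C ** (A ** B ** A)" using B(4) C(4) by (simp add: matrix_mul_assoc)
    finally show ?thesis using B(1) by simp
  qed
  have "B = B ** A ** B" using B(2) by simp
  also have "\<dots> = C ** A ** B" using BA by simp
  also have "\<dots> = C ** (A ** B)" by (simp add: matrix_mul_assoc)
  also have "\<dots> = C" using AB C(2) by (simp add: matrix_mul_assoc)
  finally show ?thesis .
qed

lemma pinv_eqI:
  fixes A :: "real^'k^'l" and B :: "real^'l^'k"
  assumes "A ** B ** A = A" "B ** A ** B = B" "transpose (A ** B) = A ** B" "transpose (B ** A) = B ** A"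
  shows "pinv A = B"
  unfolding pinv_def by (rule the_equality) (use assms penrose_unique in blast)+

lemma measurableI_closed_sets:
  fixes f :: "'a::topological_space \<Rightarrow> 'b::topological_space"
  assumes "\<And>C. closed C \<Longrightarrow> f -` C \<in> sets borel"
  shows "f \<in> borel_measurable borel"
proof (rule borel_measurableI)
  fix S :: "'b set" assume "open S"
  then have "f -` (- S) \<in> sets borel" by (intro assms) auto
  then have "- (f -` (- S)) \<in> sets borel" by auto
  then show "f -` S \<inter> space borel \<in> sets borel" by (simp add: vimage_Compl)
qed

text \<open>The graph of the Moore--Penrose inverse is closed, so preimages of closed sets are
  projections of closed sets along a \<open>\<sigma>\<close>-compact space.\<close>

lemma measurable_pinv [measurable]: "(pinv :: real^'k^'l \<Rightarrow> real^'l^'k) \<in> borel_measurable borel"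
proof -
  define P where "P p \<longleftrightarrow> (case p of (A, B) \<Rightarrow> A ** B ** A = A \<and> B ** A ** B = B \<and>
      transpose (A ** B) = A ** B \<and> transpose (B ** A) = B ** A)" for p :: "(real^'k^'l) \<times> (real^'l^'k)"
  have cl: "closed {p. P p}"
    unfolding P_def case_prod_beta
    by (intro closed_Collect_conj closed_Collect_eq continuous_intros)
  \<comment> \<open>At a matrix without a solution the defining predicate is constantly false, so
    off the projection of the graph \<open>pinv\<close> takes this one value.\<close>
  define u where "u = (THE B :: real^'l^'k. False)"
  have none: "pinv A = u" if "\<not> (\<exists>B. P (A, B))" for A
    using that unfolding pinv_def u_def P_def by (intro arg_cong[where f = The] ext) auto
  have some: "pinv A = B" if "P (A, B)" for A B
    using that by (intro pinv_eqI) (auto simp: P_def)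
  show ?thesis
  proof (rule measurableI_closed_sets)
    fix C :: "(real^'l^'k) set" assume "closed C"
    have "pinv -` C = fst ` ({p. P p} \<inter> UNIV \<times> C) \<union> (if u \<in> C then UNIV - fst ` {p. P p} else {})"
    proof (rule set_eqI)
      fix A
      show "A \<in> pinv -` C \<longleftrightarrow> A \<in> fst ` ({p. P p} \<inter> UNIV \<times> C) \<union> (if u \<in> C then UNIV - fst ` {p. P p} else {})"
      proof (cases "\<exists>B. P (A, B)")
        case True
        then obtain B where B: "P (A, B)" by blast
        have "B' = B" if "P (A, B')" for B' using some[OF that] some[OF B] by simp
        have "A \<in> fst ` {p. P p}" using B by (intro image_eqI[of _ _ "(A, B)"]) simp_all
        moreover have "A \<in> fst ` ({p. P p} \<inter> UNIV \<times> C) \<longleftrightarrow> B \<in> C"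
        proof
          assume "B \<in> C"
          then show "A \<in> fst ` ({p. P p} \<inter> UNIV \<times> C)"
            using B by (intro image_eqI[of _ _ "(A, B)"]) simp_all
        next
          assume "A \<in> fst ` ({p. P p} \<inter> UNIV \<times> C)"
          then obtain B' where "P (A, B')" "B' \<in> C" by auto
          then show "B \<in> C" using \<open>\<And>B'. P (A, B') \<Longrightarrow> B' = B\<close> by blast
        qed
        ultimately have "A \<in> fst ` ({p. P p} \<inter> UNIV \<times> C) \<longleftrightarrow> B \<in> C" "A \<in> fst ` {p. P p}" by blast+
        then show ?thesis using some[OF B] by auto
      next
        case False
        then have "A \<notin> fst ` ({p. P p} \<inter> UNIV \<times> C)" "A \<notin> fst ` {p. P p}" by auto
        then show ?thesis using none[OF False] by auto
      qed
    qed
    moreover have "fst ` ({p. P p} \<inter> UNIV \<times> C) \<in> sets borel" "fst ` {p. P p} \<in> sets borel"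
      using cl \<open>closed C\<close> by (auto intro!: borel_projection_closed closed_Int closed_Times)
    ultimately show "pinv -` C \<in> sets borel" by auto
  qed
qed

text \<open>\<open>W\<close> is a transposed design: its rows are the regressors. Rows of a Gaussian
  matrix can thus be combined, exchanged and stacked directly, fitted values are
  \<open>transpose W *v c\<close>, and a change of regressors is a multiplication from the
  left.\<close>

definition lsq :: "real^'n^'k \<Rightarrow> real^'n \<Rightarrow> real^'k" where
  "lsq W v = pinv (W ** transpose W) *v (W *v v)"

definition full_rank :: "real^'n^'k \<Rightarrow> bool" where
  "full_rank W \<longleftrightarrow> (\<forall>c. transpose W *v c = 0 \<longrightarrow> c = 0)"

lemma gram_inner: "x \<bullet> ((W ** transpose W) *v y) = (transpose W *v x) \<bullet> (transpose W *v y)"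
  for W :: "real^'n^'k"
  by (simp add: matrix_vector_mul_assoc[symmetric] inner_matrix_vector[of "transpose W"])

lemma full_rank_gram:
  assumes "full_rank (W :: real^'n^'k)"
  shows "pinv (W ** transpose W) ** (W ** transpose W) = mat 1"
    and "(W ** transpose W) ** pinv (W ** transpose W) = mat 1"
    and "transpose (pinv (W ** transpose W)) = pinv (W ** transpose W)"
proof -
  let ?G = "W ** transpose W"
  have "c = 0" if "?G *v c = 0" for c
    using gram_inner[of c W c] that assms by (simp add: full_rank_def)
  then obtain B where B: "B ** ?G = mat 1"
    using matrix_left_invertible_ker[of ?G] by auto
  then have B': "?G ** B = mat 1" by (simp add: matrix_left_right_inverse)
  have "pinv ?G = B"
    by (rule pinv_eqI) (simp_all add: B B' transpose_mat)
  then show "pinv ?G ** ?G = mat 1" "?G ** pinv ?G = mat 1" using B B' by auto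
  have "transpose ?G = ?G" by (simp add: matrix_transpose_mul)
  then have "transpose B ** ?G = mat 1" using B' by (metis matrix_transpose_mul transpose_mat)
  then have "transpose B = B" using B' by (metis matrix_mul_assoc matrix_mul_lid matrix_mul_rid)
  then show "transpose (pinv ?G) = pinv ?G" using \<open>pinv ?G = B\<close> by simp
qed

text \<open>The right-hand side is an equation between Borel functions of \<open>W\<close>, which
  makes the rank condition measurable.\<close>

lemma full_rank_iff: "full_rank W \<longleftrightarrow> pinv (W ** transpose W) ** (W ** transpose W) = mat 1"
  for W :: "real^'n^'k"
proof
  assume "pinv (W ** transpose W) ** (W ** transpose W) = mat 1"
  then have "c = 0" if "transpose W *v c = 0" for c
    using that by (metis matrix_vector_mul_assoc matrix_vector_mul_lid matrix_vector_mult_0_right)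
  then show "full_rank W" by (simp add: full_rank_def)
qed (rule full_rank_gram)

lemma measurable_full_rank [measurable]: "Measurable.pred borel (full_rank :: real^'n^'k \<Rightarrow> bool)"
  unfolding full_rank_iff[abs_def] by measurable

lemma measurable_lsq [measurable (raw)]:
  fixes f :: "'a \<Rightarrow> real^'n^'k"
  assumes [measurable]: "f \<in> borel_measurable M" "g \<in> borel_measurable M"
  shows "(\<lambda>x. lsq (f x) (g x)) \<in> borel_measurable M"
  unfolding lsq_def by measurable

lemma lsq_normal_eq:
  assumes "full_rank W"
  shows "W *v (v - transpose W *v lsq W v) = 0"
  using full_rank_gram(2)[OF assms]
  by (simp add: lsq_def matrix_vector_mult_diff_distrib matrix_vector_mul_assoc matrix_mul_assoc)

text \<open>The normal equations with an invertible Gram matrix. Explicit formulas for fits are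
  verified below by checking that the residual is orthogonal to the regressors.\<close>

lemma lsq_unique:
  assumes "full_rank W" "W *v (v - transpose W *v c) = 0"
  shows "lsq W v = c"
proof -
  have "W *v v = (W ** transpose W) *v c"
    using assms(2) by (simp add: matrix_vector_mult_diff_distrib matrix_vector_mul_assoc)
  then show ?thesis
    using full_rank_gram(1)[OF assms(1)] by (simp add: lsq_def matrix_vector_mul_assoc)
qed

lemma lsq_linear: "lsq W (a *\<^sub>R v + b *\<^sub>R w) = a *\<^sub>R lsq W v + b *\<^sub>R lsq W w"
  by (simp add: lsq_def matrix_vector_right_distrib matrix_vector_mult_scaleR)

section \<open>Sections and null sets under the standard Gaussian measure\<close>

lemma emeasure_stdg_pair:
  fixes A :: "('a::euclidean_space \<times> 'b::euclidean_space) set"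
  assumes "A \<in> sets borel"
  shows "emeasure stdg A = (\<integral>\<^sup>+x. emeasure stdg {y. (x, y) \<in> A} \<partial>stdg)"
proof -
  have "emeasure ((stdg :: 'a measure) \<Otimes>\<^sub>M stdg) A = (\<integral>\<^sup>+x. emeasure stdg (Pair x -` A) \<partial>stdg)"
    using assms by (intro stdg.emeasure_pair_measure_alt) (simp only: stdg_pair sets_stdg)
  then show ?thesis by (simp add: stdg_pair vimage_def)
qed

lemma measure_stdg_pair_le:
  fixes A :: "('a::euclidean_space \<times> 'b::euclidean_space) set"
  assumes "A \<in> sets borel" "AE x in stdg. measure stdg {y. (x, y) \<in> A} \<le> b" "0 \<le> b"
  shows "measure stdg A \<le> b"
proof -
  have "emeasure stdg A = (\<integral>\<^sup>+x. emeasure stdg {y. (x, y) \<in> A} \<partial>stdg)"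
    by (rule emeasure_stdg_pair) fact
  also have "\<dots> \<le> (\<integral>\<^sup>+x. ennreal b \<partial>(stdg :: 'a measure))"
    by (rule nn_integral_mono_AE) (use assms(2) in \<open>auto simp: stdg.emeasure_eq_measure elim!: eventually_mono intro!: ennreal_leI\<close>)
  also have "\<dots> = ennreal b" by simp
  finally show ?thesis using \<open>0 \<le> b\<close> by (simp add: stdg.emeasure_eq_measure)
qed

lemma AE_stdg_pair:
  assumes "AE z in (stdg :: ('a::euclidean_space \<times> 'b::euclidean_space) measure). P z"
  shows "AE x in stdg. AE y in stdg. P (x, y)"
proof -
  interpret S: pair_prob_space "stdg :: 'a measure" "stdg :: 'b measure" ..
  have "AE z in (stdg :: 'a measure) \<Otimes>\<^sub>M (stdg :: 'b measure). P z"
    using assms by (simp only: stdg_pair)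
  then show ?thesis by (rule S.AE_pair)
qed

lemma AE_stdg_pair_fst:
  assumes "AE x in (stdg :: 'a::euclidean_space measure). P x" and [measurable]: "Measurable.pred borel P"
  shows "AE z in (stdg :: ('a \<times> 'b::euclidean_space) measure). P (fst z)"
proof -
  interpret S: pair_prob_space "stdg :: 'a measure" "stdg :: 'b measure" ..
  have "AE z in (stdg :: 'a measure) \<Otimes>\<^sub>M (stdg :: 'b measure). P (fst z)"
  proof (rule S.AE_pair_measure)
    show "AE x in (stdg :: 'a measure). AE y in (stdg :: 'b measure). P (fst (x, y))"
      using assms(1) by simp
    have "Measurable.pred ((stdg :: 'a measure) \<Otimes>\<^sub>M (stdg :: 'b measure)) (\<lambda>z. P (fst z))"
      by measurable
    then show "{x \<in> space ((stdg :: 'a measure) \<Otimes>\<^sub>M (stdg :: 'b measure)). P (fst x)} \<in> sets (stdg \<Otimes>\<^sub>M stdg)"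
      by (simp only: pred_def)
  qed
  then show ?thesis by (simp only: stdg_pair)
qed

lemma stdg_null_subspace:
  fixes S :: "'a::euclidean_space set"
  assumes "subspace S" "dim S < DIM('a)"
  shows "emeasure stdg S = 0"
proof -
  have "S \<in> sets borel" using assms(1) by (simp add: closed_subspace)
  moreover have "negligible S" using assms by (intro negligible_lowdim) auto
  ultimately have "S \<in> null_sets lborel"
    by (simp add: negligible_iff_null_sets null_sets_completion_iff)
  then have "S \<in> null_sets stdg"
    unfolding density_stdg by (subst null_sets_density_iff) (auto dest: AE_not_in)
  then show ?thesis by auto
qed

section \<open>Least squares with Gaussian designs\<close>

text \<open>The rank-one matrix of \<open>f\<close> and \<open>u\<close>; as a function of
  \<open>u\<close> it is the adjoint of \<open>\<lambda>a. transpose a *v f\<close>.\<close>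

definition outer :: "real^'k \<Rightarrow> real^'n \<Rightarrow> real^'n^'k" where
  "outer f u = (\<chi> i. f $ i *\<^sub>R u)"

lemma outer_inner: "a \<bullet> outer f u = (transpose a *v f) \<bullet> u"
  by (simp add: outer_def inner_vec_def[of a] transpose_vector_sum inner_sum_left)

lemma transpose_outer: "transpose (outer f u) *v c = (c \<bullet> f) *\<^sub>R u"
  by (simp add: outer_def transpose_vector_sum inner_vec_def scaleR_sum_left)

lemma transpose_add_vec: "transpose (A + B) *v c = transpose A *v c + transpose B *v c" for A B :: "real^'n^'k"
  by (simp add: transpose_vector_sum scaleR_right_distrib sum.distrib)

lemma transpose_diff_vec: "transpose (A - B) *v c = transpose A *v c - transpose B *v c" for A B :: "real^'n^'k"
  by (simp add: transpose_vector_sum scaleR_right_diff_distrib sum_subtractf)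

lemma continuous_on_outer [continuous_intros]:
  assumes "continuous_on S f" "continuous_on S g"
  shows "continuous_on S (\<lambda>x. outer (f x) (g x))"
  unfolding outer_def by (intro continuous_intros assms)

text \<open>For a unit vector \<open>f\<close>, the linear map given by \<open>transpose W\<close>
  is kept on the orthogonal complement of \<open>f\<close> and sends \<open>f\<close> itself to the
  fresh vector \<open>v\<close>. This makes any one direction of a Gaussian matrix independent of
  the rest without a choice of basis.\<close>

definition replace_dir :: "real^'k \<Rightarrow> (real^'n^'k) \<times> (real^'n) \<Rightarrow> real^'n^'k" where
  "replace_dir f p = fst p - outer f (transpose (fst p) *v f) + outer f (snd p)"

lemma measurable_replace_dir [measurable]: "replace_dir f \<in> borel_measurable borel"
  unfolding replace_dir_def[abs_def] by (intro borel_measurable_continuous_onI continuous_intros)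

lemma replace_dir_transpose:
  "transpose (replace_dir f (W, v)) *v c = transpose W *v c - (c \<bullet> f) *\<^sub>R (transpose W *v f) + (c \<bullet> f) *\<^sub>R v"
  by (simp add: replace_dir_def transpose_add_vec transpose_diff_vec transpose_outer)

lemma distr_replace_dir:
  assumes "norm f = 1"
  shows "distr stdg borel (replace_dir f) = (stdg :: (real^'n^'k) measure)"
proof (rule distr_stdg_coisometry[where T' = "\<lambda>a. (a - outer f (transpose a *v f), transpose a *v f)"])
  fix a :: "real^'n^'k" and p :: "(real^'n^'k) \<times> (real^'n)"
  obtain W v where p: "p = (W, v)" by (cases p)
  have ol: "outer f u \<bullet> W = u \<bullet> (transpose W *v f)" for u
    by (subst (1 2) inner_commute) (rule outer_inner)
  show "a \<bullet> replace_dir f p = (a - outer f (transpose a *v f), transpose a *v f) \<bullet> p"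
    by (simp add: p replace_dir_def inner_diff_right inner_add_right inner_diff_left outer_inner ol)
  let ?u = "transpose a *v f"
  have ff: "f \<bullet> f = 1" using assms by (simp add: norm_eq_1)
  have ol': "outer f ?u \<bullet> a = ?u \<bullet> ?u"
    by (subst inner_commute) (rule outer_inner)
  have "(a - outer f ?u) \<bullet> (a - outer f ?u) = a \<bullet> a - ?u \<bullet> ?u"
    using ol' by (simp add: inner_diff_right inner_diff_left outer_inner transpose_outer transpose_diff_vec ff)
  then show "norm (a - outer f ?u, ?u) = norm a"
    by (simp add: norm_eq_sqrt_inner)
qed simp

lemma dim_hyperplane_image:
  fixes W :: "real^'n^'k"
  shows "subspace ((*v) (transpose W) ` {x. f \<bullet> x = 0})"
    and "f \<noteq> 0 \<Longrightarrow> dim ((*v) (transpose W) ` {x. f \<bullet> x = 0}) \<le> CARD('k) - 1"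
    and "f \<noteq> 0 \<Longrightarrow> full_rank W \<Longrightarrow> dim ((*v) (transpose W) ` {x. f \<bullet> x = 0}) = CARD('k) - 1"
proof -
  have s: "subspace {x. f \<bullet> x = 0}" by (rule subspace_hyperplane)
  show "subspace ((*v) (transpose W) ` {x. f \<bullet> x = 0})"
    by (rule linear_subspace_image[OF _ s]) simp
  assume f: "f \<noteq> 0"
  have d: "dim {x. f \<bullet> x = 0} = CARD('k) - 1" using dim_hyperplane[OF f] by simp
  show "dim ((*v) (transpose W) ` {x. f \<bullet> x = 0}) \<le> CARD('k) - 1"
    using dim_image_le[of "(*v) (transpose W)" "{x. f \<bullet> x = 0}"] d by simp
  assume "full_rank W"
  then have "inj ((*v) (transpose W))"
    by (simp add: full_rank_def vec.inj_iff_eq_0)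
  then show "dim ((*v) (transpose W) ` {x. f \<bullet> x = 0}) = CARD('k) - 1"
    using d by (subst dim_image_eq) (auto intro: inj_on_subset)
qed

text \<open>A nonzero kernel vector can be scaled so that some coordinate \<open>j\<close> is 1.
  With the other rows given, row \<open>j\<close> must then lie in a subspace of dimension at most k
  - 1 < n, a null set for the fresh row. The sets \<open>E j\<close> are measurable as projections
  of closed sets.\<close>

lemma AE_full_rank:
  assumes "CARD('k) \<le> CARD('n)"
  shows "AE W in (stdg :: (real^'n^'k) measure). full_rank W"
proof -
  define E where "E j = fst ` {p :: (real^'n^'k) \<times> (real^'k). snd p $ j = 1 \<and> transpose (fst p) *v snd p = 0}" for j
  have E_iff: "W \<in> E j \<longleftrightarrow> (\<exists>c. c $ j = 1 \<and> transpose W *v c = 0)" for W j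
    by (auto simp: E_def image_iff)
  have Eb: "E j \<in> sets borel" for j
    unfolding E_def by (intro borel_projection_closed closed_Collect_conj closed_Collect_eq continuous_intros)
  have null: "emeasure stdg (E j) = 0" for j
  proof -
    let ?f = "axis j 1 :: real^'k"
    have "emeasure stdg (E j) = emeasure (distr stdg borel (replace_dir ?f)) (E j)"
      by (simp add: distr_replace_dir)
    also have "\<dots> = emeasure stdg (replace_dir ?f -` E j)"
      using Eb by (subst emeasure_distr) auto
    also have "\<dots> = (\<integral>\<^sup>+W. emeasure stdg {v. (W, v) \<in> replace_dir ?f -` E j} \<partial>stdg)"
      using measurable_sets[OF measurable_replace_dir Eb, of ?f j] by (intro emeasure_stdg_pair) simp
    also have "\<dots> = (\<integral>\<^sup>+W. 0 \<partial>(stdg :: (real^'n^'k) measure))"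
    proof (rule nn_integral_cong)
      fix W :: "real^'n^'k"
      let ?S = "(*v) (transpose W) ` {x. ?f \<bullet> x = 0}"
      have "v \<in> ?S" if v: "replace_dir ?f (W, v) \<in> E j" for v
      proof -
        obtain c where c: "c $ j = 1" "transpose (replace_dir ?f (W, v)) *v c = 0"
          using v E_iff by blast
        have "transpose W *v c - transpose W *v ?f + v = 0"
          using c by (simp add: replace_dir_transpose inner_axis)
        then have "v = transpose W *v (?f - c)"
          by (simp add: matrix_vector_mult_diff_distrib algebra_simps eq_neg_iff_add_eq_0[symmetric])
        moreover have "?f \<bullet> (?f - c) = 0"
          using c(1) by (simp add: inner_diff_right inner_axis')
        ultimately show ?thesis by blast
      qed
      then have "{v. (W, v) \<in> replace_dir ?f -` E j} \<subseteq> ?S" by auto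
      moreover have "?S \<in> sets stdg" by (simp, intro borel_closed closed_subspace dim_hyperplane_image(1))
      ultimately have "emeasure stdg {v. (W, v) \<in> replace_dir ?f -` E j} \<le> emeasure stdg ?S"
        by (rule emeasure_mono)
      also have "\<dots> = 0"
      proof (rule stdg_null_subspace[OF dim_hyperplane_image(1)])
        have "dim ?S \<le> CARD('k) - 1" by (rule dim_hyperplane_image(2)) (simp add: axis_eq_0_iff)
        also have "\<dots> < CARD('n)"
          using assms zero_less_card_finite[where 'a='k] by linarith
        finally show "dim ?S < DIM(real^'n)" by simp
      qed
      finally show "emeasure stdg {v. (W, v) \<in> replace_dir ?f -` E j} = 0" by simp
    qed
    finally show ?thesis by simp
  qed
  have "(\<Union>j. E j) \<in> null_sets stdg"
    by (rule null_sets_UN') (use Eb null in auto)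
  then show ?thesis
  proof (rule AE_I'; safe?)
    fix W :: "real^'n^'k" assume "\<not> full_rank W"
    then obtain c where c: "transpose W *v c = 0" "c \<noteq> 0" by (auto simp: full_rank_def)
    then obtain j where j: "c $ j \<noteq> 0" by (auto simp: vec_eq_iff)
    have "W \<in> E j"
      unfolding E_iff using c j by (intro exI[of _ "(1 / c $ j) *\<^sub>R c"]) (simp add: matrix_vector_mult_scaleR)
    then show "W \<in> (\<Union>j. E j)" by blast
  qed
qed

text \<open>For a unit vector \<open>f\<close> this is the squared distance of \<open>transpose W *v f\<close> from the image under
  \<open>transpose W\<close> of the orthogonal complement of \<open>f\<close>; hence it is chi-square with \<open>n - k + 1\<close> degrees of freedom.\<close>

definition resid_sq :: "real^'k \<Rightarrow> real^'n^'k \<Rightarrow> real" where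
  "resid_sq f W = 1 / (f \<bullet> (pinv (W ** transpose W) *v f))"

lemma measurable_resid_sq [measurable]: "resid_sq f \<in> borel_measurable borel"
  unfolding resid_sq_def[abs_def] by measurable

text \<open>Let \<open>p\<close> be the fitted vector with coefficients \<open>u\<close>, the
  inverse Gram matrix applied to \<open>f\<close>. It is orthogonal to the image of the complement
  of \<open>f\<close>, and it differs from \<open>(p \<bullet> p) *\<^sub>R v\<close> by an element
  of that image. Hence the projection of \<open>v\<close> onto the span of \<open>B\<close> is
  \<open>p\<close> divided by \<open>p \<bullet> p\<close>, with squared norm
  \<open>1 / (p \<bullet> p)\<close>, and \<open>p \<bullet> p = f \<bullet> u\<close>.\<close>

lemma resid_sq_replace_dir:
  fixes W :: "real^'n^'k"
  assumes f: "norm f = 1" and full: "full_rank (replace_dir f (W, v))"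
    and B: "pairwise orthogonal B" "\<And>b. b \<in> B \<Longrightarrow> norm b = 1" "finite B"
    and span: "span B = {y. \<forall>x\<in>(*v) (transpose W) ` {x. f \<bullet> x = 0}. orthogonal x y}"
  shows "resid_sq f (replace_dir f (W, v)) = (\<Sum>b\<in>B. (b \<bullet> v)\<^sup>2)"
proof -
  let ?U = "replace_dir f (W, v)" and ?S = "(*v) (transpose W) ` {x. f \<bullet> x = 0}"
  have ff: "f \<bullet> f = 1" using f by (simp add: norm_eq_1)
  define u where "u = pinv (?U ** transpose ?U) *v f"
  define p where "p = transpose ?U *v u"
  have Uu: "(?U ** transpose ?U) *v u = f"
    using full_rank_gram(2)[OF full] by (simp add: u_def matrix_vector_mul_assoc)
  have xp: "(transpose ?U *v x) \<bullet> p = x \<bullet> f" for x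
    using gram_inner[of x ?U u] Uu by (simp add: p_def)
  have fu: "f \<bullet> u = p \<bullet> p" using xp[of u] by (simp add: p_def inner_commute)
  have "transpose ?U *v f = v" by (simp add: replace_dir_transpose ff)
  then have vp: "v \<bullet> p = 1" using xp[of f] ff by simp
  then have p0: "p \<bullet> p \<noteq> 0" by auto
  have "p \<in> span B"
    unfolding span
  proof safe
    fix x assume "f \<bullet> x = 0"
    then show "orthogonal (transpose W *v x) p"
      using xp[of x] by (simp add: replace_dir_transpose orthogonal_def inner_commute)
  qed
  have pe: "p = transpose W *v (u - (u \<bullet> f) *\<^sub>R f) + (p \<bullet> p) *\<^sub>R v"
  proof -
    have "u \<bullet> f = p \<bullet> p" using fu by (simp add: inner_commute)
    then show ?thesis
      by (subst p_def) (simp add: replace_dir_transpose matrix_vector_mult_diff_distrib matrix_vector_mult_scaleR)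
  qed
  have uS: "transpose W *v (u - (u \<bullet> f) *\<^sub>R f) \<in> ?S"
    by (intro imageI) (simp add: inner_diff_right ff inner_commute)
  have bp: "b \<bullet> p = (p \<bullet> p) * (b \<bullet> v)" if "b \<in> B" for b
  proof -
    have "b \<in> span B" using that by (rule span_base)
    then have "(transpose W *v (u - (u \<bullet> f) *\<^sub>R f)) \<bullet> b = 0"
      using uS unfolding span orthogonal_def by blast
    then show ?thesis
      by (subst pe) (simp add: inner_add_right inner_commute)
  qed
  have "p \<bullet> p = (\<Sum>b\<in>B. (p \<bullet> b) *\<^sub>R b) \<bullet> p"
    using orthonormal_basis_expand[OF B(1,2) \<open>p \<in> span B\<close> B(3)] by simp
  also have "\<dots> = (\<Sum>b\<in>B. (b \<bullet> p)\<^sup>2)"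
    by (simp add: inner_sum_left inner_sum_right power2_eq_square inner_commute)
  also have "\<dots> = (p \<bullet> p)\<^sup>2 * (\<Sum>b\<in>B. (b \<bullet> v)\<^sup>2)"
    by (simp add: bp power_mult_distrib sum_distrib_left)
  finally have "(p \<bullet> p) * (\<Sum>b\<in>B. (b \<bullet> v)\<^sup>2) = 1"
    using p0 by (simp add: power2_eq_square)
  moreover have "resid_sq f ?U = 1 / (p \<bullet> p)"
    by (simp add: resid_sq_def u_def[symmetric] fu)
  ultimately have "(p \<bullet> p) * resid_sq f ?U = (p \<bullet> p) * (\<Sum>b\<in>B. (b \<bullet> v)\<^sup>2)"
    using p0 by simp
  then show ?thesis using p0 mult_left_cancel[of "p \<bullet> p"] by blast
qed

text \<open>Given \<open>W\<close>, the basis \<open>B\<close> does not depend on the fresh vector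
  \<open>v\<close>. It has n - k + 1 elements, since the image of a hyperplane of the coefficient
  space has dimension k - 1; the chi-square bound then applies conditionally on
  \<open>W\<close>.\<close>

lemma resid_sq_deviation:
  fixes f :: "real^'k"
  assumes f: "norm f = 1" and k: "CARD('k) \<le> CARD('n)" and w: "w > 0"
  defines "N \<equiv> real CARD('n) - real CARD('k) + 1"
  shows "measure stdg {W :: real^'n^'k. \<bar>resid_sq f W - N\<bar> \<ge> w} \<le> 2 * exp (- w\<^sup>2 / (8 * max N w))"
proof -
  let ?A = "{W :: real^'n^'k. \<bar>resid_sq f W - N\<bar> \<ge> w}"
  let ?b = "2 * exp (- w\<^sup>2 / (8 * max N w))"
  have f0: "f \<noteq> 0" using f by auto
  have Ab: "?A \<in> sets borel" by measurable
  have "measure stdg ?A = measure (distr stdg borel (replace_dir f)) ?A"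
    by (simp add: distr_replace_dir f)
  also have "\<dots> = measure stdg (replace_dir f -` ?A)"
    using Ab by (subst measure_distr) auto
  also have "\<dots> \<le> ?b"
  proof (rule measure_stdg_pair_le)
    show "replace_dir f -` ?A \<in> sets borel"
      using measurable_sets[OF measurable_replace_dir Ab, of f] by simp
    have "AE p in distr (stdg :: ((real^'n^'k) \<times> (real^'n)) measure) borel (replace_dir f). full_rank p"
      unfolding distr_replace_dir[OF f] by (rule AE_full_rank[OF k])
    then have "AE p in (stdg :: ((real^'n^'k) \<times> (real^'n)) measure). full_rank (replace_dir f p)"
      by (subst (asm) AE_distr_iff) auto
    then have "AE W in (stdg :: (real^'n^'k) measure). AE v in (stdg :: (real^'n) measure). full_rank (replace_dir f (W, v))"
      by (rule AE_stdg_pair)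
    moreover note AE_full_rank[OF k]
    ultimately show "AE W in stdg. measure stdg {v. (W, v) \<in> replace_dir f -` ?A} \<le> ?b"
    proof eventually_elim
      case (elim W)
      let ?S = "(*v) (transpose W) ` {x. f \<bullet> x = 0}"
      define T where "T = {y. \<forall>x\<in>?S. orthogonal x y}"
      have "subspace T" unfolding T_def by (rule subspace_orthogonal_to_vectors)
      then obtain B where B: "B \<subseteq> T" "pairwise orthogonal B" "\<And>x. x \<in> B \<Longrightarrow> norm x = 1"
        "independent B" "card B = dim T" "span B = T"
        using orthonormal_basis_subspace by metis
      have fin: "finite B" using B(4) by (rule independent_imp_finite)
      have "dim T + dim ?S = CARD('n)"
        using dim_subspace_orthogonal_to_vectors[of ?S UNIV] dim_hyperplane_image(1)[of W f] by (simp add: T_def)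
      moreover have "dim ?S = CARD('k) - 1" using f0 elim(2) by (rule dim_hyperplane_image(3))
      moreover have "CARD('k) > 0" by simp
      ultimately have cB: "real (card B) = N" using B(5) k unfolding N_def by linarith
      have "measure stdg {v. (W, v) \<in> replace_dir f -` ?A} \<le> measure stdg {v. \<bar>(\<Sum>b\<in>B. (b \<bullet> v)\<^sup>2) - real (card B)\<bar> \<ge> w}"
      proof (rule stdg.finite_measure_mono_AE)
        show "AE v in stdg. v \<in> {v. (W, v) \<in> replace_dir f -` ?A} \<longrightarrow> v \<in> {v. \<bar>(\<Sum>b\<in>B. (b \<bullet> v)\<^sup>2) - real (card B)\<bar> \<ge> w}"
          using elim(1)
        proof eventually_elim
          case (elim v)
          have "resid_sq f (replace_dir f (W, v)) = (\<Sum>b\<in>B. (b \<bullet> v)\<^sup>2)"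
            by (rule resid_sq_replace_dir[OF f elim B(2,3) fin]) (simp_all add: B(6) T_def)
          then show ?case by (simp add: cB)
        qed
      qed simp
      also have "\<dots> \<le> ?b"
        using chi_square_deviation[OF B(2,3) w] by (simp add: cB)
      finally show ?case .
    qed
  qed simp
  finally show ?thesis .
qed

text \<open>The variables \<open>exp (- X)\<close> take values in [0, 1]. Their moments are the
  Laplace transform of \<open>X\<close> at the integers, and these determine the characteristic
  function through its power series.\<close>

lemma nonneg_Laplace_unique:
  fixes X :: "'a \<Rightarrow> real" and Y :: "'b \<Rightarrow> real"
  assumes M: "prob_space M" and N: "prob_space N"
    and [measurable]: "X \<in> borel_measurable M" "Y \<in> borel_measurable N"
    and nonneg: "\<And>x. 0 \<le> X x" "\<And>y. 0 \<le> Y y"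
    and eq: "\<And>k::nat. (\<integral>x. exp (- real k * X x) \<partial>M) = (\<integral>y. exp (- real k * Y y) \<partial>N)"
  shows "distr M borel X = distr N borel Y"
proof -
  have cf: "(CLINT x|M. iexp (t * exp (- X x))) = (\<Sum>k. (\<i> * t) ^ k / fact k * (\<integral>x. exp (- real k * X x) \<partial>M))"
    if "prob_space M" and [measurable]: "X \<in> borel_measurable M" and nn: "\<And>x. 0 \<le> X x"
    for M :: "'c measure" and X t
  proof -
    interpret prob_space M by fact
    define g where "g k x = (\<i> * t) ^ k / fact k * complex_of_real (exp (- real k * X x))" for k x
    have [measurable]: "g k \<in> borel_measurable M" for k unfolding g_def[abs_def] by measurable
    have bd: "norm (g k x) \<le> \<bar>t\<bar> ^ k / fact k" for k x
      using nn[of x] by (simp add: g_def norm_mult norm_divide norm_power divide_right_mono mult_left_le)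
    have sm: "summable (\<lambda>k. \<bar>t\<bar> ^ k / fact k)"
      using summable_exp[of "\<bar>t\<bar>"] by (simp add: field_simps)
    have gi: "integrable M (g k)" for k
      by (rule integrable_const_bound[where B = "\<bar>t\<bar> ^ k / fact k"]) (use bd in auto)
    have "iexp (t * exp (- X x)) = (\<Sum>k. g k x)" for x
    proof -
      have "(\<lambda>k. (\<i> * complex_of_real (t * exp (- X x))) ^ k /\<^sub>R fact k) sums iexp (t * exp (- X x))"
        by (rule exp_converges)
      moreover have "(\<i> * complex_of_real (t * exp (- X x))) ^ k /\<^sub>R fact k = g k x" for k
        by (simp add: g_def power_mult_distrib exp_of_nat_mult[symmetric] scaleR_conv_of_real field_simps flip: of_real_power)
      ultimately show ?thesis by (simp add: sums_unique)
    qed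
    then have "(CLINT x|M. iexp (t * exp (- X x))) = (CLINT x|M. (\<Sum>k. g k x))" by simp
    also have "\<dots> = (\<Sum>k. (CLINT x|M. g k x))"
    proof (rule integral_suminf[OF gi])
      show "AE x in M. summable (\<lambda>k. norm (g k x))"
        by (intro AE_I2 summable_comparison_test'[OF sm]) (use bd in simp)
      show "summable (\<lambda>k. \<integral>x. norm (g k x) \<partial>M)"
      proof (rule summable_comparison_test'[OF sm])
        fix k
        have "(\<integral>x. norm (g k x) \<partial>M) \<le> \<bar>t\<bar> ^ k / fact k"
          by (rule integral_le_const) (use bd gi in auto)
        then show "norm (\<integral>x. norm (g k x) \<partial>M) \<le> \<bar>t\<bar> ^ k / fact k"
          by simp
      qed
    qed
    also have "(\<lambda>k. (CLINT x|M. g k x)) = (\<lambda>k. (\<i> * t) ^ k / fact k * (\<integral>x. exp (- real k * X x) \<partial>M))"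
      unfolding g_def by (intro ext) simp
    finally show ?thesis .
  qed
  interpret M: prob_space M by fact
  interpret N: prob_space N by fact
  have "distr M borel (\<lambda>x. exp (- X x)) = distr N borel (\<lambda>y. exp (- Y y))"
  proof (rule char_eq_imp_measure_eq)
    fix t :: real
    show "(CLINT x|distr M borel (\<lambda>x. exp (- X x)). iexp (t \<bullet> x)) = (CLINT x|distr N borel (\<lambda>y. exp (- Y y)). iexp (t \<bullet> x))"
      using cf[OF M \<open>X \<in> borel_measurable M\<close> nonneg(1)] cf[OF N \<open>Y \<in> borel_measurable N\<close> nonneg(2)] eq
      by (simp add: integral_distr)
  qed (auto intro!: M.prob_space_distr N.prob_space_distr)
  then have "distr (distr M borel (\<lambda>x. exp (- X x))) borel (\<lambda>z. - ln z) = distr (distr N borel (\<lambda>y. exp (- Y y))) borel (\<lambda>z. - ln z)"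
    by simp
  then show ?thesis
    by (simp add: distr_distr o_def)
qed

text \<open>For independent Gaussian \<open>x\<close> and \<open>y\<close>, both Laplace transforms
  equal the double integral of \<open>iexp ((c *\<^sub>R f x) \<bullet> y)\<close>, integrated in
  the one or the other order. This moves the law of a squared norm to the adjoint map and replaces
  an argument by singular values.\<close>

lemma norm_sq_adjoint_distr:
  fixes f :: "'a::euclidean_space \<Rightarrow> 'b::euclidean_space" and g :: "'b \<Rightarrow> 'a"
  assumes adj: "\<And>x y. f x \<bullet> y = x \<bullet> g y"
    and [measurable]: "f \<in> borel_measurable borel" "g \<in> borel_measurable borel"
  shows "distr stdg borel (\<lambda>x. (norm (f x))\<^sup>2) = distr stdg borel (\<lambda>y. (norm (g y))\<^sup>2)"
proof (rule nonneg_Laplace_unique)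
  fix k :: nat
  interpret S: pair_prob_space "stdg :: 'a measure" "stdg :: 'b measure" ..
  define c where "c = sqrt (2 * real k)"
  have c2: "c\<^sup>2 = 2 * real k" by (simp add: c_def)
  have e: "complex_of_real (exp (- real k * (norm w)\<^sup>2)) = (CLINT y|stdg. iexp ((c *\<^sub>R w) \<bullet> y))" for w :: "'c::euclidean_space"
    unfolding char_stdg by (simp add: power_mult_distrib c2)
  have int: "integrable (stdg \<Otimes>\<^sub>M stdg) (\<lambda>(x, y). iexp ((c *\<^sub>R f x) \<bullet> y))"
    by (rule S.P.integrable_const_bound[where B=1]) (auto simp: case_prod_beta)
  have "complex_of_real (\<integral>x. exp (- real k * (norm (f x))\<^sup>2) \<partial>stdg) = (CLINT x|stdg. CLINT y|stdg. iexp ((c *\<^sub>R f x) \<bullet> y))"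
    unfolding e[symmetric] by simp
  also have "\<dots> = (CLINT y|stdg. CLINT x|stdg. iexp ((c *\<^sub>R f x) \<bullet> y))"
    using S.Fubini_integral[OF int] by simp
  also have "\<dots> = (CLINT y|stdg. CLINT x|stdg. iexp ((c *\<^sub>R g y) \<bullet> x))"
  proof -
    have "(c *\<^sub>R f x) \<bullet> y = (c *\<^sub>R g y) \<bullet> x" for x y
      using adj[of x y] by (simp add: inner_commute)
    then show ?thesis by (simp only:)
  qed
  also have "\<dots> = complex_of_real (\<integral>y. exp (- real k * (norm (g y))\<^sup>2) \<partial>stdg)"
    unfolding e[symmetric] by simp
  finally show "(\<integral>x. exp (- real k * (norm (f x))\<^sup>2) \<partial>stdg) = (\<integral>y. exp (- real k * (norm (g y))\<^sup>2) \<partial>stdg)"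
    by (rule of_real_eq_iff[THEN iffD1])
qed (auto intro: prob_space_stdg)

lemma measurable_fst_borel [measurable (raw)]:
  fixes f :: "'a \<Rightarrow> 'b::second_countable_topology \<times> 'c::second_countable_topology"
  shows "f \<in> borel_measurable M \<Longrightarrow> (\<lambda>x. fst (f x)) \<in> borel_measurable M"
  by (rule measurable_compose[of f M borel fst borel]) (auto intro!: borel_measurable_continuous_onI continuous_intros)

lemma measurable_snd_borel [measurable (raw)]:
  fixes f :: "'a \<Rightarrow> 'b::second_countable_topology \<times> 'c::second_countable_topology"
  shows "f \<in> borel_measurable M \<Longrightarrow> (\<lambda>x. snd (f x)) \<in> borel_measurable M"
  by (rule measurable_compose[of f M borel snd borel]) (auto intro!: borel_measurable_continuous_onI continuous_intros)

lemma measurable_fst_snd_borel [measurable]: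
  "(fst :: 'b::second_countable_topology \<times> 'c::second_countable_topology \<Rightarrow> 'b) \<in> borel_measurable borel"
  "(snd :: 'b::second_countable_topology \<times> 'c::second_countable_topology \<Rightarrow> 'c) \<in> borel_measurable borel"
  by (intro borel_measurable_continuous_onI continuous_intros)+

lemma linear_isometry_adjoint:
  fixes e :: "'r::euclidean_space \<Rightarrow> 'k::euclidean_space"
  assumes "linear e"
  shows "linear (adjoint e)" "adjoint e \<in> borel_measurable borel" "e \<in> borel_measurable borel"
proof -
  show l: "linear (adjoint e)" using assms by (rule adjoint_linear)
  show "adjoint e \<in> borel_measurable borel" "e \<in> borel_measurable borel"
    using l assms by (simp_all add: borel_measurable_continuous_onI linear_continuous_on linear_conv_bounded_linear)
qed

text \<open>Given \<open>W\<close>, the map \<open>\<lambda>v. adjoint e (lsq W v)\<close> has the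
  adjoint \<open>\<lambda>\<xi>. transpose W *v (pinv (W ** transpose W) *v e \<xi>)\<close>, whose
  squared norm is the quadratic form on the right. There \<open>\<xi>\<close> is independent of
  \<open>W\<close>, so numerator and denominator of the variance ratio are separated.\<close>

lemma lsq_embed_law:
  fixes e :: "'r::euclidean_space \<Rightarrow> real^'k"
  assumes e: "linear e" and k: "CARD('k) \<le> CARD('n)" and A [measurable]: "A \<in> sets (borel :: real measure)"
  shows "measure stdg {p :: (real^'n^'k) \<times> (real^'n). (norm (adjoint e (lsq (fst p) (snd p))))\<^sup>2 \<in> A}
    = measure stdg {q :: (real^'n^'k) \<times> 'r. e (snd q) \<bullet> (pinv (fst q ** transpose (fst q)) *v e (snd q)) \<in> A}"
proof -
  note [measurable] = linear_isometry_adjoint[OF e]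
  define f where "f W v = adjoint e (lsq W v)" for W :: "real^'n^'k" and v
  define g where "g W \<xi> = transpose W *v (pinv (W ** transpose W) *v e \<xi>)" for W :: "real^'n^'k" and \<xi>
  define R where "R W \<xi> = e \<xi> \<bullet> (pinv (W ** transpose W) *v e \<xi>)" for W :: "real^'n^'k" and \<xi>
  have *: "emeasure stdg {v. (norm (f W v))\<^sup>2 \<in> A} = emeasure stdg {\<xi>. R W \<xi> \<in> A}" if "full_rank W" for W
  proof -
    have adj: "f W v \<bullet> \<xi> = v \<bullet> g W \<xi>" for v \<xi>
    proof -
      have "f W v \<bullet> \<xi> = lsq W v \<bullet> e \<xi>"
        using adjoint_works[OF e, of \<xi> "lsq W v"] by (simp add: f_def inner_commute)
      also have "\<dots> = v \<bullet> g W \<xi>"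
        unfolding lsq_def inner_matrix_vector full_rank_gram(3)[OF that] g_def ..
      finally show ?thesis .
    qed
    have [measurable]: "f W \<in> borel_measurable borel" "g W \<in> borel_measurable borel" "R W \<in> borel_measurable borel"
      unfolding f_def g_def R_def by measurable
    have "(norm (g W \<xi>))\<^sup>2 = R W \<xi>" for \<xi>
    proof -
      let ?u = "pinv (W ** transpose W) *v e \<xi>"
      have "(norm (g W \<xi>))\<^sup>2 = ?u \<bullet> ((W ** transpose W) *v ?u)"
        by (simp add: g_def gram_inner power2_norm_eq_inner)
      also have "(W ** transpose W) *v ?u = e \<xi>"
        using full_rank_gram(2)[OF that] by (simp add: matrix_vector_mul_assoc)
      finally show ?thesis by (simp add: R_def inner_commute)
    qed
    then have "distr stdg borel (\<lambda>v. (norm (f W v))\<^sup>2) = distr stdg borel (R W)"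
      using norm_sq_adjoint_distr[of "f W" "g W", OF adj] by simp
    then have "emeasure (distr stdg borel (\<lambda>v. (norm (f W v))\<^sup>2)) A = emeasure (distr stdg borel (R W)) A"
      by simp
    then show ?thesis by (simp add: emeasure_distr vimage_def)
  qed
  have m1: "(\<lambda>p. (norm (f (fst p) (snd p)))\<^sup>2) \<in> borel_measurable borel" unfolding f_def by measurable
  have m2: "(\<lambda>p. R (fst p) (snd p)) \<in> borel_measurable borel" unfolding R_def by measurable
  have "emeasure stdg {p :: (real^'n^'k) \<times> (real^'n). (norm (f (fst p) (snd p)))\<^sup>2 \<in> A}
     = (\<integral>\<^sup>+W. emeasure stdg {v. (norm (f W v))\<^sup>2 \<in> A} \<partial>stdg)"
    by (subst emeasure_stdg_pair) (use measurable_sets[OF m1 A] in \<open>simp_all add: vimage_def\<close>)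
  also have "\<dots> = (\<integral>\<^sup>+W. emeasure stdg {\<xi>. R W \<xi> \<in> A} \<partial>stdg)"
    by (rule nn_integral_cong_AE) (use AE_full_rank[OF k] in \<open>eventually_elim, simp add: *\<close>)
  also have "\<dots> = emeasure stdg {q :: (real^'n^'k) \<times> 'r. R (fst q) (snd q) \<in> A}"
    by (subst emeasure_stdg_pair) (use measurable_sets[OF m2 A] in \<open>simp_all add: vimage_def\<close>)
  finally show ?thesis by (simp add: measure_def f_def R_def)
qed

lemma measure_stdg_swap:
  assumes "{p. P (fst p) (snd p)} \<in> sets (borel :: ('a::euclidean_space \<times> 'b::euclidean_space) measure)"
  shows "measure stdg {p :: 'a \<times> 'b. P (fst p) (snd p)} = measure stdg {q :: 'b \<times> 'a. P (snd q) (fst q)}"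
proof -
  have m: "(prod.swap :: 'b \<times> 'a \<Rightarrow> 'a \<times> 'b) \<in> borel_measurable borel"
    unfolding prod.swap_def by (intro borel_measurable_continuous_onI continuous_intros)
  have "distr stdg borel (prod.swap :: 'b \<times> 'a \<Rightarrow> 'a \<times> 'b) = stdg"
    by (rule distr_stdg_coisometry[where T' = prod.swap])
       (use m in \<open>auto simp: inner_prod_def norm_prod_def add.commute\<close>)
  then have "measure stdg {p :: 'a \<times> 'b. P (fst p) (snd p)} = measure (distr stdg borel (prod.swap :: 'b \<times> 'a \<Rightarrow> 'a \<times> 'b)) {p. P (fst p) (snd p)}"
    by simp
  also have "\<dots> = measure stdg (prod.swap -` {p :: 'a \<times> 'b. P (fst p) (snd p)})"
    using m assms by (subst measure_distr) auto
  also have "prod.swap -` {p :: 'a \<times> 'b. P (fst p) (snd p)} = {q :: 'b \<times> 'a. P (snd q) (fst q)}"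
    by auto
  finally show ?thesis .
qed

text \<open>Over a common denominator the error splits into a numerator part \<open>w / S\<close>
  and a denominator part \<open>r * y / S\<close>, and \<open>S\<close> exceeds
  \<open>N * (1 - y)\<close>.\<close>

lemma quotient_deviation:
  fixes N S X r w y \<tau> :: real
  assumes "N > 0" "S > 0" "\<bar>X - r\<bar> < w" "\<bar>S - N\<bar> < N * y" "r \<ge> 0" "w + r * y \<le> \<tau> * N * (1 - y)" "y < 1"
  shows "\<bar>X / S - r / N\<bar> \<le> \<tau>"
proof -
  have \<tau>: "\<tau> \<ge> 0"
  proof (rule ccontr)
    assume "\<not> \<tau> \<ge> 0"
    then have "\<tau> * (N * (1 - y)) \<le> 0" using assms by (intro mult_nonpos_nonneg) auto
    moreover have "w + r * y > 0"
    proof -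
      have "N * y > 0" using assms(4) by linarith
      then have "y > 0" using assms(1) by (simp add: zero_less_mult_iff)
      then show ?thesis using assms(3,5) by (intro add_pos_nonneg) auto
    qed
    ultimately show False using assms(6) by (simp add: mult.assoc)
  qed
  have "X / S - r / N = (N * (X - r) - r * (S - N)) / (S * N)"
    using assms by (simp add: field_simps)
  then have "\<bar>X / S - r / N\<bar> = \<bar>N * (X - r) - r * (S - N)\<bar> / (S * N)"
    using assms by (simp add: abs_mult)
  also have "\<dots> \<le> (N * w + r * (N * y)) / (S * N)"
  proof (rule divide_right_mono)
    have "\<bar>N * (X - r) - r * (S - N)\<bar> \<le> \<bar>N * (X - r)\<bar> + \<bar>r * (S - N)\<bar>" by (rule abs_triangle_ineq4)
    also have "\<dots> = N * \<bar>X - r\<bar> + r * \<bar>S - N\<bar>" using assms by (simp add: abs_mult)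
    also have "\<dots> \<le> N * w + r * (N * y)"
      using assms by (intro add_mono mult_left_mono) auto
    finally show "\<bar>N * (X - r) - r * (S - N)\<bar> \<le> N * w + r * (N * y)" .
  qed (use assms in simp)
  also have "\<dots> = (w + r * y) / S" using assms by (simp add: field_simps)
  also have "\<dots> \<le> (\<tau> * (N * (1 - y))) / S" using assms by (intro divide_right_mono) (auto simp: mult.assoc)
  also have "\<dots> \<le> (\<tau> * S) / S"
    using assms \<tau> by (intro divide_right_mono mult_left_mono) (auto simp: algebra_simps abs_less_iff)
  finally show ?thesis using assms by simp
qed

lemma resid_sq_scale:
  assumes "z \<noteq> 0"
  shows "z \<bullet> (pinv (W ** transpose W) *v z) = (norm z)\<^sup>2 / resid_sq ((1 / norm z) *\<^sub>R z) W"
  using assms by (simp add: resid_sq_def matrix_vector_mult_scaleR power2_eq_square field_simps)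

lemma measurable_resid_sq' [measurable (raw)]:
  assumes [measurable]: "f \<in> borel_measurable M" "g \<in> borel_measurable M"
  shows "(\<lambda>x. resid_sq (f x) (g x)) \<in> borel_measurable M"
  unfolding resid_sq_def by measurable

text \<open>Given \<open>\<xi>\<close>, the quadratic form is the squared norm of
  \<open>\<xi>\<close> divided by \<open>resid_sq\<close> in the direction of
  \<open>e \<xi>\<close>, and the bound for \<open>resid_sq\<close> is the same for all directions.
  \<open>D\<close> collects the bad numerators. The assumption \<open>zero\<close> covers
  \<open>\<xi> = 0\<close>, where there is no direction and the form vanishes.\<close>

lemma lsq_embed_bound:
  fixes e :: "'r::euclidean_space \<Rightarrow> real^'k" and A :: "real set" and D :: "'r set"
  assumes e: "linear e" "\<And>x. norm (e x) = norm x" and k: "CARD('k) \<le> CARD('n)"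
    and y: "0 < y" "y < 1" and N: "N = real CARD('n) - real CARD('k) + 1"
    and A [measurable]: "A \<in> sets borel" and D [measurable]: "D \<in> sets borel"
    and zero: "0 \<in> A \<Longrightarrow> 0 \<in> D"
    and step: "\<And>\<xi> S. \<xi> \<notin> D \<Longrightarrow> \<xi> \<noteq> 0 \<Longrightarrow> \<bar>S - N\<bar> < N * y \<Longrightarrow> (norm \<xi>)\<^sup>2 / S \<notin> A"
  shows "measure stdg {p :: (real^'n^'k) \<times> (real^'n). (norm (adjoint e (lsq (fst p) (snd p))))\<^sup>2 \<in> A}
    \<le> measure stdg D + 2 * exp (- N * y\<^sup>2 / 8)"
proof -
  note [measurable] = linear_isometry_adjoint[OF e(1)]
  have N1: "N \<ge> 1" using k by (simp add: N)
  have Ny: "N * y > 0" "max N (N * y) = N" using N1 y by (auto simp: mult_left_le max_def)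
  define P where "P W \<xi> \<longleftrightarrow> e \<xi> \<bullet> (pinv (W ** transpose W) *v e \<xi>) \<in> A" for W :: "real^'n^'k" and \<xi>
  define D2 where "D2 = {q :: 'r \<times> (real^'n^'k). 0 < norm (fst q) \<and> \<bar>resid_sq ((1 / norm (e (fst q))) *\<^sub>R e (fst q)) (snd q) - N\<bar> \<ge> N * y}"
  have D2m: "D2 \<in> sets borel" unfolding D2_def by measurable
  have D1m: "D \<times> (UNIV :: (real^'n^'k) set) \<in> sets borel"
    unfolding borel_prod[symmetric] by (intro pair_measureI) auto
  have "measure stdg {p :: (real^'n^'k) \<times> (real^'n). (norm (adjoint e (lsq (fst p) (snd p))))\<^sup>2 \<in> A}
     = measure stdg {q. P (fst q) (snd q)}"
    unfolding P_def by (rule lsq_embed_law[OF e(1) k A])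
  also have "\<dots> = measure stdg {q. P (snd q) (fst q)}"
    by (rule measure_stdg_swap) (unfold P_def, measurable)
  also have "\<dots> \<le> measure stdg (D \<times> UNIV \<union> D2)"
  proof (rule stdg.finite_measure_mono)
    show "D \<times> UNIV \<union> D2 \<in> sets stdg" using D1m D2m by auto
    show "{q. P (snd q) (fst q)} \<subseteq> D \<times> UNIV \<union> D2"
    proof safe
      fix \<xi> :: 'r and W :: "real^'n^'k"
      assume P: "P (snd (\<xi>, W)) (fst (\<xi>, W))" and nD2: "(\<xi>, W) \<notin> D2" 
      show "\<xi> \<in> D"
      proof (rule ccontr)
        assume nD: "\<xi> \<notin> D"
        have x0: "\<xi> \<noteq> 0"
        proof
          assume "\<xi> = 0"
          then have "e \<xi> = 0" using linear_0[OF e(1)] by simp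
          then have "0 \<in> A" using P by (simp add: P_def)
          then show False using zero nD \<open>\<xi> = 0\<close> by simp
        qed
        then have "e \<xi> \<noteq> 0" using e(2)[of \<xi>] by auto
        moreover have "\<bar>resid_sq ((1 / norm (e \<xi>)) *\<^sub>R e \<xi>) W - N\<bar> < N * y"
          using nD2 x0 by (auto simp: D2_def)
        ultimately show False
          using step[OF nD x0] P resid_sq_scale[of "e \<xi>" W] by (simp add: P_def e(2))
      qed
    qed auto
  qed
  also have "\<dots> \<le> measure stdg (D \<times> (UNIV :: (real^'n^'k) set)) + measure stdg D2"
    using D1m D2m by (intro measure_Un_le) auto
  also have "\<dots> \<le> measure stdg D + 2 * exp (- N * y\<^sup>2 / 8)"
  proof (rule add_mono)
    have "emeasure stdg (D \<times> (UNIV :: (real^'n^'k) set)) = emeasure stdg D * emeasure stdg (UNIV :: (real^'n^'k) set)"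
      unfolding stdg_pair[symmetric] by (rule stdg.emeasure_pair_measure_Times) auto
    then show "measure stdg (D \<times> (UNIV :: (real^'n^'k) set)) \<le> measure stdg D"
      by (simp add: measure_def)
    show "measure stdg D2 \<le> 2 * exp (- N * y\<^sup>2 / 8)"
    proof (rule measure_stdg_pair_le[OF D2m], intro AE_I2)
      fix \<xi> :: 'r
      show "measure stdg {W. (\<xi>, W) \<in> D2} \<le> 2 * exp (- N * y\<^sup>2 / 8)"
      proof (cases "\<xi> = 0")
        case False
        have "norm ((1 / norm (e \<xi>)) *\<^sub>R e \<xi>) = 1" using False e(2)[of \<xi>] by auto
        from resid_sq_deviation[OF this k Ny(1)] Ny(2)
        have "measure stdg {W :: real^'n^'k. \<bar>resid_sq ((1 / norm (e \<xi>)) *\<^sub>R e \<xi>) W - N\<bar> \<ge> N * y} \<le> 2 * exp (- (N * y)\<^sup>2 / (8 * N))"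
          by (simp add: N)
        also have "- (N * y)\<^sup>2 / (8 * N) = - N * y\<^sup>2 / 8" using N1 by (simp add: power2_eq_square)
        finally show ?thesis using False by (simp add: D2_def)
      qed (simp add: D2_def)
    qed simp
  qed
  finally show ?thesis .
qed

lemma lsq_embed_deviation:
  fixes e :: "'r::euclidean_space \<Rightarrow> real^'k"
  assumes e: "linear e" "\<And>x. norm (e x) = norm x" and k: "CARD('k) \<le> CARD('n)"
    and w: "w > 0" and y: "0 < y" "y < 1" and N: "N = real CARD('n) - real CARD('k) + 1"
    and \<tau>: "w + real DIM('r) * y \<le> \<tau> * N * (1 - y)"
  shows "measure stdg {p :: (real^'n^'k) \<times> (real^'n).
        \<bar>(norm (adjoint e (lsq (fst p) (snd p))))\<^sup>2 - real DIM('r) / N\<bar> > \<tau>}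
    \<le> 2 * exp (- w\<^sup>2 / (8 * max (real DIM('r)) w)) + 2 * exp (- N * y\<^sup>2 / 8)"
proof -
  let ?r = "real DIM('r)"
  have N1: "N \<ge> 1" using k by (simp add: N)
  let ?A = "{t. \<bar>t - ?r / N\<bar> > \<tau>}" and ?D = "{\<xi> :: 'r. \<bar>(norm \<xi>)\<^sup>2 - ?r\<bar> \<ge> w}"
  have "measure stdg {p :: (real^'n^'k) \<times> (real^'n). (norm (adjoint e (lsq (fst p) (snd p))))\<^sup>2 \<in> ?A}
      \<le> measure stdg ?D + 2 * exp (- N * y\<^sup>2 / 8)"
  proof (rule lsq_embed_bound[OF e k y N])
    show "?A \<in> sets borel" "?D \<in> sets borel" by measurable
    have dev: "(norm \<xi>)\<^sup>2 / S \<notin> ?A" if "\<xi> \<notin> ?D" "\<bar>S - N\<bar> < N * y" for \<xi> :: 'r and S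
    proof -
      have "N * y < N" using N1 y by simp
      then have "S > 0" using that(2) by linarith
      then show ?thesis
        using quotient_deviation[OF _ _ _ that(2) _ \<tau> y(2), of "(norm \<xi>)\<^sup>2"] that(1) N1 by auto
    qed
    then show "\<And>\<xi> S. \<xi> \<notin> ?D \<Longrightarrow> \<xi> \<noteq> 0 \<Longrightarrow> \<bar>S - N\<bar> < N * y \<Longrightarrow> (norm \<xi>)\<^sup>2 / S \<notin> ?A" by blast
    show "0 \<in> ?D" if "0 \<in> ?A"
      using dev[of 0 N] that N1 y by auto
  qed
  moreover have "measure stdg ?D \<le> 2 * exp (- w\<^sup>2 / (8 * max ?r w))"
  proof -
    have "(\<Sum>b\<in>Basis. (b \<bullet> \<xi>)\<^sup>2) = (norm \<xi>)\<^sup>2" for \<xi> :: 'r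
      unfolding power2_norm_eq_inner by (subst (2) euclidean_inner) (simp add: power2_eq_square inner_commute)
    moreover have "pairwise orthogonal (Basis :: 'r set)"
      by (auto simp: pairwise_def orthogonal_def inner_Basis)
    ultimately show ?thesis
      using chi_square_deviation[of "Basis :: 'r set", OF _ _ w] by simp
  qed
  ultimately show ?thesis by simp
qed

text \<open>The isometric embedding of the line along \<open>f\<close> has the adjoint
  \<open>\<lambda>z. f \<bullet> z\<close>, so the squared linear form is a ratio with one degree of
  freedom in the numerator. The factor \<open>1 - y\<close> allows for a denominator that is too
  small.\<close>

lemma lsq_linear_form_tail:
  fixes f :: "real^'k"
  assumes f: "norm f = 1" and k: "CARD('k) \<le> CARD('n)" and y: "0 < y" "y < 1"
    and N: "N = real CARD('n) - real CARD('k) + 1" and "\<tau> > 0"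
  shows "measure stdg {p :: (real^'n^'k) \<times> (real^'n). (f \<bullet> lsq (fst p) (snd p))\<^sup>2 > \<tau>}
    \<le> 2 * exp (- 3 * \<tau> * N * (1 - y) / 8) + 2 * exp (- N * y\<^sup>2 / 8)"
proof -
  have N1: "N \<ge> 1" using k by (simp add: N)
  let ?e = "\<lambda>t::real. t *\<^sub>R f"
  have lin: "linear ?e" by (simp add: linear_iff scaleR_left_distrib)
  have adj: "adjoint ?e z = f \<bullet> z" for z
    using adjoint_unique[of ?e "\<lambda>z. f \<bullet> z"] by simp
  have "measure stdg {p :: (real^'n^'k) \<times> (real^'n). (norm (adjoint ?e (lsq (fst p) (snd p))))\<^sup>2 \<in> {\<tau><..}}
      \<le> measure stdg {\<xi> :: real. (1 \<bullet> \<xi>)\<^sup>2 \<ge> \<tau> * N * (1 - y)} + 2 * exp (- N * y\<^sup>2 / 8)"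
  proof (rule lsq_embed_bound[OF lin _ k y N])
    fix \<xi> S :: real
    assume "\<xi> \<notin> {\<xi>. (1 \<bullet> \<xi>)\<^sup>2 \<ge> \<tau> * N * (1 - y)}" and S: "\<bar>S - N\<bar> < N * y"
    then have 1: "\<xi>\<^sup>2 < \<tau> * (N * (1 - y))" by (simp add: mult.assoc)
    have 2: "N * (1 - y) < S" using S by (simp add: algebra_simps abs_less_iff)
    moreover have "0 < N * (1 - y)" using N1 y by simp
    ultimately have "\<xi>\<^sup>2 < \<tau> * S" "S > 0"
      using 1 \<open>\<tau> > 0\<close> mult_strict_left_mono[OF 2 \<open>\<tau> > 0\<close>] by linarith+
    then show "(norm \<xi>)\<^sup>2 / S \<notin> {\<tau><..}" by (simp add: field_simps)
  qed (use f \<open>\<tau> > 0\<close> in auto)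
  moreover have "measure stdg {\<xi> :: real. (1 \<bullet> \<xi>)\<^sup>2 \<ge> \<tau> * N * (1 - y)} \<le> 2 * exp (- 3 * (\<tau> * N * (1 - y)) / 8)"
    by (rule stdg_linear_form_tail) simp
  ultimately show ?thesis by (simp add: adj mult.assoc)
qed

definition proj :: "real^'n^'k \<Rightarrow> real^'n \<Rightarrow> real^'n" where
  "proj W x = transpose W *v lsq W x"

lemma proj_linear: "proj W (a *\<^sub>R x + b *\<^sub>R y) = a *\<^sub>R proj W x + b *\<^sub>R proj W y"
  by (simp add: proj_def lsq_linear matrix_vector_right_distrib matrix_vector_mult_scaleR)

lemma proj_is_linear: "linear (proj W)"
  using proj_linear[of W 1 _ 1] proj_linear[of W _ _ 0] by (intro linearI) (simp_all add: linearI)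

lemma lsq_kernel: "W *v x = 0 \<Longrightarrow> lsq W x = 0"
  by (simp add: lsq_def)

lemma measurable_proj [measurable (raw)]:
  assumes [measurable]: "f \<in> borel_measurable M" "g \<in> borel_measurable M"
  shows "(\<lambda>x. proj (f x) (g x)) \<in> borel_measurable M"
  unfolding proj_def by measurable

context
  fixes W :: "real^'n^'k"
  assumes full: "full_rank W"
begin

lemma proj_resid: "W *v (x - proj W x) = 0"
  using lsq_normal_eq[OF full, of x] by (simp add: proj_def)

lemma lsq_transpose: "lsq W (transpose W *v c) = c"
  by (rule lsq_unique[OF full]) simp

lemma lsq_proj: "lsq W (proj W x) = lsq W x"
  by (simp add: proj_def lsq_transpose)

lemma proj_proj: "proj W (proj W x) = proj W x"
  by (simp add: proj_def lsq_transpose)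

lemma proj_sym: "proj W x \<bullet> y = x \<bullet> proj W y"
proof -
  have "proj W x \<bullet> y = lsq W x \<bullet> (W *v y)"
    by (simp add: proj_def inner_matrix_vector)
  also have "\<dots> = x \<bullet> proj W y"
    unfolding lsq_def inner_matrix_vector full_rank_gram(3)[OF full] proj_def by simp
  finally show ?thesis .
qed

lemma norm_proj_resid: "(norm (x - proj W x))\<^sup>2 + (norm (proj W x))\<^sup>2 = (norm x)\<^sup>2"
proof -
  have "proj W x \<bullet> proj W x = x \<bullet> proj W x"
    using proj_sym[of x "proj W x"] by (simp add: proj_proj)
  then show ?thesis
    by (simp add: power2_norm_eq_inner inner_diff_left inner_diff_right inner_commute)
qed

text \<open>The residual is the projection of \<open>v\<close> onto the orthogonal complement of the
  row space, which has dimension n - k.\<close>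

lemma resid_norm_deviation_fixed:
  assumes w: "w > 0" and N: "N = real CARD('n) - real CARD('k)"
  shows "measure stdg {v. \<bar>(norm (v - proj W v))\<^sup>2 - N\<bar> \<ge> w} \<le> 2 * exp (- w\<^sup>2 / (8 * max N w))"
proof -
  let ?S = "range ((*v) (transpose W))"
  define T where "T = {y. \<forall>x\<in>?S. orthogonal x y}"
  have sub: "subspace ?S" by (rule linear_subspace_image) auto
  have "subspace T" unfolding T_def by (rule subspace_orthogonal_to_vectors)
  then obtain B where B: "B \<subseteq> T" "pairwise orthogonal B" "\<And>x. x \<in> B \<Longrightarrow> norm x = 1"
    "independent B" "card B = dim T" "span B = T"
    using orthonormal_basis_subspace by metis
  have fin: "finite B" using B(4) by (rule independent_imp_finite)
  have "dim T + dim ?S = CARD('n)"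
    using dim_subspace_orthogonal_to_vectors[OF sub subspace_UNIV] by (simp add: T_def)
  moreover have "inj ((*v) (transpose W))"
    using full by (simp add: full_rank_def vec.inj_iff_eq_0)
  then have "dim ?S = CARD('k)" by (subst dim_image_eq) auto
  ultimately have cB: "real (card B) = N" using B(5) N by simp
  have "(norm (v - proj W v))\<^sup>2 = (\<Sum>b\<in>B. (b \<bullet> v)\<^sup>2)" for v
  proof -
    let ?r = "v - proj W v"
    have "(transpose W *v c) \<bullet> ?r = 0" for c
      by (simp add: inner_matrix_vector proj_resid)
    then have "?r \<in> span B" unfolding B(6) T_def by (auto simp: orthogonal_def)
    have bp: "b \<bullet> proj W v = 0" if "b \<in> B" for b
      using B(1) that by (auto simp: T_def orthogonal_def proj_def inner_commute[of b])
    have "?r \<bullet> ?r = (\<Sum>b\<in>B. (?r \<bullet> b) *\<^sub>R b) \<bullet> ?r"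
      using orthonormal_basis_expand[OF B(2,3) \<open>?r \<in> span B\<close> fin] by simp
    also have "\<dots> = (\<Sum>b\<in>B. (b \<bullet> ?r)\<^sup>2)"
      by (simp add: inner_sum_left inner_sum_right power2_eq_square inner_commute)
    also have "\<dots> = (\<Sum>b\<in>B. (b \<bullet> v)\<^sup>2)"
      by (rule sum.cong) (simp_all add: inner_diff_right bp)
    finally show ?thesis by (simp add: power2_norm_eq_inner)
  qed
  then show ?thesis using chi_square_deviation[OF B(2,3) w] by (simp add: cB)
qed

end

lemma resid_norm_deviation:
  assumes w: "w > 0" and N: "N = real CARD('n) - real CARD('k)" and k: "CARD('k) \<le> CARD('n)"
  shows "measure stdg {p :: (real^'n^'k) \<times> (real^'n). \<bar>(norm (snd p - proj (fst p) (snd p)))\<^sup>2 - N\<bar> \<ge> w}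
    \<le> 2 * exp (- w\<^sup>2 / (8 * max N w))"
proof (rule measure_stdg_pair_le)
  show "AE x in stdg. measure stdg {y. (x, y) \<in> {p :: (real^'n^'k) \<times> (real^'n). \<bar>(norm (snd p - proj (fst p) (snd p)))\<^sup>2 - N\<bar> \<ge> w}}
      \<le> 2 * exp (- w\<^sup>2 / (8 * max N w))"
    using AE_full_rank[OF k] by eventually_elim (use resid_norm_deviation_fixed[OF _ w N] in simp)
  have "(\<lambda>p :: (real^'n^'k) \<times> (real^'n). \<bar>(norm (snd p - proj (fst p) (snd p)))\<^sup>2 - N\<bar>) \<in> borel_measurable borel"
    by measurable
  from measurable_sets[OF this, of "{w..}"]
  show "{p :: (real^'n^'k) \<times> (real^'n). \<bar>(norm (snd p - proj (fst p) (snd p)))\<^sup>2 - N\<bar> \<ge> w} \<in> sets borel"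
    by (simp add: vimage_def)
qed simp

section \<open>Two-block designs\<close>

definition join :: "real^'n^'p \<Rightarrow> real^'n^'q \<Rightarrow> real^'n^('p + 'q)" where
  "join W1 W2 = (\<chi> i. case i of Inl a \<Rightarrow> W1 $ a | Inr b \<Rightarrow> W2 $ b)"

definition vjoin :: "real^'p \<Rightarrow> real^'q \<Rightarrow> real^('p + 'q)" where
  "vjoin a b = (\<chi> i. case i of Inl i \<Rightarrow> a $ i | Inr i \<Rightarrow> b $ i)"

definition vfst :: "real^('p::finite + 'q::finite) \<Rightarrow> real^'p" where "vfst c = (\<chi> i. c $ Inl i)"
definition vsnd :: "real^('p::finite + 'q::finite) \<Rightarrow> real^'q" where "vsnd c = (\<chi> i. c $ Inr i)"

lemma sum_UNIV_Plus: "(\<Sum>i\<in>(UNIV :: ('p::finite + 'q::finite) set). f i) = (\<Sum>i\<in>UNIV. f (Inl i)) + (\<Sum>i\<in>UNIV. f (Inr i))"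
  by (simp add: UNIV_Plus_UNIV[symmetric] sum.Plus del: UNIV_Plus_UNIV)

lemma vjoin_simps [simp]: "vfst (vjoin a b) = a" "vsnd (vjoin a b) = b" "vjoin (vfst c) (vsnd c) = c"
  by (simp_all add: vjoin_def vfst_def vsnd_def vec_eq_iff split: sum.split)

lemma vjoin_inner: "vjoin a b \<bullet> c = a \<bullet> vfst c + b \<bullet> vsnd c"
  by (simp add: inner_vec_def sum_UNIV_Plus vjoin_def vfst_def vsnd_def)

lemma norm_vjoin: "(norm (vjoin a b))\<^sup>2 = (norm a)\<^sup>2 + (norm b)\<^sup>2"
  by (simp add: power2_norm_eq_inner vjoin_inner)

lemma vfst_linear [simp]: "linear vfst" "linear vsnd"
  by (auto intro!: linearI simp: vfst_def vsnd_def vec_eq_iff)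

lemma measurable_vfst [measurable]: "vfst \<in> borel_measurable borel" "vsnd \<in> borel_measurable borel"
  by (auto intro!: borel_measurable_continuous_onI linear_continuous_on simp: linear_conv_bounded_linear[symmetric])

lemma transpose_join: "transpose (join W1 W2) *v c = transpose W1 *v vfst c + transpose W2 *v vsnd c"
  by (simp add: transpose_vector_sum sum_UNIV_Plus join_def vfst_def vsnd_def)

lemma join_mult: "join W1 W2 *v x = vjoin (W1 *v x) (W2 *v x)"
  by (simp add: vec_eq_iff matrix_vector_mult_def join_def vjoin_def split: sum.split)

lemma vjoin_eq_0: "vjoin a b = 0 \<longleftrightarrow> a = 0 \<and> b = 0"
  by (auto simp: vjoin_def vec_eq_iff split: sum.splits)

lemma measurable_join [measurable (raw)]:
  assumes "f \<in> borel_measurable M" "g \<in> borel_measurable M"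
  shows "(\<lambda>x. join (f x) (g x)) \<in> borel_measurable M"
proof (rule borel_measurable_continuous_Pair[OF assms])
  have "continuous_on UNIV (\<lambda>x. case i of Inl a \<Rightarrow> fst x $ a | Inr b \<Rightarrow> snd x $ b)" for i :: "'c + 'd"
    by (cases i) (auto intro!: continuous_intros)
  then show "continuous_on UNIV (\<lambda>x. join (fst x :: real^'b^'c) (snd x :: real^'b^'d))"
    unfolding join_def by (intro continuous_on_vec_lambda)
qed

lemma full_rank_join_fst: "full_rank (join W1 W2) \<Longrightarrow> full_rank W1"
  unfolding full_rank_def transpose_join
  by (metis add.right_neutral matrix_vector_mult_0_right vjoin_eq_0 vjoin_simps(1,2))

text \<open>A combination of the noise vector and the second-block regressors. With weights
  \<open>(r, d2)\<close> it is the response without its first-block part; with weights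
  \<open>(1, - e)\<close> it is the noise minus its fitted second-block part.\<close>

definition comb :: "real \<times> (real^'q) \<Rightarrow> (real^'n) \<times> (real^'n^'q) \<Rightarrow> real^'n" where
  "comb w c = fst w *\<^sub>R fst c + transpose (snd c) *v snd w"

text \<open>Exchanging the projections onto the row space of \<open>W\<close> for an independent copy preserves the law of a
  Gaussian element and does not change \<open>\<delta>2\<close>; this makes \<open>\<delta>2\<close> independent of the fit on the first block.\<close>

definition mix :: "real^'n^'p \<Rightarrow> ((real^'n) \<times> (real^'n^'q)) \<times> ((real^'n) \<times> (real^'n^'q)) \<Rightarrow> (real^'n) \<times> (real^'n^'q)" where
  "mix W z = (let M = (\<lambda>x y. x - proj W x + proj W y) in
     (M (fst (fst z)) (fst (snd z)), \<chi> i. M (snd (fst z) $ i) (snd (snd z) $ i)))"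

lemma measurable_comb [measurable (raw)]:
  assumes [measurable]: "f \<in> borel_measurable M" "g \<in> borel_measurable M"
  shows "(\<lambda>x. comb (f x) (g x)) \<in> borel_measurable M"
  unfolding comb_def by measurable

lemma distr_comb:
  fixes w :: "real \<times> (real^'q)"
  assumes "norm w = 1"
  shows "distr stdg borel (comb w) = (stdg :: (real^'n) measure)"
proof (rule distr_stdg_coisometry[where T' = "\<lambda>a. (fst w *\<^sub>R a, outer (snd w) a)"])
  fix a :: "real^'n" and c :: "(real^'n) \<times> (real^'n^'q)"
  have "outer (snd w) a \<bullet> snd c = a \<bullet> (transpose (snd c) *v snd w)"
    by (subst (1 2) inner_commute) (rule outer_inner)
  then show "a \<bullet> comb w c = (fst w *\<^sub>R a, outer (snd w) a) \<bullet> c"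
    by (simp add: comb_def inner_add_right inner_prod_def)
  have "(fst w)\<^sup>2 + (norm (snd w))\<^sup>2 = 1"
    using assms norm_Pair[of "fst w" "snd w"] by (simp add: real_sqrt_eq_1_iff)
  moreover have "outer (snd w) a \<bullet> outer (snd w) a = (norm (snd w))\<^sup>2 * (norm a)\<^sup>2"
    by (simp add: outer_inner transpose_outer power2_norm_eq_inner)
  then have "(norm (fst w *\<^sub>R a, outer (snd w) a))\<^sup>2 = ((fst w)\<^sup>2 + (norm (snd w))\<^sup>2) * (norm a)\<^sup>2"
    by (simp add: norm_Pair power_mult_distrib power2_norm_eq_inner[of "outer (snd w) a"] distrib_right)
  ultimately have "(norm (fst w *\<^sub>R a, outer (snd w) a))\<^sup>2 = (norm a)\<^sup>2" by simp
  then show "norm (fst w *\<^sub>R a, outer (snd w) a) = norm a"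
    by (simp add: power2_eq_iff_nonneg)
qed (simp add: comb_def[abs_def], measurable)

context
  fixes W :: "real^'n^'p"
  assumes full: "full_rank W"
begin

lemma continuous_on_proj [continuous_intros]:
  "continuous_on S g \<Longrightarrow> continuous_on S (\<lambda>x. proj W (g x))"
  using proj_is_linear[of W] by (simp add: linear_conv_bounded_linear bounded_linear.continuous_on)

lemma measurable_mix [measurable]: "mix W \<in> borel_measurable borel"
  unfolding mix_def[abs_def] Let_def by (intro borel_measurable_continuous_onI continuous_intros)

lemma distr_mix:
  "distr stdg borel (mix W) = (stdg :: ((real^'n) \<times> (real^'n^'q)) measure)"
proof (rule distr_stdg_coisometry[where T' = "\<lambda>a. ((fst a - proj W (fst a), \<chi> i. snd a $ i - proj W (snd a $ i)), (proj W (fst a), \<chi> i. proj W (snd a $ i)))"])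
  fix a :: "(real^'n) \<times> (real^'n^'q)" and z
  have M: "x \<bullet> (s - proj W s + proj W t) = (x - proj W x) \<bullet> s + proj W x \<bullet> t" for x s t
    using proj_sym[OF full] by (simp add: inner_add_right inner_diff_left inner_diff_right)
  show "a \<bullet> mix W z = ((fst a - proj W (fst a), \<chi> i. snd a $ i - proj W (snd a $ i)), (proj W (fst a), \<chi> i. proj W (snd a $ i))) \<bullet> z"
    by (simp add: inner_prod_def mix_def Let_def M inner_vec_def[of "snd a"] inner_vec_def[of "vec_lambda _"] sum.distrib)
  have "(norm ((fst a - proj W (fst a), \<chi> i. snd a $ i - proj W (snd a $ i)), (proj W (fst a), \<chi> i. proj W (snd a $ i))))\<^sup>2
     = ((norm (fst a - proj W (fst a)))\<^sup>2 + (norm (proj W (fst a)))\<^sup>2) + (\<Sum>i\<in>UNIV. (norm (snd a $ i - proj W (snd a $ i)))\<^sup>2 + (norm (proj W (snd a $ i)))\<^sup>2)"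
    by (simp add: power2_norm_eq_inner inner_prod_def inner_vec_def[of "vec_lambda _"] sum.distrib)
  also have "\<dots> = (norm a)\<^sup>2"
    unfolding norm_proj_resid[OF full] by (simp add: power2_norm_eq_inner inner_prod_def inner_vec_def[of "snd a"])
  finally show "norm ((fst a - proj W (fst a), \<chi> i. snd a $ i - proj W (snd a $ i)), (proj W (fst a), \<chi> i. proj W (snd a $ i))) = norm a"
    by (simp add: power2_eq_iff_nonneg)
qed measurable

text \<open>A fit on \<open>W\<close> sees only the projection of its argument onto the row space,
  and that part of the mixture comes from \<open>c'\<close>.\<close>

lemma lsq_comb_mix: "lsq W (comb w (mix W (c, c'))) = lsq W (comb w c')"
proof -
  have "transpose (\<chi> i. snd c $ i - proj W (snd c $ i) + proj W (snd c' $ i)) *v b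
     = transpose (snd c) *v b - proj W (transpose (snd c) *v b) + proj W (transpose (snd c') *v b)" for b
    by (simp add: transpose_vector_sum linear_sum[OF proj_is_linear] linear_scale[OF proj_is_linear]
          scaleR_right_distrib scaleR_right_diff_distrib sum.distrib sum_subtractf)
  then have e: "comb w (mix W (c, c')) = 1 *\<^sub>R (comb w c - proj W (comb w c)) + 1 *\<^sub>R proj W (comb w c')"
    by (simp add: comb_def mix_def Let_def linear_add[OF proj_is_linear] linear_scale[OF proj_is_linear] algebra_simps)
  show ?thesis
    unfolding e lsq_linear by (simp add: lsq_kernel[OF proj_resid[OF full]] lsq_proj[OF full])
qed

end

text \<open>The weights may depend on the sample as long as mixing leaves them unchanged: then the
  fit is computed from an independent copy while the weights come from the original. Given the
  original, a unit combination of the copy is a standard Gaussian vector, whatever the weights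
  are.\<close>

lemma lsq_comb_law_fixed:
  fixes w :: "(real^'n) \<times> (real^'n^'q) \<Rightarrow> real \<times> (real^'q)" and W :: "real^'n^'p"
  assumes full: "full_rank W" and [measurable]: "w \<in> borel_measurable borel" and norm: "\<And>c. norm (w c) = 1"
    and A [measurable]: "A \<in> sets borel"
    and inv: "AE z in stdg. w (mix W z) = w (fst z)"
  shows "emeasure stdg {c. lsq W (comb (w c) c) \<in> A} = emeasure stdg {x. lsq W x \<in> A}"
proof -
  note [measurable] = measurable_mix[OF full]
  have m1: "(\<lambda>c. lsq W (comb (w c) c)) \<in> borel_measurable borel"
    by measurable
  have m2: "(\<lambda>z. lsq W (comb (w (fst z)) (snd z))) \<in> borel_measurable borel"
    by measurable
  have "emeasure stdg {c. lsq W (comb (w c) c) \<in> A} = emeasure (distr stdg borel (mix W)) {c. lsq W (comb (w c) c) \<in> A}"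
    by (simp add: distr_mix[OF full])
  also have "\<dots> = emeasure stdg {z. lsq W (comb (w (mix W z)) (mix W z)) \<in> A}"
    using measurable_sets[OF m1 A] by (subst emeasure_distr) (simp_all add: vimage_def)
  also have "\<dots> = emeasure stdg {z. lsq W (comb (w (fst z)) (snd z)) \<in> A}"
  proof (rule emeasure_eq_AE)
    show "AE z in stdg. z \<in> {z. lsq W (comb (w (mix W z)) (mix W z)) \<in> A} \<longleftrightarrow> z \<in> {z. lsq W (comb (w (fst z)) (snd z)) \<in> A}"
      using inv
    proof eventually_elim
      case (elim z)
      then show ?case using lsq_comb_mix[OF full, of "w (fst z)" "fst z" "snd z"] by simp
    qed
    show "{z. lsq W (comb (w (fst z)) (snd z)) \<in> A} \<in> sets stdg"
      using measurable_sets[OF m2 A] by (simp add: vimage_def)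
    have "(\<lambda>z. lsq W (comb (w (mix W z)) (mix W z))) \<in> borel_measurable borel" by measurable
    from measurable_sets[OF this A] show "{z. lsq W (comb (w (mix W z)) (mix W z)) \<in> A} \<in> sets stdg"
      by (simp add: vimage_def)
  qed
  also have "\<dots> = (\<integral>\<^sup>+c. emeasure stdg {c'. lsq W (comb (w c) c') \<in> A} \<partial>stdg)"
    using measurable_sets[OF m2 A] by (subst emeasure_stdg_pair) (simp_all add: vimage_def)
  also have "\<dots> = (\<integral>\<^sup>+c. emeasure stdg {x. lsq W x \<in> A} \<partial>(stdg :: ((real^'n) \<times> (real^'n^'q)) measure))"
  proof (rule nn_integral_cong)
    fix c
    have m3: "(\<lambda>x. lsq W x) \<in> borel_measurable borel" by measurable
    have "comb (w c) \<in> borel_measurable borel" by measurable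
    then have "emeasure (distr stdg borel (comb (w c))) {x. lsq W x \<in> A} = emeasure stdg {c'. lsq W (comb (w c) c') \<in> A}"
      using measurable_sets[OF m3 A] by (subst emeasure_distr) (simp_all add: vimage_def)
    then show "emeasure stdg {c'. lsq W (comb (w c) c') \<in> A} = emeasure stdg {x. lsq W x \<in> A}"
      by (simp add: distr_comb[OF norm])
  qed
  also have "\<dots> = emeasure stdg {x. lsq W x \<in> A}" by simp
  finally show ?thesis .
qed

definition \<delta>2 :: "real^'n^'p \<Rightarrow> (real^'n) \<times> (real^'n^'q) \<Rightarrow> real^'q" where
  "\<delta>2 W c = vsnd (lsq (join W (snd c)) (fst c))"

lemma measurable_\<delta>2 [measurable (raw)]:
  assumes [measurable]: "f \<in> borel_measurable M" "g \<in> borel_measurable M"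
  shows "(\<lambda>x. \<delta>2 (f x) (g x)) \<in> borel_measurable M"
  unfolding \<delta>2_def by measurable

lemma mult_eq_0_iff: "W *v x = 0 \<longleftrightarrow> (\<forall>c. (transpose W *v c) \<bullet> x = 0)" for W :: "real^'n^'k"
proof
  assume "\<forall>c. (transpose W *v c) \<bullet> x = 0"
  then have "(W *v x) \<bullet> (W *v x) = 0" by (simp add: inner_matrix_vector)
  then show "W *v x = 0" by simp
qed (simp add: inner_matrix_vector)

text \<open>The Frisch--Waugh--Lovell principle. The residual \<open>r\<close> of the joint fit
  remains orthogonal to all regressors after mixing, and the exchange of the projections onto the
  rows of \<open>W\<close> is absorbed by new first-block coefficients, so the second block stays
  the same.\<close>

lemma \<delta>2_mix:
  fixes W :: "real^'n^'p" and c c' :: "(real^'n) \<times> (real^'n^'q)"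
  assumes full: "full_rank (join W (snd c))"
  shows "\<delta>2 W (mix W (c, c')) = \<delta>2 W c"
proof -
  have fW: "full_rank W" using full by (rule full_rank_join_fst)
  note lin = proj_is_linear[of W]
  define d where "d = lsq (join W (snd c)) (fst c)"
  define r where "r = fst c - transpose (join W (snd c)) *v d"
  have "join W (snd c) *v r = 0" unfolding r_def d_def by (rule lsq_normal_eq[OF full])
  then have r1: "W *v r = 0" and r2: "snd c *v r = 0" by (auto simp: join_mult vjoin_eq_0)
  have pr: "proj W r = 0" using r1 by (simp add: proj_def lsq_kernel)
  define v' where "v' = fst (mix W (c, c'))"
  define W' where "W' = snd (mix W (c, c'))"
  have W'b: "transpose W' *v b = transpose (snd c) *v b - proj W (transpose (snd c) *v b) + proj W (transpose (snd c') *v b)" for b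
    by (simp add: W'_def mix_def Let_def transpose_vector_sum linear_sum[OF lin] linear_scale[OF lin]
          scaleR_right_distrib scaleR_right_diff_distrib sum.distrib sum_subtractf)
  have fW': "full_rank (join W W')"
    unfolding full_rank_def
  proof (intro allI impI)
    fix b assume b: "transpose (join W W') *v b = 0"
    let ?x = "transpose (snd c) *v vsnd b"
    have e: "transpose W *v vfst b + (?x - proj W ?x + proj W (transpose (snd c') *v vsnd b)) = 0"
      using b by (simp add: transpose_join W'b)
    \<comment> \<open>Projecting removes the residual part of \<open>?x\<close>. Subtracting the
      projected equation leaves \<open>?x = proj W ?x\<close>, a linear dependence of the original
      rows, which full rank excludes unless \<open>vsnd b = 0\<close>.\<close>
    then have "proj W (transpose W *v vfst b + (?x - proj W ?x + proj W (transpose (snd c') *v vsnd b))) = 0"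
      by (simp add: linear_0[OF lin])
    then have "transpose W *v vfst b + proj W (transpose (snd c') *v vsnd b) = 0"
      by (simp add: linear_add[OF lin] linear_diff[OF lin] proj_proj[OF fW] proj_def[of W "transpose W *v vfst b"] lsq_transpose[OF fW])
    then have "(transpose W *v vfst b + (?x - proj W ?x + proj W (transpose (snd c') *v vsnd b)))
        - (transpose W *v vfst b + proj W (transpose (snd c') *v vsnd b)) = 0"
      unfolding e by simp
    then have xp: "?x = proj W ?x" by simp
    have "transpose W *v (- lsq W ?x) = - proj W ?x"
      using matrix_vector_mult_scaleR[of "transpose W" "-1" "lsq W ?x"] by (simp add: proj_def)
    then have "transpose (join W (snd c)) *v vjoin (- lsq W ?x) (vsnd b) = 0"
      using xp by (simp add: transpose_join)
    then have "vjoin (- lsq W ?x) (vsnd b) = 0" using full by (auto simp: full_rank_def)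
    then have "vsnd b = 0" by (simp add: vjoin_eq_0)
    then have "transpose W *v vfst b = 0" using e by (simp add: linear_0[OF lin])
    then have "vfst b = 0" using fW by (simp add: full_rank_def)
    then show "b = 0" using \<open>vsnd b = 0\<close> by (metis vjoin_eq_0 vjoin_simps(3))
  qed
  \<comment> \<open>The first-block coefficients that absorb the exchanged projections.\<close>
  define a where "a = lsq W (fst c' - transpose (snd c') *v vsnd d)"
  have "lsq (join W W') v' = vjoin a (vsnd d)"
  proof (rule lsq_unique[OF fW'])
    have "v' - transpose W' *v vsnd d - transpose W *v a = r"
    proof -
      have "v' - transpose W' *v vsnd d = (fst c - transpose (snd c) *v vsnd d) - proj W (fst c - transpose (snd c) *v vsnd d)
          + proj W (fst c' - transpose (snd c') *v vsnd d)"
        unfolding W'b by (simp add: v'_def mix_def Let_def linear_diff[OF lin])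
      also have "fst c - transpose (snd c) *v vsnd d = r + transpose W *v vfst d"
        by (simp add: r_def transpose_join)
      also have "proj W (r + transpose W *v vfst d) = transpose W *v vfst d"
        by (simp add: linear_add[OF lin] pr proj_def[of W "transpose W *v vfst d"] lsq_transpose[OF fW])
      finally show ?thesis by (simp add: a_def proj_def)
    qed
    then have e: "v' - transpose (join W W') *v vjoin a (vsnd d) = r"
      by (simp add: transpose_join algebra_simps)
    have "(transpose W' *v b) \<bullet> r = 0" for b
    proof -
      have "proj W x \<bullet> r = 0" for x using r1 by (simp add: proj_def inner_matrix_vector)
      then show ?thesis using r2 by (simp add: W'b inner_add_left inner_diff_left inner_matrix_vector)
    qed
    then have "W' *v r = 0" by (simp add: mult_eq_0_iff)
    then show "join W W' *v (v' - transpose (join W W') *v vjoin a (vsnd d)) = 0"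
      unfolding e using r1 by (simp add: join_mult vjoin_eq_0)
  qed
  then show ?thesis by (simp add: \<delta>2_def v'_def[symmetric] W'_def[symmetric] d_def)
qed

lemma distr_reorder:
  "distr stdg borel (\<lambda>z. (join (fst z) (snd (snd z)), fst (snd z)))
    = (stdg :: ((real^'n^('p::finite + 'q::finite)) \<times> (real^'n)) measure)" (is ?a)
  "distr stdg borel (\<lambda>z. (fst (snd z), join (fst z) (snd (snd z))))
    = (stdg :: ((real^'n) \<times> (real^'n^('p::finite + 'q::finite))) measure)" (is ?b)
proof -
  have ij: "a \<bullet> join W1 W2 = (\<chi> i. a $ Inl i) \<bullet> W1 + (\<chi> i. a $ Inr i) \<bullet> W2" for a :: "real^'n^('p + 'q)" and W1 :: "real^'n^'p" and W2 :: "real^'n^'q"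
    by (simp add: inner_vec_def[where 'b="'p+'q"] sum_UNIV_Plus join_def inner_vec_def[of "vec_lambda _"])
  have nj: "(norm (\<chi> i. a $ Inl i :: real^'n^'p))\<^sup>2 + (norm (\<chi> i. a $ Inr i :: real^'n^'q))\<^sup>2 = (norm a)\<^sup>2" for a :: "real^'n^('p + 'q)"
    by (simp add: power2_norm_eq_inner inner_vec_def[where 'b="'p+'q"] sum_UNIV_Plus inner_vec_def[of "vec_lambda _"])
  show ?a
    by (rule distr_stdg_coisometry[where T' = "\<lambda>a. (\<chi> i. fst a $ Inl i, snd a, \<chi> i. fst a $ Inr i)"])
       (auto simp: inner_prod_def ij norm_prod_def nj[symmetric] algebra_simps)
  show ?b
    by (rule distr_stdg_coisometry[where T' = "\<lambda>a. (\<chi> i. snd a $ Inl i, fst a, \<chi> i. snd a $ Inr i)"])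
       (auto simp: inner_prod_def ij norm_prod_def nj[symmetric] algebra_simps)
qed

lemma measure_reorder:
  fixes A :: "((real^'n^('p::finite + 'q::finite)) \<times> (real^'n)) set"
  assumes "A \<in> sets borel"
  shows "measure stdg {z :: (real^'n^'p) \<times> (real^'n) \<times> (real^'n^'q). (join (fst z) (snd (snd z)), fst (snd z)) \<in> A} = measure stdg A"
proof -
  have "(\<lambda>z :: (real^'n^'p) \<times> (real^'n) \<times> (real^'n^'q). (join (fst z) (snd (snd z)), fst (snd z))) \<in> borel_measurable borel"
    by measurable
  then have "measure (distr stdg borel (\<lambda>z :: (real^'n^'p) \<times> (real^'n) \<times> (real^'n^'q). (join (fst z) (snd (snd z)), fst (snd z)))) A
    = measure stdg {z :: (real^'n^'p) \<times> (real^'n) \<times> (real^'n^'q). (join (fst z) (snd (snd z)), fst (snd z)) \<in> A}"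
    using assms by (subst measure_distr) (simp_all add: vimage_def)
  then show ?thesis by (simp add: distr_reorder)
qed

lemma AE_full_rank_join:
  assumes "CARD('p) + CARD('q) \<le> CARD('n)"
  shows "AE z in (stdg :: ((real^'n^'p) \<times> (real^'n) \<times> (real^'n^'q)) measure). full_rank (join (fst z) (snd (snd z)))"
proof -
  have "AE W in (stdg :: (real^'n^('p + 'q)) measure). full_rank W"
    by (rule AE_full_rank) (use assms in simp)
  then have "AE p in (stdg :: ((real^'n^('p::finite + 'q::finite)) \<times> (real^'n)) measure). full_rank (fst p)"
    by (rule AE_stdg_pair_fst) measurable
  then have "AE p in distr (stdg :: ((real^'n^'p) \<times> (real^'n) \<times> (real^'n^'q)) measure) borel (\<lambda>z. (join (fst z) (snd (snd z)), fst (snd z))). full_rank (fst p)"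
    unfolding distr_reorder .
  then show ?thesis
    by (subst (asm) AE_distr_iff) auto
qed

text \<open>Integration over the first block. Invariance of the weights is asked at full rank, which
  holds for almost every sample.\<close>

lemma lsq_comb_law:
  fixes w :: "real^'n^'p \<Rightarrow> (real^'n) \<times> (real^'n^'q) \<Rightarrow> real \<times> (real^'q)"
  assumes [measurable]: "(\<lambda>z. w (fst z) (snd z)) \<in> borel_measurable borel" and norm: "\<And>W c. norm (w W c) = 1"
    and A [measurable]: "A \<in> sets borel" and n: "CARD('p) + CARD('q) \<le> CARD('n)"
    and inv: "\<And>W c c'. full_rank (join W (snd c)) \<Longrightarrow> w W (mix W (c, c')) = w W c"
  shows "measure stdg {z. lsq (fst z) (comb (w (fst z) (snd z)) (snd z)) \<in> A}
     = measure stdg {p :: (real^'n^'p) \<times> (real^'n). lsq (fst p) (snd p) \<in> A}"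
proof -
  have m1: "(\<lambda>z. lsq (fst z) (comb (w (fst z) (snd z)) (snd z))) \<in> borel_measurable borel" by measurable
  have m2: "(\<lambda>p :: (real^'n^'p) \<times> (real^'n). lsq (fst p) (snd p)) \<in> borel_measurable borel" by measurable
  have "emeasure stdg {z. lsq (fst z) (comb (w (fst z) (snd z)) (snd z)) \<in> A}
    = (\<integral>\<^sup>+W. emeasure stdg {c. lsq W (comb (w W c) c) \<in> A} \<partial>stdg)"
    using measurable_sets[OF m1 A] by (subst emeasure_stdg_pair) (simp_all add: vimage_def)
  also have "\<dots> = (\<integral>\<^sup>+W. emeasure stdg {x. lsq W x \<in> A} \<partial>(stdg :: (real^'n^'p) measure))"
  proof (rule nn_integral_cong_AE)
    have "AE W in (stdg :: (real^'n^'p) measure). full_rank W"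
      by (rule AE_full_rank) (use n in simp)
    moreover have "AE W in (stdg :: (real^'n^'p) measure). AE c in (stdg :: ((real^'n) \<times> (real^'n^'q)) measure). full_rank (join W (snd c))"
      using AE_stdg_pair[OF AE_full_rank_join[OF n]] by simp
    ultimately show "AE W in (stdg :: (real^'n^'p) measure). emeasure stdg {c. lsq W (comb (w W c) c) \<in> A} = emeasure stdg {x. lsq W x \<in> A}"
    proof eventually_elim
      case (elim W)
      have m: "w W \<in> borel_measurable borel"
      proof -
        have "Pair W \<in> borel_measurable borel"
          by (intro borel_measurable_continuous_onI continuous_intros)
        then show ?thesis
          using measurable_compose[OF _ assms(1), of "Pair W" borel] by simp
      qed
      show ?case
      proof (rule lsq_comb_law_fixed[OF elim(1) m norm A])
        have "AE z in (stdg :: (((real^'n) \<times> (real^'n^'q)) \<times> ((real^'n) \<times> (real^'n^'q))) measure). full_rank (join W (snd (fst z)))"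
          by (rule AE_stdg_pair_fst[OF elim(2)]) measurable
        then show "AE z in stdg. w W (mix W z) = w W (fst z)"
        proof eventually_elim
          case (elim z)
          then show ?case using inv[of W "fst z" "snd z"] by simp
        qed
      qed
    qed
  qed
  also have "\<dots> = emeasure stdg {p :: (real^'n^'p) \<times> (real^'n). lsq (fst p) (snd p) \<in> A}"
    using measurable_sets[OF m2 A] by (subst emeasure_stdg_pair) (simp_all add: vimage_def)
  finally show ?thesis by (simp add: measure_def)
qed

text \<open>The two parameters \<open>y\<close> and \<open>w\<close> of \<open>lsq_embed_deviation\<close> are chosen so that numerator and
  denominator of the variance ratio get the same share of the deviation \<open>\<tau>\<close>.\<close>

definition ratio_bound :: "real \<Rightarrow> real \<Rightarrow> real \<Rightarrow> real" where
  "ratio_bound N r \<tau> = 2 * exp (- (9/20 * \<tau> * N)\<^sup>2 / (8 * max r (9/20 * \<tau> * N)))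
     + 2 * exp (- N * (min (1/10) (9/20 * \<tau> * N / r))\<^sup>2 / 8)"

lemma lsq_embed_ratio_bound:
  fixes e :: "'r::euclidean_space \<Rightarrow> real^'k"
  assumes e: "linear e" "\<And>x. norm (e x) = norm x" and k: "CARD('k) \<le> CARD('n)"
    and N: "N = real CARD('n) - real CARD('k) + 1" and \<tau>: "\<tau> > 0"
  shows "measure stdg {p :: (real^'n^'k) \<times> (real^'n).
        \<bar>(norm (adjoint e (lsq (fst p) (snd p))))\<^sup>2 - real DIM('r) / N\<bar> > \<tau>}
    \<le> ratio_bound N (real DIM('r)) \<tau>"
  unfolding ratio_bound_def
proof (rule lsq_embed_deviation[OF e k _ _ _ N])
  have N1: "N \<ge> 1" using k by (simp add: N)
  let ?r = "real DIM('r)"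
  let ?w = "9/20 * \<tau> * N" let ?y = "min (1/10) (?w / ?r)"
  show "0 < ?w" "0 < ?y" "?y < 1" using \<tau> N1 by (auto simp: min_less_iff_disj)
  have "?r * ?y \<le> ?r * (?w / ?r)" by (intro mult_left_mono) auto
  also have "\<dots> = ?w" by simp
  finally have "?w + ?r * ?y \<le> ?w + ?w" by (rule add_left_mono)
  also have "\<dots> = 9/10 * (\<tau> * N)" by simp
  \<comment> \<open>Two shares of 9/20 make 9/10, and \<open>?y\<close> is capped at 1/10.\<close>
  also have "\<dots> \<le> (1 - ?y) * (\<tau> * N)" using \<tau> N1 by (intro mult_right_mono) auto
  finally show "?w + ?r * ?y \<le> \<tau> * N * (1 - ?y)" by (simp add: mult_ac)
qed

lemma lsq_comb_ratio_bound:
  fixes w :: "real^'n^'p \<Rightarrow> (real^'n) \<times> (real^'n^'q) \<Rightarrow> real \<times> (real^'q)"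
  assumes w: "(\<lambda>z. w (fst z) (snd z)) \<in> borel_measurable borel" "\<And>W c. norm (w W c) = 1"
    and n: "CARD('p) + CARD('q) \<le> CARD('n)"
    and inv: "\<And>W c c'. full_rank (join W (snd c)) \<Longrightarrow> w W (mix W (c, c')) = w W c"
    and N: "N = real CARD('n) - real CARD('p) + 1" and \<tau>: "\<tau> > 0"
  shows "measure stdg {z. \<bar>(norm (lsq (fst z) (comb (w (fst z) (snd z)) (snd z))))\<^sup>2 - real CARD('p) / N\<bar> > \<tau>}
     \<le> ratio_bound N (real CARD('p)) \<tau>"
proof -
  have k: "CARD('p) \<le> CARD('n)" using n by simp
  let ?A = "{x :: real^'p. \<bar>(norm x)\<^sup>2 - real CARD('p) / N\<bar> > \<tau>}"
  have "?A \<in> sets borel" by measurable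
  from lsq_comb_law[OF w this n inv]
  have "measure stdg {z. \<bar>(norm (lsq (fst z) (comb (w (fst z) (snd z)) (snd z))))\<^sup>2 - real CARD('p) / N\<bar> > \<tau>}
    = measure stdg {p :: (real^'n^'p) \<times> (real^'n). \<bar>(norm (lsq (fst p) (snd p)))\<^sup>2 - real CARD('p) / N\<bar> > \<tau>}"
    by simp
  moreover have "adjoint (\<lambda>x::real^'p. x) = (\<lambda>x. x)" by (rule adjoint_unique) simp
  ultimately show ?thesis
    using lsq_embed_ratio_bound[of "\<lambda>x::real^'p. x", OF _ _ k N \<tau>] by (simp add: linear_ident)
qed

text \<open>The tail in \<open>lsq_linear_form_tail\<close> at \<open>y = 1/10\<close>: 27/80 is 3/8
  * 9/10, and 1/800 is the square of 1/10 divided by 8.\<close>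

definition linear_bound :: "real \<Rightarrow> real \<Rightarrow> real" where
  "linear_bound N \<tau> = 2 * exp (- (27/80) * \<tau> * N) + 2 * exp (- N / 800)"

lemma lsq_linear_bound:
  fixes d :: "real^'k"
  assumes k: "CARD('k) \<le> CARD('n)" and N: "N = real CARD('n) - real CARD('k) + 1" and "\<tau> > 0"
  shows "measure stdg {p :: (real^'n^'k) \<times> (real^'n). (d \<bullet> lsq (fst p) (snd p))\<^sup>2 > (norm d)\<^sup>2 * \<tau>} \<le> linear_bound N \<tau>"
proof (cases "d = 0")
  case True
  then show ?thesis by (simp add: linear_bound_def)
next
  case False
  let ?f = "(1 / norm d) *\<^sub>R d"
  have "d \<bullet> x = norm d * (?f \<bullet> x)" for x using False by simp
  then have "(d \<bullet> x)\<^sup>2 = (norm d)\<^sup>2 * (?f \<bullet> x)\<^sup>2" for x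
    by (simp only: power_mult_distrib)
  then have "(d \<bullet> x)\<^sup>2 > (norm d)\<^sup>2 * \<tau> \<longleftrightarrow> (?f \<bullet> x)\<^sup>2 > \<tau>" for x
    using False by (simp only: mult_less_cancel_left_pos zero_less_power zero_less_norm_iff not_False_eq_True)
  then have "measure stdg {p :: (real^'n^'k) \<times> (real^'n). (d \<bullet> lsq (fst p) (snd p))\<^sup>2 > (norm d)\<^sup>2 * \<tau>}
    = measure stdg {p :: (real^'n^'k) \<times> (real^'n). (?f \<bullet> lsq (fst p) (snd p))\<^sup>2 > \<tau>}" by simp
  also have "\<dots> \<le> 2 * exp (- 3 * \<tau> * N * (1 - 1/10) / 8) + 2 * exp (- N * (1/10)\<^sup>2 / 8)"
    by (rule lsq_linear_form_tail[OF _ k _ _ N \<open>\<tau> > 0\<close>]) (use False in auto)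
  also have "\<dots> = linear_bound N \<tau>" by (simp add: linear_bound_def power2_eq_square field_simps)
  finally show ?thesis .
qed

lemma lsq_comb_linear_bound:
  fixes w :: "real^'n^'p \<Rightarrow> (real^'n) \<times> (real^'n^'q) \<Rightarrow> real \<times> (real^'q)"
  assumes w: "(\<lambda>z. w (fst z) (snd z)) \<in> borel_measurable borel" "\<And>W c. norm (w W c) = 1"
    and n: "CARD('p) + CARD('q) \<le> CARD('n)"
    and inv: "\<And>W c c'. full_rank (join W (snd c)) \<Longrightarrow> w W (mix W (c, c')) = w W c"
    and N: "N = real CARD('n) - real CARD('p) + 1" and \<tau>: "\<tau> > 0"
  shows "measure stdg {z. (d \<bullet> lsq (fst z) (comb (w (fst z) (snd z)) (snd z)))\<^sup>2 > (norm d)\<^sup>2 * \<tau>}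
     \<le> linear_bound N \<tau>"
proof -
  have k: "CARD('p) \<le> CARD('n)" using n by simp
  let ?A = "{x :: real^'p. (d \<bullet> x)\<^sup>2 > (norm d)\<^sup>2 * \<tau>}"
  have "?A \<in> sets borel" by measurable
  from lsq_comb_law[OF w this n inv] show ?thesis
    using lsq_linear_bound[OF k N \<tau>] by simp
qed

section \<open>Deterministic error bounds\<close>

text \<open>\<open>P\<close> and \<open>R\<close> stand for the images of \<open>(r, d2)\<close> and
  \<open>(1, - e)\<close> under a random map that multiplies squared norms by about
  \<open>g1\<close>. So \<open>\<alpha> *\<^sub>R P - \<gamma> *\<^sub>R R\<close> has about
  \<open>g1\<close> times the squared norm of the same combination of the preimages, whose
  coordinates are \<open>- (1 - a1) * r\<close> and
  \<open>\<alpha> *\<^sub>R d2 + \<gamma> *\<^sub>R e\<close>. This is where the factor behind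
  \<open>g1\<close> comes from; the right-hand side collects the deviations from this
  idealisation.\<close>

lemma risk_expansion:
  fixes d2 e :: "'b::real_inner" and d1 P R :: "'a::real_inner" and a1 a2 r g1 \<kappa> :: real
  defines "\<alpha> \<equiv> a1 - a2" and "\<gamma> \<equiv> (1 - a2) * r"
  shows "r\<^sup>2 + (norm (a2 *\<^sub>R d2 - \<gamma> *\<^sub>R e))\<^sup>2 + (norm (a1 *\<^sub>R d1 - \<gamma> *\<^sub>R R + \<alpha> *\<^sub>R P))\<^sup>2
     - (r\<^sup>2 + ((norm d2)\<^sup>2 * a2\<^sup>2 + r\<^sup>2 * (1 - a2)\<^sup>2 * \<kappa>)
        + g1 * ((1 - a1)\<^sup>2 * r\<^sup>2 + \<alpha>\<^sup>2 * (norm d2)\<^sup>2 + (1 - a2)\<^sup>2 * r\<^sup>2 * \<kappa>) + (norm d1)\<^sup>2 * a1\<^sup>2)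
   = (1 + g1) * \<gamma>\<^sup>2 * ((norm e)\<^sup>2 - \<kappa>) - 2 * a2 * \<gamma> * (d2 \<bullet> e) + 2 * g1 * \<alpha> * \<gamma> * (d2 \<bullet> e)
     + (\<alpha>\<^sup>2 * ((norm P)\<^sup>2 - g1 * (r\<^sup>2 + (norm d2)\<^sup>2)) + \<gamma>\<^sup>2 * ((norm R)\<^sup>2 - g1 * (1 + (norm e)\<^sup>2))
        - 2 * \<alpha> * \<gamma> * (P \<bullet> R - g1 * (r - d2 \<bullet> e)))
     + 2 * a1 * (\<alpha> * (d1 \<bullet> P) - \<gamma> * (d1 \<bullet> R))"
proof -
  have 1: "(norm (a2 *\<^sub>R d2 - \<gamma> *\<^sub>R e))\<^sup>2 = a2\<^sup>2 * (norm d2)\<^sup>2 + \<gamma>\<^sup>2 * (norm e)\<^sup>2 - 2 * a2 * \<gamma> * (d2 \<bullet> e)"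
    unfolding power2_norm_eq_inner
    by (simp add: inner_diff_left inner_diff_right inner_commute power2_eq_square algebra_simps)
  have 2: "(norm (a1 *\<^sub>R d1 - \<gamma> *\<^sub>R R + \<alpha> *\<^sub>R P))\<^sup>2 = a1\<^sup>2 * (norm d1)\<^sup>2 + \<gamma>\<^sup>2 * (norm R)\<^sup>2 + \<alpha>\<^sup>2 * (norm P)\<^sup>2
     - 2 * \<alpha> * \<gamma> * (P \<bullet> R) + 2 * a1 * (\<alpha> * (d1 \<bullet> P) - \<gamma> * (d1 \<bullet> R))"
    unfolding power2_norm_eq_inner
    by (simp add: inner_diff_left inner_diff_right inner_add_left inner_add_right inner_commute power2_eq_square algebra_simps)
  show ?thesis
    unfolding 1 2 unfolding \<alpha>_def \<gamma>_def by (simp add: power2_eq_square algebra_simps)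
qed

lemma abs_mult_le_sum_squares: "2 * \<bar>x * y\<bar> \<le> x\<^sup>2 + y\<^sup>2" for x y :: real
  using sum_squares_bound[of "\<bar>x\<bar>" "\<bar>y\<bar>"] by (simp add: abs_mult)

lemma le_sqrt_mult:
  assumes "x\<^sup>2 \<le> c * d\<^sup>2" "0 \<le> c" "0 \<le> (d::real)"
  shows "\<bar>x\<bar> \<le> sqrt c * d"
proof -
  have "x\<^sup>2 \<le> (sqrt c * d)\<^sup>2" using assms by (simp add: power_mult_distrib)
  then have "\<bar>x\<bar> \<le> \<bar>sqrt c * d\<bar>" by (simp only: abs_le_square_iff)
  then show ?thesis using assms by simp
qed

text \<open>\<open>r\<^sup>2\<close>, \<open>norm d2 ^ 2\<close> and \<open>norm d1 ^ 2\<close> are the variances of the part of the response that is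
  orthogonal to all regressors, of the part explained by the second block only, and of the part
  explained by the first block.\<close>

lemma risk_deviation:
  fixes d2 e :: "'b::real_inner" and d1 P R :: "'a::real_inner"
  assumes a: "0 \<le> a1" "a1 \<le> 1" "0 \<le> a2" "a2 \<le> 1" and r: "r > 0"
    and s: "0 < s" "s \<le> 1 / 20" and lam: "0 < lam" "lam \<le> 1"
    and q: "0 < q" "q \<le> 1" "q * (1 + g1) \<le> 1" and g1: "0 \<le> g1" and \<kappa>: "0 \<le> \<kappa>"
    and Q: "Q = r\<^sup>2 + ((norm d2)\<^sup>2 * a2\<^sup>2 + r\<^sup>2 * (1 - a2)\<^sup>2 * \<kappa>)
        + g1 * ((1 - a1)\<^sup>2 * r\<^sup>2 + (a1 - a2)\<^sup>2 * (norm d2)\<^sup>2 + (1 - a2)\<^sup>2 * r\<^sup>2 * \<kappa>) + (norm d1)\<^sup>2 * a1\<^sup>2"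
    and lamQ: "lam * ((a1 - a2)\<^sup>2 * (norm d2)\<^sup>2) \<le> Q"
    and E4: "\<bar>(norm e)\<^sup>2 - \<kappa>\<bar> \<le> 3/2 * s * q"
    and E5: "(d2 \<bullet> e)\<^sup>2 \<le> (norm d2)\<^sup>2 * (s * q / 2)\<^sup>2"
    and E6: "\<bar>(norm P)\<^sup>2 - g1 * (r\<^sup>2 + (norm d2)\<^sup>2)\<bar> \<le> s * lam / 2 * (r\<^sup>2 + (norm d2)\<^sup>2)"
      "\<bar>(norm R)\<^sup>2 - g1 * (1 + (norm e)\<^sup>2)\<bar> \<le> s * lam / 2 * (1 + (norm e)\<^sup>2)"
      "\<bar>P \<bullet> R - g1 * (r - d2 \<bullet> e)\<bar> \<le> s * lam / 2 * sqrt ((r\<^sup>2 + (norm d2)\<^sup>2) * (1 + (norm e)\<^sup>2))"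
    and E7: "(d1 \<bullet> P)\<^sup>2 \<le> (norm d1)\<^sup>2 * (s\<^sup>2 * lam / 6) * (r\<^sup>2 + (norm d2)\<^sup>2)"
      "(d1 \<bullet> R)\<^sup>2 \<le> (norm d1)\<^sup>2 * (s\<^sup>2 * lam / 6) * (1 + (norm e)\<^sup>2)"
  shows "\<bar>r\<^sup>2 + (norm (a2 *\<^sub>R d2 - ((1 - a2) * r) *\<^sub>R e))\<^sup>2
      + (norm (a1 *\<^sub>R d1 - ((1 - a2) * r) *\<^sub>R R + (a1 - a2) *\<^sub>R P))\<^sup>2 - Q\<bar> \<le> 77/10 * s * Q"
proof -
  define \<alpha> where "\<alpha> = a1 - a2"
  define \<gamma> where "\<gamma> = (1 - a2) * r"
  define A where "A = r\<^sup>2"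
  define B where "B = (norm d2)\<^sup>2"
  define C where "C = (norm d1)\<^sup>2"
  define D where "D = A + B"
  define E where "E = 1 + (norm e)\<^sup>2"
  define \<phi> where "\<phi> = d2 \<bullet> e"
  have pos: "A > 0" "B \<ge> 0" "C \<ge> 0" "D > 0" "E > 0"
    using r by (auto simp: A_def B_def C_def D_def E_def intro: add_pos_nonneg)
  have \<gamma>2: "\<gamma>\<^sup>2 = (1 - a2)\<^sup>2 * A" by (simp add: \<gamma>_def A_def power_mult_distrib)
  have sq1: "(1 - a2)\<^sup>2 \<le> 1" "\<alpha>\<^sup>2 \<le> 1" "a2\<^sup>2 \<le> 1"
    using a by (auto simp: \<alpha>_def abs_square_le_1)
  have \<gamma>A: "\<gamma>\<^sup>2 \<le> A" unfolding \<gamma>2 using sq1(1) pos by (simp add: mult_left_le_one_le)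
  have Q': "Q = A + (B * a2\<^sup>2 + \<gamma>\<^sup>2 * \<kappa>) + g1 * ((1 - a1)\<^sup>2 * A + \<alpha>\<^sup>2 * B + \<gamma>\<^sup>2 * \<kappa>) + C * a1\<^sup>2"
    unfolding Q \<gamma>2 by (simp add: A_def B_def C_def \<alpha>_def algebra_simps)
  have nn: "0 \<le> B * a2\<^sup>2" "0 \<le> \<gamma>\<^sup>2 * \<kappa>" "0 \<le> g1 * ((1 - a1)\<^sup>2 * A)" "0 \<le> g1 * (\<alpha>\<^sup>2 * B)" "0 \<le> g1 * (\<gamma>\<^sup>2 * \<kappa>)" "0 \<le> C * a1\<^sup>2"
    using pos g1 \<kappa> by auto
  have Qs: "Q = A + B * a2\<^sup>2 + \<gamma>\<^sup>2 * \<kappa> + g1 * ((1 - a1)\<^sup>2 * A) + g1 * (\<alpha>\<^sup>2 * B) + g1 * (\<gamma>\<^sup>2 * \<kappa>) + C * a1\<^sup>2"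
    unfolding Q' by (simp add: algebra_simps)
  have AQ: "A \<le> Q" using nn unfolding Qs by linarith
  have t1: "\<bar>(1 + g1) * \<gamma>\<^sup>2 * ((norm e)\<^sup>2 - \<kappa>)\<bar> \<le> 3/2 * s * Q"
  proof -
    have "\<bar>(1 + g1) * \<gamma>\<^sup>2 * ((norm e)\<^sup>2 - \<kappa>)\<bar> = ((1 + g1) * \<gamma>\<^sup>2) * \<bar>(norm e)\<^sup>2 - \<kappa>\<bar>"
      using g1 by (simp add: abs_mult)
    also have "\<dots> \<le> ((1 + g1) * \<gamma>\<^sup>2) * (3/2 * s * q)"
      using E4 g1 by (intro mult_left_mono) auto
    also have "\<dots> = (q * (1 + g1)) * (3/2 * s * \<gamma>\<^sup>2)" by simp
    \<comment> \<open>The factor \<open>q\<close> in the tolerance for the squared norm of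
      \<open>e\<close> cancels the amplification \<open>1 + g1\<close>.\<close>
    also have "\<dots> \<le> 1 * (3/2 * s * \<gamma>\<^sup>2)" using q s by (intro mult_right_mono) auto
    also have "\<dots> \<le> 3/2 * s * Q" using \<gamma>A AQ s by (simp add: mult_left_mono)
    finally show ?thesis .
  qed
  have sB: "\<bar>\<phi>\<bar> \<le> sqrt B * (s * q / 2)"
    using E5 le_sqrt_mult[of \<phi> B "s * q / 2"] pos s q by (simp add: \<phi>_def B_def)
  have t2: "\<bar>2 * a2 * \<gamma> * \<phi>\<bar> + \<bar>2 * g1 * \<alpha> * \<gamma> * \<phi>\<bar> \<le> s * Q"
  proof -
    have ab: "2 * (\<bar>x\<bar> * sqrt B * \<bar>\<gamma>\<bar>) \<le> x\<^sup>2 * B + A" for x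
      using abs_mult_le_sum_squares[of "x * sqrt B" \<gamma>] \<gamma>A pos by (simp add: power_mult_distrib abs_mult)
    have "\<bar>2 * a2 * \<gamma> * \<phi>\<bar> = 2 * (\<bar>a2\<bar> * \<bar>\<gamma>\<bar>) * \<bar>\<phi>\<bar>" by (simp add: abs_mult)
    also have "\<dots> \<le> 2 * (\<bar>a2\<bar> * \<bar>\<gamma>\<bar>) * (sqrt B * (s * q / 2))" using sB by (intro mult_left_mono) auto
    also have "\<dots> = (s * q / 2) * (2 * (\<bar>a2\<bar> * sqrt B * \<bar>\<gamma>\<bar>))" by simp
    also have "\<dots> \<le> (s * q / 2) * (a2\<^sup>2 * B + A)" using ab s q by (intro mult_left_mono) auto
    also have "\<dots> \<le> (s * 1 / 2) * (a2\<^sup>2 * B + A)" using s q pos by (intro mult_right_mono divide_right_mono mult_left_mono) auto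
    finally have 1: "\<bar>2 * a2 * \<gamma> * \<phi>\<bar> \<le> s / 2 * (a2\<^sup>2 * B + A)" by simp
    have "\<bar>2 * g1 * \<alpha> * \<gamma> * \<phi>\<bar> = 2 * g1 * (\<bar>\<alpha>\<bar> * \<bar>\<gamma>\<bar>) * \<bar>\<phi>\<bar>" using g1 by (simp add: abs_mult)
    also have "\<dots> \<le> 2 * g1 * (\<bar>\<alpha>\<bar> * \<bar>\<gamma>\<bar>) * (sqrt B * (s * q / 2))" using sB g1 by (intro mult_left_mono) auto
    also have "\<dots> = (s / 2 * (q * g1)) * (2 * (\<bar>\<alpha>\<bar> * sqrt B * \<bar>\<gamma>\<bar>))" by simp
    also have "\<dots> \<le> (s / 2 * (q * g1)) * (\<alpha>\<^sup>2 * B + A)" using ab s q g1 by (intro mult_left_mono) auto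
    also have "\<dots> = s / 2 * (q * (g1 * (\<alpha>\<^sup>2 * B)) + (q * g1) * A)" by (simp add: algebra_simps)
    also have "\<dots> \<le> s / 2 * (1 * (g1 * (\<alpha>\<^sup>2 * B)) + 1 * A)"
    proof (intro mult_left_mono add_mono mult_right_mono)
      show "q * g1 \<le> 1" using q by (simp add: algebra_simps)
    qed (use s q nn pos in auto)
    finally have 2: "\<bar>2 * g1 * \<alpha> * \<gamma> * \<phi>\<bar> \<le> s / 2 * (g1 * (\<alpha>\<^sup>2 * B) + A)" by simp
    have "s / 2 * (a2\<^sup>2 * B + A) + s / 2 * (g1 * (\<alpha>\<^sup>2 * B) + A) = s / 2 * ((B * a2\<^sup>2 + A + g1 * (\<alpha>\<^sup>2 * B)) + A)"
      by (simp add: algebra_simps)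
    also have "\<dots> \<le> s / 2 * (Q + Q)"
      using s AQ nn Qs by (intro mult_left_mono add_mono) auto
    finally show ?thesis using 1 2 by simp
  qed
  define V where "V = \<alpha>\<^sup>2 * D + \<gamma>\<^sup>2 * E"
  \<comment> \<open>The bound is 1 + 1 + 43/40, rounded up. Only the part with \<open>B\<close>
    draws on \<open>lam\<close>; the others are below \<open>Q\<close> up to constants. The fraction
    43/40 is 1 plus 3/2 * 1/20, the largest deviation of the squared norm of \<open>e\<close> from
    \<open>\<kappa>\<close>.\<close>
  have V: "lam * V \<le> 31/10 * Q"
  proof -
    have e: "(norm e)\<^sup>2 \<le> \<kappa> + 3/40"
    proof -
      have "s * q \<le> (1/20) * 1" using s q by (intro mult_mono) auto
      then show ?thesis using E4 by linarith
    qed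
    have "lam * V = lam * (\<alpha>\<^sup>2 * B) + lam * (\<alpha>\<^sup>2 * A + \<gamma>\<^sup>2 * E)"
      by (simp add: V_def D_def algebra_simps)
    also have "lam * (\<alpha>\<^sup>2 * B) \<le> Q" using lamQ by (simp add: \<alpha>_def B_def)
    also have "lam * (\<alpha>\<^sup>2 * A + \<gamma>\<^sup>2 * E) \<le> 1 * (\<alpha>\<^sup>2 * A + \<gamma>\<^sup>2 * E)"
      using lam pos by (intro mult_right_mono) auto
    also have "\<dots> \<le> A + (\<gamma>\<^sup>2 * \<kappa> + 43/40 * \<gamma>\<^sup>2)"
    proof -
      have "\<alpha>\<^sup>2 * A \<le> A" using sq1 pos by (simp add: mult_left_le_one_le)
      moreover have "\<gamma>\<^sup>2 * E \<le> \<gamma>\<^sup>2 * (\<kappa> + 43/40)" using e by (intro mult_left_mono) (auto simp: E_def)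
      ultimately show ?thesis by (simp add: algebra_simps)
    qed
    also have "\<dots> \<le> (A + \<gamma>\<^sup>2 * \<kappa>) + 43/40 * A" using \<gamma>A by simp
    also have "\<dots> \<le> Q + 43/40 * Q" using AQ nn Qs by linarith
    finally show ?thesis using AQ pos by simp
  qed
  have crossDE: "2 * (\<bar>\<alpha>\<bar> * \<bar>\<gamma>\<bar> * sqrt (D * E)) \<le> V"
    using abs_mult_le_sum_squares[of "\<alpha> * sqrt D" "\<gamma> * sqrt E"] pos
    by (simp add: V_def power_mult_distrib abs_mult real_sqrt_mult mult_ac)
  have t3: "\<bar>\<alpha>\<^sup>2 * ((norm P)\<^sup>2 - g1 * D) + \<gamma>\<^sup>2 * ((norm R)\<^sup>2 - g1 * E) - 2 * \<alpha> * \<gamma> * (P \<bullet> R - g1 * (r - \<phi>))\<bar> \<le> 31/10 * s * Q"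
  proof -
    have "\<bar>\<alpha>\<^sup>2 * ((norm P)\<^sup>2 - g1 * D) + \<gamma>\<^sup>2 * ((norm R)\<^sup>2 - g1 * E) - 2 * \<alpha> * \<gamma> * (P \<bullet> R - g1 * (r - \<phi>))\<bar>
      \<le> \<alpha>\<^sup>2 * \<bar>(norm P)\<^sup>2 - g1 * D\<bar> + \<gamma>\<^sup>2 * \<bar>(norm R)\<^sup>2 - g1 * E\<bar> + 2 * (\<bar>\<alpha>\<bar> * \<bar>\<gamma>\<bar>) * \<bar>P \<bullet> R - g1 * (r - \<phi>)\<bar>"
      by (rule order_trans[OF abs_triangle_ineq4 add_mono[OF abs_triangle_ineq order_refl], THEN order_trans]) (simp add: abs_mult)
    also have "\<dots> \<le> \<alpha>\<^sup>2 * (s * lam / 2 * D) + \<gamma>\<^sup>2 * (s * lam / 2 * E) + 2 * (\<bar>\<alpha>\<bar> * \<bar>\<gamma>\<bar>) * (s * lam / 2 * sqrt (D * E))"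
      using E6 by (intro add_mono mult_left_mono) (auto simp: D_def E_def A_def B_def \<phi>_def)
    also have "\<dots> = s / 2 * lam * (V + 2 * (\<bar>\<alpha>\<bar> * \<bar>\<gamma>\<bar> * sqrt (D * E)))"
      by (simp add: V_def algebra_simps)
    also have "\<dots> \<le> s / 2 * lam * (V + V)"
      using crossDE s lam by (intro mult_left_mono) auto
    also have "\<dots> = s * (lam * V)" by simp
    also have "\<dots> \<le> s * (31/10 * Q)" using V s by (intro mult_left_mono) auto
    finally show ?thesis by simp
  qed
  have t4: "\<bar>2 * a1 * (\<alpha> * (d1 \<bullet> P) - \<gamma> * (d1 \<bullet> R))\<bar> \<le> 41/20 * s * Q"
  proof -
    define \<nu> where "\<nu> = sqrt (s\<^sup>2 * lam / 6)"
    have \<nu>2: "\<nu>\<^sup>2 = s\<^sup>2 * lam / 6" "\<nu> \<ge> 0" using lam by (simp_all add: \<nu>_def)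
    have P: "\<bar>d1 \<bullet> P\<bar> \<le> sqrt C * \<nu> * sqrt D"
    proof -
      have "(d1 \<bullet> P)\<^sup>2 \<le> (C * \<nu>\<^sup>2) * (sqrt D)\<^sup>2"
        using E7(1) pos unfolding \<nu>2 by (simp add: C_def D_def A_def B_def)
      from le_sqrt_mult[OF this] show ?thesis using pos \<nu>2(2) by (simp add: real_sqrt_mult C_def)
    qed
    have R: "\<bar>d1 \<bullet> R\<bar> \<le> sqrt C * \<nu> * sqrt E"
    proof -
      have "(d1 \<bullet> R)\<^sup>2 \<le> (C * \<nu>\<^sup>2) * (sqrt E)\<^sup>2"
        using E7(2) pos unfolding \<nu>2 by (simp add: C_def E_def)
      from le_sqrt_mult[OF this] show ?thesis using pos \<nu>2(2) by (simp add: real_sqrt_mult C_def)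
    qed
    have "\<bar>2 * a1 * (\<alpha> * (d1 \<bullet> P) - \<gamma> * (d1 \<bullet> R))\<bar> = 2 * a1 * \<bar>\<alpha> * (d1 \<bullet> P) - \<gamma> * (d1 \<bullet> R)\<bar>"
      using a by (simp add: abs_mult)
    also have "\<dots> \<le> 2 * a1 * (\<bar>\<alpha>\<bar> * (sqrt C * \<nu> * sqrt D) + \<bar>\<gamma>\<bar> * (sqrt C * \<nu> * sqrt E))"
      using P R a by (intro mult_left_mono order_trans[OF abs_triangle_ineq4] add_mono) (auto simp: abs_mult intro!: mult_left_mono)
    \<comment> \<open>Splitting off \<open>sqrt s\<close> balances the two squares: as
      \<open>\<nu>\<^sup>2 = s\<^sup>2 * lam / 6\<close>, each of them then carries one factor
      \<open>s\<close>.\<close>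
    also have "\<dots> = 2 * (a1 * sqrt C * sqrt s * (\<nu> * (\<bar>\<alpha>\<bar> * sqrt D + \<bar>\<gamma>\<bar> * sqrt E) / sqrt s))"
      using s by (simp add: field_simps)
    also have "\<dots> \<le> (a1 * sqrt C * sqrt s)\<^sup>2 + (\<nu> * (\<bar>\<alpha>\<bar> * sqrt D + \<bar>\<gamma>\<bar> * sqrt E) / sqrt s)\<^sup>2"
      unfolding mult.assoc[symmetric, of 2 "a1 * sqrt C * sqrt s"] by (rule sum_squares_bound)
    also have "\<dots> = s * (C * a1\<^sup>2) + s * lam / 6 * (\<bar>\<alpha>\<bar> * sqrt D + \<bar>\<gamma>\<bar> * sqrt E)\<^sup>2"
      using s pos by (simp add: power_mult_distrib power_divide \<nu>2) (simp add: power2_eq_square)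
    also have "(\<bar>\<alpha>\<bar> * sqrt D + \<bar>\<gamma>\<bar> * sqrt E)\<^sup>2 = V + 2 * (\<bar>\<alpha>\<bar> * \<bar>\<gamma>\<bar> * sqrt (D * E))"
      using pos by (simp add: power2_sum power_mult_distrib V_def real_sqrt_mult mult_ac)
    also have "s * (C * a1\<^sup>2) + s * lam / 6 * \<dots> \<le> s * (C * a1\<^sup>2) + s * lam / 6 * (V + V)"
      using crossDE s lam by (intro add_left_mono mult_left_mono) auto
    also have "\<dots> = s * (C * a1\<^sup>2) + s / 3 * (lam * V)" by simp
    also have "\<dots> \<le> s * Q + s / 3 * (31/10 * Q)"
      using V s nn Qs pos by (intro add_mono mult_left_mono) auto
    also have "\<dots> \<le> 41/20 * s * Q" using s AQ pos by (simp add: algebra_simps)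
    finally show ?thesis .
  qed
  have "\<bar>r\<^sup>2 + (norm (a2 *\<^sub>R d2 - \<gamma> *\<^sub>R e))\<^sup>2 + (norm (a1 *\<^sub>R d1 - \<gamma> *\<^sub>R R + \<alpha> *\<^sub>R P))\<^sup>2 - Q\<bar>
    = \<bar>(1 + g1) * \<gamma>\<^sup>2 * ((norm e)\<^sup>2 - \<kappa>) - 2 * a2 * \<gamma> * \<phi> + 2 * g1 * \<alpha> * \<gamma> * \<phi>
     + (\<alpha>\<^sup>2 * ((norm P)\<^sup>2 - g1 * D) + \<gamma>\<^sup>2 * ((norm R)\<^sup>2 - g1 * E) - 2 * \<alpha> * \<gamma> * (P \<bullet> R - g1 * (r - \<phi>)))
     + 2 * a1 * (\<alpha> * (d1 \<bullet> P) - \<gamma> * (d1 \<bullet> R))\<bar>"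
    using risk_expansion[of r a2 d2 e a1 d1 R P \<kappa> g1] unfolding Q
    by (simp only: \<alpha>_def \<gamma>_def D_def E_def A_def B_def \<phi>_def)
  also have "\<dots> \<le> 3/2 * s * Q + s * Q + 31/10 * s * Q + 41/20 * s * Q"
    using t1 t2 t3 t4 by linarith
  also have "\<dots> \<le> 77/10 * s * Q" using s AQ pos by simp
  finally show ?thesis by (simp only: \<alpha>_def \<gamma>_def)
qed

text \<open>\<open>s2\<close>, \<open>S1\<close>, \<open>S0\<close> estimate the nested variances
  \<open>A\<close>, \<open>A + B\<close>, \<open>A + B + C\<close>, and at these values the
  combination telescopes to \<open>Q\<close>. As \<open>c2\<close> can be of the size of
  \<open>1 + g1\<close>, which is at most \<open>1 / q\<close>, the tolerances for \<open>s2\<close>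
  and \<open>S1\<close> carry \<open>q\<close>. Those for \<open>S1\<close> and \<open>S0\<close>
  carry \<open>lam\<close>, because the terms with \<open>a1\<^sup>2\<close> are controlled by
  \<open>lamQ\<close>.\<close>

lemma estimate_deviation:
  fixes a1 a2 A B C s lam q g1 \<kappa> qa c2 Q s2 S1 S0 :: real
  assumes a: "0 \<le> a1" "a1 \<le> 1" "0 \<le> a2" "a2 \<le> 1" and A: "A > 0" and BC: "0 \<le> B" "0 \<le> C"
    and s: "0 < s" and lam: "0 < lam" "lam \<le> 1"
    and q: "0 < q" "q \<le> 1" "q * (1 + g1) \<le> 1" and g1: "0 \<le> g1" and \<kappa>: "0 \<le> \<kappa>"
    and qa: "qa = 1 + (1 + g1) * \<kappa> * (1 - a2)\<^sup>2 + g1 * (1 - a1)\<^sup>2" and c2: "c2 = a2\<^sup>2 + g1 * (a1 - a2)\<^sup>2"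
    and Q: "Q = A * qa + B * c2 + C * a1\<^sup>2"
    and lamQ: "lam * ((A + B + C) * a1\<^sup>2) \<le> Q"
    and E1: "\<bar>s2 - A\<bar> \<le> s * q * A" and E2: "\<bar>S1 - (A + B)\<bar> \<le> s * q * lam * (A + B)"
    and E3: "\<bar>S0 - (A + B + C)\<bar> \<le> s * lam * (A + B + C)"
  shows "\<bar>s2 * (qa - c2) + S1 * (c2 - a1\<^sup>2) + S0 * a1\<^sup>2 - Q\<bar> \<le> 3 * s * Q"
proof -
  have "0 \<le> (1 + g1) * \<kappa> * (1 - a2)\<^sup>2" "0 \<le> g1 * (1 - a1)\<^sup>2"
    using g1 \<kappa> by (auto intro!: mult_nonneg_nonneg)
  then have qa1: "1 \<le> qa" unfolding qa by linarith
  have c20: "0 \<le> c2" using g1 by (simp add: c2)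
  have "(a1 - a2)\<^sup>2 \<le> 1" "a2\<^sup>2 \<le> 1" using a by (auto simp: abs_square_le_1)
  then have c2g: "c2 \<le> 1 + g1" using g1 unfolding c2 by (intro add_mono) (auto simp: mult_left_le)
  have qc2: "q * c2 \<le> 1"
    using mult_left_mono[OF c2g, of q] q by linarith
  have AQ: "A * qa \<le> Q" "A \<le> A * qa" "A + B * c2 \<le> Q"
    using A BC c20 qa1 by (auto simp: Q intro!: add_increasing2 mult_nonneg_nonneg)
  have t1: "\<bar>(s2 - A) * (qa - c2)\<bar> \<le> s * Q"
  proof -
    have "\<bar>qa - c2\<bar> * q \<le> qa"
    proof -
      have "\<bar>qa - c2\<bar> \<le> max qa c2" using qa1 c20 by auto
      then have "\<bar>qa - c2\<bar> * q \<le> max qa c2 * q" using q by (intro mult_right_mono) auto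
      also have "\<dots> \<le> qa"
        using qc2 qa1 q by (auto simp: max_def mult.commute[of _ q] mult_left_le_one_le)
      finally show ?thesis .
    qed
    have "\<bar>(s2 - A) * (qa - c2)\<bar> \<le> (s * q * A) * \<bar>qa - c2\<bar>"
      unfolding abs_mult using E1 by (intro mult_right_mono) auto
    also have "\<dots> = s * A * (\<bar>qa - c2\<bar> * q)" by simp
    also have "\<dots> \<le> s * A * qa" using \<open>\<bar>qa - c2\<bar> * q \<le> qa\<close> s A by (intro mult_left_mono) auto
    also have "\<dots> \<le> s * Q" using AQ s by (simp add: mult.assoc mult_left_mono)
    finally show ?thesis .
  qed
  have t2: "\<bar>(S1 - (A + B)) * (c2 - a1\<^sup>2)\<bar> \<le> s * Q"
  proof -
    have 1: "q * lam * ((A + B) * c2) \<le> Q"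
    proof -
      have "q * lam * ((A + B) * c2) \<le> q * 1 * ((A + B) * c2)"
        using lam q A BC c20 by (intro mult_right_mono mult_left_mono) auto
      also have "\<dots> = (q * c2) * A + q * (B * c2)" by (simp add: algebra_simps)
      also have "\<dots> \<le> 1 * A + 1 * (B * c2)" using qc2 q A BC c20 by (intro add_mono mult_right_mono) auto
      finally show ?thesis using AQ by simp
    qed
    have 2: "q * lam * ((A + B) * a1\<^sup>2) \<le> Q"
    proof -
      have "q * lam * ((A + B) * a1\<^sup>2) \<le> 1 * lam * ((A + B + C) * a1\<^sup>2)"
        using q lam A BC by (intro mult_mono mult_right_mono) auto
      then show ?thesis using lamQ by simp
    qed
    have "\<bar>c2 - a1\<^sup>2\<bar> \<le> max c2 (a1\<^sup>2)" using c20 zero_le_power2[of a1] by linarith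
    then have "(A + B) * \<bar>c2 - a1\<^sup>2\<bar> \<le> (A + B) * max c2 (a1\<^sup>2)" using A BC by (intro mult_left_mono) auto
    then have "q * lam * ((A + B) * \<bar>c2 - a1\<^sup>2\<bar>) \<le> q * lam * ((A + B) * max c2 (a1\<^sup>2))"
      by (rule mult_left_mono) (use q lam in auto)
    also have "\<dots> \<le> Q" using 1 2 by (auto simp: max_def)
    finally have 3: "q * lam * ((A + B) * \<bar>c2 - a1\<^sup>2\<bar>) \<le> Q" .
    have "\<bar>(S1 - (A + B)) * (c2 - a1\<^sup>2)\<bar> \<le> (s * q * lam * (A + B)) * \<bar>c2 - a1\<^sup>2\<bar>"
      unfolding abs_mult using E2 by (intro mult_right_mono) auto
    also have "\<dots> = s * (q * lam * ((A + B) * \<bar>c2 - a1\<^sup>2\<bar>))" by simp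
    also have "\<dots> \<le> s * Q" using 3 s by (intro mult_left_mono) auto
    finally show ?thesis .
  qed
  have t3: "\<bar>(S0 - (A + B + C)) * a1\<^sup>2\<bar> \<le> s * Q"
  proof -
    have "\<bar>(S0 - (A + B + C)) * a1\<^sup>2\<bar> \<le> (s * lam * (A + B + C)) * a1\<^sup>2"
      unfolding abs_mult using E3 by (simp add: mult_right_mono)
    also have "\<dots> = s * (lam * ((A + B + C) * a1\<^sup>2))" by simp
    also have "\<dots> \<le> s * Q" using lamQ s by (intro mult_left_mono) auto
    finally show ?thesis .
  qed
  have "s2 * (qa - c2) + S1 * (c2 - a1\<^sup>2) + S0 * a1\<^sup>2 - Q
     = (s2 - A) * (qa - c2) + (S1 - (A + B)) * (c2 - a1\<^sup>2) + (S0 - (A + B + C)) * a1\<^sup>2"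
    by (simp add: Q algebra_simps)
  then show ?thesis using t1 t2 t3 by linarith
qed

text \<open>The lower deviation is the critical one: \<open>1 - t = 1 / (1 + \<epsilon>)\<close>,
  and \<open>ln (1 + \<epsilon>) \<le> \<epsilon>\<close>. Above, there is room because
  \<open>ln (1 + t) \<le> t < \<epsilon>\<close>. Since \<open>t < 1\<close>, the estimate
  \<open>a\<close> is positive and the infinite value does not occur.\<close>

lemma abs_log_ratio_less:
  assumes "\<epsilon> > 0" and t: "t = \<epsilon> / (1 + \<epsilon>)" and b: "b > 0" and d: "\<bar>a - b\<bar> < t * b"
  shows "abs_log_ratio a b < ereal \<epsilon>"
proof -
  have t01: "0 < t" "t < 1" "t < \<epsilon>" "1 - t = 1 / (1 + \<epsilon>)"
    using \<open>\<epsilon> > 0\<close> by (auto simp: t field_simps)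
  have "t * b < b" using t01 b by simp
  then have a: "a > 0" using d by linarith
  have r: "a / b < 1 + t" "1 - t < a / b"
    using d b by (auto simp: field_simps abs_less_iff)
  have "ln (a / b) < ln (1 + t)" using r(1) a b t01 by (subst ln_less_cancel_iff) auto
  also have "\<dots> \<le> t" using t01 by (intro ln_add_one_self_le_self) auto
  finally have 1: "ln (a / b) < \<epsilon>" using t01 by simp
  have "ln (1 / (1 + \<epsilon>)) < ln (a / b)"
    using r(2) a b t01 \<open>\<epsilon> > 0\<close> by (subst ln_less_cancel_iff) auto
  moreover have "ln (1 / (1 + \<epsilon>)) = - ln (1 + \<epsilon>)" using \<open>\<epsilon> > 0\<close> by (simp add: ln_div)
  moreover have "ln (1 + \<epsilon>) \<le> \<epsilon>" using \<open>\<epsilon> > 0\<close> by (intro ln_add_one_self_le_self) auto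
  ultimately have "- \<epsilon> < ln (a / b)" by linarith
  with 1 a show ?thesis by (simp add: abs_log_ratio_def abs_less_iff)
qed

text \<open>With \<open>s = t / 20\<close> the two errors add up to 107/200 of \<open>t * Q\<close>,
  whereas \<open>t * b\<close> exceeds 123/200 of it, as \<open>b\<close> is below \<open>Q\<close>
  by at most 77/200 of \<open>t * Q\<close>.\<close>

lemma relative_deviation:
  fixes t s Q a b :: real
  assumes t: "0 < t" "t < 1" and s: "s = t / 20" and "Q > 0"
    and 1: "\<bar>b - Q\<bar> \<le> 77/10 * s * Q" and 2: "\<bar>a - Q\<bar> \<le> 3 * s * Q"
  shows "\<bar>a - b\<bar> < t * b"
proof -
  have tQ: "0 < t * Q" using t \<open>Q > 0\<close> by simp
  have tQ': "t * (t * Q) < t * Q" using mult_strict_right_mono[OF t(2) tQ] by simp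
  have b: "b \<ge> Q - 77/200 * (t * Q)" proof -
    have "77/10 * s * Q = 77/200 * (t * Q)" using s by simp
    then show ?thesis using 1 unfolding abs_le_iff by linarith
  qed
  have "\<bar>a - b\<bar> \<le> 107/200 * (t * Q)" proof -
    have "77/10 * s * Q = 77/200 * (t * Q)" "3 * s * Q = 30/200 * (t * Q)" using s by simp_all
    then show ?thesis using 1 2 unfolding abs_le_iff by linarith
  qed
  also have "\<dots> < t * Q - 77/200 * (t * (t * Q))" using tQ tQ' by linarith
  also have "\<dots> = t * (Q - 77/200 * (t * Q))" by (simp add: algebra_simps)
  also have "\<dots> \<le> t * b" using b t by (intro mult_left_mono) auto
  finally show ?thesis .
qed

section \<open>The exceptional set\<close>

text \<open>The numerical side of the union bound: all deviation probabilities are compared with the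
  same \<open>exp (- rate)\<close>. The parameter \<open>q\<close> is the proportion of residual
  degrees of freedom.\<close>

locale bound_params =
  fixes n k1 k2 lam q s :: real
  assumes n: "n > 0" and k: "k1 > 0" "k2 > 0" and q_eq: "q = (n - (k1 + k2)) / n" and q: "0 < q"
    and lam: "0 < lam" "lam \<le> 1" and s: "0 < s" "s \<le> 1 / 20"
begin

text \<open>All five powers of \<open>q\<close> are spent in \<open>ratio_bound_\<delta>2\<close>,
  the two powers of \<open>lam\<close> in the chi-square events and in
  \<open>ratio_bound_lsq\<close>.\<close>

definition "rate = n * lam\<^sup>2 * q ^ 5 * s\<^sup>2 / 27"

lemma nq: "n * q = n - (k1 + k2)" using n by (simp add: q_eq)

lemma q1: "q < 1" using n k by (simp add: q_eq)

lemma lam2: "0 < lam\<^sup>2" "lam\<^sup>2 \<le> lam" "lam\<^sup>2 \<le> 1"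
  using lam by (auto simp: power2_eq_square mult_left_le intro: mult_le_one)

lemma q_powers: "q ^ 5 \<le> q ^ 4" "q ^ 5 \<le> q ^ 3" "q ^ 5 \<le> q\<^sup>2" "q ^ 5 \<le> q" "q ^ 5 \<le> 1"
  using q1 q by (auto intro: power_decreasing power_le_one power_decreasing[of 1 5 q, simplified])

lemma rate_le_q: "rate \<le> n * q * s\<^sup>2 / 27" "rate \<le> n * q\<^sup>2 * s\<^sup>2 / 27" "rate \<le> n * q ^ 3 * s\<^sup>2 / 27" "rate \<le> n * q ^ 4 * s\<^sup>2 / 27" "rate \<le> n * q ^ 5 * s\<^sup>2 / 27"
    "rate \<le> n * lam * q * s\<^sup>2 / 27" "rate \<le> n * lam\<^sup>2 * q ^ 3 * s\<^sup>2 / 27"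
proof -
  have *: "n * l * p * s\<^sup>2 / 27 \<le> n * l' * p' * s\<^sup>2 / 27" if "l \<le> l'" "p \<le> p'" "0 \<le> p" "0 \<le> l'" for l l' p p'
    using that n by (intro divide_right_mono mult_right_mono mult_mono mult_left_mono) auto
  show "rate \<le> n * q * s\<^sup>2 / 27" "rate \<le> n * q\<^sup>2 * s\<^sup>2 / 27" "rate \<le> n * q ^ 3 * s\<^sup>2 / 27" "rate \<le> n * q ^ 4 * s\<^sup>2 / 27" "rate \<le> n * q ^ 5 * s\<^sup>2 / 27"
    using *[of "lam\<^sup>2" 1 "q ^ 5"] lam2 q_powers q by (simp_all add: rate_def)
  show "rate \<le> n * lam * q * s\<^sup>2 / 27" "rate \<le> n * lam\<^sup>2 * q ^ 3 * s\<^sup>2 / 27"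
    unfolding rate_def using lam2 lam q_powers q by (intro *; simp)+
qed

lemma s2: "s\<^sup>2 \<le> s / 20"
  using mult_left_mono[OF s(2), of s] s by (simp add: power2_eq_square)

lemma s22: "s\<^sup>2 \<le> 1 / 400" using s2 s by linarith

text \<open>\<open>N / 800\<close> is the exponent for a denominator that is off by one tenth. Since
  \<open>s\<^sup>2\<close> is at most 1/400, the rate stays below it.\<close>

lemma rate_800: "n * q \<le> N \<Longrightarrow> rate \<le> N / 800"
proof -
  assume "n * q \<le> N"
  have "rate \<le> n * q * s\<^sup>2 / 27" by (rule rate_le_q)
  also have "\<dots> \<le> n * q * (1 / 400) / 27" using n q s22 by (intro divide_right_mono mult_left_mono) auto
  also have "\<dots> \<le> n * q / 800" using n q by simp
  finally show ?thesis using \<open>n * q \<le> N\<close> by simp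
qed

text \<open>\<open>x\<close> is a relative deviation of a chi-square variable with \<open>N\<close>
  degrees of freedom, and \<open>x \<le> 1\<close> puts it in the Gaussian regime. It is applied
  with \<open>x\<close> equal to \<open>s * q\<close>, \<open>s * q * lam\<close> and
  \<open>s * lam\<close>.\<close>

lemma chi_bound:
  assumes N: "n * q \<le> N" and x: "s * q * lam \<le> x" "x \<le> 1"
  shows "exp (- (x * N)\<^sup>2 / (8 * max N (x * N))) \<le> exp (- rate)"
proof -
  have x0: "0 < x" using x s q lam by (meson less_le_trans mult_pos_pos)
  have N0: "0 < N" using N n q by (meson less_le_trans mult_pos_pos)
  have m: "max N (x * N) = N" using x N0 by (simp add: max_def mult_le_cancel_right1)
  have "rate \<le> n * lam\<^sup>2 * q ^ 3 * s\<^sup>2 / 27" by (rule rate_le_q)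
  also have "\<dots> \<le> n * lam\<^sup>2 * q ^ 3 * s\<^sup>2 / 8" using n q by (intro divide_left_mono) auto
  also have "\<dots> = (n * q) * (s * q * lam)\<^sup>2 / 8" by (simp add: power_mult_distrib power3_eq_cube power2_eq_square)
  also have "\<dots> \<le> N * x\<^sup>2 / 8" using N N0 x x0 s q lam n by (intro divide_right_mono mult_mono power_mono) auto
  also have "\<dots> = (x * N)\<^sup>2 / (8 * N)" using N0 by (simp add: power2_eq_square)
  finally show ?thesis by (simp add: m)
qed

lemma chi_bound_n:
  shows "exp (- (s * lam * n)\<^sup>2 / (8 * max n (s * lam * n))) \<le> exp (- rate)"
proof -
  have "s * q * lam \<le> s * lam" using s q q1 lam by (simp add: mult_left_le mult.commute mult.left_commute mult_le_cancel_right1)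
  moreover have "s * lam \<le> 1 * 1" using s lam by (intro mult_mono) auto
  moreover have "n * q \<le> n" using n q1 by simp
  ultimately show ?thesis using chi_bound[of n "s * lam"] by simp
qed

text \<open>Conditions \<open>1\<close> and \<open>2\<close> serve the chi-square numerator in its
  Gaussian and its exponential regime, condition \<open>3\<close> the denominator. Where the
  relative deviation of the denominator is capped at 1/10, \<open>rate_800\<close> takes
  over.\<close>

lemma ratio_core:
  assumes N: "n * q \<le> N" and r: "0 < r" and w: "w = 9/20 * \<tau> * N" "0 < w"
    and 1: "rate * (8 * r) \<le> w\<^sup>2" and 2: "rate \<le> w / 8" and 3: "rate * (8 * r\<^sup>2) \<le> N * w\<^sup>2"
  shows "ratio_bound N r \<tau> \<le> 4 * exp (- rate)"
proof -
  have N0: "0 < N" using N n q by (meson less_le_trans mult_pos_pos)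
  have "rate \<le> w\<^sup>2 / (8 * max r w)"
  proof (cases "r \<le> w")
    case True
    then show ?thesis using 2 w(2) by (simp add: max_def power2_eq_square)
  next
    case False
    then show ?thesis using 1 r by (simp add: max_def pos_le_divide_eq)
  qed
  then have e1: "exp (- w\<^sup>2 / (8 * max r w)) \<le> exp (- rate)" by simp
  have "rate \<le> N * (min (1/10) (w / r))\<^sup>2 / 8"
  proof (cases "1/10 \<le> w / r")
    case True
    then show ?thesis using rate_800[OF N] by (simp add: min_def power2_eq_square)
  next
    case False
    have "rate \<le> N * (w / r)\<^sup>2 / 8"
      using 3 r by (simp add: power_divide pos_le_divide_eq field_simps)
    then show ?thesis using False by (simp add: min_def)
  qed
  then have e2: "exp (- N * (min (1/10) (w / r))\<^sup>2 / 8) \<le> exp (- rate)" by simp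
  show ?thesis unfolding ratio_bound_def w(1)[symmetric] using e1 e2 by linarith
qed

text \<open>The tolerance is proportional to \<open>q\<close>, so with \<open>N \<ge> n * q\<close>
  the deviation \<open>w\<close> is of order \<open>n * q\<^sup>2 * s\<close>. Against the crude
  bound \<open>k2 \<le> n\<close>, the third condition of \<open>ratio_core\<close> needs
  \<open>rate * n\<^sup>2\<close> to be of order at most \<open>n ^ 3 * q ^ 5 * s\<^sup>2\<close>:
  the origin of the fifth power.\<close>

lemma ratio_bound_\<delta>2:
  assumes N: "n * q \<le> N"
  shows "ratio_bound N k2 (3/2 * s * q) \<le> 4 * exp (- rate)"
proof -
  define w where "w = 9/20 * (3/2 * s * q) * N"
  have wn: "w \<ge> 27/40 * (n * q\<^sup>2) * s"
    using mult_left_mono[OF N, of "27/40 * s * q"] s q by (simp add: w_def power2_eq_square mult_ac)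
  have nq2: "0 < n * q\<^sup>2" using n q by simp
  have w0: "0 < 27/40 * (n * q\<^sup>2) * s" using nq2 s by simp
  have k2n: "k2 \<le> n" using nq n k q by (smt (verit) mult_pos_pos)
  have ww: "w\<^sup>2 \<ge> (27/40)\<^sup>2 * (n\<^sup>2 * q ^ 4 * s\<^sup>2)"
  proof -
    have "(27/40 * (n * q\<^sup>2) * s)\<^sup>2 \<le> w\<^sup>2" using wn w0 by (intro power_mono) auto
    moreover have "(27/40 * (n * q\<^sup>2) * s)\<^sup>2 = (27/40)\<^sup>2 * (n\<^sup>2 * q ^ 4 * s\<^sup>2)"
      by (simp add: power_mult_distrib power_divide)
    ultimately show ?thesis by simp
  qed
  show ?thesis
  proof (rule ratio_core[OF N k(2) w_def])
    show "0 < w" using w0 wn by linarith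
    have "rate * (8 * k2) \<le> (n * q ^ 4 * s\<^sup>2 / 27) * (8 * n)"
      using rate_le_q(4) k2n k n q by (intro mult_mono) auto
    also have "\<dots> \<le> (27/40)\<^sup>2 * (n\<^sup>2 * q ^ 4 * s\<^sup>2)" using n q by (simp add: power2_eq_square)
    finally show "rate * (8 * k2) \<le> w\<^sup>2" using ww by linarith
    have "rate \<le> n * q\<^sup>2 * s\<^sup>2 / 27" by (rule rate_le_q)
    also have "\<dots> \<le> n * q\<^sup>2 * (s / 20) / 27" using s2 n q by (intro divide_right_mono mult_left_mono) auto
    also have "\<dots> \<le> w / 8" using wn w0 by (simp add: mult_ac)
    finally show "rate \<le> w / 8" .
    have "rate * (8 * k2\<^sup>2) \<le> (n * q ^ 5 * s\<^sup>2 / 27) * (8 * n\<^sup>2)"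
      using rate_le_q(5) k2n k n q by (intro mult_mono power_mono) auto
    also have "\<dots> \<le> (n * q) * ((27/40)\<^sup>2 * (n\<^sup>2 * q ^ 4 * s\<^sup>2))"
    proof -
      define X where "X = n * n\<^sup>2 * q ^ 5 * s\<^sup>2"
      have e: "(n * q) * ((27/40)\<^sup>2 * (n\<^sup>2 * q ^ 4 * s\<^sup>2)) = (27/40)\<^sup>2 * X"
        "(n * q ^ 5 * s\<^sup>2 / 27) * (8 * n\<^sup>2) = 8 / 27 * X"
        by (simp_all add: X_def eval_nat_numeral)
      have "0 \<le> X" using n q by (simp add: X_def)
      then show ?thesis unfolding e by (intro mult_right_mono) (auto simp: power2_eq_square)
    qed
    also have "\<dots> \<le> N * w\<^sup>2"
      using ww N n q by (intro mult_mono order_trans[OF _ N]) auto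
    finally show "rate * (8 * k2\<^sup>2) \<le> N * w\<^sup>2" .
  qed
qed

text \<open>The tolerance has no factor \<open>q\<close> here. In exchange \<open>k1\<close> is
  bounded by \<open>n * (1 - q)\<close>, and the surplus powers of \<open>q\<close> in the rate are
  used for the maxima of \<open>q ^ 3 * (1 - q)\<close> and \<open>q * (1 - q)\<close>.\<close>

lemma ratio_bound_lsq:
  assumes N: "n * q \<le> N"
  shows "ratio_bound N k1 (s * lam / 2) \<le> 4 * exp (- rate)"
proof -
  define w where "w = 9/20 * (s * lam / 2) * N"
  have wn: "w \<ge> 9/40 * (n * q) * (s * lam)"
    using mult_left_mono[OF N, of "9/40 * (s * lam)"] s lam by (simp add: w_def mult_ac)
  have w0: "0 < 9/40 * (n * q) * (s * lam)" using n q s lam by simp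
  have k1n: "k1 \<le> n * (1 - q)" using nq k by (simp add: algebra_simps)
  have ww: "w\<^sup>2 \<ge> (9/40)\<^sup>2 * (n\<^sup>2 * q\<^sup>2 * s\<^sup>2 * lam\<^sup>2)"
  proof -
    have "(9/40 * (n * q) * (s * lam))\<^sup>2 \<le> w\<^sup>2" using wn w0 by (intro power_mono) auto
    then show ?thesis by (simp add: power_mult_distrib power_divide)
  qed
  have qq: "q ^ 3 * (1 - q) \<le> 27/256"
  proof -
    \<comment> \<open>Double root at 3/4, where \<open>q ^ 3 * (1 - q)\<close> attains its maximum
      27/256.\<close>
    have "0 \<le> (q - 3/4)\<^sup>2 * (q\<^sup>2 + q/2 + 3/16)" using q by (intro mult_nonneg_nonneg) auto
    also have "\<dots> = 27/256 - q ^ 3 * (1 - q)" by (simp add: power2_eq_square power3_eq_cube algebra_simps)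
    finally show ?thesis by simp
  qed
  have qq2: "q\<^sup>2 * (1 - q)\<^sup>2 \<le> 1/16"
  proof -
    have "0 \<le> (q - 1/2)\<^sup>2" by simp
    also have "\<dots> = 1/4 - q * (1 - q)" by (simp add: power2_eq_square algebra_simps)
    finally have "q * (1 - q) \<le> 1/4" by simp
    then have "(q * (1 - q))\<^sup>2 \<le> (1/4)\<^sup>2" using q q1 by (intro power_mono) auto
    then show ?thesis by (simp add: power2_eq_square mult_ac)
  qed
  have X: "0 \<le> n\<^sup>2 * lam\<^sup>2 * s\<^sup>2 * q\<^sup>2" using n q by simp
  have rate0: "0 \<le> rate" using n q by (simp add: rate_def)
  show ?thesis
  proof (rule ratio_core[OF N k(1) w_def])
    show "0 < w" using w0 wn by linarith
    have "rate * (8 * k1) \<le> rate * (8 * (n * (1 - q)))"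
      using k1n rate0 by (intro mult_left_mono) auto
    also have "\<dots> = 8/27 * (q ^ 3 * (1 - q)) * (n\<^sup>2 * lam\<^sup>2 * s\<^sup>2 * q\<^sup>2)"
      by (simp add: rate_def eval_nat_numeral)
    also have "\<dots> \<le> 8/27 * (27/256) * (n\<^sup>2 * lam\<^sup>2 * s\<^sup>2 * q\<^sup>2)"
      using qq X by (intro mult_right_mono mult_left_mono) auto
    also have "\<dots> \<le> (9/40)\<^sup>2 * (n\<^sup>2 * q\<^sup>2 * s\<^sup>2 * lam\<^sup>2)" using X by (simp add: power2_eq_square mult_ac)
    finally show "rate * (8 * k1) \<le> w\<^sup>2" using ww by linarith
    have "rate \<le> n * lam * q * s\<^sup>2 / 27" by (rule rate_le_q)
    also have "\<dots> \<le> n * lam * q * (s / 20) / 27" using s2 n q lam by (intro divide_right_mono mult_left_mono) auto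
    also have "\<dots> \<le> w / 8" using wn w0 by (simp add: mult_ac)
    finally show "rate \<le> w / 8" .
    have "rate * (8 * k1\<^sup>2) \<le> rate * (8 * (n * (1 - q))\<^sup>2)"
      using k1n rate0 k by (intro mult_left_mono power_mono) auto
    also have "\<dots> = 8/27 * (q\<^sup>2 * (1 - q)\<^sup>2) * ((n * q) * (n\<^sup>2 * lam\<^sup>2 * s\<^sup>2 * q\<^sup>2))"
      by (simp add: rate_def eval_nat_numeral)
    also have "\<dots> \<le> 8/27 * (1/16) * ((n * q) * (n\<^sup>2 * lam\<^sup>2 * s\<^sup>2 * q\<^sup>2))"
      using qq2 X n q by (intro mult_right_mono mult_left_mono) auto
    also have "\<dots> \<le> (9/40)\<^sup>2 * ((n * q) * (n\<^sup>2 * lam\<^sup>2 * s\<^sup>2 * q\<^sup>2))"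
      using X n q by (intro mult_right_mono) (auto simp: power2_eq_square)
    also have "\<dots> = (n * q) * ((9/40)\<^sup>2 * (n\<^sup>2 * q\<^sup>2 * s\<^sup>2 * lam\<^sup>2))" by (simp add: mult_ac)
    also have "\<dots> \<le> N * w\<^sup>2"
      using ww N n q by (intro mult_mono order_trans[OF _ N]) auto
    finally show "rate * (8 * k1\<^sup>2) \<le> N * w\<^sup>2" .
  qed
qed

lemma linear_core:
  assumes N: "n * q \<le> N" and t: "rate \<le> 27/80 * \<tau> * (n * q)" "0 \<le> \<tau>"
  shows "linear_bound N \<tau> \<le> 4 * exp (- rate)"
proof -
  have "rate \<le> 27/80 * \<tau> * N" using t mult_left_mono[OF N, of "27/80 * \<tau>"] by linarith
  then have "exp (- (27/80) * \<tau> * N) \<le> exp (- rate)" by simp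
  moreover have "exp (- N / 800) \<le> exp (- rate)" using rate_800[OF N] by simp
  ultimately show ?thesis unfolding linear_bound_def by linarith
qed

lemma linear_bound_\<delta>2:
  assumes N: "n * q \<le> N"
  shows "linear_bound N ((s * q / 2)\<^sup>2) \<le> 4 * exp (- rate)"
proof (rule linear_core[OF N])
  have "rate \<le> n * q ^ 3 * s\<^sup>2 / 27" by (rule rate_le_q)
  also have "\<dots> \<le> 27/320 * (n * q ^ 3 * s\<^sup>2)" using n q by simp
  also have "\<dots> = 27/80 * (s * q / 2)\<^sup>2 * (n * q)" by (simp add: power2_eq_square power3_eq_cube)
  finally show "rate \<le> 27/80 * (s * q / 2)\<^sup>2 * (n * q)" .
qed simp

lemma linear_bound_lsq:
  assumes N: "n * q \<le> N"
  shows "linear_bound N (s\<^sup>2 * lam / 6) \<le> 4 * exp (- rate)"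
proof (rule linear_core[OF N])
  have "rate \<le> n * lam * q * s\<^sup>2 / 27" by (rule rate_le_q)
  also have "\<dots> \<le> 27/80 * (s\<^sup>2 * lam / 6) * (n * q)" using n q lam by (simp add: mult_ac)
  finally show "rate \<le> 27/80 * (s\<^sup>2 * lam / 6) * (n * q)" .
qed (use lam in simp)

end

section \<open>Rescaling to unit weights\<close>

lemma norm_sq_deviation:
  assumes w: "w > 0"
  shows "measure stdg {x :: 'a::euclidean_space. \<bar>(norm x)\<^sup>2 - real DIM('a)\<bar> \<ge> w} \<le> 2 * exp (- w\<^sup>2 / (8 * max (real DIM('a)) w))"
proof -
  have "(\<Sum>b\<in>Basis. (b \<bullet> \<xi>)\<^sup>2) = (norm \<xi>)\<^sup>2" for \<xi> :: 'a
    unfolding power2_norm_eq_inner by (subst (2) euclidean_inner) (simp add: power2_eq_square inner_commute)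
  moreover have "pairwise orthogonal (Basis :: 'a set)"
    by (auto simp: pairwise_def orthogonal_def inner_Basis)
  ultimately show ?thesis
    using chi_square_deviation[of "Basis :: 'a set", OF _ _ w] by simp
qed

text \<open>The default \<open>(1, 0)\<close> at zero is a unit vector, so the norm is 1 at every
  sample point, as the laws for random weights demand, and \<open>unitize_scale\<close> holds
  without exception.\<close>

definition unitize :: "real \<times> (real^'q) \<Rightarrow> real \<times> (real^'q)" where
  "unitize x = (if norm x = 0 then (1, 0) else (1 / norm x) *\<^sub>R x)"

lemma norm_unitize [simp]: "norm (unitize x) = 1"
  by (simp add: unitize_def norm_Pair)

lemma unitize_scale: "norm x *\<^sub>R unitize x = x"
  by (simp add: unitize_def zero_prod_def[symmetric])

lemma measurable_unitize [measurable (raw)]: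
  assumes [measurable]: "f \<in> borel_measurable M"
  shows "(\<lambda>x. unitize (f x)) \<in> borel_measurable M"
  unfolding unitize_def by measurable

lemma comb_linear: "comb (a *\<^sub>R x + b *\<^sub>R y) c = a *\<^sub>R comb x c + b *\<^sub>R comb y c"
  by (simp add: comb_def matrix_vector_right_distrib matrix_vector_mult_scaleR algebra_simps)

lemma lsq_comb_linear: "lsq W (comb (a *\<^sub>R x + b *\<^sub>R y) c) = a *\<^sub>R lsq W (comb x c) + b *\<^sub>R lsq W (comb y c)"
  by (simp only: comb_linear lsq_linear)

lemma lsq_comb_scale: "lsq W (comb (a *\<^sub>R x) c) = a *\<^sub>R lsq W (comb x c)"
  using lsq_comb_linear[of W a x 0 0 c] by simp

lemma norm_sq_unitize_deviation:
  assumes "\<bar>(norm (lsq W (comb (unitize x) c)))\<^sup>2 - g\<bar> \<le> t"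
  shows "\<bar>(norm (lsq W (comb x c)))\<^sup>2 - g * (norm x)\<^sup>2\<bar> \<le> t * (norm x)\<^sup>2"
proof -
  have "lsq W (comb x c) = norm x *\<^sub>R lsq W (comb (unitize x) c)"
    unfolding lsq_comb_scale[symmetric] unitize_scale ..
  then have "(norm (lsq W (comb x c)))\<^sup>2 - g * (norm x)\<^sup>2 = ((norm (lsq W (comb (unitize x) c)))\<^sup>2 - g) * (norm x)\<^sup>2"
    by (simp add: power_mult_distrib algebra_simps)
  then show ?thesis using assms by (simp add: abs_mult mult_right_mono)
qed

text \<open>Polarisation on the normalised weights, followed by rescaling. With \<open>i\<close>
  their inner product, the errors for sum and difference are weighted by \<open>2 + 2 * i\<close>
  and \<open>2 - 2 * i\<close>; these add up to 4, so the tolerance \<open>t\<close> survives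
  unchanged.\<close>

lemma inner_unitize_deviation:
  assumes 1: "\<bar>(norm (lsq W (comb (unitize (unitize x + unitize y)) c)))\<^sup>2 - g\<bar> \<le> t"
    and 2: "\<bar>(norm (lsq W (comb (unitize (unitize x - unitize y)) c)))\<^sup>2 - g\<bar> \<le> t"
  shows "\<bar>lsq W (comb x c) \<bullet> lsq W (comb y c) - g * (x \<bullet> y)\<bar> \<le> t * (norm x * norm y)"
proof -
  let ?H = "\<lambda>x. lsq W (comb x c)" and ?u = "unitize x" and ?v = "unitize y"
  have nu: "?u \<bullet> ?u = 1" "?v \<bullet> ?v = 1" by (rule norm_unitize[unfolded norm_eq_1])+
  have p: "(norm (?u + ?v))\<^sup>2 = 2 + 2 * (?u \<bullet> ?v)" and m: "(norm (?u - ?v))\<^sup>2 = 2 - 2 * (?u \<bullet> ?v)"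
    using nu by (simp_all add: power2_norm_eq_inner inner_add_left inner_add_right inner_diff_left inner_diff_right inner_commute)
  have Hp: "?H (?u + ?v) = ?H ?u + ?H ?v" using lsq_comb_linear[of W 1 ?u 1 ?v c] by simp
  have Hm: "?H (?u - ?v) = ?H ?u - ?H ?v" using lsq_comb_linear[of W 1 ?u "-1" ?v c] by simp
  have "\<bar>(norm (?H ?u + ?H ?v))\<^sup>2 - g * (2 + 2 * (?u \<bullet> ?v))\<bar> \<le> t * (2 + 2 * (?u \<bullet> ?v))"
    using norm_sq_unitize_deviation[OF 1] unfolding Hp p .
  moreover have "\<bar>(norm (?H ?u - ?H ?v))\<^sup>2 - g * (2 - 2 * (?u \<bullet> ?v))\<bar> \<le> t * (2 - 2 * (?u \<bullet> ?v))"
    using norm_sq_unitize_deviation[OF 2] unfolding Hm m .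
  moreover have "(norm (?H ?u + ?H ?v))\<^sup>2 - (norm (?H ?u - ?H ?v))\<^sup>2 = 4 * (?H ?u \<bullet> ?H ?v)"
    unfolding power2_norm_eq_inner by (simp add: inner_add_left inner_add_right inner_diff_left inner_diff_right inner_commute)
  ultimately have "\<bar>4 * (?H ?u \<bullet> ?H ?v) - 4 * (g * (?u \<bullet> ?v))\<bar> \<le> 4 * t"
  proof -
    define i where "i = ?u \<bullet> ?v"
    have e: "g * (2 + 2 * i) = 2 * g + 2 * (g * i)" "t * (2 + 2 * i) = 2 * t + 2 * (t * i)"
      "g * (2 - 2 * i) = 2 * g - 2 * (g * i)" "t * (2 - 2 * i) = 2 * t - 2 * (t * i)"
      by (simp_all add: algebra_simps)
    assume "\<bar>(norm (?H ?u + ?H ?v))\<^sup>2 - g * (2 + 2 * (?u \<bullet> ?v))\<bar> \<le> t * (2 + 2 * (?u \<bullet> ?v))"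
      "\<bar>(norm (?H ?u - ?H ?v))\<^sup>2 - g * (2 - 2 * (?u \<bullet> ?v))\<bar> \<le> t * (2 - 2 * (?u \<bullet> ?v))"
      "(norm (?H ?u + ?H ?v))\<^sup>2 - (norm (?H ?u - ?H ?v))\<^sup>2 = 4 * (?H ?u \<bullet> ?H ?v)"
    then show ?thesis unfolding i_def[symmetric] e abs_le_iff by linarith
  qed
  then have d: "\<bar>?H ?u \<bullet> ?H ?v - g * (?u \<bullet> ?v)\<bar> \<le> t"
    unfolding right_diff_distrib[symmetric] by (simp add: abs_mult)
  have "?H x = norm x *\<^sub>R ?H ?u" "?H y = norm y *\<^sub>R ?H ?v"
    unfolding lsq_comb_scale[symmetric] unitize_scale by simp_all
  moreover have xy: "x \<bullet> y = norm x * (norm y * (?u \<bullet> ?v))"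
    by (metis inner_scaleR_left inner_scaleR_right unitize_scale)
  ultimately have "?H x \<bullet> ?H y - g * (x \<bullet> y) = (norm x * norm y) * (?H ?u \<bullet> ?H ?v - g * (?u \<bullet> ?v))"
    unfolding xy by (simp add: algebra_simps)
  then show ?thesis using mult_left_mono[OF d, of "norm x * norm y"] by (simp add: abs_mult mult.commute)
qed

lemma linear_unitize_bound:
  assumes "(d \<bullet> lsq W (comb (unitize x) c))\<^sup>2 \<le> t"
  shows "(d \<bullet> lsq W (comb x c))\<^sup>2 \<le> t * (norm x)\<^sup>2"
proof -
  have "lsq W (comb x c) = norm x *\<^sub>R lsq W (comb (unitize x) c)"
    unfolding lsq_comb_scale[symmetric] unitize_scale ..
  then show ?thesis using assms by (simp add: power_mult_distrib mult.commute[of t] mult_left_mono)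
qed

text \<open>\<open>e\<close> is the error of the second block of the unit-noise least-squares fit, \<open>R\<close> that of its first block, and
  \<open>P\<close> the error of the fit on the first block alone. The first three conditions concern \<open>\<sigma>2_hat\<close> and the two
  quadratic forms in \<open>\<rho>2_hat\<close>.\<close>

definition good_sample :: "real \<Rightarrow> real \<Rightarrow> real \<Rightarrow> real \<Rightarrow> real^'p \<Rightarrow> real^'q \<Rightarrow> (real^'n^'p) \<times> (real^'n) \<times> (real^'n^'q) \<Rightarrow> bool" where
  "good_sample s q lam r d1 d2 z \<longleftrightarrow>
    (let W = fst z; c = snd z; J = join W (snd c); v = fst c; \<psi> = comb (r, d2) c; e = \<delta>2 W c;
         n = real CARD('n); k1 = real CARD('p); k2 = real CARD('q); D = r\<^sup>2 + (norm d2)\<^sup>2;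
         g = k1 / (n - k1 + 1); P = lsq W \<psi>; R = lsq W (comb (1, - e) c); E = 1 + (norm e)\<^sup>2
     in \<bar>(norm (v - proj J v))\<^sup>2 - (n - (k1 + k2))\<bar> \<le> s * q * (n - (k1 + k2))
      \<and> \<bar>(norm (\<psi> - proj W \<psi>))\<^sup>2 - (n - k1) * D\<bar> \<le> s * q * lam * ((n - k1) * D)
      \<and> \<bar>(norm (\<psi> + transpose W *v d1))\<^sup>2 - n * (D + (norm d1)\<^sup>2)\<bar> \<le> s * lam * (n * (D + (norm d1)\<^sup>2))
      \<and> \<bar>(norm e)\<^sup>2 - k2 / (n - (k1 + k2) + 1)\<bar> \<le> 3/2 * s * q
      \<and> (d2 \<bullet> e)\<^sup>2 \<le> (norm d2)\<^sup>2 * (s * q / 2)\<^sup>2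
      \<and> \<bar>(norm P)\<^sup>2 - g * D\<bar> \<le> s * lam / 2 * D
      \<and> \<bar>(norm R)\<^sup>2 - g * E\<bar> \<le> s * lam / 2 * E
      \<and> \<bar>P \<bullet> R - g * (r - d2 \<bullet> e)\<bar> \<le> s * lam / 2 * sqrt (D * E)
      \<and> (d1 \<bullet> P)\<^sup>2 \<le> (norm d1)\<^sup>2 * (s\<^sup>2 * lam / 6) * D
      \<and> (d1 \<bullet> R)\<^sup>2 \<le> (norm d1)\<^sup>2 * (s\<^sup>2 * lam / 6) * E)"

section \<open>Probability of the exceptional set\<close>

lemma measure_combine:
  fixes A :: "((real^'n^'p) \<times> (real^'n)) set"
  assumes x: "norm x = 1" and A: "A \<in> sets borel"
  shows "measure stdg {z :: (real^'n^'p) \<times> (real^'n) \<times> (real^'n^'q). (fst z, comb x (snd z)) \<in> A} = measure stdg A"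
proof -
  have m: "(\<lambda>z :: (real^'n^'p) \<times> (real^'n) \<times> (real^'n^'q). (fst z, comb x (snd z))) \<in> borel_measurable borel"
    by measurable
  have mx: "comb x \<in> borel_measurable (borel :: ((real^'n) \<times> (real^'n^'q)) measure)" by measurable
  have "emeasure stdg {z :: (real^'n^'p) \<times> (real^'n) \<times> (real^'n^'q). (fst z, comb x (snd z)) \<in> A}
     = (\<integral>\<^sup>+W. emeasure stdg {c :: (real^'n) \<times> (real^'n^'q). (W, comb x c) \<in> A} \<partial>(stdg :: (real^'n^'p) measure))"
    using measurable_sets[OF m A] by (subst emeasure_stdg_pair) (simp_all add: vimage_def)
  also have "\<dots> = (\<integral>\<^sup>+W. emeasure stdg {v. (W, v) \<in> A} \<partial>(stdg :: (real^'n^'p) measure))"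
  proof (rule nn_integral_cong)
    fix W :: "real^'n^'p"
    have "Pair W \<in> borel_measurable borel"
      by (intro borel_measurable_continuous_onI continuous_intros)
    from measurable_sets[OF this A] have "{v. (W, v) \<in> A} \<in> sets borel" by (simp add: vimage_def)
    then have "emeasure (distr stdg borel (comb x :: (real^'n) \<times> (real^'n^'q) \<Rightarrow> _)) {v. (W, v) \<in> A} = emeasure stdg {c :: (real^'n) \<times> (real^'n^'q). (W, comb x c) \<in> A}"
      using mx by (subst emeasure_distr) (simp_all add: vimage_def)
    then show "emeasure stdg {c :: (real^'n) \<times> (real^'n^'q). (W, comb x c) \<in> A} = emeasure stdg {v. (W, v) \<in> A}"
      by (simp add: distr_comb[OF x])
  qed
  also have "\<dots> = emeasure stdg A" using A by (rule emeasure_stdg_pair[symmetric])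
  finally show ?thesis by (simp add: measure_def)
qed

lemma measure_response:
  fixes x :: "real \<times> (real^('p::finite + 'q::finite))"
  assumes x: "norm x = 1" and A: "A \<in> sets borel"
  shows "measure stdg {z :: (real^'n^'p) \<times> (real^'n) \<times> (real^'n^'q). comb x (fst (snd z), join (fst z) (snd (snd z))) \<in> A} = measure stdg A"
proof -
  have m: "(\<lambda>z :: (real^'n^'p) \<times> (real^'n) \<times> (real^'n^'q). (fst (snd z), join (fst z) (snd (snd z)))) \<in> borel_measurable borel"
    by measurable
  have mc: "comb x \<in> borel_measurable (borel :: ((real^'n) \<times> (real^'n^('p + 'q))) measure)" by measurable
  have B: "{c :: (real^'n) \<times> (real^'n^('p + 'q)). comb x c \<in> A} \<in> sets borel"
    using measurable_sets[OF mc A] by (simp add: vimage_def)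
  have "measure stdg A = measure (distr stdg borel (comb x :: (real^'n) \<times> (real^'n^('p + 'q)) \<Rightarrow> _)) A"
    by (simp add: distr_comb[OF x])
  also have "\<dots> = measure stdg {c :: (real^'n) \<times> (real^'n^('p + 'q)). comb x c \<in> A}"
    using mc A by (subst measure_distr) (simp_all add: vimage_def)
  also have "\<dots> = measure (distr stdg borel (\<lambda>z :: (real^'n^'p) \<times> (real^'n) \<times> (real^'n^'q). (fst (snd z), join (fst z) (snd (snd z))))) {c. comb x c \<in> A}"
    by (simp add: distr_reorder)
  also have "\<dots> = measure stdg {z :: (real^'n^'p) \<times> (real^'n) \<times> (real^'n^'q). comb x (fst (snd z), join (fst z) (snd (snd z))) \<in> A}"
    using m B by (subst measure_distr) (simp_all add: vimage_def)
  finally show ?thesis by simp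
qed

text \<open>The conditions on combinations are homogeneous in the weights, so they are tested at
  unit weights and rescaled. Three chi-square events of weight 2 and eight ratio or linear-form
  events of weight 4 make 38. Weights built from \<open>e\<close> are random, but by
  \<open>\<delta>2_mix\<close> they are invariant under \<open>mix\<close> and obey the same bounds
  as fixed ones.\<close>

theorem good_sample_probability:
  fixes d1 :: "real^'p" and d2 :: "real^'q"
  assumes n: "CARD('p) + CARD('q) < CARD('n)" and r: "r > 0"
    and lam: "0 < lam" "lam \<le> 1" and s: "0 < s" "s \<le> 1 / 20"
  defines "q \<equiv> (real CARD('n) - (real CARD('p) + real CARD('q))) / real CARD('n)"
  shows "\<exists>Bad \<in> sets borel. measure stdg Bad \<le> 38 * exp (- (real CARD('n) * lam\<^sup>2 * q ^ 5 * s\<^sup>2 / 27)) \<and>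
     (\<forall>z :: (real^'n^'p) \<times> (real^'n) \<times> (real^'n^'q). z \<notin> Bad \<longrightarrow> good_sample s q lam r d1 d2 z)"
proof -
  let ?n = "real CARD('n)" and ?k1 = "real CARD('p)" and ?k2 = "real CARD('q)"
  have npos: "?n > 0" "?k1 > 0" "?k2 > 0" by simp_all
  have le: "CARD('p) + CARD('q) \<le> CARD('n)" and less: "CARD('p) < CARD('n)" using n by simp_all
  interpret bound_params ?n ?k1 ?k2 lam q s
    by unfold_locales (use n lam s in \<open>auto simp: q_def\<close>)
  have nk: "?n * q = ?n - (?k1 + ?k2)" by (rule nq)
  define D where "D = r\<^sup>2 + (norm d2)\<^sup>2"
  have D: "D > 0" using r by (simp add: D_def add_pos_nonneg)
  define T where "T = D + (norm d1)\<^sup>2"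
  have T: "T > 0" using D by (simp add: T_def add_pos_nonneg)
  define xa where "xa = (r, d2)"
  define xb where "xb z = (1 :: real, - \<delta>2 (fst z) (snd z))" for z :: "(real^'n^'p) \<times> (real^'n) \<times> (real^'n^'q)"
  have nxa: "(norm xa)\<^sup>2 = D" by (simp add: xa_def norm_Pair D_def)
  have nxb: "(norm (xb z))\<^sup>2 = 1 + (norm (\<delta>2 (fst z) (snd z)))\<^sup>2" for z
    by (simp add: xb_def norm_Pair)
  have mb [measurable]: "xb \<in> borel_measurable borel" unfolding xb_def[abs_def] by measurable
  have invb: "xb (W, mix W (c, c')) = xb (W, c)" if "full_rank (join W (snd c))" for W c c'
    using \<delta>2_mix[OF that] by (simp add: xb_def)
  define A1 where "A1 = {z :: (real^'n^'p) \<times> (real^'n) \<times> (real^'n^'q).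
      \<bar>(norm (fst (snd z) - proj (join (fst z) (snd (snd z))) (fst (snd z))))\<^sup>2 - ?n * q\<bar> \<ge> (s * q) * (?n * q)}"
  have A1: "measure stdg A1 \<le> 2 * exp (- rate)" "A1 \<in> sets borel"
  proof -
    let ?A = "{p :: (real^'n^('p + 'q)) \<times> (real^'n). \<bar>(norm (snd p - proj (fst p) (snd p)))\<^sup>2 - ?n * q\<bar> \<ge> (s * q) * (?n * q)}"
    have mA: "?A \<in> sets borel" by measurable
    have "measure stdg A1 = measure stdg ?A"
      using measure_reorder[OF mA] by (simp add: A1_def)
    also have "\<dots> \<le> 2 * exp (- ((s * q) * (?n * q))\<^sup>2 / (8 * max (?n * q) ((s * q) * (?n * q))))"
    proof (rule resid_norm_deviation)
      show "0 < (s * q) * (?n * q)" using s q npos by (intro mult_pos_pos) auto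
    qed (use le nk in auto)
    also have "\<dots> \<le> 2 * exp (- rate)"
    proof (rule mult_left_mono[OF chi_bound])
      show "s * q * lam \<le> s * q" using s q lam by (simp add: mult_le_cancel_left1)
      have "s * q \<le> 1 * 1" using s q q1 by (intro mult_mono) auto
      then show "s * q \<le> 1" by simp
    qed simp_all
    finally show "measure stdg A1 \<le> 2 * exp (- rate)" .
    show "A1 \<in> sets borel" unfolding A1_def by measurable
  qed
  define A2 where "A2 = {z :: (real^'n^'p) \<times> (real^'n) \<times> (real^'n^'q).
      \<bar>(norm (comb (unitize xa) (snd z) - proj (fst z) (comb (unitize xa) (snd z))))\<^sup>2 - (?n - ?k1)\<bar> \<ge> (s * q * lam) * (?n - ?k1)}"
  have A2: "measure stdg A2 \<le> 2 * exp (- rate)" "A2 \<in> sets borel"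
  proof -
    let ?A = "{p :: (real^'n^'p) \<times> (real^'n). \<bar>(norm (snd p - proj (fst p) (snd p)))\<^sup>2 - (?n - ?k1)\<bar> \<ge> (s * q * lam) * (?n - ?k1)}"
    have mA: "?A \<in> sets borel" by measurable
    have "measure stdg A2 = measure stdg ?A"
      using measure_combine[OF norm_unitize mA] by (simp add: A2_def)
    also have "\<dots> \<le> 2 * exp (- ((s * q * lam) * (?n - ?k1))\<^sup>2 / (8 * max (?n - ?k1) ((s * q * lam) * (?n - ?k1))))"
      by (rule resid_norm_deviation) (use s q lam npos less in auto)
    also have "\<dots> \<le> 2 * exp (- rate)"
    proof (rule mult_left_mono[OF chi_bound])
      have "s * q * lam \<le> 1 * 1 * 1" using s q q1 lam by (intro mult_mono) auto
      then show "s * q * lam \<le> 1" by simp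
      show "?n * q \<le> ?n - ?k1" unfolding nk by simp
    qed simp_all
    finally show "measure stdg A2 \<le> 2 * exp (- rate)" .
    show "A2 \<in> sets borel" unfolding A2_def by measurable
  qed
  \<comment> \<open>Unit weights of the whole response, which is \<open>sqrt T\<close> times a
    standard Gaussian vector.\<close>
  define x0 where "x0 = (1 / sqrt T) *\<^sub>R (r, vjoin d1 d2)"
  have nx0: "norm x0 = 1"
  proof -
    have "(norm (r, vjoin d1 d2))\<^sup>2 = T" by (simp add: norm_Pair norm_vjoin T_def D_def)
    then have "norm (r, vjoin d1 d2) = sqrt T" using real_sqrt_unique[of "norm (r, vjoin d1 d2)" T] by simp
    then show ?thesis unfolding x0_def norm_scaleR using T by simp
  qed
  define A3 where "A3 = {z :: (real^'n^'p) \<times> (real^'n) \<times> (real^'n^'q).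
      \<bar>(norm (comb x0 (fst (snd z), join (fst z) (snd (snd z)))))\<^sup>2 - ?n\<bar> \<ge> (s * lam) * ?n}"
  have A3: "measure stdg A3 \<le> 2 * exp (- rate)" "A3 \<in> sets borel"
  proof -
    let ?A = "{x :: real^'n. \<bar>(norm x)\<^sup>2 - ?n\<bar> \<ge> (s * lam) * ?n}"
    have mA: "?A \<in> sets borel" by measurable
    have "measure stdg A3 = measure stdg ?A"
      using measure_response[OF nx0 mA] by (simp add: A3_def)
    also have "\<dots> \<le> 2 * exp (- ((s * lam) * ?n)\<^sup>2 / (8 * max ?n ((s * lam) * ?n)))"
    proof -
      have "measure stdg {x :: real^'n. \<bar>(norm x)\<^sup>2 - real DIM(real^'n)\<bar> \<ge> (s * lam) * ?n}
        \<le> 2 * exp (- ((s * lam) * ?n)\<^sup>2 / (8 * max (real DIM(real^'n)) ((s * lam) * ?n)))"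
        by (rule norm_sq_deviation) (use s lam in simp)
      then show ?thesis by simp
    qed
    also have "\<dots> \<le> 2 * exp (- rate)" using chi_bound_n by simp
    finally show "measure stdg A3 \<le> 2 * exp (- rate)" .
    show "A3 \<in> sets borel" unfolding A3_def by measurable
  qed
  let ?N = "?n - (?k1 + ?k2) + 1" and ?N1 = "?n - ?k1 + 1"
  have N: "?n * q \<le> ?N" "?n * q \<le> ?N1" unfolding nk by simp_all
  define A4 where "A4 = {z :: (real^'n^'p) \<times> (real^'n) \<times> (real^'n^'q).
      \<bar>(norm (\<delta>2 (fst z) (snd z)))\<^sup>2 - ?k2 / ?N\<bar> > 3/2 * s * q}"
  have A4: "measure stdg A4 \<le> 4 * exp (- rate)" "A4 \<in> sets borel"
  proof -
    \<comment> \<open>The embedding of the second block, with adjoint \<open>vsnd\<close>; it makes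
      \<open>\<delta>2\<close> an instance of the general ratio law on the joint design.\<close>
    let ?e = "vjoin 0 :: real^'q \<Rightarrow> real^('p + 'q)"
    have lin: "linear ?e" by (auto intro!: linearI simp: vjoin_def vec_eq_iff split: sum.split)
    have adj: "adjoint ?e = vsnd" by (rule adjoint_unique) (simp add: vjoin_inner)
    have ne: "norm (?e x) = norm x" for x
    proof -
      have "(norm (?e x))\<^sup>2 = (norm x)\<^sup>2" by (simp add: norm_vjoin)
      then show ?thesis by (simp add: power2_eq_iff_nonneg)
    qed
    let ?A = "{p :: (real^'n^('p + 'q)) \<times> (real^'n). \<bar>(norm (vsnd (lsq (fst p) (snd p))))\<^sup>2 - ?k2 / ?N\<bar> > 3/2 * s * q}"
    have mA: "?A \<in> sets borel" by measurable
    have "measure stdg A4 = measure stdg ?A"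
      using measure_reorder[OF mA] by (simp add: A4_def \<delta>2_def)
    also have "\<dots> \<le> ratio_bound ?N ?k2 (3/2 * s * q)"
    proof -
      have k: "CARD('p + 'q) \<le> CARD('n)" using le by simp
      have "?N = real CARD('n) - real CARD('p + 'q) + 1" by simp
      from lsq_embed_ratio_bound[OF lin ne k this, of "3/2 * s * q"] s q show ?thesis by (simp add: adj)
    qed
    also have "\<dots> \<le> 4 * exp (- rate)" by (rule ratio_bound_\<delta>2[OF N(1)])
    finally show "measure stdg A4 \<le> 4 * exp (- rate)" .
    show "A4 \<in> sets borel" unfolding A4_def by measurable
  qed
  define A5 where "A5 = {z :: (real^'n^'p) \<times> (real^'n) \<times> (real^'n^'q).
      (d2 \<bullet> \<delta>2 (fst z) (snd z))\<^sup>2 > (norm d2)\<^sup>2 * (s * q / 2)\<^sup>2}"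
  have A5: "measure stdg A5 \<le> 4 * exp (- rate)" "A5 \<in> sets borel"
  proof -
    let ?d = "vjoin 0 d2 :: real^('p + 'q)"
    have nd: "(norm ?d)\<^sup>2 = (norm d2)\<^sup>2" by (simp add: norm_vjoin)
    let ?A = "{p :: (real^'n^('p + 'q)) \<times> (real^'n). (?d \<bullet> lsq (fst p) (snd p))\<^sup>2 > (norm ?d)\<^sup>2 * (s * q / 2)\<^sup>2}"
    have mA: "?A \<in> sets borel" by measurable
    have "measure stdg A5 = measure stdg ?A"
      using measure_reorder[OF mA] unfolding nd by (simp add: A5_def \<delta>2_def vjoin_inner)
    also have "\<dots> \<le> linear_bound ?N ((s * q / 2)\<^sup>2)"
      by (rule lsq_linear_bound) (use le s q in auto)
    also have "\<dots> \<le> 4 * exp (- rate)" by (rule linear_bound_\<delta>2[OF N(1)])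
    finally show "measure stdg A5 \<le> 4 * exp (- rate)" .
    show "A5 \<in> sets borel" unfolding A5_def by measurable
  qed
  define A6 where "A6 w = {z :: (real^'n^'p) \<times> (real^'n) \<times> (real^'n^'q).
      \<bar>(norm (lsq (fst z) (comb (unitize (w z)) (snd z))))\<^sup>2 - ?k1 / ?N1\<bar> > s * lam / 2}" for w
  define A7 where "A7 w = {z :: (real^'n^'p) \<times> (real^'n) \<times> (real^'n^'q).
      (d1 \<bullet> lsq (fst z) (comb (unitize (w z)) (snd z)))\<^sup>2 > (norm d1)\<^sup>2 * (s\<^sup>2 * lam / 6)}" for w
  have A67: "measure stdg (A6 w) \<le> 4 * exp (- rate)" "A6 w \<in> sets borel"
      "measure stdg (A7 w) \<le> 4 * exp (- rate)" "A7 w \<in> sets borel"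
    if w [measurable]: "w \<in> borel_measurable borel"
      and inv: "\<And>W c c'. full_rank (join W (snd c)) \<Longrightarrow> w (W, mix W (c, c')) = w (W, c)" for w
  proof -
    have m: "(\<lambda>z :: (real^'n^'p) \<times> (real^'n) \<times> (real^'n^'q). unitize (w (fst z, snd z))) \<in> borel_measurable borel"
      by simp
    have i: "full_rank (join W (snd c)) \<Longrightarrow> unitize (w (W, mix W (c, c'))) = unitize (w (W, c))" for W c c'
      using inv by simp
    have "measure stdg (A6 w) \<le> ratio_bound ?N1 ?k1 (s * lam / 2)"
      using lsq_comb_ratio_bound[of "\<lambda>W c. unitize (w (W, c))", OF m norm_unitize le i refl, of "s * lam / 2"] s lam
      by (simp add: A6_def)
    also have "\<dots> \<le> 4 * exp (- rate)" by (rule ratio_bound_lsq[OF N(2)])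
    finally show "measure stdg (A6 w) \<le> 4 * exp (- rate)" .
    have "measure stdg (A7 w) \<le> linear_bound ?N1 (s\<^sup>2 * lam / 6)"
      using lsq_comb_linear_bound[of "\<lambda>W c. unitize (w (W, c))", OF m norm_unitize le i refl, of "s\<^sup>2 * lam / 6" d1] s lam
      by (simp add: A7_def)
    also have "\<dots> \<le> 4 * exp (- rate)" by (rule linear_bound_lsq[OF N(2)])
    finally show "measure stdg (A7 w) \<le> 4 * exp (- rate)" .
    show "A6 w \<in> sets borel" unfolding A6_def by measurable
    show "A7 w \<in> sets borel" unfolding A7_def by measurable
  qed
  define wa where "wa = (\<lambda>z :: (real^'n^'p) \<times> (real^'n) \<times> (real^'n^'q). xa)"
  \<comment> \<open>Sum and difference of the normalised weights, for the polarisation that controls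
    \<open>P \<bullet> R\<close>.\<close>
  define wp where "wp z = unitize xa + unitize (xb z)" for z
  define wm where "wm z = unitize xa - unitize (xb z)" for z
  have m: "wa \<in> borel_measurable borel" "wp \<in> borel_measurable borel" "wm \<in> borel_measurable borel"
    unfolding wa_def wp_def[abs_def] wm_def[abs_def] by measurable
  have a6: "measure stdg (A6 wa) \<le> 4 * exp (- rate)" "A6 wa \<in> sets borel"
      "measure stdg (A7 wa) \<le> 4 * exp (- rate)" "A7 wa \<in> sets borel"
    by (intro A67[OF m(1)]; simp add: wa_def)+
  have b6: "measure stdg (A6 xb) \<le> 4 * exp (- rate)" "A6 xb \<in> sets borel"
      "measure stdg (A7 xb) \<le> 4 * exp (- rate)" "A7 xb \<in> sets borel"
    by (intro A67[OF mb] invb; assumption)+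
  have p6: "measure stdg (A6 wp) \<le> 4 * exp (- rate)" "A6 wp \<in> sets borel"
    by (intro A67[OF m(2)]; simp add: wp_def invb)+
  have m6: "measure stdg (A6 wm) \<le> 4 * exp (- rate)" "A6 wm \<in> sets borel"
    by (intro A67[OF m(3)]; simp add: wm_def invb)+
  define Bad where "Bad = A1 \<union> (A2 \<union> (A3 \<union> (A4 \<union> (A5 \<union> (A6 wa \<union> (A6 xb \<union> (A6 wp \<union> (A6 wm \<union> (A7 wa \<union> A7 xb)))))))))"
  have un: "measure stdg (S \<union> S') \<le> x + y"
    if "measure stdg S \<le> x" "S \<in> sets borel" "measure stdg S' \<le> y" "S' \<in> sets borel" for S S' :: "((real^'n^'p) \<times> (real^'n) \<times> (real^'n^'q)) set" and x y
    using measure_Un_le[of S stdg S'] that by simp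
  let ?x = "exp (- rate)"
  have "measure stdg Bad \<le> 2*?x + (2*?x + (2*?x + (4*?x + (4*?x + (4*?x + (4*?x + (4*?x + (4*?x + (4*?x + 4*?x)))))))))"
    unfolding Bad_def by (intro un A1 A2 A3 A4 A5 a6 b6 p6 m6 sets.Un)
  then have 1: "measure stdg Bad \<le> 38 * exp (- (?n * lam\<^sup>2 * q ^ 5 * s\<^sup>2 / 27))"
    by (simp add: rate_def)
  have 2: "Bad \<in> sets borel"
    unfolding Bad_def by (intro A1 A2 A3 A4 A5 a6 b6 p6 m6 sets.Un)
  have 3: "good_sample s q lam r d1 d2 z" if "z \<notin> Bad" for z
  proof -
    obtain W v W2 where z: "z = (W, v, W2)" by (metis prod.exhaust)
    let ?c = "(v, W2)" let ?\<psi> = "comb xa ?c" let ?e = "\<delta>2 W ?c"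
    let ?P = "lsq W ?\<psi>" let ?R = "lsq W (comb (1, - ?e) ?c)"
    have nA: "z \<notin> A1" "z \<notin> A2" "z \<notin> A3" "z \<notin> A4" "z \<notin> A5" "z \<notin> A6 wa" "z \<notin> A6 xb" "z \<notin> A6 wp" "z \<notin> A6 wm" "z \<notin> A7 wa" "z \<notin> A7 xb"
      using that by (auto simp: Bad_def)
    have xbz: "xb z = (1, - ?e)" by (simp add: xb_def z)
    have nb: "(norm (1 :: real, - ?e))\<^sup>2 = 1 + (norm ?e)\<^sup>2" by (simp add: norm_Pair)
    have g1: "\<bar>(norm (v - proj (join W W2) v))\<^sup>2 - (?n - (?k1 + ?k2))\<bar> \<le> s * q * (?n - (?k1 + ?k2))"
      using nA(1) unfolding nk[symmetric] by (simp add: A1_def z)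
    have g2: "\<bar>(norm (?\<psi> - proj W ?\<psi>))\<^sup>2 - (?n - ?k1) * D\<bar> \<le> s * q * lam * ((?n - ?k1) * D)"
    proof -
      let ?u = "comb (unitize xa) ?c"
      have "?\<psi> = norm xa *\<^sub>R ?u"
        using comb_linear[of "norm xa" "unitize xa" 0 0 ?c] by (simp add: unitize_scale)
      then have "?\<psi> - proj W ?\<psi> = norm xa *\<^sub>R (?u - proj W ?u)"
        by (simp add: linear_scale[OF proj_is_linear] scaleR_right_diff_distrib)
      then have "(norm (?\<psi> - proj W ?\<psi>))\<^sup>2 = D * (norm (?u - proj W ?u))\<^sup>2"
        by (simp add: power_mult_distrib nxa)
      then have "(norm (?\<psi> - proj W ?\<psi>))\<^sup>2 - (?n - ?k1) * D = D * ((norm (?u - proj W ?u))\<^sup>2 - (?n - ?k1))"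
        by (simp add: algebra_simps)
      then have "\<bar>(norm (?\<psi> - proj W ?\<psi>))\<^sup>2 - (?n - ?k1) * D\<bar> = D * \<bar>(norm (?u - proj W ?u))\<^sup>2 - (?n - ?k1)\<bar>"
        using D by (simp add: abs_mult)
      also have "\<dots> \<le> D * ((s * q * lam) * (?n - ?k1))"
        using nA(2) D by (intro mult_left_mono) (auto simp: A2_def z)
      finally show ?thesis by (simp add: mult_ac)
    qed
    have g3: "\<bar>(norm (?\<psi> + transpose W *v d1))\<^sup>2 - ?n * T\<bar> \<le> s * lam * (?n * T)"
    proof -
      let ?u = "comb x0 (v, join W W2)"
      have "?u = (1 / sqrt T) *\<^sub>R (?\<psi> + transpose W *v d1)"
        by (simp add: x0_def comb_def xa_def transpose_join matrix_vector_mult_scaleR algebra_simps)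
      then have "(norm ?u)\<^sup>2 = (1 / T) * (norm (?\<psi> + transpose W *v d1))\<^sup>2"
        using T by (simp add: power_mult_distrib power_divide)
      then have "(norm (?\<psi> + transpose W *v d1))\<^sup>2 - ?n * T = T * ((norm ?u)\<^sup>2 - ?n)"
        using T by (simp add: algebra_simps)
      then have "\<bar>(norm (?\<psi> + transpose W *v d1))\<^sup>2 - ?n * T\<bar> = T * \<bar>(norm ?u)\<^sup>2 - ?n\<bar>"
        using T by (simp add: abs_mult)
      also have "\<dots> \<le> T * ((s * lam) * ?n)"
        using nA(3) T by (intro mult_left_mono) (auto simp: A3_def z)
      finally show ?thesis by (simp add: mult_ac)
    qed
    have g4: "\<bar>(norm ?e)\<^sup>2 - ?k2 / ?N\<bar> \<le> 3/2 * s * q" "(d2 \<bullet> ?e)\<^sup>2 \<le> (norm d2)\<^sup>2 * (s * q / 2)\<^sup>2"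
      using nA(4,5) by (simp_all add: A4_def A5_def z)
    have uP: "\<bar>(norm (lsq W (comb (unitize xa) ?c)))\<^sup>2 - ?k1 / ?N1\<bar> \<le> s * lam / 2"
      and uR: "\<bar>(norm (lsq W (comb (unitize (1, - ?e)) ?c)))\<^sup>2 - ?k1 / ?N1\<bar> \<le> s * lam / 2"
      and up: "\<bar>(norm (lsq W (comb (unitize (unitize xa + unitize (1, - ?e))) ?c)))\<^sup>2 - ?k1 / ?N1\<bar> \<le> s * lam / 2"
      and um: "\<bar>(norm (lsq W (comb (unitize (unitize xa - unitize (1, - ?e))) ?c)))\<^sup>2 - ?k1 / ?N1\<bar> \<le> s * lam / 2"
      using nA(6-9) by (simp_all add: A6_def wa_def wp_def wm_def xbz not_less) (simp_all add: z)
    have g5: "\<bar>(norm ?P)\<^sup>2 - ?k1 / ?N1 * D\<bar> \<le> s * lam / 2 * D"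
      using norm_sq_unitize_deviation[OF uP] by (simp only: nxa)
    have g6: "\<bar>(norm ?R)\<^sup>2 - ?k1 / ?N1 * (1 + (norm ?e)\<^sup>2)\<bar> \<le> s * lam / 2 * (1 + (norm ?e)\<^sup>2)"
      using norm_sq_unitize_deviation[OF uR] by (simp only: nb)
    have g7: "\<bar>?P \<bullet> ?R - ?k1 / ?N1 * (r - d2 \<bullet> ?e)\<bar> \<le> s * lam / 2 * sqrt (D * (1 + (norm ?e)\<^sup>2))"
    proof -
      have "xa \<bullet> (1, - ?e) = r - d2 \<bullet> ?e" by (simp add: xa_def)
      moreover have "norm xa * norm (1 :: real, - ?e) = sqrt (D * (1 + (norm ?e)\<^sup>2))"
        unfolding nxa[symmetric] nb[symmetric] by (simp add: real_sqrt_mult)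
      ultimately show ?thesis using inner_unitize_deviation[OF up um] by (simp only:)
    qed
    have g8: "(d1 \<bullet> ?P)\<^sup>2 \<le> (norm d1)\<^sup>2 * (s\<^sup>2 * lam / 6) * D"
      using linear_unitize_bound[of d1 W xa ?c "(norm d1)\<^sup>2 * (s\<^sup>2 * lam / 6)"] nA(10)
      by (simp add: A7_def wa_def z nxa)
    have g9: "(d1 \<bullet> ?R)\<^sup>2 \<le> (norm d1)\<^sup>2 * (s\<^sup>2 * lam / 6) * (1 + (norm ?e)\<^sup>2)"
      using linear_unitize_bound[of d1 W "(1, - ?e)" ?c "(norm d1)\<^sup>2 * (s\<^sup>2 * lam / 6)"] nA(11)
      unfolding nb by (simp add: A7_def xbz) (simp add: z)
    show ?thesis
      unfolding good_sample_def Let_def z fst_conv snd_conv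
      using g1 g2 g3 g4 g5 g6 g7 g8 g9 by (simp only: xa_def D_def T_def simp_thms)
  qed
  show ?thesis using 1 2 3 by blast
qed

section \<open>The estimator in whitened coordinates\<close>

lemma least_squares_lsq: "least_squares X Y = lsq (transpose X) Y"
  by (simp add: least_squares_def lsq_def)

lemma transpose_mult_vec: "transpose (F ** V) *v c = transpose V *v (transpose F *v c)"
  for F :: "real^'k^'m" and V :: "real^'n^'k"
  by (simp add: matrix_transpose_mul matrix_vector_mul_assoc)

text \<open>A kernel vector of \<open>transpose F\<close> is one of
  \<open>transpose (F ** V)\<close>, so full rank of the product makes the square matrix
  \<open>F\<close> invertible. The row space, and with it the projection, is the same for both
  designs, and coefficients transform by \<open>transpose F\<close>.\<close>

lemma full_rank_base_change:
  fixes F :: "real^'k^'k" and V :: "real^'n^'k"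
  assumes full: "full_rank (F ** V)"
  shows "full_rank V" "F *v x = 0 \<Longrightarrow> x = 0" "lsq V y = transpose F *v lsq (F ** V) y" "proj V y = proj (F ** V) y"
proof -
  have inj: "a = 0" if "transpose F *v a = 0" for a
    using full that by (simp add: full_rank_def transpose_mult_vec)
  then obtain B where B: "B ** transpose F = mat 1"
    using matrix_left_invertible_ker[of "transpose F"] by blast
  then have B': "transpose F ** B = mat 1" by (simp add: matrix_left_right_inverse)
  show V: "full_rank V"
    unfolding full_rank_def
  proof (intro allI impI)
    fix c assume c: "transpose V *v c = 0"
    have e: "transpose F *v (B *v c) = c" using B' by (simp add: matrix_vector_mul_assoc)
    then have "transpose (F ** V) *v (B *v c) = 0" using c by (simp add: transpose_mult_vec)
    then have "B *v c = 0" using full by (simp add: full_rank_def)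
    then show "c = 0" using e by simp
  qed
  have "transpose B ** F = mat 1"
    by (metis B' matrix_transpose_mul transpose_mat transpose_transpose)
  from \<open>transpose B ** F = mat 1\<close> show F: "x = 0" if "F *v x = 0" for x
    using that by (metis matrix_vector_mul_assoc matrix_vector_mul_lid matrix_vector_mult_0_right)
  show l: "lsq V y = transpose F *v lsq (F ** V) y"
  proof (rule lsq_unique[OF V])
    have "F *v (V *v (y - transpose V *v (transpose F *v lsq (F ** V) y))) = 0"
      using lsq_normal_eq[OF full, of y] by (simp add: transpose_mult_vec matrix_vector_mul_assoc)
    then show "V *v (y - transpose V *v (transpose F *v lsq (F ** V) y)) = 0"
      by (rule F)
  qed
  show "proj V y = proj (F ** V) y"
    by (simp add: proj_def l transpose_mult_vec)
qed

lemma M1_proj: "M1 X *v y = y - proj (transpose (block1 X)) y"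
  by (simp add: M1_def proj_def lsq_def matrix_vector_mult_diff_rdistrib matrix_vector_mul_assoc matrix_mul_assoc)

lemma transpose_split: "transpose X = join (transpose (block1 X)) (transpose (block2 X))"
  by (simp add: vec_eq_iff transpose_def join_def block1_def block2_def split: sum.split)

lemma mult_block: "X *v c = block1 X *v vfst c + block2 X *v vsnd c"
  using transpose_join[of "transpose (block1 X)" "transpose (block2 X)" c]
  by (simp add: transpose_split[symmetric])

text \<open>One realisation of the sample, where all facts are deterministic. By \<open>tri\<close>
  the whitened first block is formed from the original first block alone, so regressions on that
  block also transform, through \<open>E11\<close>.\<close>

locale whitened =
  fixes X :: "real^('p::finite + 'q::finite)^'n" and Y :: "real^'n" and E :: "real^('p + 'q)^('p + 'q)"
    and W1 :: "real^'n^'p" and W2 :: "real^'n^'q" and v :: "real^'n" and r :: real and d1 :: "real^'p" and d2 :: "real^'q"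
  assumes W: "E ** transpose X = join W1 W2" and tri: "\<And>i j. E $ Inl i $ Inr j = 0"
    and full: "full_rank (join W1 W2)" and Y: "Y = r *\<^sub>R v + transpose W2 *v d2 + transpose W1 *v d1"
begin

definition "E11 = (\<chi> i j. E $ Inl i $ Inl j)"
definition "X1 = transpose (block1 X)"
definition "X2 = transpose (block2 X)"
text \<open>The response without its first-block signal: it has the same residual as
  \<open>Y\<close> on the first block, and its fit there is the error of the first-block
  regression.\<close>

definition "\<psi> = comb (r, d2) (v, W2)"
definition "\<delta> = lsq (join W1 W2) v"

lemma full': "full_rank (E ** transpose X)" using full by (simp add: W)

lemma fullX: "full_rank (transpose X)" by (rule full_rank_base_change(1)[OF full'])

lemma W1_eq: "E11 ** X1 = W1"
proof -
  have "W1 $ i = (E ** transpose X) $ Inl i" for i by (simp add: W join_def)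
  then have "W1 $ i $ l = (\<Sum>j\<in>UNIV. E $ Inl i $ j * X $ l $ j)" for i l
    by (simp add: matrix_matrix_mult_def transpose_def)
  then show ?thesis
    by (simp add: vec_eq_iff matrix_matrix_mult_def E11_def X1_def transpose_def block1_def sum_UNIV_Plus tri)
qed

lemma fullW1: "full_rank W1" by (rule full_rank_join_fst[OF full])

lemma fullX1: "full_rank X1" "lsq X1 y = transpose E11 *v lsq W1 y" "proj X1 y = proj W1 y"
  using full_rank_base_change(1,3,4)[of E11 X1] fullW1 unfolding W1_eq by auto

lemma E11_lift: "vjoin (transpose E11 *v u) 0 = transpose E *v vjoin u 0"
  by (simp add: vec_eq_iff vjoin_def matrix_vector_mult_def transpose_def sum_UNIV_Plus E11_def tri split: sum.split)

lemma Y_\<psi>: "Y = \<psi> + transpose W1 *v d1"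
  by (simp add: Y \<psi>_def comb_def)

lemma Y_join: "Y = r *\<^sub>R v + 1 *\<^sub>R (transpose (join W1 W2) *v vjoin d1 d2)"
  by (simp add: Y transpose_join)

lemma lsq_W1_Y: "lsq W1 Y = d1 + lsq W1 \<psi>"
  using lsq_linear[of W1 1 \<psi> 1 "transpose W1 *v d1"] by (simp add: Y_\<psi> lsq_transpose[OF fullW1])

lemma lsq_join_Y: "lsq (join W1 W2) Y = r *\<^sub>R \<delta> + vjoin d1 d2"
  using lsq_linear[of "join W1 W2" r v 1 "transpose (join W1 W2) *v vjoin d1 d2"]
  unfolding Y_join[symmetric] \<delta>_def by (simp add: lsq_transpose[OF full])

lemma M1_Y: "M1 X *v Y = \<psi> - proj W1 \<psi>"
  unfolding M1_proj X1_def[symmetric] fullX1(3)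
  by (simp add: Y_\<psi> linear_add[OF proj_is_linear] proj_def[of W1 "transpose W1 *v d1"] lsq_transpose[OF fullW1])

lemma Y_M1_Y: "Y \<bullet> (M1 X *v Y) = (norm (\<psi> - proj W1 \<psi>))\<^sup>2"
proof -
  have "W1 *v (\<psi> - proj W1 \<psi>) = 0" by (rule proj_resid[OF fullW1])
  then have o: "(transpose W1 *v u) \<bullet> (\<psi> - proj W1 \<psi>) = 0" for u
    by (simp add: inner_matrix_vector)
  have Ye: "Y = (\<psi> - proj W1 \<psi>) + transpose W1 *v (lsq W1 \<psi> + d1)"
    by (simp add: Y_\<psi> proj_def matrix_vector_right_distrib)
  have "Y \<bullet> (\<psi> - proj W1 \<psi>) = (\<psi> - proj W1 \<psi>) \<bullet> (\<psi> - proj W1 \<psi>)"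
    using arg_cong[OF Ye, of "\<lambda>y. y \<bullet> (\<psi> - proj W1 \<psi>)"] by (simp only: inner_add_left[of "\<psi> - proj W1 \<psi>"] o add_0_right)
  then show ?thesis by (simp add: M1_Y power2_norm_eq_inner)
qed

lemma Y_resid_Y: "Y \<bullet> ((mat 1 - M1 X) *v Y) = (norm Y)\<^sup>2 - (norm (\<psi> - proj W1 \<psi>))\<^sup>2"
  by (simp add: matrix_vector_mult_diff_rdistrib inner_diff_right Y_M1_Y power2_norm_eq_inner)

lemma \<sigma>2_hat_eq: "\<sigma>2_hat X Y = r\<^sup>2 * (norm (v - proj (join W1 W2) v))\<^sup>2 / (real CARD('n) - real CARD('p + 'q))"
proof -
  have "Y - X *v least_squares X Y = Y - proj (transpose X) Y"
    by (simp add: least_squares_lsq proj_def)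
  also have "\<dots> = Y - proj (join W1 W2) Y"
    by (simp add: full_rank_base_change(4)[OF full'] W)
  also have "\<dots> = r *\<^sub>R (v - proj (join W1 W2) v)"
  proof -
    have "proj (join W1 W2) Y = r *\<^sub>R proj (join W1 W2) v + 1 *\<^sub>R proj (join W1 W2) (transpose (join W1 W2) *v vjoin d1 d2)"
      by (subst Y_join) (rule proj_linear)
    also have "proj (join W1 W2) (transpose (join W1 W2) *v vjoin d1 d2) = transpose (join W1 W2) *v vjoin d1 d2"
      by (simp only: proj_def lsq_transpose[OF full])
    finally have "proj (join W1 W2) Y = r *\<^sub>R proj (join W1 W2) v + 1 *\<^sub>R (transpose (join W1 W2) *v vjoin d1 d2)" .
    then show ?thesis using Y_join by (simp add: scaleR_right_diff_distrib)
  qed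
  finally show ?thesis by (simp add: \<sigma>2_hat_def power_mult_distrib)
qed

text \<open>The first block of the joint normal equations. It exhibits the first-block error of the
  joint fit as a fit on \<open>W1\<close> of a combination with random weights, the form treated by
  \<open>lsq_comb_law\<close>.\<close>

lemma R_eq: "lsq W1 (comb (1, - vsnd \<delta>) (v, W2)) = vfst \<delta>"
proof (rule lsq_unique[OF fullW1])
  have "join W1 W2 *v (v - transpose (join W1 W2) *v \<delta>) = 0"
    unfolding \<delta>_def by (rule lsq_normal_eq[OF full])
  then have "W1 *v (v - (transpose W1 *v vfst \<delta> + transpose W2 *v vsnd \<delta>)) = 0"
    by (simp add: join_mult vjoin_eq_0 transpose_join)
  moreover have "comb (1, - vsnd \<delta>) (v, W2) = v - transpose W2 *v vsnd \<delta>"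
    using matrix_vector_mult_scaleR[of "transpose W2" "-1" "vsnd \<delta>"] by (simp add: comb_def)
  then have "comb (1, - vsnd \<delta>) (v, W2) - transpose W1 *v vfst \<delta> = v - (transpose W1 *v vfst \<delta> + transpose W2 *v vsnd \<delta>)"
    by simp
  ultimately show "W1 *v (comb (1, - vsnd \<delta>) (v, W2) - transpose W1 *v vfst \<delta>) = 0"
    by (simp only:)
qed

text \<open>The Frisch--Waugh--Lovell theorem in the original coordinates: the residual
  \<open>e\<close> of the joint fit is orthogonal to both blocks, hence also solves the normal
  equations of the partialled-out design \<open>V\<close> and, after removal of the second-block
  fit, those of the first block.\<close>

lemma \<theta>_hat_blocks:
  shows "\<theta>2_hat X Y = vsnd (lsq (transpose X) Y)"
    and "vfst (lsq (transpose X) Y) = lsq X1 Y - lsq X1 (block2 X *v vsnd (lsq (transpose X) Y))"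
proof -
  define \<theta> where "\<theta> = lsq (transpose X) Y"
  define e where "e = Y - X *v \<theta>"
  have "transpose X *v e = 0"
    using lsq_normal_eq[OF fullX, of Y] by (simp add: e_def \<theta>_def)
  then have e1: "X1 *v e = 0" and e2: "X2 *v e = 0"
    by (auto simp: X1_def X2_def transpose_split join_mult vjoin_eq_0)
  have Ye: "Y = e + transpose X1 *v vfst \<theta> + block2 X *v vsnd \<theta>"
    by (simp add: e_def mult_block[of X \<theta>] X1_def)
  have symM: "(M1 X *v x) \<bullet> y = x \<bullet> (M1 X *v y)" for x y
    using proj_sym[OF fullX1(1), of x y] by (simp add: M1_proj X1_def[symmetric] inner_diff_left inner_diff_right)
  have M1M1: "M1 X *v (M1 X *v x) = M1 X *v x" for x
    by (simp add: M1_proj X1_def[symmetric] linear_diff[OF proj_is_linear] proj_proj[OF fullX1(1)])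
  have trM: "transpose (M1 X) = M1 X"
  proof -
    have "transpose (M1 X) *v y = M1 X *v y" for y
      by (rule vector_eq_ldot[THEN iffD1], rule allI) (simp add: inner_matrix_vector[symmetric] symM)
    then show ?thesis by (simp add: matrix_eq)
  qed
  have MM: "M1 X ** M1 X = M1 X"
    using M1M1 by (simp add: matrix_eq matrix_vector_mul_assoc[symmetric])
  define V where "V = transpose (M1 X ** block2 X)"
  have V: "V = X2 ** M1 X" by (simp add: V_def X2_def matrix_transpose_mul trM)
  have VV: "V ** transpose V = transpose (block2 X) ** M1 X ** block2 X"
    by (simp add: V matrix_transpose_mul trM X2_def matrix_mul_assoc) (metis MM matrix_mul_assoc)
  have fV: "full_rank V"
    unfolding full_rank_def
  proof (intro allI impI)
    fix c assume "transpose V *v c = 0"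
    then have "M1 X *v (block2 X *v c) = 0" by (simp add: V_def matrix_vector_mul_assoc)
    then have "block2 X *v c = transpose X1 *v lsq X1 (block2 X *v c)"
      by (simp add: M1_proj X1_def[symmetric] proj_def)
    then have "X *v vjoin (- lsq X1 (block2 X *v c)) c = 0"
      using matrix_vector_mult_scaleR[of "block1 X" "-1" "lsq X1 (block2 X *v c)"] by (simp add: mult_block X1_def)
    then have "vjoin (- lsq X1 (block2 X *v c)) c = 0" using fullX by (simp add: full_rank_def)
    then show "c = 0" by (simp add: vjoin_eq_0)
  qed
  have pe: "proj X1 e = 0" using e1 by (simp add: proj_def lsq_kernel)
  have "lsq V Y = vsnd \<theta>"
  proof (rule lsq_unique[OF fV])
    have MY: "M1 X *v Y = e + M1 X *v (block2 X *v vsnd \<theta>)"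
      by (subst Ye) (simp add: M1_proj X1_def[symmetric] linear_add[OF proj_is_linear] pe
        proj_def[of X1 "transpose X1 *v _"] lsq_transpose[OF fullX1(1)])
    have "V *v (Y - transpose V *v vsnd \<theta>) = X2 *v (M1 X *v Y - M1 X *v (M1 X *v (block2 X *v vsnd \<theta>)))"
    proof -
      have Vx: "V *v x = X2 *v (M1 X *v x)" for x by (simp add: V matrix_vector_mul_assoc)
      have V'c: "transpose V *v c = M1 X *v (block2 X *v c)" for c by (simp add: V_def matrix_vector_mul_assoc)
      show ?thesis by (simp only: Vx V'c matrix_vector_mult_diff_distrib)
    qed
    also have "\<dots> = X2 *v e" by (simp add: MY M1M1)
    finally show "V *v (Y - transpose V *v vsnd \<theta>) = 0" using e2 by simp
  qed
  moreover have "\<theta>2_hat X Y = lsq V Y"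
    unfolding \<theta>2_hat_def lsq_def VV by (simp add: V X2_def matrix_vector_mul_assoc)
  ultimately show "\<theta>2_hat X Y = vsnd (lsq (transpose X) Y)"
    by (simp only: \<theta>_def)
  have "lsq X1 (Y - block2 X *v vsnd \<theta>) = vfst \<theta>"
    by (rule lsq_unique[OF fullX1(1)]) (use e1 in \<open>simp add: Ye\<close>)
  moreover have "lsq X1 (Y - block2 X *v vsnd \<theta>) = lsq X1 Y - lsq X1 (block2 X *v vsnd \<theta>)"
    using lsq_linear[of X1 1 Y "-1" "block2 X *v vsnd \<theta>"] by simp
  ultimately show "vfst (lsq (transpose X) Y) = lsq X1 Y - lsq X1 (block2 X *v vsnd (lsq (transpose X) Y))"
    by (simp add: \<theta>_def)
qed

text \<open>In whitened coordinates the estimator is an affine combination of the least-squares fits on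
  both blocks, on the first block only, and of the zero predictor.\<close>

lemma estimator_whitened:
  fixes c1 c2 :: real
  defines "a1 \<equiv> shrink1 c1 X Y" and "a2 \<equiv> shrink2 c2 X Y"
  shows "vjoin (\<theta>1_JS c1 c2 X Y) (\<theta>2_JS c2 X Y)
     = transpose E *v vjoin ((1 - a2) *\<^sub>R (d1 + r *\<^sub>R vfst \<delta>) + (a2 - a1) *\<^sub>R (d1 + lsq W1 \<psi>))
                            ((1 - a2) *\<^sub>R (d2 + r *\<^sub>R vsnd \<delta>))"
proof -
  define \<theta> where "\<theta> = lsq (transpose X) Y"
  have 2: "\<theta>2_JS c2 X Y = (1 - a2) *\<^sub>R vsnd \<theta>"
    by (simp add: \<theta>2_JS_def \<theta>_hat_blocks(1) a2_def \<theta>_def)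
  have "lsq X1 (block2 X *v ((1 - a2) *\<^sub>R vsnd \<theta>)) = (1 - a2) *\<^sub>R lsq X1 (block2 X *v vsnd \<theta>)"
    using lsq_linear[of X1 "1 - a2" "block2 X *v vsnd \<theta>" 0 0] by (simp add: matrix_vector_mult_scaleR)
  then have "\<theta>1_JS c1 c2 X Y = (1 - a1) *\<^sub>R lsq X1 Y - (1 - a2) *\<^sub>R lsq X1 (block2 X *v vsnd \<theta>)"
    by (simp add: \<theta>1_JS_def \<theta>1_star_JS_def \<theta>1_star_def least_squares_lsq 2 a1_def X1_def)
  also have "\<dots> = (1 - a2) *\<^sub>R vfst \<theta> + (a2 - a1) *\<^sub>R lsq X1 Y"
  proof -
    have B: "lsq X1 (block2 X *v vsnd \<theta>) = lsq X1 Y - vfst \<theta>"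
      using \<theta>_hat_blocks(2) by (simp add: \<theta>_def)
    show ?thesis unfolding B by (simp add: algebra_simps)
  qed
  finally have 1: "\<theta>1_JS c1 c2 X Y = (1 - a2) *\<^sub>R vfst \<theta> + (a2 - a1) *\<^sub>R lsq X1 Y" .
  have vj: "vjoin (x *\<^sub>R a + y *\<^sub>R b) (x *\<^sub>R c) = x *\<^sub>R vjoin a c + y *\<^sub>R vjoin b 0" for x y a b c
    by (simp add: vec_eq_iff vjoin_def split: sum.split)
  have "vjoin (\<theta>1_JS c1 c2 X Y) (\<theta>2_JS c2 X Y) = (1 - a2) *\<^sub>R \<theta> + (a2 - a1) *\<^sub>R vjoin (lsq X1 Y) 0"
    unfolding 1 2 vj by simp
  also have "\<theta> = transpose E *v (r *\<^sub>R \<delta> + vjoin d1 d2)"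
    unfolding \<theta>_def full_rank_base_change(3)[OF full'] W lsq_join_Y ..
  also have "vjoin (lsq X1 Y) 0 = transpose E *v vjoin (d1 + lsq W1 \<psi>) 0"
    unfolding fullX1(2) E11_lift lsq_W1_Y ..
  also have "(1 - a2) *\<^sub>R (transpose E *v (r *\<^sub>R \<delta> + vjoin d1 d2)) + (a2 - a1) *\<^sub>R (transpose E *v vjoin (d1 + lsq W1 \<psi>) 0)
     = transpose E *v ((1 - a2) *\<^sub>R (r *\<^sub>R \<delta> + vjoin d1 d2) + (a2 - a1) *\<^sub>R vjoin (d1 + lsq W1 \<psi>) 0)"
    by (simp add: matrix_vector_right_distrib matrix_vector_mult_scaleR)
  also have "r *\<^sub>R \<delta> + vjoin d1 d2 = vjoin (d1 + r *\<^sub>R vfst \<delta>) (d2 + r *\<^sub>R vsnd \<delta>)"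
    by (simp add: vec_eq_iff vjoin_def vfst_def vsnd_def split: sum.split)
  finally show ?thesis unfolding vj .
qed

lemma shrink_range:
  assumes "CARD('p + 'q) < CARD('n)" "0 \<le> c1" "0 \<le> c2"
  shows "0 \<le> shrink1 c1 X Y" "shrink1 c1 X Y \<le> 1" "0 \<le> shrink2 c2 X Y" "shrink2 c2 X Y \<le> 1"
proof -
  have s: "0 \<le> \<sigma>2_hat X Y" unfolding \<sigma>2_hat_def using assms(1) by (intro divide_nonneg_nonneg) auto
  have q: "\<theta> \<bullet> ((transpose V ** V) *v \<theta>) \<ge> 0" for V :: "real^'k^'n" and \<theta>
    using gram_inner[of \<theta> "transpose V" \<theta>] by simp
  show "0 \<le> shrink1 c1 X Y" "0 \<le> shrink2 c2 X Y"
    unfolding shrink1_def shrink2_def using s q assms(2,3) by (auto intro!: divide_nonneg_nonneg mult_nonneg_nonneg)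
  show "shrink1 c1 X Y \<le> 1" "shrink2 c2 X Y \<le> 1"
    by (simp_all add: shrink1_def shrink2_def)
qed

text \<open>The identity \<open>(1 + g1) * (1 + \<kappa>) = 1 + k / (n - k + 1)\<close> turns
  \<open>w1\<close> into \<open>qa - cc\<close>. In the other two terms, the part of
  \<open>w3\<close> with \<open>k1 / n\<close> joins the \<open>- S / n\<close> from the first
  quadratic form to \<open>- S / (n - k1)\<close>. What results is the telescoping shape needed in
  \<open>estimate_deviation\<close>.\<close>

lemma \<rho>2_hat_eq:
  fixes c1 c2 :: real
  defines "a1 \<equiv> shrink1 c1 X Y" and "a2 \<equiv> shrink2 c2 X Y"
    and "n \<equiv> real CARD('n)" and "k1 \<equiv> real CARD('p)" and "k2 \<equiv> real CARD('q)"
  assumes nk: "k1 + k2 < n"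
  defines "g1 \<equiv> k1 / (n - k1 + 1)" and "\<kappa> \<equiv> k2 / (n - (k1 + k2) + 1)"
  defines "qa \<equiv> 1 + (1 + g1) * \<kappa> * (1 - a2)\<^sup>2 + g1 * (1 - a1)\<^sup>2" and "cc \<equiv> a2\<^sup>2 + g1 * (a1 - a2)\<^sup>2"
  shows "\<rho>2_hat c1 c2 X Y = r\<^sup>2 * (norm (v - proj (join W1 W2) v))\<^sup>2 / (n - (k1 + k2)) * (qa - cc)
     + (norm (\<psi> - proj W1 \<psi>))\<^sup>2 / (n - k1) * (cc - a1\<^sup>2) + (norm Y)\<^sup>2 / n * a1\<^sup>2"
proof -
  have pos: "n > 0" "n - k1 > 0" "n - (k1 + k2) > 0" "n - k1 + 1 > 0" "n - (k1 + k2) + 1 > 0"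
    using nk by (simp_all add: n_def k1_def k2_def)
  define k where "k = real CARD('p + 'q)"
  have k: "k = k1 + k2" by (simp add: k_def k1_def k2_def)
  define S where "S = (norm (\<psi> - proj W1 \<psi>))\<^sup>2"
  define S0 where "S0 = (norm Y)\<^sup>2"
  define s2 where "s2 = r\<^sup>2 * (norm (v - proj (join W1 W2) v))\<^sup>2 / (n - (k1 + k2))"
  have gg: "(k1 + k2) / (n - (k1 + k2) + 1) = g1 + (1 + g1) * \<kappa>"
  proof -
    define a where "a = n - k1 + 1"
    define N where "N = n - (k1 + k2) + 1"
    have aN: "a > 0" "N > 0" "N + k2 = a" using pos by (simp_all add: a_def N_def)
    have 1: "1 + g1 = (n + 1) / a" 
    proof -
      have "n + 1 = a + k1" by (simp add: a_def)
      then show ?thesis unfolding g1_def a_def[symmetric] using aN by (simp add: add_divide_distrib)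
    qed
    have 2: "1 + \<kappa> = a / N" unfolding \<kappa>_def N_def[symmetric] using aN by (simp add: field_simps)
    have "(1 + g1) * (1 + \<kappa>) = (n + 1) / N" unfolding 1 2 using aN by simp
    moreover have "1 + (k1 + k2) / N = (n + 1) / N" using aN by (simp add: field_simps) (simp add: N_def)
    ultimately show ?thesis unfolding N_def[symmetric] by (simp add: algebra_simps)
  qed
  have SS: "(S0 - S) / n - a * (k1 / n) * 0 = S0 / n - S / n" for a using pos by (simp add: diff_divide_distrib)
  have Sn: "S / n + k1 / n * (S / (n - k1)) = S / (n - k1)"
    using pos by (simp add: field_simps)
  have "\<rho>2_hat c1 c2 X Y = w1 n k k1 a1 a2 * s2 + w2 a1 * ((S0 - S) / n) + w3 n k1 a1 a2 * (S / (n - k1))"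
    by (simp only: \<rho>2_hat_def Let_def Y_M1_Y Y_resid_Y \<sigma>2_hat_eq a1_def a2_def n_def k1_def k_def s2_def S_def S0_def
      k[unfolded k_def k1_def k2_def] k2_def)
  also have "\<dots> = s2 * (qa - cc) + S / (n - k1) * (cc - a1\<^sup>2) + S0 / n * a1\<^sup>2"
  proof -
    have "w1 n k k1 a1 a2 = qa - cc"
      unfolding w1_def k gg qa_def cc_def g1_def[symmetric] by (simp add: power2_eq_square algebra_simps)
    moreover have "w2 a1 * ((S0 - S) / n) + w3 n k1 a1 a2 * (S / (n - k1))
        = a1\<^sup>2 * (S0 / n) - a1\<^sup>2 * (S / n + k1 / n * (S / (n - k1))) + cc * (S / (n - k1))"
      unfolding w2_def w3_def cc_def g1_def[symmetric] by (simp add: diff_divide_distrib power2_eq_square algebra_simps)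
    ultimately have "w1 n k k1 a1 a2 * s2 + w2 a1 * ((S0 - S) / n) + w3 n k1 a1 a2 * (S / (n - k1))
        = (qa - cc) * s2 + (a1\<^sup>2 * (S0 / n) - a1\<^sup>2 * (S / (n - k1)) + cc * (S / (n - k1)))"
      unfolding Sn by (simp only: add.assoc)
    also have "\<dots> = s2 * (qa - cc) + S / (n - k1) * (cc - a1\<^sup>2) + S0 / n * a1\<^sup>2"
      by (simp add: algebra_simps)
    finally show ?thesis .
  qed
  finally show ?thesis by (simp only: s2_def S_def S0_def)
qed

text \<open>Minimisation over \<open>a2\<close>: for \<open>1 + g1 > 0\<close> the minimum is
  attained where \<open>a2 * (1 + g1) = g1 * a1\<close>. The ratio \<open>g1 / (1 + g1)\<close>,
  which equals \<open>k1 / (n + 1)\<close>, becomes the first choice of \<open>lam\<close>.\<close>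

lemma weight_bound: "g1 * a1\<^sup>2 \<le> (1 + g1) * (a2\<^sup>2 + g1 * (a1 - a2)\<^sup>2)" for a1 a2 g1 :: real
proof -
  have "0 \<le> (a2 * (1 + g1) - g1 * a1)\<^sup>2" by simp
  also have "\<dots> = (1 + g1) * (a2\<^sup>2 + g1 * (a1 - a2)\<^sup>2) - g1 * a1\<^sup>2"
    by (simp add: power2_eq_square algebra_simps)
  finally show ?thesis by simp
qed

text \<open>Under the first alternative for \<open>lam\<close>, \<open>weight_bound\<close> makes
  \<open>lam * a1\<^sup>2\<close> at most the coefficient \<open>cc\<close> of \<open>B\<close> in
  \<open>Q\<close>. Under the second, the noise term \<open>A\<close> of \<open>Q\<close> alone
  dominates. The vector \<open>bz\<close> is given only by its image under
  \<open>transpose E\<close>; injectivity identifies it with the explicit whitened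
  estimator.\<close>

lemma good_sample_log_ratio:
  fixes c1 c2 \<epsilon> lam :: real
  defines "n \<equiv> real CARD('n)" and "k1 \<equiv> real CARD('p)" and "k2 \<equiv> real CARD('q)"
  defines "q \<equiv> (n - (k1 + k2)) / n" and "t \<equiv> \<epsilon> / (1 + \<epsilon>)"
  defines "s \<equiv> t / 20"
  assumes nk: "CARD('p) + CARD('q) < CARD('n)" and c: "0 \<le> c1" "0 \<le> c2" and \<epsilon>: "\<epsilon> > 0" and r: "r > 0"
    and lam: "0 < lam" "lam \<le> 1" "lam \<le> k1 / (n + 1) \<or> lam * (r\<^sup>2 + (norm d2)\<^sup>2 + (norm d1)\<^sup>2) \<le> r\<^sup>2"
    and good: "good_sample s q lam r d1 d2 (W1, v, W2)"
    and b: "vjoin (\<theta>1_JS c1 c2 X Y) (\<theta>2_JS c2 X Y) = transpose E *v bz"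
    and inj: "\<And>x. transpose E *v x = 0 \<Longrightarrow> x = 0"
  shows "abs_log_ratio (\<rho>2_hat c1 c2 X Y) (r\<^sup>2 + (norm (vjoin d1 d2 - bz))\<^sup>2) < ereal \<epsilon>"
proof -
  define a1 where "a1 = shrink1 c1 X Y"
  define a2 where "a2 = shrink2 c2 X Y"
  have a: "0 \<le> a1" "a1 \<le> 1" "0 \<le> a2" "a2 \<le> 1"
    using shrink_range[of c1 c2] nk c by (simp_all add: a1_def a2_def)
  have t: "0 < t" "t < 1" using \<epsilon> by (simp_all add: t_def)
  have s: "0 < s" "s \<le> 1 / 20" using t by (simp_all add: s_def)
  have nk': "k1 + k2 < n" "0 < k1" "0 < k2" using nk by (simp_all add: n_def k1_def k2_def)
  define N where "N = n - (k1 + k2) + 1"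
  define g1 where "g1 = k1 / (n - k1 + 1)"
  define \<kappa> where "\<kappa> = k2 / N"
  have g1: "0 \<le> g1" and \<kappa>: "0 \<le> \<kappa>" using nk' by (auto simp: g1_def \<kappa>_def N_def)
  have q: "0 < q" "q \<le> 1" using nk' by (simp_all add: q_def)
  have g1': "1 + g1 = (n + 1) / (n - k1 + 1)" using nk' by (simp add: g1_def field_simps)
  have qg: "q * (1 + g1) \<le> 1"
  proof -
    have "(n - (k1 + k2)) * (n + 1) \<le> n * (n - k1 + 1)"
    proof -
      have "n * (n - k1 + 1) - (n - (k1 + k2)) * (n + 1) = n * k2 + k1 + k2" by (simp add: algebra_simps)
      moreover have "0 \<le> n * k2 + k1 + k2" using nk' by simp
      ultimately show ?thesis by linarith
    qed
    then show ?thesis using nk' unfolding g1' q_def by (simp add: divide_le_eq)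
  qed
  define A where "A = r\<^sup>2"
  define B where "B = (norm d2)\<^sup>2"
  define C where "C = (norm d1)\<^sup>2"
  have ABC: "A > 0" "0 \<le> B" "0 \<le> C" using r by (simp_all add: A_def B_def C_def)
  define qa where "qa = 1 + (1 + g1) * \<kappa> * (1 - a2)\<^sup>2 + g1 * (1 - a1)\<^sup>2"
  define cc where "cc = a2\<^sup>2 + g1 * (a1 - a2)\<^sup>2"
  define Q where "Q = A * qa + B * cc + C * a1\<^sup>2"
  have cc0: "0 \<le> cc" and qa1: "1 \<le> qa"
  proof -
    show "0 \<le> cc" using g1 by (simp add: cc_def)
    have "0 \<le> (1 + g1) * \<kappa> * (1 - a2)\<^sup>2" "0 \<le> g1 * (1 - a1)\<^sup>2" using g1 \<kappa> by (auto intro!: mult_nonneg_nonneg)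
    then show "1 \<le> qa" unfolding qa_def by linarith
  qed
  have AQ: "A \<le> A * qa" using ABC qa1 by simp
  have nn: "0 \<le> B * cc" "0 \<le> C * a1\<^sup>2" using ABC cc0 by auto
  have Qpos: "Q > 0" using AQ nn ABC unfolding Q_def by linarith
  have sq1: "a1\<^sup>2 \<le> 1" "(a1 - a2)\<^sup>2 \<le> 1" using a by (auto simp: abs_square_le_1)
  have lamQ1: "lam * ((A + B + C) * a1\<^sup>2) \<le> Q" and lamQ2: "lam * ((a1 - a2)\<^sup>2 * B) \<le> Q"
  proof -
    have "lam * ((A + B + C) * a1\<^sup>2) \<le> Q \<and> lam * ((a1 - a2)\<^sup>2 * B) \<le> Q"
      using lam(3)
    proof
      assume l: "lam \<le> k1 / (n + 1)"
      have "n - k1 + 1 > 0" using nk' by linarith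
      then have "k1 / (n + 1) = g1 / (1 + g1)" unfolding g1' unfolding g1_def by simp
      with l have l': "lam * (1 + g1) \<le> g1" using g1 by (simp add: pos_le_divide_eq)
      have "(1 + g1) * (lam * a1\<^sup>2) \<le> g1 * a1\<^sup>2" using mult_right_mono[OF l', of "a1\<^sup>2"] by (simp add: mult_ac)
      also have "\<dots> \<le> (1 + g1) * cc" unfolding cc_def by (rule weight_bound)
      finally have "lam * a1\<^sup>2 \<le> cc" using g1 by (simp add: mult_le_cancel_left)
      then have 1: "B * (lam * a1\<^sup>2) \<le> B * cc" using ABC by (intro mult_left_mono) auto
      have "lam * a1\<^sup>2 \<le> 1 * 1" using lam sq1 by (intro mult_mono) auto
      then have 2: "A * (lam * a1\<^sup>2) \<le> A * 1" using ABC by (intro mult_left_mono) auto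
      have 3: "C * (lam * a1\<^sup>2) \<le> C * a1\<^sup>2" using ABC lam by (intro mult_left_mono) (auto simp: mult_left_le_one_le)
      have "lam \<le> lam * (1 + g1)" using lam g1 by simp
      then have "lam \<le> g1" using l' by linarith
      then have "lam * (a1 - a2)\<^sup>2 \<le> g1 * (a1 - a2)\<^sup>2" by (intro mult_right_mono) auto
      also have "\<dots> \<le> cc" by (simp add: cc_def)
      finally have 4: "B * (lam * (a1 - a2)\<^sup>2) \<le> B * cc" using ABC by (intro mult_left_mono) auto
      have "lam * ((A + B + C) * a1\<^sup>2) = A * (lam * a1\<^sup>2) + B * (lam * a1\<^sup>2) + C * (lam * a1\<^sup>2)"
        by (simp add: algebra_simps)
      moreover have "lam * ((a1 - a2)\<^sup>2 * B) = B * (lam * (a1 - a2)\<^sup>2)" by simp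
      ultimately show ?thesis using 1 2 3 4 AQ nn ABC unfolding Q_def by linarith
    next
      assume l: "lam * (r\<^sup>2 + (norm d2)\<^sup>2 + (norm d1)\<^sup>2) \<le> r\<^sup>2"
      then have l': "lam * (A + B + C) \<le> A" by (simp add: A_def B_def C_def)
      have "lam * (A + B + C) * a1\<^sup>2 \<le> lam * (A + B + C) * 1" using sq1 lam ABC by (intro mult_left_mono) auto
      moreover have "lam * ((a1 - a2)\<^sup>2 * B) \<le> lam * (1 * (A + B + C))"
        using sq1 lam ABC by (intro mult_left_mono mult_mono) auto
      ultimately show ?thesis using l' AQ nn unfolding Q_def by (simp add: mult.assoc)
    qed
    then show "lam * ((A + B + C) * a1\<^sup>2) \<le> Q" "lam * ((a1 - a2)\<^sup>2 * B) \<le> Q" by auto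
  qed
  let ?e = "\<delta>2 W1 (v, W2)"
  have e: "?e = vsnd \<delta>" by (simp add: \<delta>2_def \<delta>_def)
  let ?P = "lsq W1 \<psi>" and ?R = "vfst \<delta>"
  have Re: "lsq W1 (comb (1, - ?e) (v, W2)) = ?R" unfolding e by (rule R_eq)
  note G = good[unfolded good_sample_def Let_def fst_conv snd_conv, folded \<psi>_def n_def k1_def k2_def, unfolded Re, folded g1_def N_def \<kappa>_def A_def B_def C_def]
  have "transpose E *v (bz - vjoin ((1 - a2) *\<^sub>R (d1 + r *\<^sub>R ?R) + (a2 - a1) *\<^sub>R (d1 + ?P)) ((1 - a2) *\<^sub>R (d2 + r *\<^sub>R vsnd \<delta>))) = 0"
    using b estimator_whitened[of c1 c2] by (simp add: matrix_vector_mult_diff_distrib a1_def a2_def)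
  then have bz: "bz = vjoin ((1 - a2) *\<^sub>R (d1 + r *\<^sub>R ?R) + (a2 - a1) *\<^sub>R (d1 + ?P)) ((1 - a2) *\<^sub>R (d2 + r *\<^sub>R vsnd \<delta>))"
    using inj by fastforce
  have "vjoin d1 d2 - bz = vjoin (a1 *\<^sub>R d1 - ((1 - a2) * r) *\<^sub>R ?R + (a1 - a2) *\<^sub>R ?P) (a2 *\<^sub>R d2 - ((1 - a2) * r) *\<^sub>R ?e)"
    unfolding bz e by (simp add: vec_eq_iff vjoin_def algebra_simps split: sum.split)
  then have rho: "r\<^sup>2 + (norm (vjoin d1 d2 - bz))\<^sup>2 = r\<^sup>2 + (norm (a2 *\<^sub>R d2 - ((1 - a2) * r) *\<^sub>R ?e))\<^sup>2
      + (norm (a1 *\<^sub>R d1 - ((1 - a2) * r) *\<^sub>R ?R + (a1 - a2) *\<^sub>R ?P))\<^sup>2"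
    by (simp add: norm_vjoin)
  have dev1: "\<bar>r\<^sup>2 + (norm (vjoin d1 d2 - bz))\<^sup>2 - Q\<bar> \<le> 77/10 * s * Q"
    unfolding rho
  proof (rule risk_deviation[OF a r s lam(1,2) q qg g1 \<kappa>])
    show "Q = r\<^sup>2 + ((norm d2)\<^sup>2 * a2\<^sup>2 + r\<^sup>2 * (1 - a2)\<^sup>2 * \<kappa>)
        + g1 * ((1 - a1)\<^sup>2 * r\<^sup>2 + (a1 - a2)\<^sup>2 * (norm d2)\<^sup>2 + (1 - a2)\<^sup>2 * r\<^sup>2 * \<kappa>) + (norm d1)\<^sup>2 * a1\<^sup>2"
      unfolding Q_def qa_def cc_def A_def B_def C_def by (simp add: algebra_simps)
    show "lam * ((a1 - a2)\<^sup>2 * (norm d2)\<^sup>2) \<le> Q" using lamQ2 by (simp only: B_def)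
  qed (use G in \<open>simp_all only: A_def B_def C_def\<close>)
  define s2 where "s2 = A * (norm (v - proj (join W1 W2) v))\<^sup>2 / (n - (k1 + k2))"
  define S1 where "S1 = (norm (\<psi> - proj W1 \<psi>))\<^sup>2 / (n - k1)"
  define S0 where "S0 = (norm Y)\<^sup>2 / n"
  have rh: "\<rho>2_hat c1 c2 X Y = s2 * (qa - cc) + S1 * (cc - a1\<^sup>2) + S0 * a1\<^sup>2"
    using \<rho>2_hat_eq[of c1 c2] nk'
    unfolding s2_def S1_def S0_def qa_def cc_def a1_def a2_def A_def g1_def \<kappa>_def N_def n_def k1_def k2_def by blast
  have scale: "\<bar>x / m - y\<bar> \<le> z" if "\<bar>x - m * y\<bar> \<le> z * m" "0 < m" for x m y z :: real
  proof -
    have "x / m - y = (x - m * y) / m" using that(2) by (simp add: field_simps)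
    then show ?thesis using that by (simp add: abs_divide pos_divide_le_eq)
  qed
  have dev2: "\<bar>\<rho>2_hat c1 c2 X Y - Q\<bar> \<le> 3 * s * Q"
    unfolding rh
  proof (rule estimate_deviation[OF a ABC s(1) lam(1,2) q qg g1 \<kappa> qa_def cc_def Q_def lamQ1])
    have "\<bar>(norm (v - proj (join W1 W2) v))\<^sup>2 / (n - (k1 + k2)) - 1\<bar> \<le> s * q"
      by (rule scale) (use G nk' in auto)
    then have "A * \<bar>(norm (v - proj (join W1 W2) v))\<^sup>2 / (n - (k1 + k2)) - 1\<bar> \<le> A * (s * q)"
      using ABC by (intro mult_left_mono) auto
    moreover have "s2 - A = A * ((norm (v - proj (join W1 W2) v))\<^sup>2 / (n - (k1 + k2)) - 1)"
      by (simp add: s2_def algebra_simps)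
    ultimately show "\<bar>s2 - A\<bar> \<le> s * q * A" using ABC by (simp add: abs_mult mult_ac)
    show "\<bar>S1 - (A + B)\<bar> \<le> s * q * lam * (A + B)"
      unfolding S1_def by (rule scale) (use G nk' in \<open>auto simp: mult_ac\<close>)
    show "\<bar>S0 - (A + B + C)\<bar> \<le> s * lam * (A + B + C)"
      unfolding S0_def by (rule scale) (use G nk' in \<open>auto simp: mult_ac Y_\<psi>\<close>)
  qed
  have "r\<^sup>2 + (norm (vjoin d1 d2 - bz))\<^sup>2 > 0" using r by (intro add_pos_nonneg) auto
  moreover have "\<bar>\<rho>2_hat c1 c2 X Y - (r\<^sup>2 + (norm (vjoin d1 d2 - bz))\<^sup>2)\<bar> < t * (r\<^sup>2 + (norm (vjoin d1 d2 - bz))\<^sup>2)"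
    by (rule relative_deviation[OF t _ Qpos dev1 dev2]) (simp add: s_def)
  ultimately show ?thesis
    by (intro abs_log_ratio_less[OF \<epsilon>, of t]) (simp_all add: t_def)
qed

end

section \<open>Whitening the data-generating process\<close>

text \<open>Gram--Schmidt for the form \<open>S\<close>, with control of supports. Two applications,
  one per block, give a block triangular whitening: vectors of the first block must vanish off that
  block, which a symmetric square root would not provide.\<close>

lemma gram_schmidt_extend:
  fixes S :: "real^'k^'k" and e :: "'k \<Rightarrow> real^'k"
  assumes pd: "\<And>v. v \<noteq> 0 \<Longrightarrow> v \<bullet> (S *v v) > 0" and sym: "transpose S = S"
    and "finite I" "I \<inter> J = {}"
    and e: "\<And>i j. i \<in> J \<Longrightarrow> j \<in> J \<Longrightarrow> e i \<bullet> (S *v e j) = (if i = j then 1 else 0)"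
      "\<And>i l. i \<in> J \<Longrightarrow> l \<notin> J \<Longrightarrow> e i $ l = 0"
  shows "\<exists>e'. (\<forall>i\<in>J. e' i = e i) \<and> (\<forall>i\<in>J \<union> I. \<forall>j\<in>J \<union> I. e' i \<bullet> (S *v e' j) = (if i = j then 1 else 0))
     \<and> (\<forall>i\<in>J \<union> I. \<forall>l. l \<notin> J \<union> I \<longrightarrow> e' i $ l = 0)"
  using assms(3,4)
proof (induction I rule: finite_induct)
  case empty
  then show ?case using e by (intro exI[of _ e]) auto
next
  case (insert k I)
  then obtain f where f: "\<forall>i\<in>J. f i = e i"
    and f1: "\<And>i j. i \<in> J \<union> I \<Longrightarrow> j \<in> J \<union> I \<Longrightarrow> f i \<bullet> (S *v f j) = (if i = j then 1 else 0)"
    and f2: "\<And>i l. i \<in> J \<union> I \<Longrightarrow> l \<notin> J \<union> I \<Longrightarrow> f i $ l = 0" by auto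
  let ?K = "J \<union> I"
  have kK: "k \<notin> ?K" using insert by auto
  have fin: "finite ?K" by simp
  \<comment> \<open>The earlier vectors vanish at coordinate \<open>k\<close>, so
    \<open>w $ k = 1\<close> and \<open>w\<close> is nonzero; no separate independence argument
    arises.\<close>
  define w where "w = axis k 1 - (\<Sum>i\<in>?K. (axis k 1 \<bullet> (S *v f i)) *\<^sub>R f i)"
  have wk: "w $ k = 1" using f2 kK by (simp add: w_def)
  then have "w \<noteq> 0" by auto
  define c where "c = w \<bullet> (S *v w)"
  have c: "c > 0" unfolding c_def by (rule pd) fact
  have symm: "a \<bullet> (S *v b) = b \<bullet> (S *v a)" for a b
    using inner_matrix_vector[of S a b] sym by (simp add: inner_commute)
  have wj: "w \<bullet> (S *v f j) = 0" if "j \<in> ?K" for j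
    using that fin f1 by (simp add: w_def inner_diff_left inner_sum_left if_distrib[of "\<lambda>x. _ * x"] sum.delta' cong: if_cong)
  define u where "u = (1 / sqrt c) *\<^sub>R w"
  have uu: "u \<bullet> (S *v u) = 1" using c by (simp add: u_def matrix_vector_mult_scaleR c_def[symmetric])
  have uj: "u \<bullet> (S *v f j) = 0" "f j \<bullet> (S *v u) = 0" if "j \<in> ?K" for j
    using wj[OF that] symm[of "f j" u] by (simp_all add: u_def)
  have ul: "u $ l = 0" if "l \<notin> J \<union> insert k I" for l
    using that f2 by (simp add: u_def w_def axis_def)
  define g where "g = f(k := u)"
  have gk: "g k = u" "\<And>i. i \<in> ?K \<Longrightarrow> g i = f i" using kK by (auto simp: g_def)
  have K: "J \<union> insert k I = insert k ?K" by blast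
  have "\<forall>i\<in>J. g i = e i" using f gk(2) by auto
  moreover have "g i \<bullet> (S *v g j) = (if i = j then 1 else 0)" if "i \<in> insert k ?K" "j \<in> insert k ?K" for i j
  proof (cases "i = k")
    case True
    then show ?thesis using that uu uj(1) kK gk by (cases "j = k") (metis insertE)+
  next
    case False
    then have i: "i \<in> ?K" using that by blast
    show ?thesis
    proof (cases "j = k")
      case True
      then show ?thesis using False uj(2)[OF i] gk(1) gk(2)[OF i] by simp
    next
      case False
      then have "j \<in> ?K" using that by blast
      then show ?thesis using f1 i gk(2) by simp
    qed
  qed
  moreover have "g i $ l = 0" if "i \<in> insert k ?K" "l \<notin> insert k ?K" for i l
    using that ul f2 gk unfolding K by (cases "i = k") auto
  ultimately show ?case unfolding K by blast
qed

lemma block_whitening: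
  fixes S :: "real^('p::finite + 'q::finite)^('p + 'q)"
  assumes pd: "\<And>v. v \<noteq> 0 \<Longrightarrow> v \<bullet> (S *v v) > 0" and sym: "transpose S = S"
  obtains E :: "real^('p + 'q)^('p + 'q)" where "E ** S ** transpose E = mat 1" "\<And>i j. E $ Inl i $ Inr j = 0"
proof -
  have "\<exists>e' :: 'p + 'q \<Rightarrow> real^('p + 'q). (\<forall>i\<in>{}. e' i = 0) \<and> (\<forall>i\<in>{} \<union> range Inl. \<forall>j\<in>{} \<union> range Inl. e' i \<bullet> (S *v e' j) = (if i = j then 1 else 0))
     \<and> (\<forall>i\<in>{} \<union> range Inl. \<forall>l. l \<notin> {} \<union> range Inl \<longrightarrow> e' i $ l = 0)"
    by (rule gram_schmidt_extend[OF pd sym, where e = "\<lambda>_. 0"]) auto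
  then obtain e :: "'p + 'q \<Rightarrow> real^('p + 'q)" where e: "\<And>i j. i \<in> range Inl \<Longrightarrow> j \<in> range Inl \<Longrightarrow> e i \<bullet> (S *v e j) = (if i = j then 1 else 0)"
    "\<And>i l. i \<in> range Inl \<Longrightarrow> l \<notin> range Inl \<Longrightarrow> e i $ l = 0"
    unfolding Un_empty_left by blast
  have "\<exists>e'. (\<forall>i\<in>range Inl. e' i = e i) \<and> (\<forall>i\<in>range Inl \<union> range Inr. \<forall>j\<in>range Inl \<union> range Inr. e' i \<bullet> (S *v e' j) = (if i = j then 1 else 0))
     \<and> (\<forall>i\<in>range Inl \<union> range Inr. \<forall>l. l \<notin> range Inl \<union> range Inr \<longrightarrow> e' i $ l = 0)"
    by (rule gram_schmidt_extend[OF pd sym _ _ e]) auto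
  then obtain e' where e': "\<forall>i\<in>range Inl. e' i = e i"
    "\<And>i j. i \<in> range Inl \<union> range Inr \<Longrightarrow> j \<in> range Inl \<union> range Inr \<Longrightarrow> e' i \<bullet> (S *v e' j) = (if i = j then 1 else 0)"
    by blast
  have U: "x \<in> range Inl \<union> range Inr" for x :: "'p + 'q" by (cases x) auto
  define E where "E = (\<chi> i. e' i)"
  have "(E ** S ** transpose E) $ i $ j = e' i \<bullet> (S *v e' j)" for i j
    by (simp add: matrix_mul_assoc[symmetric] matrix_matrix_mult_def[of E] inner_vec_def E_def)
       (simp add: matrix_matrix_mult_def matrix_vector_mult_def transpose_def)
  then have "E ** S ** transpose E = mat 1"
    using e'(2)[OF U U] by (simp add: vec_eq_iff mat_def)
  moreover have "E $ Inl i $ Inr j = 0" for i j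
    using e'(1) e(2)[of "Inl i" "Inr j"] by (auto simp: E_def)
  ultimately show ?thesis using that by blast
qed

section \<open>Gaussian variables, Cauchy--Schwarz and independence\<close>

lemma (in prob_space) gaussian_char:
  assumes g: "gaussian_rv M T" and mean: "expectation T = 0" and var: "expectation (\<lambda>\<omega>. (T \<omega>)\<^sup>2) = c"
  shows "(CLINT \<omega>|M. iexp (T \<omega>)) = exp (- c / 2)"
proof -
  have [measurable]: "T \<in> borel_measurable M" using g by (simp add: gaussian_rv_def)
  consider a where "AE \<omega> in M. T \<omega> = a"
    | a \<sigma> where "\<sigma> > 0" "distributed M lborel T (\<lambda>t. ennreal (normal_density a \<sigma> t))"
    using g unfolding gaussian_rv_def by blast
  then show ?thesis
  proof cases
    case (1 a)
    have "expectation T = expectation (\<lambda>_. a)" by (rule integral_cong_AE) (use 1 in auto)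
    then have a: "a = 0" using mean by (simp add: prob_space)
    have "expectation (\<lambda>\<omega>. (T \<omega>)\<^sup>2) = expectation (\<lambda>_. 0)"
      by (rule integral_cong_AE) (use 1 a in auto)
    then have c: "c = 0" using var by simp
    have "(CLINT \<omega>|M. iexp (T \<omega>)) = (CLINT \<omega>|M. 1)"
      by (rule integral_cong_AE) (use 1 a in auto)
    then show ?thesis using c by (simp add: prob_space)
  next
    case (2 a \<sigma>)
    have a: "a = 0" using normal_distributed_expectation[OF 2] mean by simp
    have v: "c = \<sigma>\<^sup>2" using normal_distributed_variance[OF 2] mean var by simp
    have d: "distributed M lborel (\<lambda>\<omega>. T \<omega> / \<sigma>) (\<lambda>t. ennreal (std_normal_density t))"
      using normal_standard_normal_convert[OF 2(1), of T 0] 2(2) a by simp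
    have "distr M borel (\<lambda>\<omega>. T \<omega> / \<sigma>) = distr M lborel (\<lambda>\<omega>. T \<omega> / \<sigma>)" by (rule distr_cong) simp_all
    also have "\<dots> = std_normal_distribution" using d by (simp add: distributed_def)
    finally have D: "distr M borel (\<lambda>\<omega>. T \<omega> / \<sigma>) = std_normal_distribution" .
    have "(CLINT \<omega>|M. iexp (T \<omega>)) = (CLINT \<omega>|M. iexp (\<sigma> * (T \<omega> / \<sigma>)))" using 2(1) by simp
    also have "\<dots> = char (distr M borel (\<lambda>\<omega>. T \<omega> / \<sigma>)) \<sigma>"
      unfolding char_def by (subst integral_distr) simp_all
    also have "\<dots> = exp (- c / 2)" unfolding D v by (simp add: char_std_normal_distribution exp_of_real)
    finally show ?thesis .
  qed
qed

lemma (in prob_space) gaussian_square_integrable: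
  assumes g: "gaussian_rv M T"
  shows "integrable M (\<lambda>\<omega>. (T \<omega>)\<^sup>2)"
proof -
  have [measurable]: "T \<in> borel_measurable M" using g by (simp add: gaussian_rv_def)
  consider a where "AE \<omega> in M. T \<omega> = a"
    | a \<sigma> where "\<sigma> > 0" "distributed M lborel T (\<lambda>t. ennreal (normal_density a \<sigma> t))"
    using g unfolding gaussian_rv_def by blast
  then show ?thesis
  proof cases
    case (1 a)
    show ?thesis
      by (rule integrable_const_bound[where B = "a\<^sup>2"]) (use 1 in auto)
  next
    case (2 a \<sigma>)
    have d: "distributed M lborel (\<lambda>\<omega>. (T \<omega> - a) / \<sigma>) (\<lambda>t. ennreal (std_normal_density t))"
      using normal_standard_normal_convert[OF 2(1), of T a] 2(2) by simp
    have 1: "integrable M (\<lambda>\<omega>. ((T \<omega> - a) / \<sigma>)\<^sup>2)"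
      by (subst distributed_integrable[OF d, of "\<lambda>t. t\<^sup>2", symmetric])
         (use integrable_std_normal_moment[of 2] in simp_all)
    have i2: "integrable M (\<lambda>\<omega>. (T \<omega> - a) / \<sigma>)"
      by (subst distributed_integrable[OF d, of "\<lambda>t. t", symmetric])
         (use integrable_std_normal_moment[of 1] in simp_all)
    have "(T \<omega>)\<^sup>2 = \<sigma>\<^sup>2 * ((T \<omega> - a) / \<sigma>)\<^sup>2 + 2 * a * \<sigma> * ((T \<omega> - a) / \<sigma>) + a\<^sup>2" for \<omega>
      using 2(1) by (simp add: field_simps power2_eq_square)
    moreover have "integrable M (\<lambda>\<omega>. \<sigma>\<^sup>2 * ((T \<omega> - a) / \<sigma>)\<^sup>2 + 2 * a * \<sigma> * ((T \<omega> - a) / \<sigma>) + a\<^sup>2)"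
      by (intro Bochner_Integration.integrable_add integrable_mult_right 1 i2) simp
    ultimately show ?thesis by (simp only:)
  qed
qed

lemma (in prob_space) integrable_mult_square:
  assumes [measurable]: "f \<in> borel_measurable M" "g \<in> borel_measurable M"
    and f: "integrable M (\<lambda>\<omega>. (f \<omega>)\<^sup>2)" and g: "integrable M (\<lambda>\<omega>. (g \<omega>)\<^sup>2 :: real)"
  shows "integrable M (\<lambda>\<omega>. f \<omega> * g \<omega>)"
proof (rule Bochner_Integration.integrable_bound[of M "\<lambda>\<omega>. (f \<omega>)\<^sup>2 + (g \<omega>)\<^sup>2"])
  have "\<bar>f \<omega> * g \<omega>\<bar> \<le> (f \<omega>)\<^sup>2 + (g \<omega>)\<^sup>2" for \<omega>
    using abs_mult_le_sum_squares[of "f \<omega>" "g \<omega>"] zero_le_power2[of "f \<omega>"] zero_le_power2[of "g \<omega>"] by linarith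
  then show "AE \<omega> in M. norm (f \<omega> * g \<omega>) \<le> norm ((f \<omega>)\<^sup>2 + (g \<omega>)\<^sup>2)" by simp
qed (use f g in auto)

lemma (in prob_space) expectation_sq_le:
  assumes [measurable]: "f \<in> borel_measurable M" and f: "integrable M (\<lambda>\<omega>. (f \<omega>)\<^sup>2 :: real)"
  shows "(expectation f)\<^sup>2 \<le> expectation (\<lambda>\<omega>. (f \<omega>)\<^sup>2)"
proof -
  have i: "integrable M f" by (rule square_integrable_imp_integrable[OF _ f]) simp
  have "0 \<le> expectation (\<lambda>\<omega>. (f \<omega> - expectation f)\<^sup>2)" by (rule integral_nonneg_AE) simp
  also have "\<dots> = expectation (\<lambda>\<omega>. (f \<omega>)\<^sup>2) - (expectation f)\<^sup>2"
    by (rule variance_eq[OF i f])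
  finally show ?thesis by simp
qed

lemma (in prob_space) expectation_mult_sq_le:
  assumes [measurable]: "f \<in> borel_measurable M" "g \<in> borel_measurable M"
    and f: "integrable M (\<lambda>\<omega>. (f \<omega>)\<^sup>2)" and g: "integrable M (\<lambda>\<omega>. (g \<omega>)\<^sup>2 :: real)"
  shows "(expectation (\<lambda>\<omega>. f \<omega> * g \<omega>))\<^sup>2 \<le> expectation (\<lambda>\<omega>. (f \<omega>)\<^sup>2) * expectation (\<lambda>\<omega>. (g \<omega>)\<^sup>2)"
proof -
  let ?a = "expectation (\<lambda>\<omega>. (f \<omega>)\<^sup>2)" and ?b = "expectation (\<lambda>\<omega>. (g \<omega>)\<^sup>2)" and ?c = "expectation (\<lambda>\<omega>. f \<omega> * g \<omega>)"
  have fg: "integrable M (\<lambda>\<omega>. f \<omega> * g \<omega>)" by (rule integrable_mult_square) fact+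
  have q: "0 \<le> t\<^sup>2 * ?a - 2 * t * ?c + ?b" for t
  proof -
    have "0 \<le> expectation (\<lambda>\<omega>. (t * f \<omega> - g \<omega>)\<^sup>2)" by (rule integral_nonneg_AE) simp
    also have "(\<lambda>\<omega>. (t * f \<omega> - g \<omega>)\<^sup>2) = (\<lambda>\<omega>. t\<^sup>2 * (f \<omega>)\<^sup>2 - 2 * t * (f \<omega> * g \<omega>) + (g \<omega>)\<^sup>2)"
      by (auto simp: power2_eq_square algebra_simps)
    also have "expectation \<dots> = t\<^sup>2 * ?a - 2 * t * ?c + ?b" using f g fg by simp
    finally show ?thesis .
  qed
  have a0: "0 \<le> ?a" by (rule integral_nonneg_AE) simp
  show ?thesis
  proof (cases "?a = 0")
    case True
    have "?c = 0"
    proof (rule ccontr)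
      assume "?c \<noteq> 0"
      \<comment> \<open>At this argument the polynomial, which is affine when \<open>?a = 0\<close>,
        has the value -1.\<close>
      then show False using q[of "(?b + 1) / (2 * ?c)"] True by (simp add: field_simps)
    qed
    then show ?thesis using True by simp
  next
    case False
    then have "0 < ?a" using a0 by linarith
    have "0 \<le> ?a * ((?c / ?a)\<^sup>2 * ?a - 2 * (?c / ?a) * ?c + ?b)" by (rule mult_nonneg_nonneg[OF less_imp_le[OF \<open>0 < ?a\<close>] q])
    also have "\<dots> = ?a * ?b - ?c\<^sup>2" using \<open>0 < ?a\<close> by (simp add: power2_eq_square field_simps)
    finally show ?thesis by simp
  qed
qed

text \<open>Events about a function of \<open>X\<close> belong to the sigma-algebra generated by
  \<open>X\<close>. This connects independence of elements of different types with
  \<open>indep_var\<close>.\<close>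

lemma (in prob_space) indep_elements_indep_var:
  assumes "indep_elements M S X T Z" and g: "g \<in> measurable S S'" and h: "h \<in> measurable T T'"
  shows "indep_var S' (\<lambda>\<omega>. g (X \<omega>)) T' (\<lambda>\<omega>. h (Z \<omega>))"
proof -
  have X: "X \<in> measurable M S" and Z: "Z \<in> measurable M T"
    and ind: "indep_set (sets (vimage_algebra (space M) X S)) (sets (vimage_algebra (space M) Z T))"
    using assms(1) by (auto simp: indep_elements_def)
  have sub: "sigma_sets (space M) {(\<lambda>\<omega>. g (X \<omega>)) -` A \<inter> space M | A. A \<in> sets S'} \<subseteq> sets (vimage_algebra (space M) X S)"
    if g: "g \<in> measurable S S'" and X: "X \<in> measurable M S" for g :: "'x \<Rightarrow> 'y" and X S S'
  proof -
    have "space (vimage_algebra (space M) X S) = space M" by simp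
    have "(\<lambda>\<omega>. g (X \<omega>)) -` A \<inter> space M \<in> sets (vimage_algebra (space M) X S)" if "A \<in> sets S'" for A
    proof -
      have "(\<lambda>\<omega>. g (X \<omega>)) -` A \<inter> space M = X -` (g -` A \<inter> space S) \<inter> space M"
        using measurable_space[OF X] by auto
      then show ?thesis
        using in_vimage_algebra[OF measurable_sets[OF g that], of X "space M"] by simp
    qed
    then show ?thesis
      using sets.sigma_sets_subset[of "{(\<lambda>\<omega>. g (X \<omega>)) -` A \<inter> space M | A. A \<in> sets S'}" "vimage_algebra (space M) X S"] by auto
  qed
  have "indep_set (sigma_sets (space M) {(\<lambda>\<omega>. g (X \<omega>)) -` A \<inter> space M | A. A \<in> sets S'})
      (sigma_sets (space M) {(\<lambda>\<omega>. h (Z \<omega>)) -` A \<inter> space M | A. A \<in> sets T'})"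
    using ind sub[OF g X] sub[OF h Z] unfolding indep_set_def
    by (elim indep_sets_mono_sets) (auto split: bool.split)
  then show ?thesis
    unfolding indep_var_eq using measurable_compose[OF X g] measurable_compose[OF Z h] by simp
qed

section \<open>Moments of the data-generating process\<close>

context regression_dgp
begin

lemma y_gaussian: "gaussian_rv M y"
  using gaussian[unfolded jointly_gaussian_def, rule_format, of "{None}" "\<lambda>_. 1"] by simp

lemma y_sq_integrable: "integrable M (\<lambda>\<omega>. (y \<omega>)\<^sup>2)"
  by (rule gaussian_square_integrable[OF y_gaussian])

lemma x_integrable: "integrable M (x i)"
  by (rule square_integrable_imp_integrable[OF x_measurable x_sq_integrable])

lemma y_integrable: "integrable M y"
  by (rule square_integrable_imp_integrable[OF y_measurable y_sq_integrable])

lemma u_integrable: "integrable M u"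
  by (rule square_integrable_imp_integrable[OF u_measurable u_sq_integrable])

lemmas dgp_measurable [measurable] = x_measurable y_measurable u_measurable

lemma xx_integrable: "integrable M (\<lambda>\<omega>. x i \<omega> * x j \<omega>)"
  by (rule integrable_mult_square) (auto intro: x_sq_integrable)

lemma yx_integrable: "integrable M (\<lambda>\<omega>. y \<omega> * x i \<omega>)"
  by (rule integrable_mult_square) (auto intro: x_sq_integrable y_sq_integrable)

lemma ux_integrable: "integrable M (\<lambda>\<omega>. u \<omega> * x i \<omega>)"
  by (rule integrable_mult_square) (auto intro: x_sq_integrable u_sq_integrable)

lemma uy_integrable: "integrable M (\<lambda>\<omega>. u \<omega> * y \<omega>)"
  by (rule integrable_mult_square) (auto intro: y_sq_integrable u_sq_integrable)

lemma expectation_u_sq: "expectation (\<lambda>\<omega>. (u \<omega>)\<^sup>2) = \<sigma>2"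
  using u_variance u_mean by simp

lemma expectation_u_x: "expectation (\<lambda>\<omega>. u \<omega> * x i \<omega>) = 0"
proof -
  have "indep_var borel (\<lambda>\<omega>. (\<lambda>t. t) (u \<omega>)) borel (\<lambda>\<omega>. (\<lambda>f. f i) (\<lambda>i. x i \<omega>))"
    by (rule indep_elements_indep_var[OF u_x_indep]) simp_all
  then have "indep_var borel u borel (x i)" by simp
  from indep_var_lebesgue_integral[OF this u_integrable x_integrable] show ?thesis
    using u_mean by simp
qed

definition "remainder N \<omega> = y \<omega> - u \<omega> - (\<Sum>i<N. x i \<omega> * \<beta> i)"

lemma remainder_sq_integrable: "integrable M (\<lambda>\<omega>. (remainder N \<omega>)\<^sup>2)"
proof -
  have "(remainder N \<omega>)\<^sup>2 = (y \<omega>)\<^sup>2 + (u \<omega>)\<^sup>2 - 2 * (u \<omega> * y \<omega>) - 2 * (\<Sum>i<N. \<beta> i * (y \<omega> * x i \<omega>)) + 2 * (\<Sum>i<N. \<beta> i * (u \<omega> * x i \<omega>))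
      + (\<Sum>i<N. \<Sum>j<N. \<beta> i * \<beta> j * (x i \<omega> * x j \<omega>))" for \<omega>
  proof -
    have "(\<Sum>i<N. x i \<omega> * \<beta> i)\<^sup>2 = (\<Sum>i<N. \<Sum>j<N. \<beta> i * \<beta> j * (x i \<omega> * x j \<omega>))"
      by (simp add: power2_eq_square sum_product mult_ac)
    moreover have "(\<Sum>i<N. \<beta> i * (y \<omega> * x i \<omega>)) = y \<omega> * (\<Sum>i<N. x i \<omega> * \<beta> i)"
      "(\<Sum>i<N. \<beta> i * (u \<omega> * x i \<omega>)) = u \<omega> * (\<Sum>i<N. x i \<omega> * \<beta> i)"
      by (simp_all add: sum_distrib_left mult_ac)
    ultimately show ?thesis by (simp add: remainder_def power2_eq_square algebra_simps)
  qed
  then show ?thesis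
    by (simp only:) (intro Bochner_Integration.integrable_add Bochner_Integration.integrable_diff integrable_mult_right
      Bochner_Integration.integrable_sum y_sq_integrable u_sq_integrable uy_integrable yx_integrable ux_integrable xx_integrable)
qed

lemma remainder_measurable [measurable]: "remainder N \<in> borel_measurable M"
  unfolding remainder_def[abs_def] by measurable

lemma remainder_tendsto: "(\<lambda>N. expectation (\<lambda>\<omega>. (remainder N \<omega>)\<^sup>2)) \<longlonglongrightarrow> 0"
proof -
  have "(\<lambda>N. ennreal (expectation (\<lambda>\<omega>. (remainder N \<omega>)\<^sup>2))) \<longlonglongrightarrow> ennreal 0"
    using series nn_integral_eq_integral[OF remainder_sq_integrable] by (simp add: remainder_def)
  then show ?thesis
    by (subst (asm) tendsto_ennreal_iff) (auto intro!: always_eventually integral_nonneg_AE)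
qed

text \<open>Noise and regressors being centred, every remainder of the series has the same mean as
  \<open>y\<close>, while its second moment tends to 0.\<close>

lemma expectation_y: "expectation y = 0"
proof -
  have "expectation (remainder N) = expectation y" for N
  proof -
    have "expectation (remainder N) = expectation y - expectation u - (\<Sum>i<N. expectation (x i) * \<beta> i)"
      unfolding remainder_def using y_integrable u_integrable x_integrable by simp
    then show ?thesis by (simp add: u_mean x_centered)
  qed
  then have "(expectation y)\<^sup>2 \<le> expectation (\<lambda>\<omega>. (remainder N \<omega>)\<^sup>2)" for N
    using expectation_sq_le[OF remainder_measurable remainder_sq_integrable, of N] by simp
  then have "(expectation y)\<^sup>2 \<le> 0"
    by (intro LIMSEQ_le_const[OF remainder_tendsto]) auto
  then show ?thesis by simp
qed

text \<open>Cauchy--Schwarz for \<open>u\<close> and the remainder of the series. The covariance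
  serves in \<open>whitening\<close> to keep the unexplained variance away from 0.\<close>

lemma expectation_u_y: "expectation (\<lambda>\<omega>. u \<omega> * y \<omega>) = \<sigma>2"
proof -
  have "expectation (\<lambda>\<omega>. u \<omega> * remainder N \<omega>) = expectation (\<lambda>\<omega>. u \<omega> * y \<omega>) - \<sigma>2" for N
  proof -
    have "u \<omega> * remainder N \<omega> = u \<omega> * y \<omega> - (u \<omega>)\<^sup>2 - (\<Sum>i<N. \<beta> i * (u \<omega> * x i \<omega>))" for \<omega>
      by (simp add: remainder_def power2_eq_square algebra_simps sum_distrib_left)
    then have "expectation (\<lambda>\<omega>. u \<omega> * remainder N \<omega>) = expectation (\<lambda>\<omega>. u \<omega> * y \<omega>) - expectation (\<lambda>\<omega>. (u \<omega>)\<^sup>2) - (\<Sum>i<N. \<beta> i * expectation (\<lambda>\<omega>. u \<omega> * x i \<omega>))"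
      using uy_integrable u_sq_integrable ux_integrable by simp
    then show ?thesis by (simp add: expectation_u_sq expectation_u_x)
  qed
  then have "(expectation (\<lambda>\<omega>. u \<omega> * y \<omega>) - \<sigma>2)\<^sup>2 \<le> expectation (\<lambda>\<omega>. (u \<omega>)\<^sup>2) * expectation (\<lambda>\<omega>. (remainder N \<omega>)\<^sup>2)" for N
    using expectation_mult_sq_le[OF u_measurable remainder_measurable u_sq_integrable remainder_sq_integrable, of N] by simp
  moreover have "(\<lambda>N. expectation (\<lambda>\<omega>. (u \<omega>)\<^sup>2) * expectation (\<lambda>\<omega>. (remainder N \<omega>)\<^sup>2)) \<longlonglongrightarrow> expectation (\<lambda>\<omega>. (u \<omega>)\<^sup>2) * 0"
    by (intro tendsto_intros remainder_tendsto)
  ultimately have "(expectation (\<lambda>\<omega>. u \<omega> * y \<omega>) - \<sigma>2)\<^sup>2 \<le> expectation (\<lambda>\<omega>. (u \<omega>)\<^sup>2) * 0"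
    by (intro LIMSEQ_le_const) auto
  then show ?thesis by simp
qed

lemma subvec_inner: "a \<bullet> subvec s x \<omega> = (\<Sum>k\<in>UNIV. a $ k * x (s k) \<omega>)"
  by (simp add: inner_vec_def subvec_def)

lemma subvec_inner_measurable [measurable]: "(\<lambda>\<omega>. a \<bullet> subvec s x \<omega>) \<in> borel_measurable M"
  unfolding subvec_inner by measurable

lemma subvec_inner_integrable: "integrable M (\<lambda>\<omega>. a \<bullet> subvec s x \<omega>)"
  unfolding subvec_inner using x_integrable by simp

lemma subvec_inner_mean: "expectation (\<lambda>\<omega>. a \<bullet> subvec s x \<omega>) = 0"
  unfolding subvec_inner using x_integrable x_centered by simp

lemma subvec_inner_mult:
  "integrable M (\<lambda>\<omega>. (a \<bullet> subvec s x \<omega>) * (b \<bullet> subvec s x \<omega>))"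
  "expectation (\<lambda>\<omega>. (a \<bullet> subvec s x \<omega>) * (b \<bullet> subvec s x \<omega>)) = a \<bullet> (subcov M s x *v b)"
proof -
  have e: "(a \<bullet> subvec s x \<omega>) * (b \<bullet> subvec s x \<omega>) = (\<Sum>k\<in>UNIV. \<Sum>l\<in>UNIV. a $ k * b $ l * (x (s k) \<omega> * x (s l) \<omega>))" for \<omega>
    by (simp add: subvec_inner sum_product mult_ac)
  show "integrable M (\<lambda>\<omega>. (a \<bullet> subvec s x \<omega>) * (b \<bullet> subvec s x \<omega>))"
    unfolding e using xx_integrable by simp
  have "expectation (\<lambda>\<omega>. (a \<bullet> subvec s x \<omega>) * (b \<bullet> subvec s x \<omega>)) = (\<Sum>k\<in>UNIV. \<Sum>l\<in>UNIV. a $ k * b $ l * second_moment M x (s k) (s l))"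
    unfolding e using xx_integrable by (simp add: second_moment_def)
  also have "\<dots> = a \<bullet> (subcov M s x *v b)"
    by (simp add: inner_vec_def matrix_vector_mult_def subcov_def sum_distrib_left mult_ac)
  finally show "expectation (\<lambda>\<omega>. (a \<bullet> subvec s x \<omega>) * (b \<bullet> subvec s x \<omega>)) = a \<bullet> (subcov M s x *v b)" .
qed

lemma y_subvec_integrable: "integrable M (\<lambda>\<omega>. y \<omega> * (a \<bullet> subvec s x \<omega>))"
  unfolding subvec_inner sum_distrib_left mult.left_commute[of "y _"] using yx_integrable by simp

lemma subcov_sym: "transpose (subcov M s x) = subcov M s x"
  by (simp add: vec_eq_iff transpose_def subcov_def second_moment_def mult.commute)

lemma subcov_pos_def:
  assumes s: "inj s" and v: "v \<noteq> 0"
  shows "v \<bullet> (subcov M s x *v v) > 0"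
proof -
  define v' where "v' i = v $ (inv s i)" for i
  obtain k where k: "v $ k \<noteq> 0" using v by (auto simp: vec_eq_iff)
  have v's: "v' (s k) = v $ k" for k using s by (simp add: v'_def)
  have "(\<Sum>i\<in>range s. \<Sum>j\<in>range s. v' i * second_moment M x i j * v' j) > 0"
    by (rule covariance_pos_def) (use k v's in auto)
  also have "(\<Sum>i\<in>range s. \<Sum>j\<in>range s. v' i * second_moment M x i j * v' j) = v \<bullet> (subcov M s x *v v)"
    by (simp only: sum.reindex[OF s] o_def v's inner_vec_def matrix_vector_mult_def subcov_def sum_distrib_left
      vec_lambda_beta inner_real_def mult.assoc)
  finally show ?thesis .
qed

lemma gaussian_combination:
  assumes s: "inj s"
  shows "gaussian_rv M (\<lambda>\<omega>. \<alpha> * y \<omega> + e \<bullet> subvec s x \<omega>)"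
proof -
  define a where "a i = (case i of None \<Rightarrow> \<alpha> | Some n \<Rightarrow> e $ (inv s n))" for i
  have "gaussian_rv M (\<lambda>\<omega>. \<Sum>i\<in>insert None (Some ` range s). a i * (case_option y x) i \<omega>)"
    by (rule gaussian[unfolded jointly_gaussian_def, rule_format]) simp
  also have "(\<lambda>\<omega>. \<Sum>i\<in>insert None (Some ` range s). a i * (case_option y x) i \<omega>) = (\<lambda>\<omega>. \<alpha> * y \<omega> + e \<bullet> subvec s x \<omega>)"
  proof
    fix \<omega>
    have "(\<Sum>i\<in>insert None (Some ` range s). a i * (case_option y x) i \<omega>) = \<alpha> * y \<omega> + (\<Sum>i\<in>Some ` range s. a i * (case_option y x) i \<omega>)"
      by (subst sum.insert) (auto simp: a_def)
    also have "(\<Sum>i\<in>Some ` range s. a i * (case_option y x) i \<omega>) = (\<Sum>k\<in>UNIV. e $ k * x (s k) \<omega>)"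
      by (subst sum.reindex) (auto simp: sum.reindex[OF s] a_def s)
    finally show "(\<Sum>i\<in>insert None (Some ` range s). a i * (case_option y x) i \<omega>) = \<alpha> * y \<omega> + e \<bullet> subvec s x \<omega>"
      by (simp add: subvec_inner)
  qed
  finally show ?thesis .
qed

text \<open>\<open>d\<close> consists of the covariances of \<open>y\<close> with the whitened
  regressors, and \<open>r\<^sup>2\<close> is the residual variance. The residual has covariance
  \<open>\<sigma>2\<close> with \<open>u\<close>, so Cauchy--Schwarz gives
  \<open>r\<^sup>2 \<ge> \<sigma>2\<close>, hence positivity. Every linear combination is a centred
  Gaussian variable, so its variance alone determines the joint characteristic function.\<close>

theorem whitening:
  fixes s :: "'p::finite + 'q::finite \<Rightarrow> nat"
  assumes s: "inj s"
  obtains E :: "real^('p + 'q)^('p + 'q)" and d :: "real^('p + 'q)" and r :: real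
  where "r > 0" "E ** subcov M s x ** transpose E = mat 1" "\<And>i j. E $ Inl i $ Inr j = 0"
    "\<And>a b. (CLINT \<omega>|M. iexp (a * ((y \<omega> - d \<bullet> (E *v subvec s x \<omega>)) / r) + b \<bullet> (E *v subvec s x \<omega>))) = exp (- (a\<^sup>2 + (norm b)\<^sup>2) / 2)"
    "\<And>c. integrable M (\<lambda>\<omega>. (y \<omega> - c \<bullet> (E *v subvec s x \<omega>))\<^sup>2)"
    "\<And>c. expectation (\<lambda>\<omega>. (y \<omega> - c \<bullet> (E *v subvec s x \<omega>))\<^sup>2) = r\<^sup>2 + (norm (d - c))\<^sup>2"
proof -
  let ?S = "subcov M s x"
  obtain E :: "real^('p + 'q)^('p + 'q)" where E: "E ** ?S ** transpose E = mat 1" "\<And>i j. E $ Inl i $ Inr j = 0"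
    using block_whitening[OF subcov_pos_def[OF s] subcov_sym] by blast
  let ?z = "\<lambda>\<omega>. E *v subvec s x \<omega>"
  have cz: "c \<bullet> ?z \<omega> = (transpose E *v c) \<bullet> subvec s x \<omega>" for c \<omega>
    by (simp add: inner_matrix_vector[of "transpose E"])
  have zz: "expectation (\<lambda>\<omega>. (a \<bullet> ?z \<omega>) * (b \<bullet> ?z \<omega>)) = a \<bullet> b" for a b
  proof -
    have "expectation (\<lambda>\<omega>. (a \<bullet> ?z \<omega>) * (b \<bullet> ?z \<omega>)) = (transpose E *v a) \<bullet> (?S *v (transpose E *v b))"
      unfolding cz by (rule subvec_inner_mult)
    also have "\<dots> = a \<bullet> ((E ** ?S ** transpose E) *v b)"
      by (simp add: inner_matrix_vector matrix_vector_mul_assoc matrix_mul_assoc)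
    finally show ?thesis by (simp add: E)
  qed
  have zi: "integrable M (\<lambda>\<omega>. (a \<bullet> ?z \<omega>) * (b \<bullet> ?z \<omega>))" for a b
    unfolding cz by (rule subvec_inner_mult)
  have yzi: "integrable M (\<lambda>\<omega>. y \<omega> * (c \<bullet> ?z \<omega>))" for c
    unfolding cz by (rule y_subvec_integrable)
  define d where "d = (\<chi> i. expectation (\<lambda>\<omega>. y \<omega> * (axis i 1 \<bullet> ?z \<omega>)))"
  have yz: "expectation (\<lambda>\<omega>. y \<omega> * (c \<bullet> ?z \<omega>)) = d \<bullet> c" for c
  proof -
    have "y \<omega> * (c \<bullet> ?z \<omega>) = (\<Sum>i\<in>UNIV. c $ i * (y \<omega> * (axis i 1 \<bullet> ?z \<omega>)))" for \<omega>
      by (simp add: inner_vec_def[of c] sum_distrib_left inner_axis' mult_ac)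
    then have "expectation (\<lambda>\<omega>. y \<omega> * (c \<bullet> ?z \<omega>)) = (\<Sum>i\<in>UNIV. c $ i * expectation (\<lambda>\<omega>. y \<omega> * (axis i 1 \<bullet> ?z \<omega>)))"
      using yzi by simp
    then show ?thesis by (simp add: d_def inner_vec_def mult.commute)
  qed
  define Y2 where "Y2 = expectation (\<lambda>\<omega>. (y \<omega>)\<^sup>2)"
  have sq: "integrable M (\<lambda>\<omega>. (\<alpha> * y \<omega> + b \<bullet> ?z \<omega>)\<^sup>2)"
    "expectation (\<lambda>\<omega>. (\<alpha> * y \<omega> + b \<bullet> ?z \<omega>)\<^sup>2) = \<alpha>\<^sup>2 * Y2 + 2 * \<alpha> * (d \<bullet> b) + b \<bullet> b" for \<alpha> b
  proof -
    have e: "(\<alpha> * y \<omega> + b \<bullet> ?z \<omega>)\<^sup>2 = \<alpha>\<^sup>2 * (y \<omega>)\<^sup>2 + 2 * \<alpha> * (y \<omega> * (b \<bullet> ?z \<omega>)) + (b \<bullet> ?z \<omega>) * (b \<bullet> ?z \<omega>)" for \<omega>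
      by (simp add: power2_eq_square algebra_simps)
    show "integrable M (\<lambda>\<omega>. (\<alpha> * y \<omega> + b \<bullet> ?z \<omega>)\<^sup>2)"
      unfolding e using y_sq_integrable yzi zi by (intro Bochner_Integration.integrable_add integrable_mult_right)
    show "expectation (\<lambda>\<omega>. (\<alpha> * y \<omega> + b \<bullet> ?z \<omega>)\<^sup>2) = \<alpha>\<^sup>2 * Y2 + 2 * \<alpha> * (d \<bullet> b) + b \<bullet> b"
      unfolding e Y2_def using y_sq_integrable yzi zi by (simp add: yz zz)
  qed
  define A where "A = Y2 - d \<bullet> d"
  have res: "integrable M (\<lambda>\<omega>. (y \<omega> - c \<bullet> ?z \<omega>)\<^sup>2)"
    "expectation (\<lambda>\<omega>. (y \<omega> - c \<bullet> ?z \<omega>)\<^sup>2) = A + (norm (d - c))\<^sup>2" for c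
    using sq(1)[of 1 "- c"] sq(2)[of 1 "- c"]
    by (simp_all add: A_def power2_norm_eq_inner inner_diff_left inner_diff_right inner_commute)
  have "\<sigma>2\<^sup>2 \<le> \<sigma>2 * A"
  proof -
    have m: "(\<lambda>\<omega>. y \<omega> - d \<bullet> ?z \<omega>) \<in> borel_measurable M" unfolding cz by (intro borel_measurable_diff y_measurable subvec_inner_measurable)
    have e: "u \<omega> * (y \<omega> - d \<bullet> ?z \<omega>) = u \<omega> * y \<omega> - (\<Sum>k\<in>UNIV. (transpose E *v d) $ k * (u \<omega> * x (s k) \<omega>))" for \<omega>
      unfolding cz subvec_inner by (simp add: algebra_simps sum_distrib_left)
    have "expectation (\<lambda>\<omega>. u \<omega> * (y \<omega> - d \<bullet> ?z \<omega>)) = \<sigma>2"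
      unfolding e using uy_integrable ux_integrable by (simp add: expectation_u_y expectation_u_x)
    then show ?thesis
      using expectation_mult_sq_le[OF u_measurable m u_sq_integrable res(1)] res(2)[of d] by (simp add: expectation_u_sq)
  qed
  then have "\<sigma>2 \<le> A" using \<sigma>2_pos by (simp add: power2_eq_square)
  then have A: "A > 0" using \<sigma>2_pos by simp
  define r where "r = sqrt A"
  have r: "r > 0" "r\<^sup>2 = A" using A by (simp_all add: r_def)
  show ?thesis
  proof (rule that[OF r(1) E])
    show "integrable M (\<lambda>\<omega>. (y \<omega> - c \<bullet> ?z \<omega>)\<^sup>2)" for c by (rule res)
    show "expectation (\<lambda>\<omega>. (y \<omega> - c \<bullet> ?z \<omega>)\<^sup>2) = r\<^sup>2 + (norm (d - c))\<^sup>2" for c by (simp add: res r)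
    show "(CLINT \<omega>|M. iexp (a * ((y \<omega> - d \<bullet> ?z \<omega>) / r) + b \<bullet> ?z \<omega>)) = exp (- (a\<^sup>2 + (norm b)\<^sup>2) / 2)" for a b
    proof -
      define \<alpha> where "\<alpha> = a / r"
      define b' where "b' = b - \<alpha> *\<^sub>R d"
      have e: "a * ((y \<omega> - d \<bullet> ?z \<omega>) / r) + b \<bullet> ?z \<omega> = \<alpha> * y \<omega> + b' \<bullet> ?z \<omega>" for \<omega>
        using r by (simp add: \<alpha>_def b'_def inner_diff_left field_simps)
      have g: "gaussian_rv M (\<lambda>\<omega>. \<alpha> * y \<omega> + b' \<bullet> ?z \<omega>)"
        unfolding cz by (rule gaussian_combination[OF s])
      have m: "expectation (\<lambda>\<omega>. \<alpha> * y \<omega> + b' \<bullet> ?z \<omega>) = 0"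
        unfolding cz by (subst Bochner_Integration.integral_add)
          (intro integrable_mult_right y_integrable subvec_inner_integrable | simp add: expectation_y subvec_inner_mean)+
      have "\<alpha>\<^sup>2 * Y2 + 2 * \<alpha> * (d \<bullet> b') + b' \<bullet> b' = \<alpha>\<^sup>2 * A + b \<bullet> b"
        by (simp add: b'_def A_def inner_diff_left inner_diff_right inner_commute power2_eq_square algebra_simps)
      also have "\<alpha>\<^sup>2 * A = a\<^sup>2" using r A by (simp add: \<alpha>_def power_divide)
      finally have "expectation (\<lambda>\<omega>. (\<alpha> * y \<omega> + b' \<bullet> ?z \<omega>)\<^sup>2) = a\<^sup>2 + (norm b)\<^sup>2"
        by (simp add: sq power2_norm_eq_inner)
      from gaussian_char[OF g m this] show ?thesis unfolding e .
    qed
  qed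
qed

end

section \<open>The law of the sample and the prediction error\<close>

lemma borel_measurable_vec_lambda:
  fixes f :: "'a \<Rightarrow> 'i::finite \<Rightarrow> 'b::euclidean_space"
  assumes "\<And>i. (\<lambda>\<omega>. f \<omega> i) \<in> borel_measurable M"
  shows "(\<lambda>\<omega>. \<chi> i. f \<omega> i) \<in> borel_measurable M"
proof -
  have "continuous_on UNIV (axis i :: 'b \<Rightarrow> 'b^'i)" for i :: 'i
  proof -
    have "continuous_on UNIV (\<lambda>x::'b. if j = i then x else 0)" for j by (cases "j = i") auto
    then show ?thesis unfolding axis_def by (intro continuous_on_vec_lambda)
  qed
  then have "(axis i :: 'b \<Rightarrow> 'b^'i) \<in> borel_measurable borel" for i
    by (rule borel_measurable_continuous_onI)
  from measurable_compose[OF assms this] have "(\<lambda>\<omega>. \<Sum>i\<in>UNIV. axis i (f \<omega> i)) \<in> borel_measurable M"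
    by (intro borel_measurable_sum) auto
  also have "(\<lambda>\<omega>. \<Sum>i\<in>UNIV. axis i (f \<omega> i)) = (\<lambda>\<omega>. \<chi> i. f \<omega> i)"
    by (auto simp: fun_eq_iff vec_eq_iff axis_def)
  finally show ?thesis .
qed

section \<open>Conditioning on an independent element\<close>

context prob_space
begin

lemma indep_elements_joint_law:
  assumes "indep_elements M S X T Z"
  shows "distr M (T \<Otimes>\<^sub>M S) (\<lambda>\<omega>. (Z \<omega>, X \<omega>)) = distr M T Z \<Otimes>\<^sub>M distr M S X"
proof -
  have [measurable]: "X \<in> measurable M S" "Z \<in> measurable M T"
    and ind: "indep_set (sets (vimage_algebra (space M) X S)) (sets (vimage_algebra (space M) Z T))"
    using assms by (auto simp: indep_elements_def)
  interpret X: prob_space "distr M S X" by (rule prob_space_distr) simp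
  interpret Z: prob_space "distr M T Z" by (rule prob_space_distr) simp
  show ?thesis
  proof (rule pair_measure_eqI[symmetric])
    fix A B assume "A \<in> sets (distr M T Z)" "B \<in> sets (distr M S X)"
    then have AB [measurable]: "A \<in> sets T" "B \<in> sets S" by auto
    have "prob ((X -` B \<inter> space M) \<inter> (Z -` A \<inter> space M)) = prob (X -` B \<inter> space M) * prob (Z -` A \<inter> space M)"
      by (rule indep_setD[OF ind]) (auto intro: in_vimage_algebra AB)
    moreover have "(X -` B \<inter> space M) \<inter> (Z -` A \<inter> space M) = (\<lambda>\<omega>. (Z \<omega>, X \<omega>)) -` (A \<times> B) \<inter> space M" by auto
    ultimately show "emeasure (distr M T Z) A * emeasure (distr M S X) B
        = emeasure (distr M (T \<Otimes>\<^sub>M S) (\<lambda>\<omega>. (Z \<omega>, X \<omega>))) (A \<times> B)"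
      by (simp add: emeasure_distr emeasure_eq_measure ennreal_mult mult.commute)
  qed (auto intro: X.sigma_finite_measure_axioms Z.sigma_finite_measure_axioms cong: sets_pair_measure_cong)
qed

text \<open>The freezing lemma: the joint law is a product, so the independent element can be
  integrated out at a fixed value of \<open>Z\<close>. Sets of the conditioning sigma-algebra are
  preimages under \<open>Z\<close>, and their indicators are functions of \<open>Z\<close>.\<close>

lemma nn_cond_exp_indep:
  assumes ind: "indep_elements M S X T Z" and f [measurable]: "f \<in> borel_measurable (T \<Otimes>\<^sub>M S)"
  shows "AE \<omega> in M. (\<integral>\<^sup>+b. f (Z \<omega>, b) \<partial>distr M S X)
    = nn_cond_exp M (vimage_algebra (space M) Z T) (\<lambda>\<omega>. f (Z \<omega>, X \<omega>)) \<omega>"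
proof -
  let ?F = "vimage_algebra (space M) Z T"
  have X [measurable]: "X \<in> measurable M S" and Z [measurable]: "Z \<in> measurable M T"
    using ind by (auto simp: indep_elements_def)
  have setsF: "sets ?F = {Z -` A \<inter> space M | A. A \<in> sets T}"
    using Z by (intro sets_vimage_algebra2) (auto intro: measurable_space)
  interpret finite_measure_subalgebra M ?F
    by unfold_locales (auto simp: subalgebra_def setsF)
  interpret X: prob_space "distr M S X" by (rule prob_space_distr) simp
  have [measurable]: "(\<lambda>z. \<integral>\<^sup>+b. f (z, b) \<partial>distr M S X) \<in> borel_measurable T"
    by (rule X.borel_measurable_nn_integral_fst) simp
  show ?thesis
  proof (rule nn_cond_exp_charact)
    fix A assume "A \<in> sets ?F"
    then obtain B where B [measurable]: "B \<in> sets T" and A: "A = Z -` B \<inter> space M" by (auto simp: setsF)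
    have iA: "indicator A \<omega> = (indicator B (Z \<omega>) :: ennreal)" if "\<omega> \<in> space M" for \<omega>
      using that by (simp add: A indicator_def)
    have "(\<integral>\<^sup>+\<omega>\<in>A. f (Z \<omega>, X \<omega>) \<partial>M) = (\<integral>\<^sup>+\<omega>. (\<lambda>p. f p * indicator B (fst p)) (Z \<omega>, X \<omega>) \<partial>M)"
      by (intro nn_integral_cong) (simp add: iA)
    also have "\<dots> = (\<integral>\<^sup>+p. f p * indicator B (fst p) \<partial>distr M (T \<Otimes>\<^sub>M S) (\<lambda>\<omega>. (Z \<omega>, X \<omega>)))"
      by (subst nn_integral_distr) simp_all
    also have "\<dots> = (\<integral>\<^sup>+z. \<integral>\<^sup>+b. f (z, b) * indicator B z \<partial>distr M S X \<partial>distr M T Z)"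
      unfolding indep_elements_joint_law[OF ind]
      by (subst X.nn_integral_fst[symmetric]) simp_all
    also have "\<dots> = (\<integral>\<^sup>+z. (\<integral>\<^sup>+b. f (z, b) \<partial>distr M S X) * indicator B z \<partial>distr M T Z)"
      by (intro nn_integral_cong nn_integral_multc) simp
    also have "\<dots> = (\<integral>\<^sup>+\<omega>. (\<integral>\<^sup>+b. f (Z \<omega>, b) \<partial>distr M S X) * indicator B (Z \<omega>) \<partial>M)"
      by (subst nn_integral_distr) simp_all
    also have "\<dots> = (\<integral>\<^sup>+\<omega>\<in>A. (\<integral>\<^sup>+b. f (Z \<omega>, b) \<partial>distr M S X) \<partial>M)"
      by (intro nn_integral_cong) (simp add: iA)
    finally show "(\<integral>\<^sup>+\<omega>\<in>A. f (Z \<omega>, X \<omega>) \<partial>M) = (\<integral>\<^sup>+\<omega>\<in>A. (\<integral>\<^sup>+b. f (Z \<omega>, b) \<partial>distr M S X) \<partial>M)" .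
  next
    show "(\<lambda>\<omega>. \<integral>\<^sup>+b. f (Z \<omega>, b) \<partial>distr M S X) \<in> borel_measurable ?F"
      by (rule measurable_compose[OF measurable_vimage_algebra1]) (use measurable_space[OF Z] in auto)
  qed simp
qed

lemma real_cond_exp_indep:
  assumes ind: "indep_elements M S X T Z" and f [measurable]: "f \<in> borel_measurable (T \<Otimes>\<^sub>M S)"
    and nonneg: "\<And>p. 0 \<le> f p"
  shows "AE \<omega> in M. real_cond_exp M (vimage_algebra (space M) Z T) (\<lambda>\<omega>. f (Z \<omega>, X \<omega>)) \<omega>
    = enn2real (\<integral>\<^sup>+b. ennreal (f (Z \<omega>, b)) \<partial>distr M S X)"
proof -
  have 1: "(\<lambda>p. ennreal (f p)) \<in> borel_measurable (T \<Otimes>\<^sub>M S)" by simp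
  have 2: "(\<lambda>p. 0 :: ennreal) \<in> borel_measurable (T \<Otimes>\<^sub>M S)" by simp
  show ?thesis
    using nn_cond_exp_indep[OF ind 1] nn_cond_exp_indep[OF ind 2]
  proof eventually_elim
    case (elim \<omega>)
    \<comment> \<open>\<open>real_cond_exp\<close> subtracts the conditional expectation of the
      negative part, which vanishes here.\<close>
    have "(\<lambda>\<omega>. ennreal (- f (Z \<omega>, X \<omega>))) = (\<lambda>_. 0)" using nonneg by (auto simp: ennreal_neg)
    then show ?case using elim by (simp add: real_cond_exp_def)
  qed
qed

end

text \<open>A function on the observation space instead of the probability space: the estimator has
  to be a measurable function of \<open>sample\<close> for the freezing lemma to apply.\<close>

definition obs_vec :: "('k::finite \<Rightarrow> nat) \<Rightarrow> real \<times> (nat \<Rightarrow> real) \<Rightarrow> real^'k" where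
  "obs_vec s p = (\<chi> k. snd p (s k))"

lemma obs_vec_obs: "obs_vec s (obs y x \<omega>) = subvec s x \<omega>" "fst (obs y x \<omega>) = y \<omega>"
  by (simp_all add: obs_vec_def obs_def subvec_def)

lemma measurable_fst_obs_space [measurable]: "fst \<in> borel_measurable obs_space"
  unfolding obs_space_def by simp

lemma measurable_obs_vec [measurable]: "obs_vec s \<in> borel_measurable obs_space"
proof -
  have "(\<lambda>p. snd p (s k)) \<in> borel_measurable obs_space" for k
    unfolding obs_space_def
    by (rule measurable_compose[OF measurable_snd measurable_component_singleton]) simp
  then show ?thesis unfolding obs_vec_def[abs_def] by (rule borel_measurable_vec_lambda)
qed

definition sample_design :: "('k::finite \<Rightarrow> nat) \<Rightarrow> ('n::finite \<Rightarrow> real \<times> (nat \<Rightarrow> real)) \<Rightarrow> real^'k^'n" where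
  "sample_design s S = (\<chi> j. obs_vec s (S j))"

definition sample_response :: "('n::finite \<Rightarrow> real \<times> (nat \<Rightarrow> real)) \<Rightarrow> real^'n" where
  "sample_response S = (\<chi> j. fst (S j))"

lemma sample_design_sample: "sample_design s (sample yt xt \<omega>) = design s xt \<omega>"
  by (simp add: sample_design_def sample_def design_def obs_vec_obs)

lemma sample_response_sample: "sample_response (sample yt xt \<omega>) = response yt \<omega>"
  by (simp add: sample_response_def sample_def response_def obs_vec_obs)

lemma measurable_sample_component: "(\<lambda>S. S j) \<in> measurable sample_space obs_space"
  unfolding sample_space_def by (rule measurable_component_singleton) simp

lemma measurable_sample_design [measurable]: "sample_design s \<in> borel_measurable sample_space"
  unfolding sample_design_def[abs_def]
  by (intro borel_measurable_vec_lambda measurable_compose[OF measurable_sample_component measurable_obs_vec])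

lemma measurable_sample_response [measurable]: "sample_response \<in> borel_measurable sample_space"
  unfolding sample_response_def[abs_def]
  by (intro borel_measurable_vec_lambda measurable_compose[OF measurable_sample_component measurable_fst_obs_space])

definition coefficients :: "real \<Rightarrow> real \<Rightarrow> real^('p::finite + 'q::finite)^'n::finite \<Rightarrow> real^'n \<Rightarrow> real^('p + 'q)" where
  "coefficients c1 c2 X Y = vjoin (\<theta>1_JS c1 c2 X Y) (\<theta>2_JS c2 X Y)"

lemma measurable_block [measurable]:
  "block1 \<in> borel_measurable borel" "block2 \<in> borel_measurable borel"
  unfolding block1_def[abs_def] block2_def[abs_def]
  by (auto intro!: borel_measurable_continuous_onI continuous_intros)

lemma measurable_vjoin [measurable (raw)]:
  fixes f :: "'a \<Rightarrow> real^'p::finite" and g :: "'a \<Rightarrow> real^'q::finite"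
  assumes "f \<in> borel_measurable M" "g \<in> borel_measurable M"
  shows "(\<lambda>\<omega>. vjoin (f \<omega>) (g \<omega>)) \<in> borel_measurable M"
proof (rule borel_measurable_continuous_Pair[OF assms])
  have "continuous_on UNIV (\<lambda>x. case i of Inl a \<Rightarrow> fst x $ a | Inr b \<Rightarrow> snd x $ b)" for i :: "'p + 'q"
    by (cases i) (auto intro!: continuous_intros)
  then show "continuous_on UNIV (\<lambda>x. vjoin (fst x :: real^'p) (snd x :: real^'q))"
    unfolding vjoin_def by (intro continuous_on_vec_lambda)
qed

lemma measurable_coefficients:
  assumes f [measurable]: "f \<in> borel_measurable M" and g [measurable]: "g \<in> borel_measurable M"
  shows "(\<lambda>\<omega>. coefficients c1 c2 (f \<omega>) (g \<omega>)) \<in> borel_measurable M"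
proof -
  have [measurable]: "(\<lambda>\<omega>. M1 (f \<omega>)) \<in> borel_measurable M" unfolding M1_def by measurable
  have [measurable]: "(\<lambda>\<omega>. \<sigma>2_hat (f \<omega>) (g \<omega>)) \<in> borel_measurable M"
    unfolding \<sigma>2_hat_def least_squares_def by measurable
  have [measurable]: "(\<lambda>\<omega>. \<theta>1_star (f \<omega>) (g \<omega>)) \<in> borel_measurable M"
    unfolding \<theta>1_star_def least_squares_def by measurable
  have [measurable]: "(\<lambda>\<omega>. \<theta>2_hat (f \<omega>) (g \<omega>)) \<in> borel_measurable M" unfolding \<theta>2_hat_def by measurable
  have [measurable]: "(\<lambda>\<omega>. shrink1 c1 (f \<omega>) (g \<omega>)) \<in> borel_measurable M" unfolding shrink1_def by measurable
  have [measurable]: "(\<lambda>\<omega>. shrink2 c2 (f \<omega>) (g \<omega>)) \<in> borel_measurable M"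
    unfolding shrink2_def X2_star_def by measurable
  have [measurable]: "(\<lambda>\<omega>. \<theta>2_JS c2 (f \<omega>) (g \<omega>)) \<in> borel_measurable M" unfolding \<theta>2_JS_def by measurable
  have [measurable]: "(\<lambda>\<omega>. \<theta>1_JS c1 c2 (f \<omega>) (g \<omega>)) \<in> borel_measurable M"
    unfolding \<theta>1_JS_def \<theta>1_star_JS_def least_squares_def by measurable
  show ?thesis unfolding coefficients_def by measurable
qed

lemma y0_hat_inner:
  assumes bij: "bij_betw s UNIV {i. m i = 1}" and m: "\<And>i. m i \<in> {0, 1 :: nat}"
  shows "y0_hat m s c1 c2 yt xt x0 \<omega> = coefficients c1 c2 (design s xt \<omega>) (response yt \<omega>) \<bullet> subvec s x0 \<omega>"
proof -
  have inj: "inj s" and rng: "range s = {i. m i = 1}" using bij by (auto simp: bij_betw_def)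
  let ?X = "design s xt \<omega>" and ?Y = "response yt \<omega>"
  have b: "\<beta>_hat m s c1 c2 ?X ?Y (s k) = coefficients c1 c2 ?X ?Y $ k" for k
  proof -
    have "m (s k) = 1" using rng by auto
    then show ?thesis by (simp add: \<beta>_hat_def coefficients_def vjoin_def inv_f_f[OF inj])
  qed
  have "y0_hat m s c1 c2 yt xt x0 \<omega> = (\<Sum>i\<in>range s. x0 i \<omega> * \<beta>_hat m s c1 c2 ?X ?Y i)"
    unfolding y0_hat_def
  proof (rule suminf_finite)
    fix i assume "i \<notin> range s"
    then have "m i = 0" using m[of i] by (auto simp: rng)
    then show "x0 i \<omega> * \<beta>_hat m s c1 c2 ?X ?Y i = 0" by (simp add: \<beta>_hat_def)
  qed simp
  then show ?thesis by (simp add: sum.reindex[OF inj] b inner_vec_def subvec_def mult.commute)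
qed

context regression_sample
begin

lemma obs_measurable [measurable]: "obs y x \<in> measurable M obs_space"
proof -
  have "(\<lambda>\<omega> i. x i \<omega>) \<in> measurable M (Pi\<^sub>M UNIV (\<lambda>_. borel))"
    by (rule measurable_PiM_single') (auto simp: x_measurable)
  then show ?thesis unfolding obs_space_def obs_def[abs_def] using y_measurable by simp
qed

lemma obs_training_measurable [measurable]: "obs (yt j) (xt j) \<in> measurable M obs_space"
  using training_indep by (auto simp: indep_vars_def)

text \<open>Freezing the sample reduces the conditional error to the risk of a fixed linear
  predictor under the law of \<open>(y, x)\<close>. \<open>G\<close> passes to whitened
  coefficients, since \<open>G b \<bullet> (E *v z) = b \<bullet> z\<close>.\<close>

lemma prediction_error:
  assumes bij: "bij_betw s UNIV {i. m i = 1}" and m: "\<And>i. m i \<in> {0, 1 :: nat}"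
    and int: "\<And>c. integrable M (\<lambda>\<omega>. (y \<omega> - c \<bullet> (E *v subvec s x \<omega>))\<^sup>2)"
    and ex: "\<And>c. expectation (\<lambda>\<omega>. (y \<omega> - c \<bullet> (E *v subvec s x \<omega>))\<^sup>2) = r\<^sup>2 + (norm (d - c))\<^sup>2"
    and G: "\<And>b. transpose E *v (G b) = b"
  shows "AE \<omega> in M. \<rho>2 M m s c1 c2 yt xt y0 x0 \<omega>
    = r\<^sup>2 + (norm (d - G (coefficients c1 c2 (design s xt \<omega>) (response yt \<omega>))))\<^sup>2"
proof -
  define b where "b S = coefficients c1 c2 (sample_design s S) (sample_response S)" for S :: "'n \<Rightarrow> real \<times> (nat \<Rightarrow> real)"
  define f where "f p = (b (fst p) \<bullet> obs_vec s (snd p) - fst (snd p))\<^sup>2" for p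
  have [measurable]: "b \<in> borel_measurable sample_space"
    unfolding b_def[abs_def] by (rule measurable_coefficients) simp_all
  have f [measurable]: "f \<in> borel_measurable (sample_space \<Otimes>\<^sub>M obs_space)" unfolding f_def[abs_def] by measurable
  have e: "f (sample yt xt \<omega>, obs y0 x0 \<omega>) = (y0_hat m s c1 c2 yt xt x0 \<omega> - y0 \<omega>)\<^sup>2" for \<omega>
    by (simp add: f_def b_def y0_hat_inner[OF bij m] sample_design_sample sample_response_sample obs_vec_obs)
  have i: "enn2real (\<integral>\<^sup>+p. ennreal (f (S, p)) \<partial>distr M obs_space (obs y0 x0)) = r\<^sup>2 + (norm (d - G (b S)))\<^sup>2"
    if S: "S \<in> space sample_space" for S
  proof -
    have [measurable]: "(\<lambda>p. f (S, p)) \<in> borel_measurable obs_space"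
      by (rule measurable_compose[OF measurable_Pair1'[OF S] f])
    have e: "f (S, obs y x \<omega>) = (y \<omega> - G (b S) \<bullet> (E *v subvec s x \<omega>))\<^sup>2" for \<omega>
    proof -
      have "G (b S) \<bullet> (E *v subvec s x \<omega>) = b S \<bullet> subvec s x \<omega>"
        by (metis G inner_commute inner_matrix_vector)
      then show ?thesis by (simp add: f_def obs_vec_obs power2_commute)
    qed
    have "(\<integral>\<^sup>+p. ennreal (f (S, p)) \<partial>distr M obs_space (obs y0 x0)) = (\<integral>\<^sup>+\<omega>. ennreal (f (S, obs y x \<omega>)) \<partial>M)"
      unfolding new_copy by (subst nn_integral_distr) simp_all
    also have "\<dots> = (\<integral>\<^sup>+\<omega>. ennreal ((y \<omega> - G (b S) \<bullet> (E *v subvec s x \<omega>))\<^sup>2) \<partial>M)"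
      by (simp add: e)
    also have "(\<integral>\<^sup>+\<omega>. ennreal ((y \<omega> - G (b S) \<bullet> (E *v subvec s x \<omega>))\<^sup>2) \<partial>M) = ennreal (r\<^sup>2 + (norm (d - G (b S)))\<^sup>2)"
      by (subst nn_integral_eq_integral[OF int]) (simp_all add: ex)
    finally show ?thesis by (simp del: ennreal_plus)
  qed
  have "AE \<omega> in M. real_cond_exp M (vimage_algebra (space M) (sample yt xt) sample_space) (\<lambda>\<omega>. f (sample yt xt \<omega>, obs y0 x0 \<omega>)) \<omega>
    = enn2real (\<integral>\<^sup>+p. ennreal (f (sample yt xt \<omega>, p)) \<partial>distr M obs_space (obs y0 x0))"
    by (rule real_cond_exp_indep[OF new_indep f]) (simp add: f_def)
  moreover have "sample yt xt \<omega> \<in> space sample_space" if "\<omega> \<in> space M" for \<omega>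
    using new_indep that by (auto simp: indep_elements_def dest: measurable_space)
  ultimately show ?thesis
    unfolding e \<rho>2_def[symmetric]
    by (auto simp: i b_def sample_design_sample sample_response_sample)
qed

definition whitened_sample :: "('p::finite + 'q::finite \<Rightarrow> nat) \<Rightarrow> real^('p + 'q)^('p + 'q) \<Rightarrow> real^('p + 'q) \<Rightarrow> real
    \<Rightarrow> 'a \<Rightarrow> (real^'n^'p) \<times> (real^'n) \<times> (real^'n^'q)" where
  "whitened_sample s E d r \<omega> =
    ((\<chi> i j. (E *v subvec s (xt j) \<omega>) $ Inl i),
     ((\<chi> j. (yt j \<omega> - d \<bullet> (E *v subvec s (xt j) \<omega>)) / r),
      (\<chi> i j. (E *v subvec s (xt j) \<omega>) $ Inr i)))"

text \<open>Independence makes the characteristic function factorise over the observations. The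
  whitened sample is arranged by regressors, so the double sums are exchanged to collect the
  coefficients \<open>b j\<close> belonging to observation \<open>j\<close>.\<close>

lemma whitened_sample_law:
  fixes s :: "'p::finite + 'q::finite \<Rightarrow> nat" and E :: "real^('p + 'q)^('p + 'q)"
  assumes cf: "\<And>a b. (CLINT \<omega>|M. iexp (a * ((y \<omega> - d \<bullet> (E *v subvec s x \<omega>)) / r) + b \<bullet> (E *v subvec s x \<omega>)))
      = exp (- (a\<^sup>2 + (norm b)\<^sup>2) / 2)"
  shows "whitened_sample s E d r \<in> borel_measurable M" "distr M borel (whitened_sample s E d r) = stdg"
proof -
  define z where "z p = E *v obs_vec s p" for p
  define v where "v p = (fst p - d \<bullet> z p) / r" for p
  have [measurable]: "z \<in> borel_measurable obs_space" unfolding z_def[abs_def] by measurable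
  have [measurable]: "v \<in> borel_measurable obs_space" unfolding v_def[abs_def] by measurable
  have W: "whitened_sample s E d r \<omega> = ((\<chi> i j. z (obs (yt j) (xt j) \<omega>) $ Inl i),
     ((\<chi> j. v (obs (yt j) (xt j) \<omega>)), (\<chi> i j. z (obs (yt j) (xt j) \<omega>) $ Inr i)))" for \<omega>
    by (simp add: whitened_sample_def z_def v_def obs_vec_obs)
  have zm: "(\<lambda>\<omega>. z (obs (yt j) (xt j) \<omega>)) \<in> borel_measurable M"
    and vm: "(\<lambda>\<omega>. v (obs (yt j) (xt j) \<omega>)) \<in> borel_measurable M" for j
    by (auto intro: measurable_compose[OF obs_training_measurable])
  have "(\<lambda>w :: real^('p + 'q). w $ k) \<in> borel_measurable borel" for k
    by (intro borel_measurable_continuous_onI continuous_intros)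
  note zkm = measurable_compose[OF zm this]
  show m [measurable]: "whitened_sample s E d r \<in> borel_measurable M"
    unfolding W[abs_def]
    by (intro borel_measurable_Pair borel_measurable_vec_lambda zkm vm)
  show "distr M borel (whitened_sample s E d r) = stdg"
  proof (rule stdg_eqI)
    show "prob_space (distr M borel (whitened_sample s E d r))" by (rule prob_space_distr) simp
    fix a :: "(real^'n^'p) \<times> (real^'n) \<times> (real^'n^'q)"
    obtain A1 a0 A2 where a: "a = (A1, a0, A2)" by (cases a) auto
    define b where "b j = vjoin (\<chi> i. A1 $ i $ j) (\<chi> i. A2 $ i $ j)" for j
    define h where "h j p = iexp (a0 $ j * v p + b j \<bullet> z p)" for j p
    have h [measurable]: "h j \<in> borel_measurable obs_space" for j unfolding h_def[abs_def] by measurable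
    have bz: "b j \<bullet> w = (\<Sum>i\<in>UNIV. A1 $ i $ j * w $ Inl i) + (\<Sum>i\<in>UNIV. A2 $ i $ j * w $ Inr i)" for j w
      unfolding b_def vjoin_inner by (simp add: inner_vec_def vfst_def vsnd_def)
    have "a \<bullet> whitened_sample s E d r \<omega> = (\<Sum>j\<in>UNIV. a0 $ j * v (obs (yt j) (xt j) \<omega>) + b j \<bullet> z (obs (yt j) (xt j) \<omega>))" for \<omega>
    proof -
      have "(\<Sum>i\<in>UNIV. \<Sum>j\<in>UNIV. A1 $ i $ j * z (obs (yt j) (xt j) \<omega>) $ Inl i) = (\<Sum>j\<in>UNIV. \<Sum>i\<in>UNIV. A1 $ i $ j * z (obs (yt j) (xt j) \<omega>) $ Inl i)"
        by (rule sum.swap)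
      moreover have "(\<Sum>i\<in>UNIV. \<Sum>j\<in>UNIV. A2 $ i $ j * z (obs (yt j) (xt j) \<omega>) $ Inr i) = (\<Sum>j\<in>UNIV. \<Sum>i\<in>UNIV. A2 $ i $ j * z (obs (yt j) (xt j) \<omega>) $ Inr i)"
        by (rule sum.swap)
      ultimately show ?thesis
        unfolding W a bz by (simp add: inner_vec_def sum.distrib)
    qed
    then have prod: "iexp (a \<bullet> whitened_sample s E d r \<omega>) = (\<Prod>j\<in>UNIV. h j (obs (yt j) (xt j) \<omega>))" for \<omega>
      by (simp add: h_def exp_sum sum_distrib_left)
    have int: "integrable M (\<lambda>\<omega>. h j (obs (yt j) (xt j) \<omega>))" for j
      by (rule integrable_const_bound[where B = 1]) (auto simp: h_def)
    have "(CLINT w|distr M borel (whitened_sample s E d r). iexp (a \<bullet> w)) = (CLINT \<omega>|M. iexp (a \<bullet> whitened_sample s E d r \<omega>))"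
      by (subst integral_distr) simp_all
    also have "\<dots> = (\<Prod>j\<in>UNIV. CLINT \<omega>|M. h j (obs (yt j) (xt j) \<omega>))"
      unfolding prod
      by (rule indep_vars_lebesgue_integral[OF _ indep_vars_compose2[OF training_indep] int]) simp_all
    also have "\<dots> = (\<Prod>j\<in>UNIV. complex_of_real (exp (- ((a0 $ j)\<^sup>2 + (norm (b j))\<^sup>2) / 2)))"
    proof (rule prod.cong[OF refl])
      fix j
      have "(CLINT \<omega>|M. h j (obs (yt j) (xt j) \<omega>)) = (CLINT p|distr M obs_space (obs (yt j) (xt j)). h j p)"
        by (subst integral_distr) simp_all
      also have "\<dots> = (CLINT \<omega>|M. h j (obs y x \<omega>))"
        unfolding training_copies by (subst integral_distr) simp_all
      also have "\<dots> = exp (- ((a0 $ j)\<^sup>2 + (norm (b j))\<^sup>2) / 2)"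
        using cf[of "a0 $ j" "b j"] by (simp add: h_def v_def z_def obs_vec_obs)
      finally show "(CLINT \<omega>|M. h j (obs (yt j) (xt j) \<omega>)) = complex_of_real (exp (- ((a0 $ j)\<^sup>2 + (norm (b j))\<^sup>2) / 2))" .
    qed
    also have "\<dots> = exp (\<Sum>j\<in>UNIV. - ((a0 $ j)\<^sup>2 + (norm (b j))\<^sup>2) / 2)"
      by (simp add: exp_sum del: exp_of_real of_real_exp)
    also have "(\<Sum>j\<in>UNIV. - ((a0 $ j)\<^sup>2 + (norm (b j))\<^sup>2) / 2) = - (norm a)\<^sup>2 / 2"
    proof -
      have "(norm (b j))\<^sup>2 = (\<Sum>i\<in>UNIV. (A1 $ i $ j)\<^sup>2) + (\<Sum>i\<in>UNIV. (A2 $ i $ j)\<^sup>2)" for j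
        unfolding b_def norm_vjoin unfolding power2_norm_eq_inner by (simp add: inner_vec_def power2_eq_square)
      moreover have "(norm a)\<^sup>2 = (\<Sum>i\<in>UNIV. \<Sum>j\<in>UNIV. (A1 $ i $ j)\<^sup>2) + (\<Sum>j\<in>UNIV. (a0 $ j)\<^sup>2) + (\<Sum>i\<in>UNIV. \<Sum>j\<in>UNIV. (A2 $ i $ j)\<^sup>2)"
        unfolding a power2_norm_eq_inner by (simp add: inner_vec_def power2_eq_square)
      moreover have "(\<Sum>i\<in>UNIV. \<Sum>j\<in>UNIV. (A1 $ i $ j)\<^sup>2) = (\<Sum>j\<in>UNIV. \<Sum>i\<in>UNIV. (A1 $ i $ j)\<^sup>2)"
        "(\<Sum>i\<in>UNIV. \<Sum>j\<in>UNIV. (A2 $ i $ j)\<^sup>2) = (\<Sum>j\<in>UNIV. \<Sum>i\<in>UNIV. (A2 $ i $ j)\<^sup>2)"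
        by (rule sum.swap)+
      ultimately show ?thesis
        by (simp add: sum.distrib sum_divide_distrib[symmetric] sum_negf sum_subtractf)
    qed
    finally show "(CLINT w|distr M borel (whitened_sample s E d r). iexp (a \<bullet> w)) = exp (- (norm a)\<^sup>2 / 2)" .
  qed simp
qed

end

section \<open>Conditional normality and the noise proportion\<close>

lemma measure_eqI_rectangles:
  assumes M: "finite_measure M" and sets: "sets M = sets (A \<Otimes>\<^sub>M B)" "sets N = sets (A \<Otimes>\<^sub>M B)"
    and eq: "\<And>a b. a \<in> sets A \<Longrightarrow> b \<in> sets B \<Longrightarrow> emeasure M (a \<times> b) = emeasure N (a \<times> b)"
  shows "M = N"
proof (rule measure_eqI_generator_eq[OF Int_stable_pair_measure_generator[of A B]])
  show "{a \<times> b |a b. a \<in> sets A \<and> b \<in> sets B} \<subseteq> Pow (space A \<times> space B)"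
    using sets.space_closed[of A] sets.space_closed[of B] by auto
  show "sets M = sigma_sets (space A \<times> space B) {a \<times> b |a b. a \<in> sets A \<and> b \<in> sets B}"
    "sets N = sigma_sets (space A \<times> space B) {a \<times> b |a b. a \<in> sets A \<and> b \<in> sets B}"
    by (simp_all add: sets sets_pair_measure)
  show "range (\<lambda>i::nat. space A \<times> space B) \<subseteq> {a \<times> b |a b. a \<in> sets A \<and> b \<in> sets B}"
    by auto
  show "emeasure M (space A \<times> space B) \<noteq> \<infinity>" for i :: nat
    using finite_measure.emeasure_finite[OF M] by simp
qed (auto simp: eq)

lemma normal_second_moment:
  assumes sd: "sd > 0"
  shows "(\<integral>\<^sup>+t. ennreal (normal_density a sd t) * ennreal ((t - c)\<^sup>2) \<partial>lborel) = ennreal (sd\<^sup>2 + (a - c)\<^sup>2)"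
proof -
  have e: "normal_density a sd t * (t - c)\<^sup>2
      = normal_density a sd t * (t - a)\<^sup>2 + 2 * (a - c) * (normal_density a sd t * (t - a)) + (a - c)\<^sup>2 * normal_density a sd t" for t
    by (simp add: power2_eq_square algebra_simps)
  have i: "integrable lborel (\<lambda>t. normal_density a sd t * (t - a)\<^sup>2)"
    "integrable lborel (\<lambda>t. normal_density a sd t * (t - a))" "integrable lborel (normal_density a sd)"
    using integrable_normal_moment[OF sd, of a 2] integrable_normal_moment[OF sd, of a 1]
    by (simp_all add: sd)
  have int: "integrable lborel (\<lambda>t. normal_density a sd t * (t - c)\<^sup>2)"
    unfolding e by (intro Bochner_Integration.integrable_add integrable_mult_right i)
  have "(\<integral>t. normal_density a sd t * (t - c)\<^sup>2 \<partial>lborel) = sd\<^sup>2 + (a - c)\<^sup>2"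
    unfolding e using i integral_normal_moment_even[OF sd, of a 1] integral_normal_moment_odd[OF sd, of a 0]
    by (simp add: sd)
  then show ?thesis
    using nn_integral_eq_integral[OF int] by (simp add: ennreal_mult' normal_density_nonneg)
qed

context regression_dgp
begin

lemma subvec_measurable [measurable]: "subvec s x \<in> borel_measurable M"
  unfolding subvec_def[abs_def] by (rule borel_measurable_vec_lambda) simp

text \<open>The hypothesis gives the conditional probability of each Borel set \<open>B\<close>
  separately, each with its own null set. Integrated over the preimage of \<open>A\<close> it gives
  the mass of the rectangle \<open>A \<times> B\<close>, and rectangles determine the joint
  law.\<close>

lemma conditionally_normal_joint_law:
  fixes s :: "'k::finite \<Rightarrow> nat"
  assumes cn: "conditionally_normal M y (subvec s x) \<theta> v"
  shows "distr M (borel \<Otimes>\<^sub>M lborel) (\<lambda>\<omega>. (subvec s x \<omega>, y \<omega>))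
    = density (distr M borel (subvec s x) \<Otimes>\<^sub>M lborel) (\<lambda>p. ennreal (normal_density (fst p \<bullet> \<theta>) (sqrt v) (snd p)))"
proof (rule measure_eqI_rectangles[where A = borel and B = lborel])
  let ?z = "subvec s x"
  let ?F = "vimage_algebra (space M) ?z borel"
  let ?D = "distr M borel ?z"
  let ?\<phi> = "\<lambda>w t. ennreal (normal_density (w \<bullet> \<theta>) (sqrt v) t)"
  have v: "v > 0" using cn by (simp add: conditionally_normal_def)
  have \<phi> [measurable]: "(\<lambda>p. ?\<phi> (fst p) (snd p)) \<in> borel_measurable (borel \<Otimes>\<^sub>M lborel)"
    unfolding normal_density_def by measurable
  have [measurable]: "(\<lambda>p. normal_density (fst p \<bullet> \<theta>) (sqrt v) (snd p)) \<in> borel_measurable (?D \<Otimes>\<^sub>M lborel)"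
    unfolding normal_density_def by measurable
  interpret finite_measure_subalgebra M ?F
    by unfold_locales (auto simp: subalgebra_def sets_vimage_algebra2 intro!: measurable_sets)
  interpret D: prob_space ?D by (rule prob_space_distr) simp
  show "finite_measure (distr M (borel \<Otimes>\<^sub>M lborel) (\<lambda>\<omega>. (?z \<omega>, y \<omega>)))"
    by (rule finite_measure_distr) simp
  fix A :: "(real^'k) set" and B :: "real set" assume "A \<in> sets borel" "B \<in> sets lborel"
  then have A [measurable]: "A \<in> sets borel" and B [measurable]: "B \<in> sets borel" by auto
  define A' where "A' = ?z -` A \<inter> space M"
  have A'F: "A' \<in> sets ?F" unfolding A'_def by (rule in_vimage_algebra) simp
  have A' [measurable]: "A' \<in> sets M" unfolding A'_def by simp
  define f where "f \<omega> = (indicator B (y \<omega>) :: real)" for \<omega>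
  have f: "integrable M f" unfolding f_def[abs_def] by (rule integrable_const_bound[where B = 1]) auto
  let ?g = "real_cond_exp M ?F f"
  have g0: "AE \<omega> in M. ?g \<omega> \<ge> 0"
    by (rule real_cond_exp_pos[OF _ borel_measurable_integrable[OF f]]) (simp add: f_def)
  have K: "AE \<omega> in M. ?g \<omega> = measure (density lborel (?\<phi> (?z \<omega>))) B"
    using cn B unfolding conditionally_normal_def f_def[abs_def] by blast
  have "emeasure (distr M (borel \<Otimes>\<^sub>M lborel) (\<lambda>\<omega>. (?z \<omega>, y \<omega>))) (A \<times> B) = emeasure M {\<omega> \<in> space M. ?z \<omega> \<in> A \<and> y \<omega> \<in> B}"
    by (subst emeasure_distr) (auto intro!: arg_cong[where f = "emeasure M"])
  also have "\<dots> = (\<integral>\<^sup>+\<omega>. ennreal (indicator A' \<omega> *\<^sub>R f \<omega>) \<partial>M)"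
  proof -
    have "emeasure M {\<omega> \<in> space M. ?z \<omega> \<in> A \<and> y \<omega> \<in> B} = (\<integral>\<^sup>+\<omega>. indicator {\<omega> \<in> space M. ?z \<omega> \<in> A \<and> y \<omega> \<in> B} \<omega> \<partial>M)"
      by (rule nn_integral_indicator[symmetric]) simp
    also have "\<dots> = (\<integral>\<^sup>+\<omega>. ennreal (indicator A' \<omega> *\<^sub>R f \<omega>) \<partial>M)"
      by (rule nn_integral_cong) (auto simp: f_def A'_def split: split_indicator)
    finally show ?thesis .
  qed
  also have "\<dots> = ennreal (\<integral>\<omega>\<in>A'. f \<omega> \<partial>M)"
    unfolding set_lebesgue_integral_def
    by (rule nn_integral_eq_integral[OF integrable_mult_indicator[OF A' f]]) (auto simp: f_def)
  also have "\<dots> = ennreal (\<integral>\<omega>\<in>A'. ?g \<omega> \<partial>M)"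
    by (subst real_cond_exp_intA[OF f A'F]) simp
  also have "\<dots> = (\<integral>\<^sup>+\<omega>. ennreal (indicator A' \<omega> *\<^sub>R ?g \<omega>) \<partial>M)"
    unfolding set_lebesgue_integral_def
    by (rule nn_integral_eq_integral[OF integrable_mult_indicator[OF A' real_cond_exp_int(1)[OF f]], symmetric])
      (use g0 in eventually_elim, simp)
  also have "\<dots> = (\<integral>\<^sup>+\<omega>. indicator A (?z \<omega>) * (\<integral>\<^sup>+t. ?\<phi> (?z \<omega>) t * indicator B t \<partial>lborel) \<partial>M)"
  proof (rule nn_integral_cong_AE, use K AE_space in eventually_elim)
    case (elim \<omega>)
    interpret N: prob_space "density lborel (?\<phi> (?z \<omega>))"
      using v by (intro prob_space_normal_density) simp
    have "ennreal (?g \<omega>) = emeasure (density lborel (?\<phi> (?z \<omega>))) B"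
      using elim by (simp add: N.emeasure_eq_measure)
    also have "\<dots> = (\<integral>\<^sup>+t. ?\<phi> (?z \<omega>) t * indicator B t \<partial>lborel)"
      by (rule emeasure_density) simp_all
    finally show ?case using elim by (auto simp: A'_def split: split_indicator)
  qed
  also have "\<dots> = (\<integral>\<^sup>+w. indicator A w * (\<integral>\<^sup>+t. ?\<phi> w t * indicator B t \<partial>lborel) \<partial>?D)"
  proof -
    have "(\<lambda>p. ?\<phi> (fst p) (snd p) * indicator B (snd p)) \<in> borel_measurable (borel \<Otimes>\<^sub>M lborel)" by simp
    from lborel.borel_measurable_nn_integral_fst[OF this]
    have "(\<lambda>w. indicator A w * (\<integral>\<^sup>+t. ?\<phi> w t * indicator B t \<partial>lborel)) \<in> borel_measurable ?D" by simp
    from nn_integral_distr[OF subvec_measurable this] show ?thesis ..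
  qed
  also have "\<dots> = (\<integral>\<^sup>+w. \<integral>\<^sup>+t. ?\<phi> w t * indicator (A \<times> B) (w, t) \<partial>lborel \<partial>?D)"
  proof (rule nn_integral_cong)
    fix w
    have "(\<integral>\<^sup>+t. ?\<phi> w t * indicator (A \<times> B) (w, t) \<partial>lborel) = (\<integral>\<^sup>+t. indicator A w * (?\<phi> w t * indicator B t) \<partial>lborel)"
      by (rule nn_integral_cong) (simp split: split_indicator)
    also have "\<dots> = indicator A w * (\<integral>\<^sup>+t. ?\<phi> w t * indicator B t \<partial>lborel)"
      by (rule nn_integral_cmult) simp
    finally show "indicator A w * (\<integral>\<^sup>+t. ?\<phi> w t * indicator B t \<partial>lborel) = (\<integral>\<^sup>+t. ?\<phi> w t * indicator (A \<times> B) (w, t) \<partial>lborel)" ..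
  qed
  also have "\<dots> = (\<integral>\<^sup>+p. ?\<phi> (fst p) (snd p) * indicator (A \<times> B) p \<partial>(?D \<Otimes>\<^sub>M lborel))"
    by (subst lborel.nn_integral_fst[symmetric]) simp_all
  also have "\<dots> = emeasure (density (?D \<Otimes>\<^sub>M lborel) (\<lambda>p. ?\<phi> (fst p) (snd p))) (A \<times> B)"
    by (rule emeasure_density[symmetric]) simp_all
  finally show "emeasure (distr M (borel \<Otimes>\<^sub>M lborel) (\<lambda>\<omega>. (?z \<omega>, y \<omega>))) (A \<times> B)
    = emeasure (density (?D \<Otimes>\<^sub>M lborel) (\<lambda>p. ?\<phi> (fst p) (snd p))) (A \<times> B)" .
qed (auto cong: sets_pair_measure_cong)

text \<open>Bias--variance decomposition under the joint law. Through the mean squared errors of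
  suitable linear predictors it compares the pair \<open>\<theta>\<close>, \<open>v\<close> with the
  pair \<open>d\<close>, \<open>r\<close> of the whitening.\<close>

lemma conditionally_normal_risk:
  assumes cn: "conditionally_normal M y (subvec s x) \<theta> v"
  shows "expectation (\<lambda>\<omega>. (y \<omega> - b \<bullet> subvec s x \<omega>)\<^sup>2) = v + (\<theta> - b) \<bullet> (subcov M s x *v (\<theta> - b))"
proof -
  let ?z = "subvec s x"
  let ?D = "distr M borel ?z"
  let ?\<phi> = "\<lambda>w t. ennreal (normal_density (w \<bullet> \<theta>) (sqrt v) t)"
  have v: "v > 0" using cn by (simp add: conditionally_normal_def)
  have e: "(y \<omega> - b \<bullet> ?z \<omega>)\<^sup>2 = (y \<omega>)\<^sup>2 - 2 * (y \<omega> * (b \<bullet> ?z \<omega>)) + (b \<bullet> ?z \<omega>) * (b \<bullet> ?z \<omega>)" for \<omega>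
    by (simp add: power2_eq_square algebra_simps)
  have int: "integrable M (\<lambda>\<omega>. (y \<omega> - b \<bullet> ?z \<omega>)\<^sup>2)"
    unfolding e by (intro Bochner_Integration.integrable_add Bochner_Integration.integrable_diff integrable_mult_right
      y_sq_integrable y_subvec_integrable subvec_inner_mult)
  have [measurable]: "(\<lambda>p. normal_density (fst p \<bullet> \<theta>) (sqrt v) (snd p)) \<in> borel_measurable (?D \<Otimes>\<^sub>M lborel)"
    unfolding normal_density_def by measurable
  have psd: "(\<theta> - b) \<bullet> (subcov M s x *v (\<theta> - b)) \<ge> 0"
    unfolding subvec_inner_mult(2)[symmetric] by (rule integral_nonneg_AE) simp
  have "ennreal (expectation (\<lambda>\<omega>. (y \<omega> - b \<bullet> ?z \<omega>)\<^sup>2)) = (\<integral>\<^sup>+\<omega>. ennreal ((y \<omega> - b \<bullet> ?z \<omega>)\<^sup>2) \<partial>M)"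
    by (rule nn_integral_eq_integral[OF int, symmetric]) simp
  also have "\<dots> = (\<integral>\<^sup>+p. ennreal ((snd p - b \<bullet> fst p)\<^sup>2) \<partial>distr M (borel \<Otimes>\<^sub>M lborel) (\<lambda>\<omega>. (?z \<omega>, y \<omega>)))"
    by (subst nn_integral_distr) simp_all
  also have "\<dots> = (\<integral>\<^sup>+p. ?\<phi> (fst p) (snd p) * ennreal ((snd p - b \<bullet> fst p)\<^sup>2) \<partial>(?D \<Otimes>\<^sub>M lborel))"
    unfolding conditionally_normal_joint_law[OF cn] by (subst nn_integral_density) simp_all
  also have "\<dots> = (\<integral>\<^sup>+w. \<integral>\<^sup>+t. ?\<phi> w t * ennreal ((t - b \<bullet> w)\<^sup>2) \<partial>lborel \<partial>?D)"
    by (subst lborel.nn_integral_fst[symmetric]) simp_all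
  also have "\<dots> = (\<integral>\<^sup>+w. ennreal (v + ((\<theta> - b) \<bullet> w)\<^sup>2) \<partial>?D)"
    using v by (simp add: normal_second_moment inner_diff_left inner_diff_right inner_commute del: ennreal_plus)
  also have "\<dots> = (\<integral>\<^sup>+\<omega>. ennreal (v + ((\<theta> - b) \<bullet> ?z \<omega>) * ((\<theta> - b) \<bullet> ?z \<omega>)) \<partial>M)"
    by (subst nn_integral_distr) (simp_all add: power2_eq_square del: ennreal_plus)
  also have "\<dots> = ennreal (v + (\<theta> - b) \<bullet> (subcov M s x *v (\<theta> - b)))"
    using v by (subst nn_integral_eq_integral) (auto intro!: subvec_inner_mult simp: subvec_inner_mult prob_space simp del: ennreal_plus)
  finally show ?thesis using psd v int by (simp add: integral_nonneg_AE del: ennreal_plus)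
qed

end

text \<open>\<open>S\<close> need not be measurable: \<^const>\<open>measure\<close> is \<open>0\<close> on non-measurable sets.\<close>

lemma (in finite_measure) measure_le_null_extension:
  assumes T: "T \<in> sets M" and sub: "AE \<omega> in M. \<omega> \<in> S \<longrightarrow> \<omega> \<in> T"
  shows "measure M S \<le> measure M T"
proof (cases "S \<in> sets M")
  case True
  then show ?thesis using T sub by (intro finite_measure_mono_AE)
qed (simp add: measure_notin_sets)

context regression_sample
begin

text \<open>Almost every outcome with a large log ratio is mapped into the bad set by the whitened
  sample, whose law is \<open>stdg\<close>. The exceptional null sets come from rank deficiency and
  from the version of the conditional expectation.\<close>

lemma log_ratio_bound:
  fixes s :: "'p::finite + 'q::finite \<Rightarrow> nat" and E :: "real^('p + 'q)^('p + 'q)" and c1 c2 \<epsilon> lam :: real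
  assumes bij: "bij_betw s UNIV {i. m i = 1}" and m: "\<And>i. m i \<in> {0, 1 :: nat}"
    and n: "CARD('p) + CARD('q) < CARD('n)" and c: "c1 \<ge> 0" "c2 \<ge> 0" and \<epsilon>: "\<epsilon> > 0" and r: "r > 0"
    and E: "E ** subcov M s x ** transpose E = mat 1" and tri: "\<And>i j. E $ Inl i $ Inr j = 0"
    and cf: "\<And>a b. (CLINT \<omega>|M. iexp (a * ((y \<omega> - d \<bullet> (E *v subvec s x \<omega>)) / r) + b \<bullet> (E *v subvec s x \<omega>)))
      = exp (- (a\<^sup>2 + (norm b)\<^sup>2) / 2)"
    and int: "\<And>c. integrable M (\<lambda>\<omega>. (y \<omega> - c \<bullet> (E *v subvec s x \<omega>))\<^sup>2)"
    and ex: "\<And>c. expectation (\<lambda>\<omega>. (y \<omega> - c \<bullet> (E *v subvec s x \<omega>))\<^sup>2) = r\<^sup>2 + (norm (d - c))\<^sup>2"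
    and lam: "0 < lam" "lam \<le> 1"
      "lam \<le> real CARD('p) / (real CARD('n) + 1) \<or> lam * (r\<^sup>2 + (norm d)\<^sup>2) \<le> r\<^sup>2"
  defines "q \<equiv> (real CARD('n) - (real CARD('p) + real CARD('q))) / real CARD('n)"
    and "t \<equiv> \<epsilon> / (1 + \<epsilon>) / 20"
  shows "measure M {\<omega> \<in> space M.
        abs_log_ratio (\<rho>2_hat c1 c2 (design s xt \<omega>) (response yt \<omega>)) (\<rho>2 M m s c1 c2 yt xt y0 x0 \<omega>) \<ge> ereal \<epsilon>}
      \<le> 38 * exp (- (real CARD('n) * lam\<^sup>2 * q ^ 5 * t\<^sup>2 / 27))"
proof -
  define B where "B = subcov M s x ** transpose E"
  have EB: "E ** B = mat 1" using E by (simp add: B_def matrix_mul_assoc)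
  then have BE: "B ** E = mat 1" by (simp add: matrix_left_right_inverse)
  define G where "G b = transpose B *v b" for b
  have "transpose E ** transpose B = mat 1" "transpose B ** transpose E = mat 1"
    using EB BE by (simp_all add: matrix_transpose_mul[symmetric])
  then have G: "transpose E *v (G b) = b" and injE: "transpose E *v b = 0 \<Longrightarrow> b = 0" for b
    by (simp_all add: G_def matrix_vector_mul_assoc)
      (metis matrix_vector_mul_assoc matrix_vector_mul_lid matrix_vector_mult_0_right)
  define d1 where "d1 = vfst d"
  define d2 where "d2 = vsnd d"
  have d: "d = vjoin d1 d2" by (simp add: d1_def d2_def)
  have t: "0 < t" "t \<le> 1 / 20" using \<epsilon> by (simp_all add: t_def field_simps)
  let ?W = "whitened_sample s E d r"
  have W [measurable]: "?W \<in> borel_measurable M" and law: "distr M borel ?W = stdg"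
    using whitened_sample_law[of d E s r] cf by auto
  obtain Bad where Bad [measurable]: "Bad \<in> sets borel"
    and pBad: "measure stdg Bad \<le> 38 * exp (- (real CARD('n) * lam\<^sup>2 * q ^ 5 * t\<^sup>2 / 27))"
    and good: "\<And>z :: (real^'n^'p) \<times> (real^'n) \<times> (real^'n^'q). z \<notin> Bad \<Longrightarrow> good_sample t q lam r d1 d2 z"
    using good_sample_probability[OF n r lam(1,2) t, of d1 d2] unfolding q_def by blast
  have "AE z in distr M borel ?W. full_rank (join (fst z) (snd (snd z)))"
    unfolding law using n by (intro AE_full_rank_join) simp
  then have full: "AE \<omega> in M. full_rank (join (fst (?W \<omega>)) (snd (snd (?W \<omega>))))"
    by (rule AE_distrD[OF W])
  define S where "S = {\<omega> \<in> space M.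
        abs_log_ratio (\<rho>2_hat c1 c2 (design s xt \<omega>) (response yt \<omega>)) (\<rho>2 M m s c1 c2 yt xt y0 x0 \<omega>) \<ge> ereal \<epsilon>}"
  have "AE \<omega> in M. \<omega> \<in> S \<longrightarrow> \<omega> \<in> ?W -` Bad \<inter> space M"
    using full prediction_error[OF bij m int ex G, where ?c1.0 = c1 and ?c2.0 = c2] AE_space
  proof eventually_elim
    case (elim \<omega>)
    show ?case
    proof (rule ccontr)
      assume "\<not> (\<omega> \<in> S \<longrightarrow> \<omega> \<in> ?W -` Bad \<inter> space M)"
      then have S: "\<omega> \<in> S" and nB: "?W \<omega> \<notin> Bad" using elim by auto
      obtain W1 v W2 where w: "?W \<omega> = (W1, v, W2)" by (cases "?W \<omega>") auto
      then have W1: "W1 = (\<chi> i j. (E *v subvec s (xt j) \<omega>) $ Inl i)"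
        and v: "v = (\<chi> j. (yt j \<omega> - d \<bullet> (E *v subvec s (xt j) \<omega>)) / r)"
        and W2: "W2 = (\<chi> i j. (E *v subvec s (xt j) \<omega>) $ Inr i)"
        by (auto simp: whitened_sample_def)
      let ?X = "design s xt \<omega>" and ?Y = "response yt \<omega>"
      interpret whitened ?X ?Y E W1 W2 v r d1 d2
      proof
        show "E ** transpose ?X = join W1 W2"
          by (simp add: vec_eq_iff matrix_matrix_mult_def transpose_def design_def join_def W1 W2
              matrix_vector_mult_def split: sum.split)
        show "full_rank (join W1 W2)" using elim(1) by (simp add: w)
        show "?Y = r *\<^sub>R v + transpose W2 *v d2 + transpose W1 *v d1"
        proof (subst vec_eq_iff, rule allI)
          fix j
          have tv: "(transpose W *v c) $ j = (\<Sum>i\<in>UNIV. W $ i $ j * c $ i)" for W :: "real^'n^'k::finite" and c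
            by (simp add: matrix_vector_mult_def transpose_def)
          have "d \<bullet> (E *v subvec s (xt j) \<omega>) = (transpose W2 *v d2) $ j + (transpose W1 *v d1) $ j"
            unfolding d vjoin_inner
            by (simp add: inner_vec_def vfst_def vsnd_def W1 W2 tv mult.commute)
          then show "?Y $ j = (r *\<^sub>R v + transpose W2 *v d2 + transpose W1 *v d1) $ j"
            using r by (simp add: response_def v)
        qed
      qed (rule tri)
      have "abs_log_ratio (\<rho>2_hat c1 c2 ?X ?Y) (r\<^sup>2 + (norm (vjoin d1 d2 - G (coefficients c1 c2 ?X ?Y)))\<^sup>2) < ereal \<epsilon>"
      proof (rule good_sample_log_ratio[OF n c \<epsilon> r lam(1,2)])
        show "lam \<le> real CARD('p) / (real CARD('n) + 1) \<or> lam * (r\<^sup>2 + (norm d2)\<^sup>2 + (norm d1)\<^sup>2) \<le> r\<^sup>2"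
          using lam(3) by (simp add: d norm_vjoin add_ac)
        show "good_sample (\<epsilon> / (1 + \<epsilon>) / 20) ((real CARD('n) - (real CARD('p) + real CARD('q))) / real CARD('n)) lam r d1 d2 (W1, v, W2)"
          using good[OF nB] unfolding w t_def q_def .
        show "vjoin (\<theta>1_JS c1 c2 ?X ?Y) (\<theta>2_JS c2 ?X ?Y) = transpose E *v G (coefficients c1 c2 ?X ?Y)"
          by (simp add: G coefficients_def)
      qed (rule injE)
      then show False using S elim(2) unfolding S_def d[symmetric] by auto
    qed
  qed
  then have "measure M S \<le> measure M (?W -` Bad \<inter> space M)"
    by (intro measure_le_null_extension) simp
  also have "\<dots> = measure stdg Bad"
    unfolding law[symmetric] by (simp add: measure_distr)
  finally show ?thesis using pBad unfolding S_def by simp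
qed

end

text \<open>Here 10800 is 27 * 20^2. Passing from \<open>n + 1\<close> to \<open>n\<close> costs at
  most the factor 64/49, since at least six regressors and fewer regressors than observations give
  \<open>n \<ge> 7\<close>, and 10800 * 64/49 is below 14397.\<close>

lemma block_size_exponent:
  fixes n k1 q e :: real
  assumes n: "n \<ge> 7" and q: "q \<ge> 0" and e: "e > 0"
  shows "n * (k1 / n)\<^sup>2 * q ^ 5 * (e\<^sup>2 / (14397 * (1 + e)\<^sup>2)) \<le> n * (k1 / (n + 1))\<^sup>2 * q ^ 5 * (e / (1 + e) / 20)\<^sup>2 / 27"
proof -
  have sq: "(e / (1 + e) / 20)\<^sup>2 = e\<^sup>2 / (1 + e)\<^sup>2 / 400"
    unfolding power_divide by simp
  \<comment> \<open>\<open>14397 * n\<^sup>2 - 10800 * (n + 1)\<^sup>2\<close> exceeds this product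
    by the constant 14253.\<close>
  have "0 \<le> (n - 7) * (3597 * n + 3579)" using n by simp
  then have "10800 * (n + 1)\<^sup>2 \<le> 14397 * n\<^sup>2" by (simp add: power2_eq_square algebra_simps)
  then have "1 / (14397 * n\<^sup>2) \<le> 1 / (10800 * (n + 1)\<^sup>2)"
    using n by (intro divide_left_mono) auto
  then have "n * k1\<^sup>2 * q ^ 5 * (e\<^sup>2 / (1 + e)\<^sup>2) * (1 / (14397 * n\<^sup>2)) \<le> n * k1\<^sup>2 * q ^ 5 * (e\<^sup>2 / (1 + e)\<^sup>2) * (1 / (10800 * (n + 1)\<^sup>2))"
    using n q by (intro mult_left_mono) auto
  then show ?thesis unfolding sq by (simp add: power_divide mult_ac)
qed

lemma signal_exponent:
  fixes n q e \<mu> :: real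
  assumes "n \<ge> 0" "q \<ge> 0" "\<mu> \<ge> 0"
  shows "n * q ^ 5 * (e\<^sup>2 / (28279 * (1 + \<mu>)\<^sup>2 * (1 + e)\<^sup>2)) \<le> n * (1 / (1 + \<mu>))\<^sup>2 * q ^ 5 * (e / (1 + e) / 20)\<^sup>2 / 27"
proof -
  have sq: "(e / (1 + e) / 20)\<^sup>2 = e\<^sup>2 / (1 + e)\<^sup>2 / 400"
    unfolding power_divide by simp
  have "n * q ^ 5 * (e\<^sup>2 / ((1 + \<mu>)\<^sup>2 * (1 + e)\<^sup>2)) * (1 / 28279) \<le> n * q ^ 5 * (e\<^sup>2 / ((1 + \<mu>)\<^sup>2 * (1 + e)\<^sup>2)) * (1 / 10800)"
    using assms by (intro mult_left_mono) auto
  then show ?thesis unfolding sq by (simp add: power_divide mult_ac)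
qed

theorem theorem1:
  fixes M :: "'a measure"
    and y u y0 :: "'a \<Rightarrow> real" and x x0 :: "nat \<Rightarrow> 'a \<Rightarrow> real"
    and \<beta> :: "nat \<Rightarrow> real" and \<sigma>2 :: real
    and yt :: "'n::finite \<Rightarrow> 'a \<Rightarrow> real" and xt :: "'n \<Rightarrow> nat \<Rightarrow> 'a \<Rightarrow> real"
    and \<M> :: "(nat \<Rightarrow> nat) set" and m :: "nat \<Rightarrow> nat"
    and s :: "'p::finite + 'q::finite \<Rightarrow> nat"
    and c1 c2 \<epsilon> :: real
  assumes "regression_sample M y x u \<beta> \<sigma>2 yt xt y0 x0"
    and "\<M> \<subseteq> candidate_models CARD('n)"
    and "m \<in> \<M>"
    and "block_division m s"
    and "c1 \<ge> 0" and "c2 \<ge> 0"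
    and "\<epsilon> > 0"
  shows
    "measure M {\<omega> \<in> space M.
        abs_log_ratio (\<rho>2_hat c1 c2 (design s xt \<omega>) (response yt \<omega>))
                      (\<rho>2 M m s c1 c2 yt xt y0 x0 \<omega>) \<ge> ereal \<epsilon>}
      \<le> 31 * real (model_size m) *
         exp (- real CARD('n) * (real CARD('p) / real CARD('n))\<^sup>2
              * (1 - real (model_size m) / real CARD('n)) ^ 5
              * (\<epsilon>\<^sup>2 / (14397 * (1 + \<epsilon>)\<^sup>2)))
     \<and>
     (\<forall>\<theta> \<sigma>2m. conditionally_normal M y (subvec s x) \<theta> \<sigma>2m \<longrightarrow>
       (let \<mu> = (\<theta> \<bullet> (subcov M s x *v \<theta>)) / \<sigma>2m in
        measure M {\<omega> \<in> space M.
          abs_log_ratio (\<rho>2_hat c1 c2 (design s xt \<omega>) (response yt \<omega>))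
                        (\<rho>2 M m s c1 c2 yt xt y0 x0 \<omega>) \<ge> ereal \<epsilon>}
        \<le> 31 * real (model_size m) *
           exp (- real CARD('n) * (1 - real (model_size m) / real CARD('n)) ^ 5
                * (\<epsilon>\<^sup>2 / (28279 * (1 + \<mu>)\<^sup>2 * (1 + \<epsilon>)\<^sup>2)))))"
proof -
  interpret regression_sample M y x u \<beta> \<sigma>2 yt xt y0 x0 by fact
  have m: "\<And>i. m i \<in> {0, 1}" and size: "6 \<le> model_size m" "model_size m < CARD('n)"
    using assms(2,3) by (auto simp: candidate_models_def)
  have bij: "bij_betw s UNIV {i. m i = 1}" using assms(4) by (simp add: block_division_def)
  have inj: "inj s" using bij by (simp add: bij_betw_def)
  have m1: "m i \<noteq> 0 \<longleftrightarrow> m i = 1" for i using m[of i] by auto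
  have "model_size m = (\<Sum>i | m i = 1. 1)"
    unfolding model_size_def m1 by (rule sum.cong) simp_all
  also have "\<dots> = CARD('p + 'q)" using bij_betw_same_card[OF bij] by simp
  finally have k: "model_size m = CARD('p) + CARD('q)" by (simp add: card_UNIV_sum)
  have n: "CARD('p) + CARD('q) < CARD('n)" "real CARD('n) \<ge> 7" using size k by auto
  obtain E :: "real^('p + 'q)^('p + 'q)" and d r where r: "r > 0"
    and wh: "E ** subcov M s x ** transpose E = mat 1" "\<And>i j. E $ Inl i $ Inr j = 0"
      "\<And>a b. (CLINT \<omega>|M. iexp (a * ((y \<omega> - d \<bullet> (E *v subvec s x \<omega>)) / r) + b \<bullet> (E *v subvec s x \<omega>))) = exp (- (a\<^sup>2 + (norm b)\<^sup>2) / 2)"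
      "\<And>c. integrable M (\<lambda>\<omega>. (y \<omega> - c \<bullet> (E *v subvec s x \<omega>))\<^sup>2)"
    and ex: "\<And>c. expectation (\<lambda>\<omega>. (y \<omega> - c \<bullet> (E *v subvec s x \<omega>))\<^sup>2) = r\<^sup>2 + (norm (d - c))\<^sup>2"
    by (rule whitening[OF inj]; rule that; blast)
  define q where "q = (real CARD('n) - (real CARD('p) + real CARD('q))) / real CARD('n)"
  have q: "1 - real (model_size m) / real CARD('n) = q" "q \<ge> 0"
    using n by (simp_all add: q_def k diff_divide_distrib)
  define P where "P = measure M {\<omega> \<in> space M.
        abs_log_ratio (\<rho>2_hat c1 c2 (design s xt \<omega>) (response yt \<omega>))
                      (\<rho>2 M m s c1 c2 yt xt y0 x0 \<omega>) \<ge> ereal \<epsilon>}"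
  have bound: "P \<le> 31 * real (model_size m) * exp (- e)"
    if lam: "0 < lam" "lam \<le> 1" "lam \<le> real CARD('p) / (real CARD('n) + 1) \<or> lam * (r\<^sup>2 + (norm d)\<^sup>2) \<le> r\<^sup>2"
      and e: "e \<le> real CARD('n) * lam\<^sup>2 * q ^ 5 * (\<epsilon> / (1 + \<epsilon>) / 20)\<^sup>2 / 27" for lam e
  proof -
    have "P \<le> 38 * exp (- (real CARD('n) * lam\<^sup>2 * q ^ 5 * (\<epsilon> / (1 + \<epsilon>) / 20)\<^sup>2 / 27))"
      unfolding P_def q_def by (rule log_ratio_bound[OF bij m n(1) assms(5-7) r wh ex lam])
    also have "\<dots> \<le> 38 * exp (- e)" using e by simp
    \<comment> \<open>With at least six regressors the factor is at least 186, well above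
      38.\<close>
    also have "\<dots> \<le> 31 * real (model_size m) * exp (- e)" using size by (intro mult_right_mono) auto
    finally show ?thesis .
  qed
  have 1: "P \<le> 31 * real (model_size m) * exp (- (real CARD('n) * (real CARD('p) / real CARD('n))\<^sup>2 * q ^ 5 * (\<epsilon>\<^sup>2 / (14397 * (1 + \<epsilon>)\<^sup>2))))"
    by (rule bound[OF _ _ _ block_size_exponent]) (use n q assms(7) in \<open>auto simp: field_simps\<close>)
  have 2: "P \<le> 31 * real (model_size m) * exp (- (real CARD('n) * q ^ 5 * (\<epsilon>\<^sup>2 / (28279 * (1 + \<mu>)\<^sup>2 * (1 + \<epsilon>)\<^sup>2))))"
    if cn: "conditionally_normal M y (subvec s x) \<theta> v" and \<mu>: "\<mu> = (\<theta> \<bullet> (subcov M s x *v \<theta>)) / v" for \<theta> v \<mu>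
  proof -
    have v: "v > 0" using cn by (simp add: conditionally_normal_def)
    have psd: "w \<bullet> (subcov M s x *v w) \<ge> 0" for w
      using subcov_pos_def[OF inj, of w] by (cases "w = 0") auto
    have \<mu>0: "\<mu> \<ge> 0" using psd[of \<theta>] v by (simp add: \<mu>)
    \<comment> \<open>Both sides are the second moment of \<open>y\<close>, computed as the risk of
      the zero predictor.\<close>
    have "r\<^sup>2 + (norm d)\<^sup>2 = v * (1 + \<mu>)"
      using ex[of 0] conditionally_normal_risk[OF cn, of 0] v by (simp add: \<mu> field_simps)
    \<comment> \<open>The predictor with whitened coefficients \<open>d\<close> has risk
      \<open>r\<^sup>2\<close>, and under conditional normality no linear predictor has risk below
      \<open>v\<close>. Together with the previous identity this makes
      \<open>1 / (1 + \<mu>)\<close> an admissible \<open>lam\<close>.\<close>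
    moreover have "v \<le> r\<^sup>2"
    proof -
      have "d \<bullet> (E *v subvec s x \<omega>) = (transpose E *v d) \<bullet> subvec s x \<omega>" for \<omega>
        by (metis inner_commute inner_matrix_vector)
      then show ?thesis
        using ex[of d] conditionally_normal_risk[OF cn, of "transpose E *v d"] psd[of "\<theta> - transpose E *v d"] by simp
    qed
    ultimately have "1 / (1 + \<mu>) * (r\<^sup>2 + (norm d)\<^sup>2) \<le> r\<^sup>2" using \<mu>0 by simp
    then show ?thesis
      using \<mu>0 q by (intro bound[OF _ _ _ signal_exponent]) auto
  qed
  show ?thesis
    using 1 2 unfolding P_def[symmetric] q(1) Let_def by auto
qed

end
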